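(* Let $\mathscr{D}$, $\omega$, $\varphi$, $V$, $\pi_N$ be as in the context. There exist bounded holomorphic functions $B_j$, $j=0,1,2,\ldots$, defined in an open neighborhood of $\mathbb{C}\setminus\mathscr{D}$, with $B_0\equiv 1$ and $B_j(\infty)=0$ for $j\ge 1$, such that for any given $\varkappa\in\mathbb{N}=\{0,1,2,\ldots\}$ and $A>0$ the monic orthogonal polynomial $\pi_N$ admits the asymptotic expansion $$\pi_N(z)=C_N\,\varphi'(z)\,\varphi(z)^N\,\mathrm{e}^{V(z)}\Big(\sum_{j=0}^{\varkappa}N^{-j}B_j(z)+\mathrm{O}(N^{-\varkappa-1})\Big)$$ as $N\to+\infty$, valid (with uniform implied constant) for all $z\in\mathbb{C}$ with $\mathrm{dist}_{\mathbb{C}}(z,\mathbb{C}\setminus\mathscr{D})\le A N^{-1}\log N$. Here, for $N\ge 1$, $$C_N=(\varphi'(\infty))^{-N-1}\mathrm{e}^{-V(\infty)}=\mathrm{cap}(\mathscr{D})^{N+1}\exp\Big(\tfrac12\int_{\mathbb{T}}\log(\omega\circ\varphi^{-1})\,\mathrm{d}\sigma\Big),$$ where $\mathrm{cap}(\mathscr{D})$ is the logarithmic capacity of $\mathscr{D}$.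
   Context: $\mathscr{D}\subset\mathbb{C}$ is a bounded Jordan domain with real-analytic boundary, and $\omega\ge 0$ is a continuous weight function on $\mathscr{D}$ such that $\log\omega$ extends to a real-analytic function in a neighborhood of $\partial\mathscr{D}$ (so $\omega$ is defined and strictly positive near $\partial\mathscr{D}$). $\mathbb{D}$ is the unit disk, $\mathbb{T}$ the unit circle, $\mathbb{D}_{\mathrm e}=\{z\in\mathbb{C}:|z|>1\}$. Normalized measures: $\mathrm{dA}=\pi^{-1}\mathrm{d}x\,\mathrm{d}y$ and $\mathrm{d}\sigma=(2\pi)^{-1}|\mathrm{d}z|$. $\varphi$ is the conformal mapping of $\mathbb{C}\setminus\overline{\mathscr{D}}$ onto $\mathbb{D}_{\mathrm e}$ with $\varphi(\infty)=\infty$ and $\varphi'(\infty)>0$; it extends to a univalent holomorphic function in a neighborhood of $\mathbb{C}\setminus\mathscr{D}$, and $\varphi'(\infty)=1/\mathrm{cap}(\mathscr{D})$. $V$ is the Szegő function of $\omega$ relative to $\mathscr{D}$: the unique bounded holomorphic function on $\mathbb{C}\setminus\overline{\mathscr{D}}$ (including at $\infty$) with $2\,\mathrm{Re}\,V=-\log\omega$ on $\partial\mathscr{D}$ and $V(\infty)\in\mathbb{R}$; it extends holomorphically across $\partial\mathscr{D}$. $\pi_N$ is the monic polynomial of degree $N$ that is orthogonal to all polynomials of degree $\le N-1$ in $L^2(\mathscr{D},\omega\,\mathrm{dA})$. *)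

theory Defs
  imports "HOL-Analysis.Analysis" "HOL-Computational_Algebra.Polynomial"
    "HOL-Probability.Probability_Measure"
begin

definition real_analytic_on :: "(complex \<Rightarrow> real) \<Rightarrow> complex set \<Rightarrow> bool"
  where "real_analytic_on f S \<longleftrightarrow>
    (\<forall>a\<in>S. \<exists>r>0. \<exists>c :: nat \<times> nat \<Rightarrow> real. \<forall>x y. \<bar>x\<bar> < r \<longrightarrow> \<bar>y\<bar> < r \<longrightarrow>
       ((\<lambda>(m, n). c (m, n) * x ^ m * y ^ n) has_sum f (a + Complex x y)) UNIV)"

text \<open>The boundary parametrization \<open>\<gamma>\<close> is a 1-periodic function on the whole real line, so that
  analyticity and regularity also hold at the base point of the loop.\<close>

definition analytic_Jordan_curve :: "(real \<Rightarrow> complex) \<Rightarrow> bool"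
  where "analytic_Jordan_curve \<gamma> \<longleftrightarrow>
    simple_path \<gamma> \<and> pathfinish \<gamma> = pathstart \<gamma> \<and> (\<forall>t. \<gamma> (t + 1) = \<gamma> t) \<and>
    (\<forall>t. \<exists>r>0. \<exists>c :: nat \<Rightarrow> complex. \<forall>s. \<bar>s\<bar> < r \<longrightarrow>
       (\<lambda>n. c n * of_real s ^ n) sums \<gamma> (t + s)) \<and>
    (\<forall>t. vector_derivative \<gamma> (at t) \<noteq> 0)"

definition analytic_Jordan_domain :: "complex set \<Rightarrow> bool"
  where "analytic_Jordan_domain D \<longleftrightarrow>
    open D \<and> connected D \<and> bounded D \<and>
    (\<exists>\<gamma>. analytic_Jordan_curve \<gamma> \<and> path_image \<gamma> = frontier D)"

text \<open>The values of \<open>\<omega>\<close> on the neighbourhood \<open>W\<close> of the boundary are those of the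
  extension; values outside \<open>D \<union> W\<close> are irrelevant.\<close>

definition admissible_weight :: "complex set \<Rightarrow> (complex \<Rightarrow> real) \<Rightarrow> bool"
  where "admissible_weight D \<omega> \<longleftrightarrow>
    continuous_on D \<omega> \<and> (\<forall>z\<in>D. 0 \<le> \<omega> z) \<and>
    (\<exists>W. open W \<and> frontier D \<subseteq> W \<and> (\<forall>z\<in>W. 0 < \<omega> z) \<and> real_analytic_on (\<lambda>z. ln (\<omega> z)) W)"

definition at_inf :: "(complex \<Rightarrow> complex) \<Rightarrow> complex"
  where "at_inf f = Lim at_infinity f"

text \<open>The conformal map of the exterior of \<open>D\<close> onto the exterior disk, already extended to a
  univalent function on a neighbourhood \<open>U\<close> of the complement of \<open>D\<close>. The value of
  \<open>deriv \<phi>\<close> at infinity is its limit there.\<close>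

definition exterior_conformal_map :: "complex set \<Rightarrow> (complex \<Rightarrow> complex) \<Rightarrow> bool"
  where "exterior_conformal_map D \<phi> \<longleftrightarrow>
    (\<exists>U. open U \<and> - D \<subseteq> U \<and> \<phi> holomorphic_on U \<and> inj_on \<phi> U) \<and>
    \<phi> ` (- closure D) = {w. 1 < norm w} \<and>
    filterlim \<phi> at_infinity at_infinity \<and>
    (\<exists>c::real. 0 < c \<and> (deriv \<phi> \<longlongrightarrow> of_real c) at_infinity)"

definition szego_function :: "complex set \<Rightarrow> (complex \<Rightarrow> real) \<Rightarrow> (complex \<Rightarrow> complex) \<Rightarrow> bool"
  where "szego_function D \<omega> V \<longleftrightarrow>
    (\<exists>U. open U \<and> - D \<subseteq> U \<and> V holomorphic_on U) \<and>
    bounded (V ` (- closure D)) \<and>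
    (\<forall>z\<in>frontier D. 2 * Re (V z) = - ln (\<omega> z)) \<and>
    (\<exists>v::real. (V \<longlongrightarrow> of_real v) at_infinity)"

definition dA :: "complex measure"
  where "dA = scale_measure (ennreal (1 / pi)) lborel"

definition weighted_inner ::
    "complex set \<Rightarrow> (complex \<Rightarrow> real) \<Rightarrow> (complex \<Rightarrow> complex) \<Rightarrow> (complex \<Rightarrow> complex) \<Rightarrow> complex"
  where "weighted_inner D \<omega> f g = (LINT z:D|dA. f z * cnj (g z) * of_real (\<omega> z))"

definition monic_orthogonal_poly ::
    "complex set \<Rightarrow> (complex \<Rightarrow> real) \<Rightarrow> nat \<Rightarrow> complex poly \<Rightarrow> bool"
  where "monic_orthogonal_poly D \<omega> N p \<longleftrightarrow>
    degree p = N \<and> lead_coeff p = 1 \<and>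
    (\<forall>q. degree q < N \<longrightarrow> weighted_inner D \<omega> (poly p) (poly q) = 0)"

text \<open>The energy of \<open>\<mu>\<close> is the double integral of \<open>log (1 / |z - w|)\<close>, computed as the difference
  of the integrals of its positive and negative parts. The integrand is infinite on the diagonal,
  which has to be written out because \<open>ln 0 = 0\<close> in HOL.\<close>

definition log_energy :: "complex measure \<Rightarrow> ereal"
  where "log_energy \<mu> =
    enn2ereal (\<integral>\<^sup>+ z. \<integral>\<^sup>+ w. (if z = w then \<infinity> else ennreal (- ln (dist z w))) \<partial>\<mu> \<partial>\<mu>) -
    enn2ereal (\<integral>\<^sup>+ z. \<integral>\<^sup>+ w. ennreal (ln (dist z w)) \<partial>\<mu> \<partial>\<mu>)"

text \<open>Logarithmic capacity of a bounded set: the supremum of \<open>exp (- log_energy \<mu>)\<close> over all Borel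
  probability measures with compact support in \<open>E\<close>; measures of infinite energy contribute 0.\<close>

definition log_capacity :: "complex set \<Rightarrow> real"
  where "log_capacity E = Sup (insert 0 {exp (- real_of_ereal (log_energy \<mu>)) | \<mu>.
    prob_space \<mu> \<and> sets \<mu> = sets borel \<and>
    (\<exists>K. compact K \<and> K \<subseteq> E \<and> emeasure \<mu> (- K) = 0) \<and> log_energy \<mu> \<noteq> \<infinity>})"

definition circle_mean :: "(complex \<Rightarrow> real) \<Rightarrow> real"
  where "circle_mean f = 1 / (2 * pi) * integral {0..2 * pi} (\<lambda>t. f (cis t))"

definition leading_const :: "(complex \<Rightarrow> complex) \<Rightarrow> (complex \<Rightarrow> complex) \<Rightarrow> nat \<Rightarrow> complex"
  where "leading_const \<phi> V N = at_inf (deriv \<phi>) powi (- int N - 1) * exp (- at_inf V)"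

end

theory Submission
  imports Defs "HOL-Complex_Analysis.Complex_Analysis" "HOL-Probability.Probability"
    "HOL-Real_Asymp.Real_Asymp"
begin

text \<open>Near the boundary, pull everything back by the inverse of \<open>\<phi>\<close> composed with \<open>exp\<close> to a vertical strip
  around the imaginary axis, where the weight becomes \<open>\<Omega> = \<omega> exp (2 Re V)\<close>, equal to 1 on the axis and expandable
  in powers of \<open>2 Re z\<close> with holomorphic coefficients. Repeated integration by parts in the direction normal
  to the axis expands the inner product of \<open>\<phi>' \<phi>^N e^V B\<close> with a polynomial of lower degree in powers of \<open>1/N\<close>;
  requiring all boundary terms to vanish determines the coefficients \<open>B_j\<close> recursively. The polynomial part
  of the truncated ansatz differs from it by an exponentially small error, hence is almost orthogonal to lower
  degrees, and by Bessel its distance to the orthogonal polynomial is small in \<open>L^2\<close>. Cauchy estimates make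
  this pointwise at the loss of a power of \<open>N\<close>, absorbed by taking more terms.

  The capacity is \<open>1 / \<phi>'(\<infinity>)\<close>: the same approximating polynomials with \<open>V = 0\<close> are near-minimal monic
  polynomials on \<open>D\<close>, so Fekete's argument, averaged over independent points, bounds every energy from
  below; the images of the uniform measures on circles inside the unit circle almost attain the bound.\<close>

section \<open>Integrals over vertical lines and oscillatory integrals\<close>

text \<open>In the coordinate \<open>z\<close> with \<open>w = exp z\<close>, Green's formula is
  short: the derivative in \<open>Re z\<close> of the integral of \<open>f * cnj q\<close> over a
  period is twice that of \<open>f' * cnj q\<close>, because tangential derivatives integrate to
  zero. With a factor \<open>exp (N * z)\<close> every integration by parts gains
  \<open>1/N\<close>. Two obstacles shape the rest. The collar has an inner edge
  \<open>Re z = -c\<close>. There the ansatz has size \<open>exp (-c N)\<close>, but the test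
  polynomial is controlled only in \<open>L^1\<close> of a collar of width \<open>c' > c\<close>;
  recovering its values at \<open>-c\<close> costs \<open>exp ((c' - c) N)\<close>, so the edge term
  decays when \<open>c' < 2 c\<close>. Secondly, passing from mean-square to pointwise bounds at
  depth \<open>A log N / N\<close> costs the power
  \<open>N ^ (nat \<lceil>2 * A\<rceil> + 2)\<close>, so the ansatz is carried that many orders
  further than requested. The recursion is solvable because on the axis all powers of
  \<open>2 Re z\<close> vanish except the zeroth, whose coefficient \<open>h 0\<close> is 1 by the
  Szego condition: the newest coefficient enters its boundary term with factor 1, next to terms made
  of earlier ones.\<close>

definition vstrip :: "real set \<Rightarrow> complex set"
  where "vstrip I = {z. Re z \<in> I}"

text \<open>These are the holomorphic functions of \<open>w = exp z\<close> on an annulus. The strip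
  is preferred because radial and tangential derivatives have constant coefficients there.\<close>

definition periodic_holomorphic_on :: "(complex \<Rightarrow> complex) \<Rightarrow> real set \<Rightarrow> bool"
  where "periodic_holomorphic_on f I \<longleftrightarrow>
    f holomorphic_on vstrip I \<and> (\<forall>z\<in>vstrip I. f (z + 2 * of_real pi * \<i>) = f z)"

text \<open>Without the factor \<open>\<i>\<close> of a contour integral: \<open>2 * pi\<close>
  times the mean over the circle \<open>|w| = exp x\<close>.\<close>

definition vline_integral :: "(complex \<Rightarrow> complex) \<Rightarrow> real \<Rightarrow> complex"
  where "vline_integral f x = integral {0..2 * pi} (\<lambda>t. f (Complex x t))"

lemma open_vstrip: "open I \<Longrightarrow> open (vstrip I)"
  using continuous_open_preimage[of UNIV Re I]
  by (simp add: vstrip_def vimage_def continuous_on_Re)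

lemma convex_vstrip:
  assumes "convex I" shows "convex (vstrip I)"
proof -
  have "vstrip I = Re -` I" by (auto simp: vstrip_def)
  moreover have "convex (Re -` I)"
    using assms by (rule convex_linear_vimage[rotated]) (simp add: bounded_linear.linear bounded_linear_Re)
  ultimately show ?thesis by simp
qed

lemma Complex_in_vstrip [simp]: "Complex x t \<in> vstrip I \<longleftrightarrow> x \<in> I"
  by (simp add: vstrip_def)

lemma vstrip_shift [simp]: "z + 2 * of_real pi * \<i> \<in> vstrip I \<longleftrightarrow> z \<in> vstrip I"
  by (simp add: vstrip_def)

lemma continuous_on_Complex [continuous_intros]:
  assumes "continuous_on A f" "continuous_on A g"
  shows "continuous_on A (\<lambda>x. Complex (f x) (g x))"
  unfolding Complex_eq by (intro continuous_intros assms)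

lemma continuous_on_vline:
  assumes "continuous_on (vstrip I) f" "x \<in> I"
  shows "continuous_on A (\<lambda>t. f (Complex x t))"
  by (rule continuous_on_compose2[OF assms(1)]) (use assms(2) in \<open>auto intro!: continuous_intros\<close>)

lemma continuous_on_vstrip_pair:
  assumes "continuous_on (vstrip I) f" "J \<subseteq> I"
  shows "continuous_on (J \<times> A) (\<lambda>(x, t). f (Complex x t))"
  unfolding split_beta
  by (rule continuous_on_compose2[OF assms(1)]) (use assms(2) in \<open>auto intro!: continuous_intros\<close>)

lemma periodic_holomorphic_onD:
  assumes "periodic_holomorphic_on f I"
  shows "f holomorphic_on vstrip I" "continuous_on (vstrip I) f"
    and "z \<in> vstrip I \<Longrightarrow> f (z + 2 * of_real pi * \<i>) = f z"
  using assms by (auto simp: periodic_holomorphic_on_def intro: holomorphic_on_imp_continuous_on)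

lemma periodic_holomorphic_on_subset:
  assumes "periodic_holomorphic_on f I" "J \<subseteq> I"
  shows "periodic_holomorphic_on f J"
proof -
  have "vstrip J \<subseteq> vstrip I" using assms(2) by (auto simp: vstrip_def)
  then show ?thesis
    using assms by (auto simp: periodic_holomorphic_on_def intro: holomorphic_on_subset)
qed

lemma periodic_holomorphic_on_intros:
  assumes "periodic_holomorphic_on f I" "periodic_holomorphic_on g I"
  shows "periodic_holomorphic_on (\<lambda>z. f z + g z) I"
    and "periodic_holomorphic_on (\<lambda>z. f z * g z) I"
    and "periodic_holomorphic_on (\<lambda>z. f z - g z) I"
    and "periodic_holomorphic_on (\<lambda>z. - f z) I"
    and "periodic_holomorphic_on (\<lambda>z. c) I"
  using assms by (auto simp: periodic_holomorphic_on_def intro!: holomorphic_intros)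

lemma periodic_holomorphic_on_sum:
  assumes "\<And>i. i \<in> A \<Longrightarrow> periodic_holomorphic_on (f i) I"
  shows "periodic_holomorphic_on (\<lambda>z. \<Sum>i\<in>A. f i z) I"
  using assms by (auto simp: periodic_holomorphic_on_def intro!: holomorphic_intros)

lemma exp_add_2pi: "exp (z + 2 * of_real pi * \<i>) = exp z"
  by (simp add: exp_add)

lemma periodic_holomorphic_on_exp_nat:
  "periodic_holomorphic_on (\<lambda>z. exp (of_nat n * z)) I"
  unfolding periodic_holomorphic_on_def
  by (auto intro!: holomorphic_intros simp: exp_of_nat_mult exp_add_2pi)

lemma periodic_holomorphic_on_exp:
  "periodic_holomorphic_on exp I" "periodic_holomorphic_on (\<lambda>z. exp (- z)) I"
proof -
  have "exp (- (z + 2 * of_real pi * \<i>)) = exp (- z)" for z :: complex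
    by (simp only: exp_minus exp_add_2pi)
  then show "periodic_holomorphic_on exp I" "periodic_holomorphic_on (\<lambda>z. exp (- z)) I"
    unfolding periodic_holomorphic_on_def
    by (auto intro!: holomorphic_intros simp: exp_add_2pi simp del: minus_add_distrib)
qed

lemma periodic_holomorphic_on_compose_exp_minus:
  assumes "P holomorphic_on ball 0 (exp (- a))"
  shows "periodic_holomorphic_on (\<lambda>z. P (exp (- z))) {a<..}"
proof -
  have "(P \<circ> (\<lambda>z. exp (- z))) holomorphic_on vstrip {a<..}"
    by (rule holomorphic_on_compose_gen[OF _ assms]) (auto intro!: holomorphic_intros simp: vstrip_def)
  then show ?thesis
    by (auto simp: periodic_holomorphic_on_def o_def exp_minus exp_add_2pi)
qed

lemma periodic_holomorphic_on_deriv: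
  assumes "open I" "periodic_holomorphic_on f I"
  shows "periodic_holomorphic_on (deriv f) I"
proof -
  have hol: "f holomorphic_on vstrip I" and op: "open (vstrip I)"
    using assms by (auto simp: periodic_holomorphic_on_def open_vstrip)
  have "deriv f (z + 2 * of_real pi * \<i>) = deriv f z" if z: "z \<in> vstrip I" for z
  proof -
    have "(f has_field_derivative deriv f (z + 2 * of_real pi * \<i>)) (at (z + 2 * of_real pi * \<i>))"
      using holomorphic_derivI[OF hol op] z by simp
    then have "((\<lambda>z. f (z + 2 * of_real pi * \<i>)) has_field_derivative deriv f (z + 2 * of_real pi * \<i>)) (at z)"
      using DERIV_shift by blast
    moreover have "eventually (\<lambda>u. f (u + 2 * of_real pi * \<i>) = f u) (nhds z)"
      using eventually_nhds_in_open[OF op z]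
      by (rule eventually_mono) (use assms in \<open>auto simp: periodic_holomorphic_on_def\<close>)
    ultimately have "(f has_field_derivative deriv f (z + 2 * of_real pi * \<i>)) (at z)"
      using DERIV_cong_ev[OF refl, of "\<lambda>u. f (u + 2 * of_real pi * \<i>)" f z, OF _ refl] by simp
    then show ?thesis by (rule DERIV_imp_deriv[symmetric])
  qed
  then show ?thesis
    using holomorphic_deriv[OF hol op] by (auto simp: periodic_holomorphic_on_def)
qed

section \<open>Cauchy's theorem and integral formula for periodic functions\<close>

lemma has_vector_derivative_vline:
  assumes "(f has_field_derivative f') (at (Complex x t))"
  shows "((\<lambda>t. f (Complex x t)) has_vector_derivative \<i> * f') (at t within A)"
    and "((\<lambda>x. f (Complex x t)) has_vector_derivative f') (at x within A)"
proof -
  have "((\<lambda>t. Complex x t) has_vector_derivative \<i>) (at t within A)"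
    unfolding Complex_eq by (auto intro!: derivative_eq_intros)
  then show "((\<lambda>t. f (Complex x t)) has_vector_derivative \<i> * f') (at t within A)"
    using field_vector_diff_chain_within[of "\<lambda>t. Complex x t" \<i> t A f f'] assms
    by (auto simp: o_def intro: has_field_derivative_at_within)
  have "((\<lambda>x. Complex x t) has_vector_derivative 1) (at x within A)"
    unfolding Complex_eq by (auto intro!: derivative_eq_intros)
  then show "((\<lambda>x. f (Complex x t)) has_vector_derivative f') (at x within A)"
    using field_vector_diff_chain_within[of "\<lambda>x. Complex x t" 1 x A f f'] assms
    by (auto simp: o_def intro: has_field_derivative_at_within)
qed

text \<open>Cauchy's theorem for a rectangle whose horizontal sides cancel by periodicity, obtained
  from a primitive on the convex strip.\<close>

lemma vline_integral_shift:
  assumes I: "open I" "convex I" and f: "periodic_holomorphic_on f I" and xy: "x \<in> I" "y \<in> I"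
  shows "vline_integral f x = vline_integral f y"
proof -
  let ?S = "vstrip I"
  have op: "open ?S" and cx: "convex ?S" using I open_vstrip convex_vstrip by auto
  obtain g where g: "\<And>z. z \<in> ?S \<Longrightarrow> (g has_field_derivative f z) (at z within ?S)"
    using holomorphic_convex_primitive'[OF cx op] f by (auto simp: periodic_holomorphic_on_def)
  have g': "(g has_field_derivative f z) (at z)" if "z \<in> ?S" for z
    using g[OF that] at_within_open[OF that op] by simp
  have eq: "vline_integral f x = (g (Complex x 0 + 2 * of_real pi * \<i>) - g (Complex x 0)) / \<i>"
    if "x \<in> I" for x
  proof -
    have "((\<lambda>t. \<i> * f (Complex x t)) has_integral (g (Complex x (2 * pi)) - g (Complex x 0))) {0..2*pi}"
      by (rule fundamental_theorem_of_calculus) (use that in \<open>auto intro!: has_vector_derivative_vline g'\<close>)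
    then have "\<i> * vline_integral f x = g (Complex x (2 * pi)) - g (Complex x 0)"
      unfolding vline_integral_def
      by (metis integral_mult_right integral_unique)
    moreover have "Complex x (2 * pi) = Complex x 0 + 2 * of_real pi * \<i>"
      by (simp add: complex_eq_iff)
    ultimately show ?thesis by (metis complex_i_not_zero nonzero_mult_div_cancel_left)
  qed
  \<comment> \<open>The increment of the primitive over one period has derivative zero, by
    periodicity of \<open>f\<close>, so every line gives the same value.\<close>
  have "\<exists>c. \<forall>z\<in>?S. g (z + 2 * of_real pi * \<i>) - g z = c"
  proof (rule has_field_derivative_zero_constant[OF cx])
    fix z assume z: "z \<in> ?S"
    then have "((\<lambda>z. g (z + 2 * of_real pi * \<i>)) has_field_derivative f (z + 2 * of_real pi * \<i>)) (at z)"
      using g'[of "z + 2 * of_real pi * \<i>"] DERIV_shift by fastforce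
    from DERIV_diff[OF this g'[OF z]]
    show "((\<lambda>z. g (z + 2 * of_real pi * \<i>) - g z) has_field_derivative 0) (at z within ?S)"
      using f z by (auto simp: periodic_holomorphic_on_def intro: has_field_derivative_at_within)
  qed
  then show ?thesis using eq xy by (metis Complex_in_vstrip)
qed

lemma vline_integral_norm_le:
  assumes "continuous_on {0..2*pi} (\<lambda>t. f (Complex x t))" "\<And>t. t \<in> {0..2*pi} \<Longrightarrow> norm (f (Complex x t)) \<le> B"
  shows "norm (vline_integral f x) \<le> 2 * pi * B"
  unfolding vline_integral_def
  using integral_bound[of 0 "2*pi" "\<lambda>t. f (Complex x t)" B] assms by (auto simp: mult.commute)

lemma vline_integral_diff_const:
  fixes c :: complex
  assumes "continuous_on {0..2*pi} (\<lambda>t. f (Complex x t))"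
  shows "vline_integral (\<lambda>z. f z - c) x = vline_integral f x - 2 * pi * c"
proof -
  have "vline_integral (\<lambda>z. f z - c) x = vline_integral f x - integral {0..2*pi} (\<lambda>t. c)"
    unfolding vline_integral_def
    using assms by (intro integral_diff integrable_continuous_real) auto
  then show ?thesis by (simp add: scaleR_conv_of_real)
qed

text \<open>The integral does not depend on the line, so the line may be moved to infinity. The
  limit is required uniformly in \<open>Im z\<close>; in the variable \<open>exp (- z)\<close> it is
  an ordinary limit at the origin.\<close>

lemma vline_integral_limit:
  fixes L :: complex
  assumes f: "periodic_holomorphic_on f {a<..}"
    and lim: "\<And>e. e > 0 \<Longrightarrow> \<exists>X. \<forall>z. Re z > X \<longrightarrow> norm (f z - L) < e"
    and x: "x > a"
  shows "vline_integral f x = 2 * pi * L"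
proof -
  have c: "continuous_on {0..2*pi} (\<lambda>t. f (Complex y t))" if "y > a" for y
    using periodic_holomorphic_onD(2)[OF f] that by (intro continuous_on_vline[of "{a<..}"]) auto
  have "norm (vline_integral f x - 2 * pi * L) \<le> e" if e: "e > 0" for e
  proof -
    obtain X where X: "\<forall>z. Re z > X \<longrightarrow> norm (f z - L) < e / (2 * pi)"
      using lim[of "e / (2*pi)"] e by auto
    define y where "y = max X a + 1"
    have y: "y > X" "y > a" by (auto simp: y_def)
    have "vline_integral f x = vline_integral f y"
      using y x by (intro vline_integral_shift[OF _ _ f]) auto
    moreover have "norm (vline_integral (\<lambda>z. f z - L) y) \<le> 2 * pi * (e / (2 * pi))"
      using X y c[of y] by (intro vline_integral_norm_le continuous_intros) (auto intro: less_imp_le)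
    ultimately show ?thesis using vline_integral_diff_const[OF c[of y]] y by simp
  qed
  then show ?thesis using dense_eq0_I by (metis norm_conv_dist abs_norm_cancel eq_iff_diff_eq_0 norm_eq_zero)
qed

text \<open>Negation maps the period \<open>[0, 2 pi]\<close> of \<open>t\<close> to
  \<open>[-2 pi, 0]\<close>, and periodicity moves it back. This transfers results at the right end
  to the left end.\<close>

lemma vline_integral_reflect:
  assumes "\<And>z. z \<in> vstrip {x} \<Longrightarrow> f (z + 2 * of_real pi * \<i>) = f z"
  shows "vline_integral f x = vline_integral (\<lambda>z. f (- z)) (- x)"
proof -
  have "f (Complex x (t + 2 * pi)) = f (Complex x t)" for t
    using assms[of "Complex x t"] by (simp add: vstrip_def Complex_eq algebra_simps)
  note per = this
  have "vline_integral (\<lambda>z. f (- z)) (- x) = integral {0..2*pi} (\<lambda>t. f (Complex x (- t)))"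
    unfolding vline_integral_def by (simp add: Complex_eq algebra_simps)
  also have "\<dots> = integral {-(2*pi)..0} (\<lambda>t. f (Complex x t))"
    using Henstock_Kurzweil_Integration.integral_reflect_real[where a=0 and b="2*pi" and f="\<lambda>t. f (Complex x (- t))"] by simp
  also have "\<dots> = integral {-(2*pi)..0} (\<lambda>t. f (Complex x (t + 2*pi)))" by (simp add: per)
  also have "\<dots> = vline_integral f x"
    unfolding vline_integral_def
    using integral_shift_real_ivl[where a=0 and b="2*pi" and c="2*pi" and f="\<lambda>t. f (Complex x t)"] by (simp add: add.commute)
  finally show ?thesis ..
qed

lemma vline_integral_limit_left:
  fixes L :: complex
  assumes f: "periodic_holomorphic_on f {..<a}"
    and lim: "\<And>e. e > 0 \<Longrightarrow> \<exists>X. \<forall>z. Re z < X \<longrightarrow> norm (f z - L) < e"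
    and x: "x < a"
  shows "vline_integral f x = 2 * pi * L"
proof -
  have per: "f (- z - 2 * of_real pi * \<i>) = f (- z)" if "z \<in> vstrip {-a<..}" for z
    using periodic_holomorphic_onD(3)[OF f, of "- z - 2 * of_real pi * \<i>"] that
    by (simp add: vstrip_def)
  have "(f \<circ> uminus) holomorphic_on vstrip {-a<..}"
    using f by (intro holomorphic_on_compose_gen[of _ _ _ "vstrip {..<a}"])
      (auto simp: periodic_holomorphic_on_def vstrip_def intro!: holomorphic_intros)
  then have "periodic_holomorphic_on (\<lambda>z. f (- z)) {-a<..}"
    using per by (auto simp: periodic_holomorphic_on_def o_def)
  moreover have "\<exists>X. \<forall>z. Re z > X \<longrightarrow> norm (f (- z) - L) < e" if "e > 0" for e
  proof -
    obtain X where X: "\<forall>z. Re z < X \<longrightarrow> norm (f z - L) < e" using lim[OF \<open>e > 0\<close>] ..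
    show ?thesis by (rule exI[of _ "- X"]) (use X in auto)
  qed
  ultimately have "vline_integral (\<lambda>z. f (- z)) (- x) = 2 * pi * L"
    using x by (intro vline_integral_limit) auto
  then show ?thesis
    using vline_integral_reflect[of x f] f x by (auto simp: periodic_holomorphic_on_def vstrip_def)
qed


lemma vline_integral_mean:
  fixes P :: "complex \<Rightarrow> complex"
  assumes P: "P holomorphic_on ball 0 (exp (- a))" and x: "a < x"
  shows "vline_integral (\<lambda>z. P (exp (- z))) x = 2 * pi * P 0"
proof (rule vline_integral_limit[OF periodic_holomorphic_on_compose_exp_minus[OF P] _ x])
  fix e :: real assume "e > 0"
  have "isCont P 0"
    using holomorphic_on_imp_continuous_on[OF P] by (auto simp: continuous_on_eq_continuous_at)
  then obtain d where d: "d > 0" "\<And>y. dist y 0 < d \<Longrightarrow> dist (P y) (P 0) < e"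
    unfolding continuous_at_eps_delta using \<open>e > 0\<close> by metis
  show "\<exists>X. \<forall>z. X < Re z \<longrightarrow> norm (P (exp (- z)) - P 0) < e"
  proof (intro exI allI impI)
    fix z :: complex assume "- ln d < Re z"
    then have "exp (- Re z) < exp (ln d)" by simp
    then show "norm (P (exp (- z)) - P 0) < e"
      using d(2)[of "exp (- z)"] d(1) by (simp add: dist_norm)
  qed
qed

text \<open>With \<open>Y = exp (- u)\<close> and \<open>X = exp (- z)\<close> the integrand is
  \<open>P Y * Y / (Y - X)\<close>, the Cauchy integrand on the circle
  \<open>|Y| = exp (- x)\<close> around \<open>X\<close>. Splitting off \<open>P X\<close> leaves
  \<open>Y\<close> times a holomorphic divided difference, which has mean zero.\<close>

lemma Cauchy_vline:
  fixes P :: "complex \<Rightarrow> complex"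
  assumes P: "P holomorphic_on ball 0 (exp (- a))" and x: "a < x" "x < Re z"
  shows "vline_integral (\<lambda>u. P (exp (- u)) / (1 - exp (u - z))) x = 2 * pi * P (exp (- z))"
proof -
  define X where "X = exp (- z)"
  define g where "g = (\<lambda>Y. if Y = X then deriv P X else (P Y - P X) / (Y - X))"
  define f2 where "f2 = (\<lambda>u. 1 / (1 - exp (u - z)))"
  have g: "g holomorphic_on ball 0 (exp (- a))"
    unfolding g_def by (rule pole_lemma_open[OF P]) auto
  then have G: "(\<lambda>Y. Y * g Y) holomorphic_on ball 0 (exp (- a))"
    by (intro holomorphic_intros)
  have v1: "vline_integral (\<lambda>u. exp (- u) * g (exp (- u))) x = 0"
    using vline_integral_mean[OF G x(1)] by simp
  have nz: "1 - exp (u - z) \<noteq> 0" if "Re u < Re z" for u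
    using that norm_exp_eq_Re[of "u - z"] by (metis eq_iff_diff_eq_0 less_irrefl exp_less_one_iff minus_complex.simps(1) norm_one diff_less_0_iff_less)
  have "f2 (z' + 2 * of_real pi * \<i>) = f2 z'" for z'
    using exp_add_2pi[of "z' - z"] by (simp add: f2_def algebra_simps)
  then have f2: "periodic_holomorphic_on f2 {..<Re z}"
    unfolding periodic_holomorphic_on_def
    using nz by (auto simp: f2_def vstrip_def intro!: holomorphic_intros)
  \<comment> \<open>The pure kernel is holomorphic to the left of \<open>z\<close> and tends to 1
    there, so its mean is 1; no small circle around the pole is needed.\<close>
  have v2: "vline_integral f2 x = 2 * pi * (1::complex)"
  proof (rule vline_integral_limit_left[OF f2 _ x(2)])
    fix e :: real assume e: "e > 0"
    show "\<exists>X. \<forall>u. Re u < X \<longrightarrow> norm (f2 u - 1) < e"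
    proof (intro exI allI impI)
      fix u assume u: "Re u < Re z + ln (min (1/2) (e/2))"
      define q where "q = exp (u - z)"
      have "norm q = exp (Re u - Re z)" by (simp add: q_def)
      also have "\<dots> < exp (ln (min (1/2) (e/2)))" using u by simp
      also have "\<dots> = min (1/2) (e/2)" using e by simp
      finally have q: "norm q < 1/2" "norm q < e/2" by auto
      have q1: "1 - q \<noteq> 0" using q(1) by auto
      have "norm (1 - q) \<ge> 1/2" using q(1) norm_triangle_ineq2[of 1 q] by auto
      moreover have "f2 u - 1 = q / (1 - q)" using q1 by (simp add: f2_def q_def[symmetric] field_simps)
      ultimately have "norm (f2 u - 1) \<le> norm q / (1/2)"
        by (simp only: norm_divide) (intro divide_left_mono, auto)
      then show "norm (f2 u - 1) < e" using q by simp
    qed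
  qed
  have eq: "P (exp (- u)) / (1 - exp (u - z)) = exp (- u) * g (exp (- u)) + P X * f2 u"
    if "Re u = x" for u
  proof -
    define Y where "Y = exp (- u)"
    have Y0: "Y \<noteq> 0" by (simp add: Y_def)
    have q: "exp (u - z) = X / Y" by (simp add: X_def Y_def exp_diff exp_minus field_simps)
    have "1 - X / Y \<noteq> 0" using nz[of u] that x q by simp
    then have ne: "Y - X \<noteq> 0" using Y0 by (simp add: field_simps)
    have g': "g Y = (P Y - P X) / (Y - X)" using ne by (simp add: g_def)
    have f': "f2 u = Y / (Y - X)" using Y0 ne unfolding f2_def q by (simp add: field_simps)
    have "P Y / (1 - X / Y) = P Y * Y / (Y - X)" using Y0 ne by (simp add: field_simps)
    also have "\<dots> = Y * ((P Y - P X) / (Y - X)) + P X * (Y / (Y - X))"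
      using ne by (simp add: add_divide_distrib[symmetric] algebra_simps)
    finally show ?thesis unfolding q f' Y_def[symmetric] g' by simp
  qed
  have c1: "continuous_on {0..2*pi} (\<lambda>t. exp (- Complex x t) * g (exp (- Complex x t)))"
    using periodic_holomorphic_onD(2)[OF periodic_holomorphic_on_compose_exp_minus[OF G]] x
    by (intro continuous_on_vline[of "{a<..}"]) auto
  have c2: "continuous_on {0..2*pi} (\<lambda>t. f2 (Complex x t))"
    using periodic_holomorphic_onD(2)[OF f2] x by (intro continuous_on_vline[of "{..<Re z}"]) auto
  have "vline_integral (\<lambda>u. P (exp (- u)) / (1 - exp (u - z))) x
      = vline_integral (\<lambda>u. exp (- u) * g (exp (- u)) + P X * f2 u) x"
    unfolding vline_integral_def using eq by (intro integral_cong) auto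
  also have "\<dots> = vline_integral (\<lambda>u. exp (- u) * g (exp (- u))) x + P X * vline_integral f2 x"
    unfolding vline_integral_def
    by (subst integral_add) (auto intro!: integrable_continuous_real continuous_intros c1 c2)
  finally show ?thesis using v1 v2 by (simp add: X_def mult.commute)
qed

lemma vline_norm_integral_continuous:
  assumes "continuous_on (vstrip I) f" "J \<subseteq> I"
  shows "continuous_on J (\<lambda>x. integral {0..2*pi} (\<lambda>t. norm (f (Complex x t))))"
proof -
  have "continuous_on (J \<times> cbox 0 (2*pi)) (\<lambda>(x, t). norm (f (Complex x t)))"
    using continuous_on_vstrip_pair[OF assms, of "cbox 0 (2*pi)"] unfolding split_beta
    by (intro continuous_intros)
  from integral_continuous_on_param[OF this] show ?thesis by simp
qed

lemma vline_integral_continuous: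
  assumes "continuous_on (vstrip I) f" "J \<subseteq> I"
  shows "continuous_on J (vline_integral f)"
  using integral_continuous_on_param[of J 0 "2*pi" "\<lambda>x t. f (Complex x t)"]
    continuous_on_vstrip_pair[OF assms] by (simp add: vline_integral_def[abs_def])

text \<open>Averaging the Cauchy formula over the lines \<open>x1 \<le> x \<le> x2\<close> bounds a
  point value by an area integral; \<open>1 - exp (x2 - y)\<close> is a lower bound for the
  denominator of the kernel on all these lines.\<close>

lemma norm_le_vstrip_average:
  fixes P :: "complex \<Rightarrow> complex"
  assumes P: "P holomorphic_on ball 0 (exp (- a))"
    and x: "a < x1" "x1 < x2" "x2 < y" "y \<le> Re z"
  shows "norm (P (exp (- z))) * (2 * pi * (x2 - x1) * (1 - exp (x2 - y)))
    \<le> integral {x1..x2} (\<lambda>x. integral {0..2*pi} (\<lambda>t. norm (P (exp (- Complex x t)))))"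
proof -
  define d where "d = 1 - exp (x2 - y)"
  have d: "d > 0" using x by (simp add: d_def)
  note per = periodic_holomorphic_on_compose_exp_minus[OF P]
  have cont: "continuous_on (vstrip {a<..}) (\<lambda>z. P (exp (- z)))"
    using periodic_holomorphic_onD(2)[OF per] .
  have *: "norm (P (exp (- z))) * (2 * pi * d) \<le> integral {0..2*pi} (\<lambda>t. norm (P (exp (- Complex v t))))"
    if v: "v \<in> {x1..x2}" for v
  proof -
    have cv: "continuous_on {0..2*pi} (\<lambda>t. P (exp (- Complex v t)))"
      using v x by (intro continuous_on_vline[OF cont]) auto
    have nz: "norm (1 - exp (Complex v t - z)) \<ge> d" for t
    proof -
      have "norm (exp (Complex v t - z)) \<le> exp (x2 - y)" using v x by simp
      then show ?thesis using norm_triangle_ineq2[of 1 "exp (Complex v t - z)"] unfolding d_def norm_one by linarith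
    qed
    then have nz0: "1 - exp (Complex v t - z) \<noteq> 0" for t using d by (metis norm_zero not_less)
    have "2 * pi * norm (P (exp (- z))) = norm (vline_integral (\<lambda>u. P (exp (- u)) / (1 - exp (u - z))) v)"
      using Cauchy_vline[OF P, of v z] v x by (simp add: norm_mult)
    also have "\<dots> \<le> integral {0..2*pi} (\<lambda>t. norm (P (exp (- Complex v t))) / d)"
      unfolding vline_integral_def
    proof (rule integral_norm_bound_integral)
      show "(\<lambda>t. P (exp (- Complex v t)) / (1 - exp (Complex v t - z))) integrable_on {0..2*pi}"
        using nz0 by (intro integrable_continuous_real continuous_intros cv) auto
      show "(\<lambda>t. norm (P (exp (- Complex v t))) / d) integrable_on {0..2*pi}"
        using d by (intro integrable_continuous_real continuous_intros cv) auto
      show "norm (P (exp (- Complex v t)) / (1 - exp (Complex v t - z))) \<le> norm (P (exp (- Complex v t))) / d"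
        for t using nz[of t] d by (simp add: norm_divide frac_le)
    qed
    also have "\<dots> = integral {0..2*pi} (\<lambda>t. norm (P (exp (- Complex v t)))) / d" by simp
    finally show ?thesis using d by (simp add: field_simps)
  qed
  have "integral {x1..x2} (\<lambda>x. norm (P (exp (- z))) * (2 * pi * d)) \<le>
     integral {x1..x2} (\<lambda>x. integral {0..2*pi} (\<lambda>t. norm (P (exp (- Complex x t)))))"
    using x by (intro integral_le * integrable_continuous_real vline_norm_integral_continuous[OF cont]) auto
  then show ?thesis using x by (simp add: d_def[symmetric] algebra_simps)
qed

text \<open>The \<open>x\<close>-derivative of \<open>f * cnj q\<close> is
  \<open>f' * cnj q + f * cnj q'\<close>, the \<open>t\<close>-derivative is \<open>\<i>\<close>
  times the difference of the same two terms. The latter integrates to zero over a period, so both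
  terms contribute equally and the derivative of \<open>q\<close> disappears.\<close>

lemma vline_pair_has_vector_derivative:
  assumes I: "open I" "convex I" and f: "periodic_holomorphic_on f I" and q: "periodic_holomorphic_on q I"
    and x: "x \<in> I"
  shows "(vline_integral (\<lambda>z. f z * cnj (q z)) has_vector_derivative
      2 * vline_integral (\<lambda>z. deriv f z * cnj (q z)) x) (at x)"
proof -
  note f' = periodic_holomorphic_on_deriv[OF I(1) f] and q' = periodic_holomorphic_on_deriv[OF I(1) q]
  note cont = periodic_holomorphic_onD(2)[OF f] periodic_holomorphic_onD(2)[OF q]
     periodic_holomorphic_onD(2)[OF f'] periodic_holomorphic_onD(2)[OF q']
  have Df: "(f has_field_derivative deriv f z) (at z)" "(q has_field_derivative deriv q z) (at z)"
    if "z \<in> vstrip I" for z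
    using holomorphic_derivI[OF periodic_holomorphic_onD(1)[OF f] open_vstrip[OF I(1)] that]
      holomorphic_derivI[OF periodic_holomorphic_onD(1)[OF q] open_vstrip[OF I(1)] that] by auto
  define fx where "fx = (\<lambda>x t. deriv f (Complex x t) * cnj (q (Complex x t)) + f (Complex x t) * cnj (deriv q (Complex x t)))"
  have cl: "continuous_on A (\<lambda>t. g (Complex y t))" if "y \<in> I" "g \<in> {f, q, deriv f, deriv q}" for y g A
    using that cont by (auto intro: continuous_on_vline)
  have cfx: "continuous_on (I \<times> cbox 0 (2 * pi)) (\<lambda>(x, t). fx x t)"
    unfolding fx_def split_beta
    using cont[THEN continuous_on_vstrip_pair, OF subset_refl, of "cbox 0 (2*pi)"]
    by (intro continuous_intros) (auto simp: split_beta)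
  have "((\<lambda>x. integral (cbox 0 (2*pi)) (\<lambda>t. f (Complex x t) * cnj (q (Complex x t)))) has_vector_derivative
      integral (cbox 0 (2*pi)) (fx x)) (at x within I)"
  proof (rule leibniz_rule_vector_derivative[OF _ _ cfx x I(2)])
    fix y :: real and t assume y: "y \<in> I"
    then show "((\<lambda>y. f (Complex y t) * cnj (q (Complex y t))) has_vector_derivative fx y t) (at y within I)"
      unfolding fx_def
      using has_vector_derivative_mult[OF has_vector_derivative_vline(2)[OF Df(1)]
          has_vector_derivative_cnj[OF has_vector_derivative_vline(2)[OF Df(2)]]]
      by (simp add: algebra_simps)
  next
    fix y assume y: "y \<in> I"
    show "(\<lambda>t. f (Complex y t) * cnj (q (Complex y t))) integrable_on cbox 0 (2*pi)"
      using cl[OF y] by (intro integrable_continuous continuous_intros) auto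
  qed
  then have D: "(vline_integral (\<lambda>z. f z * cnj (q z)) has_vector_derivative integral {0..2*pi} (fx x)) (at x)"
    unfolding vline_integral_def[abs_def] at_within_open[OF x I(1)] box_real by simp
  define A where "A = vline_integral (\<lambda>z. deriv f z * cnj (q z)) x"
  define B where "B = integral {0..2*pi} (\<lambda>t. f (Complex x t) * cnj (deriv q (Complex x t)))"
  have intg: "(\<lambda>t. deriv f (Complex x t) * cnj (q (Complex x t))) integrable_on {0..2*pi}"
    "(\<lambda>t. f (Complex x t) * cnj (deriv q (Complex x t))) integrable_on {0..2*pi}"
    using cl[OF x] by (auto intro!: integrable_continuous_real continuous_intros)
  have AB: "integral {0..2*pi} (fx x) = A + B"
    unfolding fx_def A_def B_def vline_integral_def by (intro integral_add intg)
  \<comment> \<open>The integral of an exact \<open>t\<close>-derivative of a periodic function,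
    evaluated at both ends of the period.\<close>
  have "((\<lambda>t. \<i> * (deriv f (Complex x t) * cnj (q (Complex x t)) - f (Complex x t) * cnj (deriv q (Complex x t))))
     has_integral (f (Complex x (2*pi)) * cnj (q (Complex x (2*pi))) - f (Complex x 0) * cnj (q (Complex x 0)))) {0..2*pi}"
  proof (rule fundamental_theorem_of_calculus)
    fix t assume "t \<in> {0..2*pi}"
    show "((\<lambda>t. f (Complex x t) * cnj (q (Complex x t))) has_vector_derivative
      \<i> * (deriv f (Complex x t) * cnj (q (Complex x t)) - f (Complex x t) * cnj (deriv q (Complex x t)))) (at t within {0..2*pi})"
      using has_vector_derivative_mult[OF has_vector_derivative_vline(1)[OF Df(1)]
          has_vector_derivative_cnj[OF has_vector_derivative_vline(1)[OF Df(2)]]] x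
      by (simp add: algebra_simps)
  qed simp
  moreover have "Complex x (2 * pi) = Complex x 0 + 2 * of_real pi * \<i>"
    by (simp add: complex_eq_iff)
  ultimately have "((\<lambda>t. \<i> * (deriv f (Complex x t) * cnj (q (Complex x t)) - f (Complex x t) * cnj (deriv q (Complex x t))))
     has_integral 0) {0..2*pi}"
    using x f q by (simp add: periodic_holomorphic_on_def)
  moreover have "((\<lambda>t. \<i> * (deriv f (Complex x t) * cnj (q (Complex x t)) - f (Complex x t) * cnj (deriv q (Complex x t))))
     has_integral \<i> * (A - B)) {0..2*pi}"
    unfolding A_def B_def vline_integral_def
    by (intro has_integral_mult_right has_integral_diff integrable_integral intg)
  ultimately have "\<i> * (A - B) = 0" using has_integral_unique by blast
  then have "A = B" by simp
  then show ?thesis using D AB A_def by simp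
qed

section \<open>Integration by parts in powers of \<open>2 Re z\<close>\<close>

text \<open>A sequence \<open>f\<close> stands for the function \<open>z \<mapsto> \<Sum>k. f k z * (2 Re z)^k\<close>; \<open>dseq\<close> is the Wirtinger derivative
  in \<open>z\<close>, where \<open>2 Re z = z + cnj z\<close>.\<close>

definition dseq :: "(nat \<Rightarrow> complex \<Rightarrow> complex) \<Rightarrow> nat \<Rightarrow> complex \<Rightarrow> complex"
  where "dseq f k z = deriv (f k) z + of_nat (k + 1) * f (k + 1) z"

definition osc_integral ::
    "nat \<Rightarrow> nat \<Rightarrow> real \<Rightarrow> (complex \<Rightarrow> complex) \<Rightarrow> (nat \<Rightarrow> complex \<Rightarrow> complex) \<Rightarrow> complex"
  where "osc_integral K N c q f = (\<Sum>k<K. integral {-c..0} (\<lambda>x. of_real ((2 * x) ^ k) *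
     vline_integral (\<lambda>z. exp (of_nat N * z) * f k z * cnj (q z)) x))"

text \<open>The boundary term on the inner edge of the collar. It is never expanded, since it turns
  out to be exponentially small.\<close>

definition inner_term ::
    "nat \<Rightarrow> nat \<Rightarrow> real \<Rightarrow> (complex \<Rightarrow> complex) \<Rightarrow> (nat \<Rightarrow> complex \<Rightarrow> complex) \<Rightarrow> complex"
  where "inner_term K N c q f = (\<Sum>k<K. of_real ((2 * (- c)) ^ k) *
     vline_integral (\<lambda>z. exp (of_nat N * z) * f k z * cnj (q z)) (- c))"

lemma dseq_periodic_holomorphic:
  assumes "open I" "\<And>k. periodic_holomorphic_on (f k) I"
  shows "periodic_holomorphic_on (dseq f k) I"
  unfolding dseq_def[abs_def]
  by (intro periodic_holomorphic_on_intros(1,2) periodic_holomorphic_on_intros(5)[OF assms(2) assms(2)]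
     periodic_holomorphic_on_deriv assms)

lemma dseq_zero:
  assumes "\<And>k. k \<ge> K \<Longrightarrow> f k = (\<lambda>z. 0)"
  shows "k \<ge> K \<Longrightarrow> dseq f k = (\<lambda>z. 0)"
  using assms[of k] assms[of "k+1"] by (simp add: dseq_def[abs_def])

text \<open>Integrate the derivative of \<open>G x\<close>, the line integral of the whole
  integrand: it is \<open>2 N\<close> times \<open>G\<close> plus twice the same expression for
  \<open>dseq f\<close>. At \<open>x = 0\<close> the powers of \<open>2 x\<close> leave only the
  entry \<open>f 0\<close>.\<close>

lemma osc_integral_by_parts:
  assumes I: "open I" "convex I" and f: "\<And>k. periodic_holomorphic_on (f k) I" and q: "periodic_holomorphic_on q I"
    and c: "0 \<le> c" "{-c..0} \<subseteq> I" and K: "K > 0" "\<And>k. k \<ge> K \<Longrightarrow> f k = (\<lambda>z. 0)"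
  shows "of_nat N * osc_integral K N c q f =
     vline_integral (\<lambda>z. exp (of_nat N * z) * f 0 z * cnj (q z)) 0 / 2 - inner_term K N c q f / 2
     - osc_integral K N c q (dseq f)"
proof -
  define m where "m = (\<lambda>g. vline_integral (\<lambda>z. exp (of_nat N * z) * g z * cnj (q z)))"
  have per: "periodic_holomorphic_on (\<lambda>z. exp (of_nat N * z) * g z) I" if "periodic_holomorphic_on g I" for g
    by (intro periodic_holomorphic_on_intros periodic_holomorphic_on_exp_nat that)
  have contg: "continuous_on (vstrip I) (\<lambda>z. exp (of_nat N * z) * g z * cnj (q z))"
    if "periodic_holomorphic_on g I" for g
    by (intro continuous_intros periodic_holomorphic_onD(2) that q)
  have mc: "continuous_on {-c..0} (m g)" if "periodic_holomorphic_on g I" for g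
    unfolding m_def by (rule vline_integral_continuous[OF contg[OF that] c(2)])
  have m_add: "m (\<lambda>z. a * g z + b * h z) x = a * m g x + b * m h x"
    if "periodic_holomorphic_on g I" "periodic_holomorphic_on h I" "x \<in> I" for g h x a b
  proof -
    have "m (\<lambda>z. a * g z + b * h z) x = integral {0..2*pi} (\<lambda>t.
       a * (exp (of_nat N * Complex x t) * g (Complex x t) * cnj (q (Complex x t))) +
       b * (exp (of_nat N * Complex x t) * h (Complex x t) * cnj (q (Complex x t))))"
      unfolding m_def vline_integral_def by (intro integral_cong) (simp add: algebra_simps)
    also have "\<dots> = a * m g x + b * m h x"
      unfolding m_def vline_integral_def
      by (subst integral_add)
         (auto intro!: integrable_continuous_real continuous_on_mult_const continuous_on_mult_left
            continuous_on_vline[OF contg[OF that(1)] that(3)] continuous_on_vline[OF contg[OF that(2)] that(3)])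
    finally show ?thesis .
  qed
  have m': "(m g has_vector_derivative 2 * of_nat N * m g x + 2 * m (deriv g) x) (at x)"
    if g: "periodic_holomorphic_on g I" and x: "x \<in> I" for g x
  proof -
    have "(m g has_vector_derivative 2 * vline_integral (\<lambda>z. deriv (\<lambda>z. exp (of_nat N * z) * g z) z * cnj (q z)) x) (at x)"
      unfolding m_def by (rule vline_pair_has_vector_derivative[OF I per[OF g] q x])
    moreover have "deriv (\<lambda>z. exp (of_nat N * z) * g z) z = exp (of_nat N * z) * (of_nat N * g z + 1 * deriv g z)"
      if "z \<in> vstrip I" for z
      by (rule DERIV_imp_deriv)
         (auto intro!: derivative_eq_intros holomorphic_derivI[OF periodic_holomorphic_onD(1)[OF g] open_vstrip[OF I(1)] that]
            simp: algebra_simps)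
    then have "vline_integral (\<lambda>z. deriv (\<lambda>z. exp (of_nat N * z) * g z) z * cnj (q z)) x
        = m (\<lambda>z. of_nat N * g z + 1 * deriv g z) x"
      unfolding m_def vline_integral_def using x by (intro integral_cong) simp
    ultimately show ?thesis
      using m_add[OF g periodic_holomorphic_on_deriv[OF I(1) g] x, of "of_nat N" 1]
      by (simp only: distrib_left mult.assoc mult_1)
  qed
  have md: "m (dseq f k) x = m (deriv (f k)) x + of_nat (k + 1) * m (f (k+1)) x" if "x \<in> I" for k x
    using m_add[OF periodic_holomorphic_on_deriv[OF I(1) f[of k]] f[of "k+1"] that, of 1 "of_nat (k+1)"]
    by (simp add: dseq_def[abs_def])
  have mz: "m (\<lambda>z. 0) x = 0" for x by (simp add: m_def vline_integral_def)
  define G where "G = (\<lambda>x. \<Sum>k<K. of_real ((2 * x) ^ k) * m (f k) x)"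
  define G' where "G' = (\<lambda>x. \<Sum>k<K. of_real ((2 * x) ^ k) * m (f k) x * (2 * of_nat N) + 2 * (of_real ((2 * x) ^ k) * m (dseq f k) x))"
  have G: "(G has_vector_derivative G' x) (at x within {-c..0})" if "x \<in> {-c..0}" for x
  proof -
    have xI: "x \<in> I" using that c by auto
    define p where "p = (\<lambda>k. if k = 0 then 0 else 2 * of_nat k * (2 * of_real x) ^ (k - 1) :: complex)"
    have p: "((\<lambda>x. of_real ((2 * x) ^ k)) has_vector_derivative p k) (at x)" for k
    proof (cases k)
      case (Suc n)
      have "((\<lambda>x. (2 * x) ^ k) has_real_derivative 2 * real k * (2 * x) ^ (k - 1)) (at x)"
        by (rule derivative_eq_intros refl | simp add: mult_ac)+
      then have "((\<lambda>x. complex_of_real ((2 * x) ^ k)) has_vector_derivative of_real (2 * real k * (2 * x) ^ (k - 1))) (at x)"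
        by (intro has_vector_derivative_of_real) (simp add: has_real_derivative_iff_has_vector_derivative)
      then show ?thesis by (simp add: p_def Suc)
    qed (simp add: p_def)
    have "(G has_vector_derivative (\<Sum>k<K. of_real ((2 * x) ^ k) * (2 * of_nat N * m (f k) x + 2 * m (deriv (f k)) x)
        + p k * m (f k) x)) (at x)"
      unfolding G_def
      by (intro has_vector_derivative_sum has_vector_derivative_mult p m' f xI)
    \<comment> \<open>The derivative of \<open>(2 x) ^ (k + 1)\<close> is
      \<open>2 (k + 1) (2 x) ^ k\<close>, so the sum is shifted by one index. The shift brings in
      \<open>f K\<close>, which is zero; this is why the sequences are cut off at
      \<open>K\<close>.\<close>
    moreover have "(\<Sum>k<K. p k * m (f k) x) = (\<Sum>k<K. 2 * (of_real ((2*x)^k) * (of_nat (k+1) * m (f (k+1)) x)))"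
    proof -
      have "(\<Sum>k<K. p k * m (f k) x) = (\<Sum>k<Suc K. p k * m (f k) x)"
        using K(2)[of K] by (simp add: mz)
      also have "\<dots> = (\<Sum>k<K. p (Suc k) * m (f (Suc k)) x)"
        by (subst sum.lessThan_Suc_shift) (simp add: p_def)
      finally show ?thesis by (simp add: p_def algebra_simps)
    qed
    ultimately have "(G has_vector_derivative G' x) (at x)"
      unfolding G'_def using md[OF xI] by (simp add: sum.distrib algebra_simps)
    then show ?thesis by (rule has_vector_derivative_at_within)
  qed
  have "(G' has_integral G 0 - G (-c)) {-c..0}"
    by (rule fundamental_theorem_of_calculus) (use c G in auto)
  moreover have "(G' has_integral (2 * of_nat N * osc_integral K N c q f + 2 * osc_integral K N c q (dseq f))) {-c..0}"
  proof -
    have "((\<lambda>x. of_real ((2 * x) ^ k) * m g x) has_integral integral {-c..0} (\<lambda>x. of_real ((2 * x) ^ k) * m g x)) {-c..0}"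
      if "periodic_holomorphic_on g I" for g k
      by (intro integrable_integral integrable_continuous_real continuous_intros mc that)
    note hi = this
    have "(G' has_integral (\<Sum>k<K. integral {-c..0} (\<lambda>x. of_real ((2 * x) ^ k) * m (f k) x) * (2 * of_nat N) +
        2 * integral {-c..0} (\<lambda>x. of_real ((2 * x) ^ k) * m (dseq f k) x))) {-c..0}"
      unfolding G'_def
      by (intro has_integral_sum has_integral_add has_integral_mult_left has_integral_mult_right hi f dseq_periodic_holomorphic I) auto
    then show ?thesis
      by (simp add: osc_integral_def m_def sum.distrib sum_distrib_left mult_ac)
  qed
  ultimately have "2 * of_nat N * osc_integral K N c q f + 2 * osc_integral K N c q (dseq f) = G 0 - G (-c)"
    using has_integral_unique by blast
  moreover have "G 0 = m (f 0) 0"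
    unfolding G_def using K(1) by (subst sum.remove[of _ 0]) (auto simp: power_0_left)
  moreover have "G (-c) = inner_term K N c q f" unfolding G_def inner_term_def m_def ..
  ultimately show ?thesis by (simp add: m_def field_simps)
qed

lemma dseq_funpow:
  assumes "open I" "\<And>k. periodic_holomorphic_on (f k) I" "\<And>k. k \<ge> K \<Longrightarrow> f k = (\<lambda>z. 0)"
  shows "periodic_holomorphic_on ((dseq ^^ l) f k) I" "k \<ge> K \<Longrightarrow> (dseq ^^ l) f k = (\<lambda>z. 0)"
proof -
  have "(\<forall>k. periodic_holomorphic_on ((dseq ^^ l) f k) I) \<and> (\<forall>k\<ge>K. (dseq ^^ l) f k = (\<lambda>z. 0))"
  proof (induction l)
    case (Suc l)
    then show ?case using dseq_periodic_holomorphic[OF assms(1)] dseq_zero[of K "(dseq ^^ l) f"] by auto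
  qed (use assms in auto)
  then show "periodic_holomorphic_on ((dseq ^^ l) f k) I" "k \<ge> K \<Longrightarrow> (dseq ^^ l) f k = (\<lambda>z. 0)" by auto
qed

text \<open>The integral left over by one integration by parts is of the same kind with
  \<open>dseq f\<close> in place of \<open>f\<close>, so the step can be repeated, each time with a
  factor \<open>- 1 / N\<close>.\<close>

lemma osc_integral_expansion:
  assumes I: "open I" "convex I" and f: "\<And>k. periodic_holomorphic_on (f k) I" and q: "periodic_holomorphic_on q I"
    and c: "0 \<le> c" "{-c..0} \<subseteq> I" and K: "K > 0" "\<And>k. k \<ge> K \<Longrightarrow> f k = (\<lambda>z. 0)" and N: "N > 0"
  shows "osc_integral K N c q f = (\<Sum>l<M. (-1) ^ l / of_nat N ^ (l + 1) *
       (vline_integral (\<lambda>z. exp (of_nat N * z) * (dseq ^^ l) f 0 z * cnj (q z)) 0 / 2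
        - inner_term K N c q ((dseq ^^ l) f) / 2))
     + (-1) ^ M / of_nat N ^ M * osc_integral K N c q ((dseq ^^ M) f)"
proof (induction M)
  case (Suc M)
  define g where "g = (dseq ^^ M) f"
  have g: "\<And>k. periodic_holomorphic_on (g k) I" "\<And>k. k \<ge> K \<Longrightarrow> g k = (\<lambda>z. 0)"
    using dseq_funpow[of I f K, OF I(1) f K(2)] by (auto simp: g_def)
  define E where "E = vline_integral (\<lambda>z. exp (of_nat N * z) * g 0 z * cnj (q z)) 0 / 2 - inner_term K N c q g / 2"
  have "of_nat N * osc_integral K N c q g = E - osc_integral K N c q (dseq g)"
    unfolding E_def by (rule osc_integral_by_parts[OF I g(1) q c K(1) g(2)])
  then have *: "osc_integral K N c q g = (E - osc_integral K N c q (dseq g)) / of_nat N"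
    using N by (simp add: field_simps)
  then have "(-1) ^ M / of_nat N ^ M * osc_integral K N c q g =
     (-1) ^ M / of_nat N ^ (M + 1) * E + (-1) ^ Suc M / of_nat N ^ Suc M * osc_integral K N c q (dseq g)"
    unfolding * using N by (simp add: field_simps)
  then show ?case using Suc by (simp add: g_def E_def)
qed simp

section \<open>Expansions of real-analytic weights along the axis\<close>

text \<open>Cauchy's inequality on radius \<open>d / 2\<close> bounds the coefficients by
  \<open>B * (2 / d) ^ k\<close>. For \<open>norm y \<le> d / 4\<close> the tail is dominated by a
  geometric series of ratio \<open>1/2\<close>, whence the factor 2.\<close>

lemma power_series_tail_bound:
  fixes f :: "complex \<Rightarrow> complex"
  assumes f: "f holomorphic_on ball 0 d" and d: "d > 0" and B: "\<And>y. y \<in> ball 0 d \<Longrightarrow> norm (f y) \<le> B"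
    and y: "norm y \<le> d / 4"
  shows "norm (f y - (\<Sum>k<M. (deriv ^^ k) f 0 / fact k * y ^ k)) \<le> 2 * B * (2 / d) ^ M * norm y ^ M"
proof -
  define a where "a = (\<lambda>k. (deriv ^^ k) f 0 / fact k)"
  have B0: "B \<ge> 0" using B[of 0] d by (meson centre_in_ball norm_ge_zero order_trans)
  have "norm ((deriv ^^ k) f 0) \<le> fact k * B / (d/2) ^ k" for k
  proof (rule Cauchy_inequality)
    show "f holomorphic_on ball 0 (d/2)" using d by (intro holomorphic_on_subset[OF f]) auto
    show "continuous_on (cball 0 (d/2)) f"
      using d by (intro continuous_on_subset[OF holomorphic_on_imp_continuous_on[OF f]]) auto
  qed (use d B in auto)
  then have a: "norm (a k) \<le> B * (2 / d) ^ k" for k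
    by (simp add: a_def norm_divide field_simps power_divide)
  have "y \<in> ball 0 d" using y d by auto
  from holomorphic_power_series[OF f this] have "(\<lambda>k. a k * y ^ k) sums f y"
    by (simp add: a_def)
  then have s: "(\<lambda>k. a (k + M) * y ^ (k + M)) sums (f y - (\<Sum>k<M. a k * y ^ k))"
    by (rule sums_split_initial_segment)
  define r where "r = 2 / d * norm y"
  have r: "0 \<le> r" "r \<le> 1/2" using y d by (auto simp: r_def field_simps)
  have g: "(\<lambda>k. B * r ^ M * (1/2) ^ k) sums (B * r ^ M * (1 / (1 - 1/2)))"
    by (intro sums_mult geometric_sums) auto
  have "norm (f y - (\<Sum>k<M. a k * y ^ k)) \<le> B * r ^ M * (1 / (1 - 1/2))"
  proof (rule norm_sums_le[OF s g])
    fix k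
    have "norm (a (k + M) * y ^ (k + M)) \<le> B * (2 / d) ^ (k + M) * norm y ^ (k + M)"
      using a[of "k+M"] by (simp add: norm_mult norm_power mult_right_mono)
    also have "\<dots> = B * r ^ M * r ^ k" by (simp only: r_def power_mult_distrib power_add mult_ac)
    also have "\<dots> \<le> B * r ^ M * (1/2) ^ k"
      using r B0 by (intro mult_left_mono power_mono) auto
    finally show "norm (a (k + M) * y ^ (k + M)) \<le> B * r ^ M * (1/2) ^ k" .
  qed
  then show ?thesis unfolding r_def a_def power_mult_distrib by (simp add: mult_ac)
qed

text \<open>Only separate holomorphy is at hand, so holomorphy of the Taylor coefficients in
  \<open>z\<close> needs an argument: by induction, \<open>h k\<close> is a uniform limit of
  quotients built from \<open>H\<close> at fixed \<open>y\<close> and the earlier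
  coefficients.\<close>

lemma separately_holomorphic_expansion:
  fixes H :: "complex \<Rightarrow> complex \<Rightarrow> complex"
  assumes S: "open S" and d: "d > 0"
    and H1: "\<And>y. y \<in> ball 0 d \<Longrightarrow> (\<lambda>z. H z y) holomorphic_on S"
    and H2: "\<And>z. z \<in> S \<Longrightarrow> H z holomorphic_on ball 0 d"
    and B: "\<And>z y. z \<in> S \<Longrightarrow> y \<in> ball 0 d \<Longrightarrow> norm (H z y) \<le> B"
  obtains h where "\<And>k. h k holomorphic_on S"
    and "\<And>M. \<exists>C. \<forall>z\<in>S. \<forall>y. norm y \<le> d / 4 \<longrightarrow> norm (H z y - (\<Sum>k<M. h k z * y ^ k)) \<le> C * norm y ^ M"
proof -
  define h where "h = (\<lambda>k z. (deriv ^^ k) (H z) 0 / fact k)"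
  have bd: "norm (H z y - (\<Sum>k<M. h k z * y ^ k)) \<le> 2 * B * (2 / d) ^ M * norm y ^ M"
    if "z \<in> S" "norm y \<le> d / 4" for z y M
    unfolding h_def using power_series_tail_bound[OF H2[OF that(1)] d B[OF that(1)] that(2)] by simp
  have "h k holomorphic_on S" for k
  proof (induction k rule: less_induct)
    case (less k)
    \<comment> \<open>Nonzero points tending to 0 within the range of the tail bound. Dividing the
      remainder of order \<open>k\<close> by \<open>y n ^ k\<close> gives \<open>h k\<close> up to
      an error of order \<open>norm (y n)\<close>, uniformly in \<open>z\<close>.\<close>
    define y where "y = (\<lambda>n. complex_of_real (d / 4 / real (Suc n)))"
    have y: "y n \<in> ball 0 d" "norm (y n) \<le> d / 4" "y n \<noteq> 0" for n
    proof -
      have eq: "norm (y n) = d / 4 / real (Suc n)" unfolding y_def norm_of_real using d by simp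
      also have "\<dots> \<le> d / 4" using d by (simp add: field_simps)
      finally show "norm (y n) \<le> d / 4" .
      then show "y n \<in> ball 0 d" using d by auto
      show "y n \<noteq> 0" using eq d by (metis divide_eq_0_iff norm_eq_zero of_nat_eq_0_iff less_irrefl nat.distinct(1) zero_neq_numeral)
    qed
    have "(\<lambda>n. d / 4 / real (Suc n)) \<longlonglongrightarrow> 0" by (rule LIMSEQ_Suc[OF lim_const_over_n])
    then have y0: "(\<lambda>n. norm (y n)) \<longlonglongrightarrow> 0"
      unfolding y_def norm_of_real by (rule tendsto_rabs_zero)
    define g where "g = (\<lambda>n z. (H z (y n) - (\<Sum>j<k. h j z * y n ^ j)) / y n ^ k)"
    define C where "C = 2 * B * (2 / d) ^ Suc k"
    have gh: "norm (g n z - h k z) \<le> C * norm (y n)" if "z \<in> S" for n z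
    proof -
      have "g n z - h k z = (H z (y n) - (\<Sum>j<Suc k. h j z * y n ^ j)) / y n ^ k"
        using y(3)[of n] by (simp add: g_def field_simps)
      then have "norm (g n z - h k z) \<le> C * norm (y n) ^ Suc k / norm (y n) ^ k"
        unfolding C_def using bd[OF that y(2)[of n], of "Suc k"]
        by (simp only: norm_divide norm_power) (intro divide_right_mono, auto)
      then show ?thesis using y(3)[of n] by simp
    qed
    have ul: "uniform_limit S g (h k) sequentially"
    proof (rule uniform_limitI)
      fix e :: real assume "e > 0"
      have "(\<lambda>n. C * norm (y n)) \<longlonglongrightarrow> C * 0" by (intro tendsto_intros y0)
      then have "\<forall>\<^sub>F n in sequentially. C * norm (y n) < e"
        using \<open>e > 0\<close> by (auto dest: order_tendstoD)
      then show "\<forall>\<^sub>F n in sequentially. \<forall>x\<in>S. dist (g n x) (h k x) < e"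
        by eventually_elim (use gh in \<open>auto simp: dist_norm intro: le_less_trans\<close>)
    qed
    show "h k holomorphic_on S"
    proof (rule holomorphic_uniform_sequence[OF S])
      show "g n holomorphic_on S" for n
        unfolding g_def using less y(1,3) by (intro holomorphic_intros H1) auto
      fix x assume "x \<in> S"
      then obtain e where "e > 0" "cball x e \<subseteq> S" using S open_contains_cball by blast
      then show "\<exists>d>0. cball x d \<subseteq> S \<and> uniform_limit (cball x d) g (h k) sequentially"
        using uniform_limit_on_subset[OF ul] by blast
    qed
  qed
  then show ?thesis using that[of h] bd by blast
qed

section \<open>Uniqueness and gluing of expansions in \<open>2 Re z\<close>\<close>

definition axis_expansion ::
    "(complex \<Rightarrow> complex) \<Rightarrow> complex set \<Rightarrow> (nat \<Rightarrow> complex \<Rightarrow> complex) \<Rightarrow> (nat \<Rightarrow> real) \<Rightarrow> bool"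
  where "axis_expansion F S h C \<longleftrightarrow> (\<forall>k. h k holomorphic_on S) \<and>
     (\<forall>M. \<forall>z\<in>S. norm (F z - (\<Sum>k<M. h k z * of_real (2 * Re z) ^ k)) \<le> C M * \<bar>Re z\<bar> ^ M)"

lemma axis_expansion_subset:
  assumes "axis_expansion F S h C" "T \<subseteq> S" shows "axis_expansion F T h C"
  using assms unfolding axis_expansion_def by (meson holomorphic_on_subset subsetD)

lemma axis_expansion_mono:
  assumes "axis_expansion F S h C" "\<And>M. C M \<le> C' M" shows "axis_expansion F S h C'"
  using assms unfolding axis_expansion_def
  by (meson abs_ge_zero mult_right_mono order_trans zero_le_power)

lemma axis_expansion_shift:
  assumes h: "axis_expansion F S h C" and F: "\<And>z. F (z + of_real t * \<i>) = F z"
  shows "axis_expansion F ((\<lambda>z. z + of_real t * \<i>) -` S) (\<lambda>k z. h k (z + of_real t * \<i>)) C"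
  unfolding axis_expansion_def
proof (intro conjI allI ballI)
  fix k
  have "(h k \<circ> (\<lambda>z. z + of_real t * \<i>)) holomorphic_on ((\<lambda>z. z + of_real t * \<i>) -` S)"
    using h by (intro holomorphic_on_compose_gen[of _ _ _ S]) (auto simp: axis_expansion_def intro!: holomorphic_intros)
  then show "(\<lambda>z. h k (z + of_real t * \<i>)) holomorphic_on ((\<lambda>z. z + of_real t * \<i>) -` S)"
    by (simp add: o_def)
next
  fix M z assume "z \<in> (\<lambda>z. z + of_real t * \<i>) -` S"
  then have "norm (F (z + of_real t * \<i>) - (\<Sum>k<M. h k (z + of_real t * \<i>) * of_real (2 * Re (z + of_real t * \<i>)) ^ k))
     \<le> C M * \<bar>Re (z + of_real t * \<i>)\<bar> ^ M"
    using h unfolding axis_expansion_def by blast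
  then show "norm (F z - (\<Sum>k<M. h k (z + of_real t * \<i>) * of_real (2 * Re z) ^ k)) \<le> C M * \<bar>Re z\<bar> ^ M"
    by (simp add: F)
qed

text \<open>Remainder bounds of all orders already fix the coefficients: if they agree below
  \<open>k\<close>, the difference at \<open>k\<close> is of order \<open>Re z\<close> off the axis,
  hence zero on the axis by continuity, hence zero on the connected set by the identity
  theorem.\<close>

lemma axis_expansion_unique:
  assumes S: "open S" "convex S" and ax: "Complex 0 s \<in> S"
    and h: "axis_expansion F S h C" and h': "axis_expansion F S h' C'" and z: "z \<in> S"
  shows "h k z = h' k z"
  using z
proof (induction k arbitrary: z rule: less_induct)
  case (less k)
  define g where "g = (\<lambda>z. h k z - h' k z)"
  have g: "g holomorphic_on S"
    unfolding g_def using h h' by (intro holomorphic_intros) (auto simp: axis_expansion_def)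
  define D where "D = C (Suc k) + C' (Suc k)"
  have le: "norm (g z) \<le> D * \<bar>Re z\<bar>" if "z \<in> S" "Re z \<noteq> 0" for z
  proof -
    have 1: "norm (F z - (\<Sum>k<Suc k. h k z * of_real (2 * Re z) ^ k)) \<le> C (Suc k) * \<bar>Re z\<bar> ^ Suc k"
      and 2: "norm (F z - (\<Sum>k<Suc k. h' k z * of_real (2 * Re z) ^ k)) \<le> C' (Suc k) * \<bar>Re z\<bar> ^ Suc k"
      using h h' that unfolding axis_expansion_def by blast+
    have eq: "(\<Sum>j<k. h j z * of_real (2 * Re z) ^ j) = (\<Sum>j<k. h' j z * of_real (2 * Re z) ^ j)"
      using less.IH that by (intro sum.cong) auto
    have "g z * of_real (2 * Re z) ^ k = (F z - (\<Sum>k<Suc k. h' k z * of_real (2 * Re z) ^ k))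
       - (F z - (\<Sum>k<Suc k. h k z * of_real (2 * Re z) ^ k))"
      using eq by (simp add: g_def algebra_simps)
    also have "norm \<dots> \<le> C' (Suc k) * \<bar>Re z\<bar> ^ Suc k + C (Suc k) * \<bar>Re z\<bar> ^ Suc k"
      using 1 2 norm_triangle_ineq4 by (meson add_mono order_trans)
    finally have "norm (g z) * \<bar>2 * Re z\<bar> ^ k \<le> D * \<bar>Re z\<bar> ^ Suc k"
      unfolding D_def norm_mult norm_power norm_of_real by (simp only: algebra_simps)
    moreover have "norm (g z) * \<bar>Re z\<bar> ^ k \<le> norm (g z) * \<bar>2 * Re z\<bar> ^ k"
      by (intro mult_left_mono power_mono) auto
    ultimately have "norm (g z) * \<bar>Re z\<bar> ^ k \<le> D * \<bar>Re z\<bar> * \<bar>Re z\<bar> ^ k"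
      by (simp add: mult_ac)
    then show ?thesis using that by simp
  qed
  have zero: "g (Complex 0 t) = 0" if t: "Complex 0 t \<in> S" for t
  proof -
    have "isCont g (Complex 0 t)"
      using holomorphic_on_imp_continuous_on[OF g] S(1) t continuous_on_eq_continuous_at by blast
    moreover have c: "((\<lambda>x. Complex x t) \<longlongrightarrow> Complex 0 t) (at_right 0)"
      unfolding Complex_eq by (auto intro!: tendsto_eq_intros)
    ultimately have "((\<lambda>x. g (Complex x t)) \<longlongrightarrow> g (Complex 0 t)) (at_right 0)"
      by (rule isCont_tendsto_compose)
    then have 1: "((\<lambda>x. norm (g (Complex x t))) \<longlongrightarrow> norm (g (Complex 0 t))) (at_right 0)"
      by (rule tendsto_norm)
    have 2: "((\<lambda>x::real. D * \<bar>x\<bar>) \<longlongrightarrow> 0) (at_right 0)"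
      by (auto intro!: tendsto_eq_intros)
    have "\<forall>\<^sub>F x in at_right 0. Complex x t \<in> S"
      using topological_tendstoD[OF c S(1) t] .
    moreover have "\<forall>\<^sub>F x::real in at_right 0. x > 0" by (simp add: eventually_at_right_less)
    ultimately have "\<forall>\<^sub>F x in at_right 0. norm (g (Complex x t)) \<le> D * \<bar>x\<bar>"
      by eventually_elim (use le in force)
    then have "norm (g (Complex 0 t)) \<le> 0"
      using tendsto_le[OF _ 2 1] by simp
    then show ?thesis by simp
  qed
  define U where "U = {z \<in> S. Re z = 0}"
  have "Complex 0 s islimpt U"
    unfolding islimpt_approachable
  proof (intro allI impI)
    fix e :: real assume "e > 0"
    obtain r where r: "r > 0" "ball (Complex 0 s) r \<subseteq> S" using S(1) ax open_contains_ball by blast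
    define w where "w = Complex 0 (s + min e r / 2)"
    have "dist w (Complex 0 s) = min e r / 2" using \<open>e > 0\<close> r(1) by (simp add: w_def dist_norm cmod_def)
    then show "\<exists>x'\<in>U. x' \<noteq> Complex 0 s \<and> dist x' (Complex 0 s) < e"
      using r \<open>e > 0\<close> by (intro bexI[of _ w]) (auto simp: U_def w_def dist_commute)
  qed
  moreover have "g w = 0" if "w \<in> U" for w
    using zero[of "Im w"] that by (simp add: U_def complex_eq_iff) (metis complex_eq_iff complex.sel)
  ultimately have "g z = 0"
    using analytic_continuation[OF g S(1) convex_connected[OF S(2)], of U "Complex 0 s" z] ax less.prems
    by (auto simp: U_def)
  then show ?case by (simp add: g_def)
qed

text \<open>A Lebesgue number for a finite cover of one period yields one radius; the finitely many
  charts yield one family of constants; other heights are translated into the first period.\<close>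

lemma axis_expansion_uniform_charts:
  assumes per: "\<And>z. F (z + 2 * of_real pi * \<i>) = F z"
    and loc: "\<And>t. \<exists>e>0. \<exists>h C. axis_expansion F (ball (Complex 0 t) e) h C"
  obtains \<delta> hs C where "\<delta> > 0" "\<And>t. axis_expansion F (ball (Complex 0 t) \<delta>) (hs t) C"
proof -
  obtain e h C where e: "\<And>t. e t > 0" and h: "\<And>t. axis_expansion F (ball (Complex 0 t) (e t)) (h t) (C t)"
    using loc by metis
  define A where "A = (\<lambda>t. Complex 0 t) ` {0..2*pi}"
  have A: "compact A" unfolding A_def by (intro compact_continuous_image continuous_intros) auto
  have "A \<subseteq> (\<Union>t\<in>{0..2*pi}. ball (Complex 0 t) (e t))" using e by (force simp: A_def)
  then obtain T where T: "T \<subseteq> {0..2*pi}" "finite T" "A \<subseteq> (\<Union>t\<in>T. ball (Complex 0 t) (e t))"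
    using compactE_image[OF A, of "{0..2*pi}" "\<lambda>t. ball (Complex 0 t) (e t)"] by auto
  obtain \<delta> where \<delta>: "0 < \<delta>" "\<And>x. x \<in> A \<Longrightarrow> \<exists>G \<in> (\<lambda>t. ball (Complex 0 t) (e t)) ` T. ball x \<delta> \<subseteq> G"
    using Heine_Borel_lemma[OF A, of "(\<lambda>t. ball (Complex 0 t) (e t)) ` T"] T(3) by auto
  then have "\<forall>t\<in>{0..2*pi}. \<exists>u\<in>T. ball (Complex 0 t) \<delta> \<subseteq> ball (Complex 0 u) (e u)"
    by (auto simp: A_def)
  then obtain u where u: "\<And>t. t \<in> {0..2*pi} \<Longrightarrow> u t \<in> T \<and> ball (Complex 0 t) \<delta> \<subseteq> ball (Complex 0 (u t)) (e (u t))"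
    by metis
  \<comment> \<open>The sum over the finite subcover dominates each of its constants.\<close>
  define C' where "C' = (\<lambda>M. \<Sum>t\<in>T. \<bar>C t M\<bar>)"
  have C': "C t M \<le> C' M" if "t \<in> T" for t M
  proof -
    have "\<bar>C t M\<bar> \<le> C' M" unfolding C'_def using T(2) that by (intro member_le_sum) auto
    then show ?thesis by linarith
  qed
  have loc0: "axis_expansion F (ball (Complex 0 t) \<delta>) (h (u t)) C'" if "t \<in> {0..2*pi}" for t
    using axis_expansion_mono[OF axis_expansion_subset[OF h]] u[OF that] C' by blast
  \<comment> \<open>The multiple of the period that carries the height \<open>t\<close> into
    \<open>[0, 2 pi]\<close>.\<close>
  define n where "n = (\<lambda>t. - 2 * pi * of_int \<lfloor>t / (2 * pi)\<rfloor>)"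
  have n: "t + n t \<in> {0..2*pi}" for t
  proof -
    have "of_int \<lfloor>t / (2*pi)\<rfloor> \<le> t / (2*pi)" "t / (2*pi) \<le> of_int \<lfloor>t / (2*pi)\<rfloor> + 1" by linarith+
    then have "of_int \<lfloor>t / (2*pi)\<rfloor> * (2*pi) \<le> t" "t \<le> (of_int \<lfloor>t / (2*pi)\<rfloor> + 1) * (2 * pi)"
      using mult_right_mono[of "of_int \<lfloor>t / (2*pi)\<rfloor>" "t / (2*pi)" "2*pi"]
        mult_right_mono[of "t / (2*pi)" "of_int \<lfloor>t / (2*pi)\<rfloor> + 1" "2*pi"] by simp_all
    then show ?thesis by (simp add: n_def algebra_simps)
  qed
  have Fn: "F (z + of_real (- 2 * pi * of_int m) * \<i>) = F z" for z m
  proof -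
    have 1: "F (z + of_real (2 * pi * of_nat m) * \<i>) = F z" for z m
    proof (induction m)
      case (Suc m)
      have "F (z + of_real (2 * pi * of_nat (Suc m)) * \<i>) = F ((z + of_real (2 * pi * of_nat m) * \<i>) + 2 * of_real pi * \<i>)"
        by (simp add: algebra_simps)
      then show ?case using per Suc by simp
    qed simp
    show ?thesis
    proof (cases "m \<le> 0")
      case True
      then show ?thesis using 1[of z "nat (- m)"] by simp
    next
      case False
      then show ?thesis using 1[of "z + of_real (- 2 * pi * of_int m) * \<i>" "nat m"] by simp
    qed
  qed
  define hs where "hs = (\<lambda>t k z. h (u (t + n t)) k (z + of_real (n t) * \<i>))"
  have "axis_expansion F (ball (Complex 0 t) \<delta>) (hs t) C'" for t
  proof -
    have "axis_expansion F ((\<lambda>z. z + of_real (n t) * \<i>) -` ball (Complex 0 (t + n t)) \<delta>) (hs t) C'"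
      unfolding hs_def by (rule axis_expansion_shift[OF loc0[OF n]]) (unfold n_def, rule Fn)
    moreover have "(\<lambda>z. z + of_real (n t) * \<i>) -` ball (Complex 0 (t + n t)) \<delta> = ball (Complex 0 t) \<delta>"
    proof -
      have "norm (Complex 0 (t + n t) - (z + of_real (n t) * \<i>)) = norm (Complex 0 t - z)" for z
        by (rule arg_cong[of _ _ norm]) (simp add: complex_eq_iff)
      then show ?thesis unfolding vimage_def ball_def dist_norm by auto
    qed
    ultimately show ?thesis by simp
  qed
  then show ?thesis using that \<delta>(1) by blast
qed

text \<open>At \<open>z\<close> the coefficients are read off from the chart centred at its own
  height. Uniqueness shows that this agrees with every other chart containing \<open>z\<close>,
  which gives both holomorphy and periodicity.\<close>

lemma axis_expansion_glue:
  assumes per: "\<And>z. F (z + 2 * of_real pi * \<i>) = F z"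
    and loc: "\<And>t. \<exists>e>0. \<exists>h C. axis_expansion F (ball (Complex 0 t) e) h C"
  obtains \<delta> h C where "\<delta> > 0" "\<And>k. periodic_holomorphic_on (h k) {-\<delta><..<\<delta>}"
    "axis_expansion F (vstrip {-\<delta><..<\<delta>}) h C"
proof -
  obtain \<delta> hs C where \<delta>: "\<delta> > 0" and hs: "\<And>t. axis_expansion F (ball (Complex 0 t) \<delta>) (hs t) C"
    using axis_expansion_uniform_charts[OF per loc] by metis
  define h where "h = (\<lambda>k z. hs (Im z) k z)"
  have own: "z \<in> ball (Complex 0 (Im z)) \<delta>" if "z \<in> vstrip {-\<delta><..<\<delta>}" for z
  proof -
    have "Complex 0 (Im z) - z = of_real (- Re z)" by (simp add: complex_eq_iff)
    then show ?thesis using that by (simp add: dist_norm vstrip_def abs_less_iff del: of_real_minus)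
  qed
  have eq: "h k z = g k z" if z: "z \<in> ball (Complex 0 t) \<delta>" "z \<in> vstrip {-\<delta><..<\<delta>}"
    and g: "axis_expansion F (ball (Complex 0 t) \<delta>) g C" for k z t g
  proof -
    \<comment> \<open>A convex set that contains the axis point at height \<open>Im z\<close>, as
      the uniqueness lemma demands.\<close>
    let ?S = "ball (Complex 0 t) \<delta> \<inter> ball (Complex 0 (Im z)) \<delta>"
    have "norm (Complex 0 t - Complex 0 (Im z)) \<le> norm (Complex 0 t - z)"
      by (simp add: cmod_def)
    then have "Complex 0 (Im z) \<in> ?S" using z \<delta> by (simp add: dist_norm)
    then show ?thesis
      unfolding h_def
      by (intro axis_expansion_unique[of ?S "Im z" F "hs (Im z)" C g C])
        (use own z in \<open>auto intro!: convex_Int intro: axis_expansion_subset[OF hs] axis_expansion_subset[OF g]\<close>)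
  qed
  have hol: "h k holomorphic_on vstrip {-\<delta><..<\<delta>}" for k
  proof -
    have "\<exists>f'. (h k has_field_derivative f') (at z)" if z: "z \<in> vstrip {-\<delta><..<\<delta>}" for z
    proof -
      let ?S = "ball (Complex 0 (Im z)) \<delta> \<inter> vstrip {-\<delta><..<\<delta>}"
      have "hs (Im z) k holomorphic_on ?S" using hs by (auto simp: axis_expansion_def intro: holomorphic_on_subset)
      then have "h k holomorphic_on ?S"
        by (rule holomorphic_transform) (use eq[OF _ _ hs] in auto)
      moreover have "open ?S" by (intro open_Int open_vstrip) auto
      ultimately show ?thesis using own[OF z] z holomorphic_derivI by blast
    qed
    then show ?thesis by (simp add: holomorphic_on_open open_vstrip)
  qed
  have "h k (z + 2 * of_real pi * \<i>) = h k z" if z: "z \<in> vstrip {-\<delta><..<\<delta>}" for k z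
  proof -
    define t where "t = Im z + 2 * pi"
    have F: "F (z + of_real (2 * pi) * \<i>) = F z" for z using per[of z] by simp
    have "axis_expansion F ((\<lambda>z. z + of_real (2*pi) * \<i>) -` ball (Complex 0 t) \<delta>) (\<lambda>k z. hs t k (z + of_real (2*pi) * \<i>)) C"
      by (rule axis_expansion_shift[OF hs F])
    moreover have "(\<lambda>z. z + of_real (2*pi) * \<i>) -` ball (Complex 0 t) \<delta> = ball (Complex 0 (Im z)) \<delta>"
    proof -
      have "norm (Complex 0 t - (w + of_real (2*pi) * \<i>)) = norm (Complex 0 (Im z) - w)" for w
        by (rule arg_cong[of _ _ norm]) (simp add: complex_eq_iff t_def)
      then show ?thesis unfolding vimage_def ball_def dist_norm by auto
    qed
    ultimately have "axis_expansion F (ball (Complex 0 (Im z)) \<delta>) (\<lambda>k z. hs t k (z + of_real (2*pi) * \<i>)) C"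
      by simp
    from eq[OF own[OF z] z this] have "h k z = hs t k (z + of_real (2*pi) * \<i>)" .
    then show ?thesis by (simp add: h_def t_def)
  qed
  then have 1: "periodic_holomorphic_on (h k) {-\<delta><..<\<delta>}" for k
    using hol by (auto simp: periodic_holomorphic_on_def)
  have "axis_expansion F (vstrip {-\<delta><..<\<delta>}) h C"
    unfolding axis_expansion_def
  proof (intro conjI allI ballI hol)
    fix M z assume "z \<in> vstrip {-\<delta><..<\<delta>}"
    from own[OF this] show "norm (F z - (\<Sum>k<M. h k z * of_real (2 * Re z) ^ k)) \<le> C M * \<bar>Re z\<bar> ^ M"
      using hs[of "Im z"] unfolding axis_expansion_def h_def by blast
  qed
  then show ?thesis using that \<delta> 1 by blast
qed

section \<open>Complexification of a real-analytic weight\<close>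

lemma holomorphic_double_series:
  fixes c :: "nat \<times> nat \<Rightarrow> real"
  assumes S: "open S" and sm: "(\<lambda>(m, n). \<bar>c (m, n)\<bar> * r ^ m * r ^ n) summable_on UNIV"
    and X: "X holomorphic_on S" "\<And>z. z \<in> S \<Longrightarrow> norm (X z) \<le> r"
    and Y: "Y holomorphic_on S" "\<And>z. z \<in> S \<Longrightarrow> norm (Y z) \<le> r"
  shows "(\<lambda>z. \<Sum>\<^sub>\<infinity>(m, n). of_real (c (m, n)) * X z ^ m * Y z ^ n) holomorphic_on S"
    and "z \<in> S \<Longrightarrow> norm (\<Sum>\<^sub>\<infinity>(m, n). of_real (c (m, n)) * X z ^ m * Y z ^ n) \<le> (\<Sum>\<^sub>\<infinity>(m, n). \<bar>c (m, n)\<bar> * r ^ m * r ^ n)"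
proof -
  define f where "f = (\<lambda>(m, n) z. of_real (c (m, n)) * X z ^ m * Y z ^ n)"
  define B where "B = (\<lambda>(m, n). \<bar>c (m, n)\<bar> * r ^ m * r ^ n)"
  have le: "norm (f p z) \<le> B p" if "z \<in> S" for p z
  proof -
    obtain m n where p: "p = (m, n)" by fastforce
    have r: "r \<ge> 0" using X(2)[OF that] norm_ge_zero order_trans by blast
    have "norm (f p z) = \<bar>c (m, n)\<bar> * norm (X z) ^ m * norm (Y z) ^ n"
      by (simp add: f_def p norm_mult norm_power)
    also have "\<dots> \<le> \<bar>c (m, n)\<bar> * r ^ m * r ^ n"
      using X(2)[OF that] Y(2)[OF that] r by (intro mult_mono power_mono) auto
    finally show ?thesis by (simp add: B_def p)
  qed
  have smB: "B summable_on UNIV" using sm by (simp add: B_def)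
  \<comment> \<open>The M-test runs over finite sets of index pairs, so no order of summation has to
    be chosen.\<close>
  have ul: "uniform_limit S (\<lambda>A z. \<Sum>p\<in>A. f p z) (\<lambda>z. \<Sum>\<^sub>\<infinity>p. f p z) (finite_subsets_at_top UNIV)"
    by (rule Weierstrass_m_test_general[OF le smB])
  have feq: "(\<Sum>\<^sub>\<infinity>p. f p z) = (\<Sum>\<^sub>\<infinity>(m, n). of_real (c (m, n)) * X z ^ m * Y z ^ n)" for z
    by (intro infsum_cong) (auto simp: f_def)
  have fh: "(\<lambda>z. \<Sum>p\<in>A. f p z) holomorphic_on S" for A
    using X Y by (intro holomorphic_intros) (auto simp: f_def split_beta intro!: holomorphic_intros)
  have "\<exists>f'. ((\<lambda>z. \<Sum>\<^sub>\<infinity>p. f p z) has_field_derivative f') (at z)" if z: "z \<in> S" for z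
  proof -
    obtain e where e: "e > 0" "cball z e \<subseteq> S" using S z open_contains_cball by blast
    have "(\<lambda>z. \<Sum>\<^sub>\<infinity>p. f p z) holomorphic_on ball z e"
    proof (rule holomorphic_uniform_limit[OF _ uniform_limit_on_subset[OF ul e(2)]])
      show "\<forall>\<^sub>F A in finite_subsets_at_top UNIV. continuous_on (cball z e) (\<lambda>z. \<Sum>p\<in>A. f p z)
         \<and> (\<lambda>z. \<Sum>p\<in>A. f p z) holomorphic_on ball z e"
        using e(2) ball_subset_cball[of z e]
        by (intro always_eventually allI conjI continuous_on_subset[OF holomorphic_on_imp_continuous_on[OF fh]]
            holomorphic_on_subset[OF fh]) auto
    qed auto
    then show ?thesis using e(1) holomorphic_derivI[of _ "ball z e" z] by auto
  qed
  then show "(\<lambda>z. \<Sum>\<^sub>\<infinity>(m, n). of_real (c (m, n)) * X z ^ m * Y z ^ n) holomorphic_on S"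
    unfolding feq[symmetric] by (simp add: holomorphic_on_open S)
  assume z: "z \<in> S"
  have "norm (\<Sum>\<^sub>\<infinity>p. f p z) \<le> (\<Sum>\<^sub>\<infinity>p. B p)"
  proof (rule norm_infsum_le)
    show "((\<lambda>p. f p z) has_sum (\<Sum>\<^sub>\<infinity>p. f p z)) UNIV"
      using abs_summable_summable[OF Infinite_Sum.abs_summable_on_comparison_test'[OF smB le[OF z]]] by simp
    show "(B has_sum (\<Sum>\<^sub>\<infinity>p. B p)) UNIV" using smB by simp
  qed (use le[OF z] in auto)
  then show "norm (\<Sum>\<^sub>\<infinity>(m, n). of_real (c (m, n)) * X z ^ m * Y z ^ n) \<le> (\<Sum>\<^sub>\<infinity>(m, n). \<bar>c (m, n)\<bar> * r ^ m * r ^ n)"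
    unfolding feq B_def .
qed


lemma holomorphic_on_reflected_ball:
  assumes "f holomorphic_on ball z0 R"
  shows "(\<lambda>s. cnj (f (cnj s))) holomorphic_on ball (cnj z0) R"
proof -
  have "cnj ` ball (cnj z0) R \<subseteq> ball z0 R"
    by (auto simp: dist_norm simp flip: complex_cnj_diff) (metis complex_cnj_cnj complex_cnj_diff complex_mod_cnj)
  then have "(cnj \<circ> f \<circ> cnj) holomorphic_on ball (cnj z0) R"
    using assms by (intro holomorphic_on_compose_cnj_cnj) (auto intro: holomorphic_on_subset)
  then show ?thesis by (simp add: o_def)
qed

text \<open>Polarization: \<open>cnj z\<close> is replaced by the independent variable
  \<open>y - z\<close>. The real and imaginary parts of \<open>\<Psi> z - \<Psi> z0\<close> become
  holomorphic in \<open>z\<close> and in \<open>y\<close>, and so does the whole function. Its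
  Taylor series in \<open>y\<close>, evaluated at \<open>y = 2 Re z = z + cnj z\<close>, is the
  required expansion.\<close>

lemma analytic_weight_local_expansion:
  fixes \<Psi> v :: "complex \<Rightarrow> complex" and g :: "complex \<Rightarrow> real" and c :: "nat \<times> nat \<Rightarrow> real"
  assumes G: "open G" "z0 \<in> G" "Re z0 = 0" and \<Psi>: "\<Psi> holomorphic_on G" and v: "v holomorphic_on G"
    and r: "r > 0" and c: "\<And>x y. \<bar>x\<bar> < r \<Longrightarrow> \<bar>y\<bar> < r \<Longrightarrow>
       ((\<lambda>(m, n). c (m, n) * x ^ m * y ^ n) has_sum g (\<Psi> z0 + Complex x y)) UNIV"
  shows "\<exists>e>0. \<exists>h C. axis_expansion (\<lambda>z. exp (of_real (g (\<Psi> z)) + v z + cnj (v z))) (ball z0 e) h C"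
proof -
  define a where "a = \<Psi> z0"
  define r' where "r' = r / 2"
  have "isCont \<Psi> z0" "isCont v z0"
    using G \<Psi> v holomorphic_on_imp_continuous_on continuous_on_eq_continuous_at by blast+
  then obtain e1 e2 where e1: "e1 > 0" "\<And>z. dist z z0 < e1 \<Longrightarrow> dist (\<Psi> z) a < r'"
    and e2: "e2 > 0" "\<And>z. dist z z0 < e2 \<Longrightarrow> dist (v z) (v z0) < 1"
    unfolding continuous_at_eps_delta a_def r'_def using r by (metis half_gt_zero zero_less_one)
  obtain e3 where e3: "e3 > 0" "ball z0 e3 \<subseteq> G" using G open_contains_ball by blast
  \<comment> \<open>Halving leaves room: with \<open>z\<close> within \<open>e\<close> of
    \<open>z0\<close> and \<open>y\<close> within \<open>e\<close> of \<open>0\<close>, the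
    reflected argument \<open>cnj (y - z)\<close> stays within \<open>2 * e\<close> of
    \<open>z0\<close>.\<close>
  define e where "e = min e1 (min e2 e3) / 2"
  have e: "e > 0" using e1 e2 e3 by (simp add: e_def)
  have \<Psi>2: "\<Psi> holomorphic_on ball z0 (2*e)" and v2: "v holomorphic_on ball z0 (2*e)"
    using e3 by (auto simp: e_def intro!: holomorphic_on_subset[OF \<Psi>] holomorphic_on_subset[OF v])
  have \<Psi>le: "norm (\<Psi> z - a) \<le> r'" and vle: "norm (v z) \<le> norm (v z0) + 1" if "z \<in> ball z0 (2*e)" for z
  proof -
    have *: "dist z z0 < e1" "dist z z0 < e2" using that by (auto simp: e_def dist_commute)
    show "norm (\<Psi> z - a) \<le> r'" using e1(2)[OF *(1)] by (simp add: dist_norm)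
    have "norm (v z - v z0) < 1" using e2(2)[OF *(2)] by (simp add: dist_norm)
    then show "norm (v z) \<le> norm (v z0) + 1" using norm_triangle_sub[of "v z" "v z0"] by simp
  qed
  define P where "P = (\<lambda>z. \<Psi> z - a)"
  define Ps where "Ps = (\<lambda>s. cnj (P (cnj s)))"
  define vs where "vs = (\<lambda>s. cnj (v (cnj s)))"
  have P: "P holomorphic_on ball z0 (2*e)" unfolding P_def by (intro holomorphic_intros \<Psi>2)
  have Ps: "Ps holomorphic_on ball (cnj z0) (2*e)" and vs: "vs holomorphic_on ball (cnj z0) (2*e)"
    unfolding Ps_def vs_def by (intro holomorphic_on_reflected_ball P v2)+
  \<comment> \<open>At \<open>y - z = cnj z\<close> these are the real and imaginary parts of
    \<open>P z\<close>, since \<open>Ps (cnj z) = cnj (P z)\<close>.\<close>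
  define X where "X = (\<lambda>z y. (P z + Ps (y - z)) / 2)"
  define Y where "Y = (\<lambda>z y. (P z - Ps (y - z)) / (2 * \<i>))"
  define L where "L = (\<lambda>z y. \<Sum>\<^sub>\<infinity>(m, n). of_real (c (m, n)) * X z y ^ m * Y z y ^ n)"
  define H where "H = (\<lambda>z y. exp (L z y + v z + vs (y - z)))"
  have in2: "z \<in> ball z0 (2*e)" "y - z \<in> ball (cnj z0) (2*e)" "cnj (y - z) \<in> ball z0 (2*e)"
    if z: "z \<in> ball z0 e" and y: "y \<in> ball 0 e" for z y
  proof -
    show "z \<in> ball z0 (2*e)" using z e by auto
    \<comment> \<open>The centre lies on the axis; this is why \<open>y - z\<close> is near
      \<open>cnj z0\<close> for small \<open>y\<close>.\<close>
    have z0: "cnj z0 = - z0" using G(3) by (simp add: complex_eq_iff)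
    have "norm (- z0 - (y - z)) \<le> norm (z - z0) + norm y"
      using norm_triangle_ineq4[of "z - z0" y] by (simp add: algebra_simps)
    also have "\<dots> < 2 * e" using z y by (simp add: dist_norm norm_minus_commute)
    finally show 1: "y - z \<in> ball (cnj z0) (2*e)" by (simp add: dist_norm z0)
    have "norm (z0 - cnj (y - z)) = norm (cnj z0 - (y - z))"
      by (metis complex_cnj_cnj complex_cnj_diff complex_mod_cnj)
    then show "cnj (y - z) \<in> ball z0 (2*e)" using 1 by (simp add: dist_norm)
  qed
  have Ple: "norm (P z) \<le> r'" "norm (Ps (y - z)) \<le> r'" "norm (v z) \<le> norm (v z0) + 1" "norm (vs (y - z)) \<le> norm (v z0) + 1"
    if z: "z \<in> ball z0 e" and y: "y \<in> ball 0 e" for z y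
    using in2[OF that] \<Psi>le vle
    by (auto simp: P_def Ps_def vs_def simp del: complex_cnj_diff)
  have XY: "norm (X z y) \<le> r'" "norm (Y z y) \<le> r'" if z: "z \<in> ball z0 e" and y: "y \<in> ball 0 e" for z y
  proof -
    have "norm (P z + Ps (y - z)) \<le> r' + r'" "norm (P z - Ps (y - z)) \<le> r' + r'"
      using Ple[OF that] by (meson add_mono norm_triangle_le norm_triangle_le_diff order_trans norm_triangle_ineq norm_triangle_ineq4)+
    then show "norm (X z y) \<le> r'" "norm (Y z y) \<le> r'" by (auto simp: X_def Y_def norm_divide norm_mult)
  qed
  \<comment> \<open>Unconditional convergence at the corner \<open>(r', r')\<close> is absolute
    convergence, and that majorizes the complexified series.\<close>
  have sm: "(\<lambda>(m, n). \<bar>c (m, n)\<bar> * r' ^ m * r' ^ n) summable_on UNIV"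
  proof -
    have "((\<lambda>(m, n). c (m, n) * r' ^ m * r' ^ n) has_sum g (\<Psi> z0 + Complex r' r')) UNIV"
      using r by (intro c) (auto simp: r'_def)
    then have "(\<lambda>(m, n). c (m, n) * r' ^ m * r' ^ n) summable_on UNIV" by (auto simp: summable_on_def)
    then have "(\<lambda>p. norm ((\<lambda>(m, n). c (m, n) * r' ^ m * r' ^ n) p)) summable_on UNIV"
      by (subst (asm) summable_on_iff_abs_summable_on_real)
    then show ?thesis
      by (rule summable_on_cong[THEN iffD1, rotated]) (use r in \<open>auto simp: abs_mult r'_def\<close>)
  qed
  have comp1: "(\<lambda>z. f (y - z)) holomorphic_on ball z0 e" if "f holomorphic_on ball (cnj z0) (2*e)" "y \<in> ball 0 e" for f y
    using holomorphic_on_compose_gen[of "\<lambda>z. y - z" "ball z0 e" f "ball (cnj z0) (2*e)", unfolded o_def]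
      that in2(2)[OF _ that(2)] by (simp add: image_subset_iff holomorphic_intros)
  have comp2: "(\<lambda>y. f (y - z)) holomorphic_on ball 0 e" if "f holomorphic_on ball (cnj z0) (2*e)" "z \<in> ball z0 e" for f z
    using holomorphic_on_compose_gen[of "\<lambda>y. y - z" "ball 0 e" f "ball (cnj z0) (2*e)", unfolded o_def]
      that in2(2)[OF that(2)] by (simp add: image_subset_iff holomorphic_intros)
  have sub: "ball z0 e \<subseteq> ball z0 (2*e)" using e by auto
  have H1: "(\<lambda>z. H z y) holomorphic_on ball z0 e" if y: "y \<in> ball 0 e" for y
  proof -
    have "(\<lambda>z. X z y) holomorphic_on ball z0 e" "(\<lambda>z. Y z y) holomorphic_on ball z0 e"
      unfolding X_def Y_def
      by (intro holomorphic_intros comp1[OF Ps y] holomorphic_on_subset[OF P sub]; simp)+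
    then have "(\<lambda>z. L z y) holomorphic_on ball z0 e"
      unfolding L_def by (intro holomorphic_double_series[OF _ sm]) (use XY y in auto)
    then show ?thesis unfolding H_def
      by (intro holomorphic_intros comp1[OF vs y] holomorphic_on_subset[OF v2 sub])
  qed
  have H2: "H z holomorphic_on ball 0 e" if z: "z \<in> ball z0 e" for z
  proof -
    have "X z holomorphic_on ball 0 e" "Y z holomorphic_on ball 0 e"
      unfolding X_def Y_def by (intro holomorphic_intros comp2[OF Ps z]; simp)+
    then have "L z holomorphic_on ball 0 e"
      unfolding L_def by (intro holomorphic_double_series[OF _ sm]) (use XY z in auto)
    then show ?thesis unfolding H_def by (intro holomorphic_intros comp2[OF vs z])
  qed
  define B where "B = exp ((\<Sum>\<^sub>\<infinity>(m, n). \<bar>c (m, n)\<bar> * r' ^ m * r' ^ n) + (norm (v z0) + 1) + (norm (v z0) + 1))"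
  have HB: "norm (H z y) \<le> B" if zy: "z \<in> ball z0 e" "y \<in> ball 0 e" for z y
  proof -
    have "norm (L z y) \<le> (\<Sum>\<^sub>\<infinity>(m, n). \<bar>c (m, n)\<bar> * r' ^ m * r' ^ n)"
      unfolding L_def
      by (rule holomorphic_double_series(2)[where S="ball z0 e" and X="\<lambda>_. X z y" and Y="\<lambda>_. Y z y", OF _ sm])
        (use XY[OF zy] zy in \<open>auto intro!: holomorphic_intros\<close>)
    then have "norm (L z y + v z + vs (y - z)) \<le> (\<Sum>\<^sub>\<infinity>(m, n). \<bar>c (m, n)\<bar> * r' ^ m * r' ^ n) + (norm (v z0) + 1) + (norm (v z0) + 1)"
      using Ple(3,4)[OF zy] by (meson add_mono norm_triangle_ineq order_trans)
    then show ?thesis unfolding H_def B_def using norm_exp[of "L z y + v z + vs (y - z)"] exp_le_cancel_iff order_trans by blast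
  qed
  obtain h where h: "\<And>k. h k holomorphic_on ball z0 e"
    and C: "\<And>M. \<exists>C. \<forall>z\<in>ball z0 e. \<forall>y. norm y \<le> e / 4 \<longrightarrow> norm (H z y - (\<Sum>k<M. h k z * y ^ k)) \<le> C * norm y ^ M"
    using separately_holomorphic_expansion[OF open_ball e H1 H2 HB] by blast
  then obtain C where C: "\<And>M z y. z \<in> ball z0 e \<Longrightarrow> norm y \<le> e / 4 \<Longrightarrow> norm (H z y - (\<Sum>k<M. h k z * y ^ k)) \<le> C M * norm y ^ M"
    by metis
  have Heq: "H z (of_real (2 * Re z)) = exp (of_real (g (\<Psi> z)) + v z + cnj (v z))" if z: "z \<in> ball z0 (e/8)" for z
  proof -
    have ze: "z \<in> ball z0 e" using z e by auto
    have yz: "of_real (2 * Re z) - z = cnj z" by (simp add: complex_eq_iff)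
    have "norm (P z) \<le> r'" using \<Psi>le[of z] ze e by (auto simp: P_def)
    then have "\<bar>Re (P z)\<bar> < r" "\<bar>Im (P z)\<bar> < r"
      using abs_Re_le_cmod[of "P z"] abs_Im_le_cmod[of "P z"] r by (auto simp: r'_def)
    moreover have "\<Psi> z0 + Complex (Re (P z)) (Im (P z)) = \<Psi> z"
      by (simp only: complex_surj) (simp add: P_def a_def)
    ultimately have hs: "((\<lambda>(m, n). c (m, n) * Re (P z) ^ m * Im (P z) ^ n) has_sum g (\<Psi> z)) UNIV"
      using c[of "Re (P z)" "Im (P z)"] by simp
    have "X z (of_real (2 * Re z)) = of_real (Re (P z))" "Y z (of_real (2 * Re z)) = of_real (Im (P z))"
      unfolding X_def Y_def yz Ps_def by (auto simp: complex_eq_iff)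
    then have "L z (of_real (2 * Re z)) = (\<Sum>\<^sub>\<infinity>p. of_real ((\<lambda>(m, n). c (m, n) * Re (P z) ^ m * Im (P z) ^ n) p))"
      unfolding L_def by (intro infsum_cong) auto
    also have "\<dots> = of_real (g (\<Psi> z))" using has_sum_of_real[OF hs] by (rule infsumI)
    finally show ?thesis unfolding H_def yz by (simp add: vs_def)
  qed
  \<comment> \<open>On this ball \<open>|2 Re z| \<le> e / 4\<close>, the range of \<open>y\<close>
    in which the remainder bounds hold; \<open>2 ^ M\<close> accounts for powers of
    \<open>2 Re z\<close> in place of \<open>Re z\<close>.\<close>
  have "axis_expansion (\<lambda>z. exp (of_real (g (\<Psi> z)) + v z + cnj (v z))) (ball z0 (e/8)) h (\<lambda>M. C M * 2 ^ M)"
    unfolding axis_expansion_def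
  proof (intro conjI allI ballI)
    show "h k holomorphic_on ball z0 (e/8)" for k using e by (intro holomorphic_on_subset[OF h]) auto
    fix M z assume z: "z \<in> ball z0 (e/8)"
    have "\<bar>Re (z - z0)\<bar> \<le> norm (z - z0)" by (rule abs_Re_le_cmod)
    then have "\<bar>Re z\<bar> \<le> e / 8" using z G(3) by (simp add: dist_norm norm_minus_commute)
    then have "norm (complex_of_real (2 * Re z)) \<le> e / 4" by simp
    moreover have "z \<in> ball z0 e" using z e by auto
    ultimately have "norm (H z (of_real (2 * Re z)) - (\<Sum>k<M. h k z * of_real (2 * Re z) ^ k)) \<le> C M * norm (complex_of_real (2 * Re z)) ^ M"
      using C by blast
    then show "norm (exp (of_real (g (\<Psi> z)) + v z + cnj (v z)) - (\<Sum>k<M. h k z * of_real (2 * Re z) ^ k)) \<le> C M * 2 ^ M * \<bar>Re z\<bar> ^ M"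
      unfolding Heq[OF z] by (simp add: abs_mult power_mult_distrib mult_ac)
  qed
  then show ?thesis using e by (metis zero_less_divide_iff zero_less_numeral)
qed

section \<open>Change of variables\<close>

text \<open>Identification with \<open>real ^ 2\<close>, the setting of the change of variables
  theorem, where Jacobians are determinants of matrices.\<close>

definition complex_of_vec :: "real ^ 2 \<Rightarrow> complex"
  where "complex_of_vec v = Complex (v $ 1) (v $ 2)"

definition vec_of_complex :: "complex \<Rightarrow> real ^ 2"
  where "vec_of_complex z = (\<chi> i. if i = 1 then Re z else Im z)"

lemma vec_complex_inverse [simp]:
  "complex_of_vec (vec_of_complex z) = z" "vec_of_complex (complex_of_vec v) = v"
  by (auto simp: complex_of_vec_def vec_of_complex_def vec_eq_iff forall_2 complex_eq_iff)

lemma bounded_linear_complex_of_vec: "bounded_linear complex_of_vec"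
proof -
  have "linear complex_of_vec"
    by (rule linearI) (auto simp: complex_of_vec_def complex_eq_iff)
  then show ?thesis by (rule linear_conv_bounded_linear[THEN iffD1])
qed

lemma bounded_linear_vec_of_complex: "bounded_linear vec_of_complex"
proof -
  have "linear vec_of_complex"
    by (rule linearI) (auto simp: vec_of_complex_def vec_eq_iff)
  then show ?thesis by (rule linear_conv_bounded_linear[THEN iffD1])
qed

lemma borel_measurable_complex_of_vec [measurable]: "complex_of_vec \<in> borel_measurable borel"
  by (intro borel_measurable_continuous_onI linear_continuous_on bounded_linear_complex_of_vec)

lemma lborel_complex_eq_vec: "(lborel :: complex measure) = distr lborel borel complex_of_vec"
proof (rule lborel_eqI)
  fix l u :: complex assume lu: "\<And>b. b \<in> Basis \<Longrightarrow> l \<bullet> b \<le> u \<bullet> b"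
  have le: "Re l \<le> Re u" "Im l \<le> Im u" using lu[of 1] lu[of \<i>] by (auto simp: Basis_complex_def inner_complex_def)
  have vim: "complex_of_vec -` box l u = box (vec_of_complex l) (vec_of_complex u)"
    by (auto simp: in_box_complex_iff mem_box_cart forall_2 complex_of_vec_def vec_of_complex_def)
  have B: "(Basis :: (real^2) set) = {axis 1 1, axis 2 1}"
    by (auto simp: Basis_vec_def UNIV_2)
  have "emeasure (distr lborel borel complex_of_vec) (box l u) = emeasure lborel (box (vec_of_complex l) (vec_of_complex u))"
    by (simp add: emeasure_distr vim)
  also have "\<dots> = ennreal (\<Prod>b\<in>Basis. (vec_of_complex u - vec_of_complex l) \<bullet> b)"
    using le by (intro emeasure_lborel_box) (auto simp: B inner_axis vec_of_complex_def)
  also have "(\<Prod>b\<in>Basis. (vec_of_complex u - vec_of_complex l) \<bullet> b) = (Re u - Re l) * (Im u - Im l)"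
    by (simp add: B axis_eq_axis inner_axis vec_of_complex_def)
  also have "\<dots> = (\<Prod>b\<in>Basis. (u - l) \<bullet> b)" by (simp add: Basis_complex_def inner_complex_def)
  finally show "emeasure (distr lborel borel complex_of_vec) (box l u) = ennreal (\<Prod>b\<in>Basis. (u - l) \<bullet> b)" .
qed simp

text \<open>The product form serves iterated integration, the vector form above serves the change of
  variables.\<close>

lemma lborel_complex_eq_prod:
  "(lborel :: complex measure) = distr lborel borel (\<lambda>p. Complex (fst p) (snd p))"
proof (rule lborel_eqI)
  fix l u :: complex assume lu: "\<And>b. b \<in> Basis \<Longrightarrow> l \<bullet> b \<le> u \<bullet> b"
  let ?t = "\<lambda>p. Complex (fst p) (snd p)"
  have m [measurable]: "?t \<in> borel_measurable borel"
    by (intro borel_measurable_continuous_onI continuous_intros)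
  have le: "Re l \<le> Re u" "Im l \<le> Im u" using lu[of 1] lu[of \<i>] by (auto simp: Basis_complex_def inner_complex_def)
  have vim: "?t -` box l u = box (Re l, Im l) (Re u, Im u)"
    by (auto simp: in_box_complex_iff mem_box Basis_prod_def)
  have B: "(Basis :: (real \<times> real) set) = {(1, 0), (0, 1)}"
    by (auto simp: Basis_prod_def)
  have "emeasure (distr lborel borel ?t) (box l u) = emeasure lborel (box (Re l, Im l) (Re u, Im u))"
    by (simp add: emeasure_distr vim)
  also have "\<dots> = ennreal (\<Prod>b\<in>Basis. ((Re u, Im u) - (Re l, Im l)) \<bullet> b)"
    using le by (intro emeasure_lborel_box) (auto simp: B)
  also have "(\<Prod>b\<in>Basis. ((Re u, Im u) - (Re l, Im l)) \<bullet> b) = (Re u - Re l) * (Im u - Im l)"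
    by (simp add: B)
  also have "\<dots> = (\<Prod>b\<in>Basis. (u - l) \<bullet> b)" by (simp add: Basis_complex_def inner_complex_def)
  finally show "emeasure (distr lborel borel ?t) (box l u) = ennreal (\<Prod>b\<in>Basis. (u - l) \<bullet> b)" .
qed simp

text \<open>Arguments and values are both moved to \<open>real ^ 2\<close>, since the change of
  variables theorem speaks of vector-valued functions. Borel measurability of the integrand allows
  passing between \<open>lborel\<close> and its completion.\<close>

lemma set_integral_complex_vec:
  fixes F :: "complex \<Rightarrow> complex"
  assumes m: "(\<lambda>z. indicator A z *\<^sub>R F z) \<in> borel_measurable borel"
  shows "(\<lambda>v. vec_of_complex (F (complex_of_vec v))) absolutely_integrable_on (complex_of_vec -` A)
      \<longleftrightarrow> set_integrable lborel A F"
    and "set_integrable lborel A F \<Longrightarrow>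
      integral (complex_of_vec -` A) (\<lambda>v. vec_of_complex (F (complex_of_vec v))) = vec_of_complex (LINT z:A|lborel. F z)"
proof -
  define H where "H = (\<lambda>v. indicator (complex_of_vec -` A) v *\<^sub>R vec_of_complex (F (complex_of_vec v)))"
  have H: "H v = vec_of_complex (indicator A (complex_of_vec v) *\<^sub>R F (complex_of_vec v))" for v
    using linear_scale[OF bounded_linear.linear[OF bounded_linear_vec_of_complex]]
    by (auto simp: H_def indicator_def linear_0[OF bounded_linear.linear[OF bounded_linear_vec_of_complex]])
  have mv: "vec_of_complex \<in> borel_measurable borel"
    by (intro borel_measurable_continuous_onI linear_continuous_on bounded_linear_vec_of_complex)
  have m2: "(\<lambda>v. indicator A (complex_of_vec v) *\<^sub>R F (complex_of_vec v)) \<in> borel_measurable lborel"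
    using measurable_compose[OF borel_measurable_complex_of_vec m] by simp
  have mH: "H \<in> borel_measurable lborel"
    unfolding H[abs_def] using measurable_compose[OF m2 mv] by simp
  have 1: "set_integrable lborel A F \<longleftrightarrow> integrable lborel (\<lambda>v. indicator A (complex_of_vec v) *\<^sub>R F (complex_of_vec v))"
    unfolding set_integrable_def using m
    by (subst lborel_complex_eq_vec, subst integrable_distr_eq) auto
  have 2: "integrable lborel (\<lambda>v. indicator A (complex_of_vec v) *\<^sub>R F (complex_of_vec v)) \<longleftrightarrow> integrable lborel H"
  proof
    assume "integrable lborel (\<lambda>v. indicator A (complex_of_vec v) *\<^sub>R F (complex_of_vec v))"
    from integrable_bounded_linear[OF bounded_linear_vec_of_complex this]
    show "integrable lborel H" by (simp add: H[abs_def])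
  next
    assume "integrable lborel H"
    from integrable_bounded_linear[OF bounded_linear_complex_of_vec this]
    show "integrable lborel (\<lambda>v. indicator A (complex_of_vec v) *\<^sub>R F (complex_of_vec v))"
      by (simp only: H vec_complex_inverse)
  qed
  have 3: "integrable lborel H \<longleftrightarrow> (\<lambda>v. vec_of_complex (F (complex_of_vec v))) absolutely_integrable_on (complex_of_vec -` A)"
    unfolding set_integrable_def H_def[symmetric] using integrable_completion[OF mH] by simp
  show iff: "(\<lambda>v. vec_of_complex (F (complex_of_vec v))) absolutely_integrable_on (complex_of_vec -` A)
      \<longleftrightarrow> set_integrable lborel A F" using 1 2 3 by simp
  assume int: "set_integrable lborel A F"
  have "integral (complex_of_vec -` A) (\<lambda>v. vec_of_complex (F (complex_of_vec v))) = integral\<^sup>L lebesgue H"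
    using set_lebesgue_integral_eq_integral(2)[of "complex_of_vec -` A" "\<lambda>v. vec_of_complex (F (complex_of_vec v))"] iff int
    by (simp add: set_lebesgue_integral_def H_def)
  also have "\<dots> = integral\<^sup>L lborel H" by (rule integral_completion[OF mH])
  also have "\<dots> = vec_of_complex (integral\<^sup>L lborel (\<lambda>v. indicator A (complex_of_vec v) *\<^sub>R F (complex_of_vec v)))"
    unfolding H using int 1 by (intro integral_bounded_linear bounded_linear_vec_of_complex) auto
  also have "integral\<^sup>L lborel (\<lambda>v. indicator A (complex_of_vec v) *\<^sub>R F (complex_of_vec v)) = (LINT z:A|lborel. F z)"
    unfolding set_lebesgue_integral_def using m
    by (subst lborel_complex_eq_vec, subst integral_distr) auto
  finally show "integral (complex_of_vec -` A) (\<lambda>v. vec_of_complex (F (complex_of_vec v))) = vec_of_complex (LINT z:A|lborel. F z)" .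
qed

lemma det_matrix_mult_complex:
  "det (matrix (\<lambda>h. vec_of_complex (w * complex_of_vec h))) = (norm w)\<^sup>2"
  by (simp add: det_2 matrix_def complex_of_vec_def vec_of_complex_def axis_def cmod_def power2_eq_square[symmetric])

text \<open>The real derivative of a holomorphic map is multiplication by a complex number, whose
  determinant is the squared modulus.\<close>

lemma complex_change_of_variables:
  fixes \<Psi> \<Psi>' f :: "complex \<Rightarrow> complex"
  assumes S: "S \<in> sets borel" and der: "\<And>z. z \<in> S \<Longrightarrow> (\<Psi> has_field_derivative \<Psi>' z) (at z within S)"
    and inj: "inj_on \<Psi> S"
    and fm: "(\<lambda>z. indicator (\<Psi> ` S) z *\<^sub>R f z) \<in> borel_measurable borel"
    and int: "set_integrable lborel S (\<lambda>z. of_real ((norm (\<Psi>' z))\<^sup>2) * f (\<Psi> z))"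
  shows "set_integrable lborel (\<Psi> ` S) f"
    and "(LINT z:\<Psi> ` S|lborel. f z) = (LINT z:S|lborel. of_real ((norm (\<Psi>' z))\<^sup>2) * f (\<Psi> z))"
proof -
  define g where "g = (\<lambda>v. vec_of_complex (\<Psi> (complex_of_vec v)))"
  define g' where "g' = (\<lambda>v h. vec_of_complex (\<Psi>' (complex_of_vec v) * complex_of_vec h))"
  define f' where "f' = (\<lambda>v. vec_of_complex (f (complex_of_vec v)))"
  define S' where "S' = complex_of_vec -` S"
  have S': "S' \<in> sets lebesgue"
    using measurable_sets[OF borel_measurable_complex_of_vec S] by (simp add: S'_def sets_completionI_sets)
  have g'_der: "(g has_derivative g' v) (at v within S')" if "v \<in> S'" for v
  proof -
    have 1: "(complex_of_vec has_derivative complex_of_vec) (at v within S')"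
      by (rule bounded_linear_imp_has_derivative[OF bounded_linear_complex_of_vec])
    have "complex_of_vec ` S' \<subseteq> S" by (auto simp: S'_def)
    moreover have "(\<Psi> has_derivative (*) (\<Psi>' (complex_of_vec v))) (at (complex_of_vec v) within S)"
      using der[of "complex_of_vec v"] that by (simp add: S'_def has_field_derivative_def)
    ultimately have "(\<Psi> has_derivative (*) (\<Psi>' (complex_of_vec v))) (at (complex_of_vec v) within complex_of_vec ` S')"
      by (rule has_derivative_subset[rotated])
    from diff_chain_within[OF 1 this]
    have "((\<lambda>v. \<Psi> (complex_of_vec v)) has_derivative (\<lambda>h. \<Psi>' (complex_of_vec v) * complex_of_vec h)) (at v within S')"
      by (simp add: o_def)
    from bounded_linear.has_derivative[OF bounded_linear_vec_of_complex this]
    show ?thesis by (simp add: g_def g'_def)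
  qed
  have inj': "inj_on g S'"
    unfolding inj_on_def g_def S'_def
    by (metis inj inj_onD vec_complex_inverse vimage_eq)
  have img: "g ` S' = complex_of_vec -` (\<Psi> ` S)"
  proof (rule set_eqI)
    fix v
    have "v \<in> g ` S' \<longleftrightarrow> (\<exists>z\<in>S. v = vec_of_complex (\<Psi> z))"
      unfolding g_def S'_def image_iff by (metis vec_complex_inverse(1) vimage_eq)
    also have "\<dots> \<longleftrightarrow> (\<exists>z\<in>S. complex_of_vec v = \<Psi> z)" by (metis vec_complex_inverse)
    finally show "v \<in> g ` S' \<longleftrightarrow> v \<in> complex_of_vec -` (\<Psi> ` S)" by (simp add: image_iff)
  qed
  have deq: "\<bar>det (matrix (g' v))\<bar> *\<^sub>R f' (g v) =
     vec_of_complex (of_real ((norm (\<Psi>' (complex_of_vec v)))\<^sup>2) * f (\<Psi> (complex_of_vec v)))" for v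
    unfolding g'_def f'_def g_def det_matrix_mult_complex vec_complex_inverse scaleR_conv_of_real[symmetric]
      linear_scale[OF bounded_linear.linear[OF bounded_linear_vec_of_complex]] by simp
  define I where "I = (LINT z:S|lborel. of_real ((norm (\<Psi>' z))\<^sup>2) * f (\<Psi> z))"
  have Fm: "(\<lambda>z. indicator S z *\<^sub>R (of_real ((norm (\<Psi>' z))\<^sup>2) * f (\<Psi> z))) \<in> borel_measurable borel"
    using int by (auto simp: set_integrable_def dest!: borel_measurable_integrable)
  have "(\<lambda>v. \<bar>det (matrix (g' v))\<bar> *\<^sub>R f' (g v)) absolutely_integrable_on S' \<and>
     integral S' (\<lambda>v. \<bar>det (matrix (g' v))\<bar> *\<^sub>R f' (g v)) = vec_of_complex I"
    unfolding deq S'_def I_def using set_integral_complex_vec[OF Fm] int by auto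
  then have "f' absolutely_integrable_on (g ` S') \<and> integral (g ` S') f' = vec_of_complex I"
    using has_absolute_integral_change_of_variables[OF S' g'_der inj', of f' "vec_of_complex I"] by blast
  then have *: "f' absolutely_integrable_on (complex_of_vec -` (\<Psi> ` S))"
    "integral (complex_of_vec -` (\<Psi> ` S)) f' = vec_of_complex I" by (auto simp: img)
  show i: "set_integrable lborel (\<Psi> ` S) f"
    using set_integral_complex_vec(1)[OF fm] *(1) by (simp add: f'_def)
  from set_integral_complex_vec(2)[OF fm i] *(2)
  have "vec_of_complex (LINT z:\<Psi> ` S|lborel. f z) = vec_of_complex I" by (simp add: f'_def)
  then show "(LINT z:\<Psi> ` S|lborel. f z) = (LINT z:S|lborel. of_real ((norm (\<Psi>' z))\<^sup>2) * f (\<Psi> z))"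
    unfolding I_def by (metis vec_complex_inverse(1))
qed

text \<open>The set may contain any part of the boundary of the box, because that boundary is
  negligible.\<close>

lemma complex_box_integral:
  fixes F :: "complex \<Rightarrow> complex"
  assumes F: "continuous_on (cbox (Complex a c) (Complex b d)) F"
    and R: "R \<in> sets borel" "box (Complex a c) (Complex b d) \<subseteq> R" "R \<subseteq> cbox (Complex a c) (Complex b d)"
  shows "set_integrable lborel R F"
    and "(LINT z:R|lborel. F z) = integral {a..b} (\<lambda>x. integral {c..d} (\<lambda>y. F (Complex x y)))"
proof -
  let ?B = "cbox (Complex a c) (Complex b d)" and ?t = "\<lambda>p. Complex (fst p) (snd p)"
  have m [measurable]: "?t \<in> borel_measurable borel"
    by (intro borel_measurable_continuous_onI continuous_intros)
  have iB: "set_integrable lborel ?B F"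
    unfolding set_integrable_def by (rule borel_integrable_compact[OF compact_cbox F])
  show iR: "set_integrable lborel R F" by (rule set_integrable_subset[OF iB]) (use R in auto)
  have "(LINT z:R|lborel. F z) = integral R F" using set_borel_integral_eq_integral(2)[OF iR] .
  also have "\<dots> = integral ?B F"
  proof (rule integral_spike_set)
    have "{x \<in> R - ?B. F x \<noteq> 0} = {}" using R by auto
    then show "negligible {x \<in> R - ?B. F x \<noteq> 0}" by (simp only: negligible_empty)
    show "negligible {x \<in> ?B - R. F x \<noteq> 0}"
      by (rule negligible_subset[OF negligible_frontier_interval[of "Complex a c" "Complex b d"]]) (use R in auto)
  qed
  also have "\<dots> = (LINT z:?B|lborel. F z)" using set_borel_integral_eq_integral(2)[OF iB] by simp
  also have "\<dots> = (LINT p:cbox (a, c) (b, d)|lborel. F (?t p))"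
  proof -
    have "(\<lambda>z. indicator ?B z *\<^sub>R F z) \<in> borel_measurable borel"
      using iB by (auto simp: set_integrable_def dest!: borel_measurable_integrable)
    then have "(LINT z:?B|lborel. F z) = (LINT p|lborel. indicator ?B (?t p) *\<^sub>R F (?t p))"
      unfolding set_lebesgue_integral_def
      by (subst lborel_complex_eq_prod, subst integral_distr) auto
    moreover have "indicator ?B (?t p) = (indicator (cbox (a, c) (b, d)) p :: real)" for p
      by (cases p) (auto simp: indicator_def in_cbox_complex_iff cbox_Pair_eq)
    ultimately show ?thesis by (simp add: set_lebesgue_integral_def)
  qed
  also have "\<dots> = integral (cbox (a, c) (b, d)) (\<lambda>p. F (?t p))"
  proof (rule set_borel_integral_eq_integral(2))
    show "set_integrable lborel (cbox (a, c) (b, d)) (\<lambda>p. F (?t p))"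
      unfolding set_integrable_def
      by (rule borel_integrable_compact, simp, rule continuous_on_compose2[OF F])
        (auto intro!: continuous_intros simp: in_cbox_complex_iff cbox_Pair_eq)
  qed
  also have "\<dots> = integral (cbox a b) (\<lambda>x. integral (cbox c d) (\<lambda>y. F (?t (x, y))))"
    by (rule integral_prod_continuous, rule continuous_on_compose2[OF F])
      (auto intro!: continuous_intros simp: in_cbox_complex_iff cbox_Pair_eq)
  finally show "(LINT z:R|lborel. F z) = integral {a..b} (\<lambda>x. integral {c..d} (\<lambda>y. F (Complex x y)))" by simp
qed

text \<open>Half open in \<open>Im z\<close>, so that \<open>exp\<close> is injective on it and
  still covers the full open annulus.\<close>

definition half_open_collar :: "real \<Rightarrow> complex set"
  where "half_open_collar c = {z. - c < Re z \<and> Re z < 0 \<and> 0 \<le> Im z \<and> Im z < 2 * pi}"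

text \<open>The collar itself is not open, but its image is, being the image of a full annulus;
  openness makes \<open>f\<close> times the indicator Borel measurable although \<open>f\<close> is
  only continuous near the collar.\<close>

lemma collar_integral:
  fixes \<Psi> f :: "complex \<Rightarrow> complex"
  assumes I: "open I" "{-c..0} \<subseteq> I" and \<Psi>: "\<Psi> holomorphic_on vstrip I"
    and inj: "inj_on \<Psi> (half_open_collar c)" and op: "open (\<Psi> ` half_open_collar c)"
    and f: "continuous_on (\<Psi> ` vstrip {-c..0}) f"
  shows "set_integrable lborel (\<Psi> ` half_open_collar c) f"
    and "(LINT z:\<Psi> ` half_open_collar c|lborel. f z) =
      integral {-c..0} (\<lambda>x. integral {0..2*pi} (\<lambda>t. of_real ((norm (deriv \<Psi> (Complex x t)))\<^sup>2) * f (\<Psi> (Complex x t))))"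
proof -
  let ?R = "half_open_collar c"
  let ?F = "\<lambda>z. of_real ((norm (deriv \<Psi> z))\<^sup>2) * f (\<Psi> z)"
  have "?R = {z. - c < Re z} \<inter> {z. Re z < 0} \<inter> ({z. 0 \<le> Im z} \<inter> {z. Im z < 2 * pi})"
    by (auto simp: half_open_collar_def)
  moreover have "{z. - c < Re z} \<in> sets borel" "{z. Re z < 0} \<in> sets borel" "{z. 0 \<le> Im z} \<in> sets borel" "{z. Im z < 2 * pi} \<in> sets borel"
    by (auto intro!: borel_open borel_closed open_halfspace_Re_gt open_halfspace_Re_lt open_halfspace_Im_lt closed_halfspace_Im_ge)
  ultimately have R: "?R \<in> sets borel" by (metis sets.Int)
  have sub: "?R \<subseteq> vstrip {-c..0}" "cbox (Complex (-c) 0) (Complex 0 (2*pi)) \<subseteq> vstrip {-c..0}" "vstrip {-c..0} \<subseteq> vstrip I"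
    using I by (auto simp: half_open_collar_def vstrip_def in_cbox_complex_iff)
  have opS: "open (vstrip I)" using I open_vstrip by auto
  have contF: "continuous_on (vstrip {-c..0}) ?F"
    using sub holomorphic_on_imp_continuous_on[OF holomorphic_deriv[OF \<Psi> opS]] holomorphic_on_imp_continuous_on[OF \<Psi>]
    by (intro continuous_intros continuous_on_compose2[OF f]) (auto intro: continuous_on_subset)
  have 1: "set_integrable lborel ?R ?F"
    and 2: "(LINT z:?R|lborel. ?F z) = integral {-c..0} (\<lambda>x. integral {0..2*pi} (\<lambda>t. ?F (Complex x t)))"
    by (rule complex_box_integral[OF continuous_on_subset[OF contF sub(2)] R];
        auto simp: in_box_complex_iff in_cbox_complex_iff half_open_collar_def)+
  have fm: "(\<lambda>z. indicator (\<Psi> ` ?R) z *\<^sub>R f z) \<in> borel_measurable borel"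
    using op sub by (intro borel_measurable_continuous_on_indicator continuous_on_subset[OF f]) auto
  have der: "(\<Psi> has_field_derivative deriv \<Psi> z) (at z within ?R)" if "z \<in> ?R" for z
    by (rule has_field_derivative_at_within, rule holomorphic_derivI[OF \<Psi> opS]) (use that sub in auto)
  show "set_integrable lborel (\<Psi> ` ?R) f"
    by (rule complex_change_of_variables(1)[OF R der inj fm 1])
  show "(LINT z:\<Psi> ` ?R|lborel. f z) = integral {-c..0} (\<lambda>x. integral {0..2*pi} (\<lambda>t. ?F (Complex x t)))"
    using complex_change_of_variables(2)[OF R der inj fm 1] 2 by simp
qed

lemma dA_eq_density: "dA = density lborel (\<lambda>_. ennreal (1 / pi))"
  unfolding dA_def by (rule measure_eqI) (auto simp: emeasure_density_const mult.commute)

lemma sets_dA [measurable_cong, simp]: "sets dA = sets borel"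
  by (simp add: dA_def)

lemma set_integrable_dA:
  fixes f :: "complex \<Rightarrow> complex"
  assumes "set_integrable lborel A f"
  shows "set_integrable dA A f" "(LINT z:A|dA. f z) = (LINT z:A|lborel. f z) / of_real pi"
proof -
  have m: "(\<lambda>z. indicator A z *\<^sub>R f z) \<in> borel_measurable borel"
    using assms by (auto simp: set_integrable_def dest!: borel_measurable_integrable)
  show "set_integrable dA A f"
  proof -
    have "integrable lborel (\<lambda>z. (1/pi) *\<^sub>R (indicator A z *\<^sub>R f z))"
      using assms unfolding set_integrable_def by (rule integrable_scaleR_right)
    then show ?thesis
      unfolding set_integrable_def dA_eq_density using m by (subst integrable_density) auto
  qed
  have "(LINT z:A|dA. f z) = (LINT z|lborel. (1/pi) *\<^sub>R (indicator A z *\<^sub>R f z))"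
    unfolding set_lebesgue_integral_def dA_eq_density using m by (subst integral_density) auto
  also have "\<dots> = (1/pi) *\<^sub>R (LINT z:A|lborel. f z)"
    by (simp only: integral_scaleR_right set_lebesgue_integral_def)
  finally show "(LINT z:A|dA. f z) = (LINT z:A|lborel. f z) / of_real pi"
    by (simp add: scaleR_conv_of_real)
qed

section \<open>The exterior chart\<close>

text \<open>\<open>\<psi>\<close> is the inverse of \<open>\<phi>\<close>, \<open>\<kappa>\<close>
  is \<open>\<phi>'(\<infinity>)\<close>, and \<open>\<rho> < 1\<close> records how far the map
  continues across the boundary. The geometry is expressed through \<open>\<psi>\<close>, whose
  domain is simple.\<close>

locale exterior_chart =
  fixes D :: "complex set" and \<phi> \<psi> :: "complex \<Rightarrow> complex" and \<rho> \<kappa> :: real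
  assumes open_D: "open D" and bounded_D: "bounded D"
    and \<rho>: "0 < \<rho>" "\<rho> < 1" and \<kappa>: "\<kappa> > 0"
    and \<psi>_hol: "\<psi> holomorphic_on {w. \<rho> < norm w}"
    and \<phi>_\<psi>: "\<And>w. \<rho> < norm w \<Longrightarrow> \<phi> (\<psi> w) = w"
    and \<psi>_in_D: "\<And>w. \<rho> < norm w \<Longrightarrow> \<psi> w \<in> D \<longleftrightarrow> norm w < 1"
    and \<psi>_\<phi>: "\<And>z. z \<notin> D \<Longrightarrow> 1 \<le> norm (\<phi> z) \<and> \<psi> (\<phi> z) = z"
    and deriv_\<phi>: "\<And>w. \<rho> < norm w \<Longrightarrow> deriv \<phi> (\<psi> w) * deriv \<psi> w = 1"
    and \<phi>_hol: "\<phi> holomorphic_on \<psi> ` {w. \<rho> < norm w}"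
    and \<psi>_asymp: "((\<lambda>w. \<psi> w / w) \<longlongrightarrow> of_real (1 / \<kappa>)) at_infinity"
    and deriv_\<psi>_asymp: "(deriv \<psi> \<longlongrightarrow> of_real (1 / \<kappa>)) at_infinity"

text \<open>\<open>D\<close> is the inside of the curve: a connected set that meets \<open>D\<close>
  and misses its frontier lies in \<open>D\<close>. The unbounded component therefore cannot meet
  \<open>D\<close>, and the inside must be all of it. Every boundary point is then a limit of
  exterior points.\<close>

lemma Jordan_domain_frontier_exterior:
  assumes "analytic_Jordan_domain D"
  shows "open D" "bounded D" "frontier D \<subseteq> closure (- closure D)"
proof -
  obtain \<gamma> where D: "open D" "connected D" "bounded D" and \<gamma>: "simple_path \<gamma>" "pathfinish \<gamma> = pathstart \<gamma>"
    and fr: "path_image \<gamma> = frontier D"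
    using assms by (auto simp: analytic_Jordan_domain_def analytic_Jordan_curve_def)
  note J = Jordan_inside_outside[OF \<gamma>]
  let ?C = "path_image \<gamma>"
  have disj: "D \<inter> ?C = {}" unfolding fr using D(1) frontier_disjoint_eq by blast
  have ne: "D \<noteq> {}" using fr by auto
  have out: "D \<inter> outside ?C = {}"
  proof (rule ccontr)
    assume a: "D \<inter> outside ?C \<noteq> {}"
    have "outside ?C \<subseteq> D"
    proof (rule ccontr)
      assume "\<not> outside ?C \<subseteq> D"
      then have "outside ?C \<inter> frontier D \<noteq> {}" using a J by (intro connected_Int_frontier) auto
      then show False using fr outside_no_overlap[of ?C] by auto
    qed
    then show False using J D(3) bounded_subset by blast
  qed
  have "D \<subseteq> inside ?C" using out disj J by blast
  moreover have "inside ?C \<subseteq> D"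
  proof (rule ccontr)
    assume "\<not> inside ?C \<subseteq> D"
    then have "inside ?C \<inter> frontier D \<noteq> {}" using ne \<open>D \<subseteq> inside ?C\<close> J by (intro connected_Int_frontier) auto
    then show False using fr inside_no_overlap[of ?C] by auto
  qed
  ultimately have eq: "D = inside ?C" by blast
  have "closure D = inside ?C \<union> ?C" using eq fr by (metis closure_Un_frontier)
  then have "- closure D = outside ?C" using J by blast
  moreover have "frontier (outside ?C) = ?C" using J by blast
  ultimately show "frontier D \<subseteq> closure (- closure D)"
    using fr by (metis closure_Un_frontier Un_upper2)
qed (use assms in \<open>auto simp: analytic_Jordan_domain_def\<close>)

text \<open>Put \<open>g x = 1 / \<phi> (1 / x)\<close>; it extends injectively over 0, so
  \<open>L = g'(0)\<close> is nonzero. The chain rule gives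
  \<open>g' x = \<phi>' (1 / x) * (g x / x)^2\<close>, and letting \<open>x\<close> tend to 0 yields
  \<open>L = \<kappa> * L^2\<close>, so \<open>L = 1 / \<kappa>\<close>.\<close>

lemma exterior_map_ratio_at_infinity:
  fixes \<phi> :: "complex \<Rightarrow> complex"
  assumes B: "B > 0" and \<phi>: "\<phi> holomorphic_on {z. B < norm z}" and inj: "inj_on \<phi> {z. B < norm z}"
    and nz: "\<And>z. B < norm z \<Longrightarrow> \<phi> z \<noteq> 0"
    and inf: "filterlim \<phi> at_infinity at_infinity"
    and \<kappa>: "\<kappa> > 0" "(deriv \<phi> \<longlongrightarrow> of_real \<kappa>) at_infinity"
  shows "((\<lambda>z. z / \<phi> z) \<longlongrightarrow> of_real (1 / \<kappa>)) at_infinity"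
proof -
  define g where "g = (\<lambda>x. if x = 0 then 0 else 1 / \<phi> (1 / x))"
  let ?b = "ball 0 (1 / B) :: complex set"
  have bd: "B < norm (1 / x)" if "x \<in> ?b - {0}" for x
    using that B by (simp add: norm_divide field_simps)
  have opB: "open {z::complex. B < norm z}" by (intro open_Collect_less continuous_intros)
  have g1: "g holomorphic_on ?b - {0}"
  proof -
    have "(\<lambda>x. 1 / (\<phi> \<circ> (\<lambda>x. 1 / x)) x) holomorphic_on ?b - {0}"
      using nz bd by (intro holomorphic_intros holomorphic_on_compose_gen[OF _ \<phi>]) auto
    then show ?thesis by (rule holomorphic_transform) (auto simp: g_def)
  qed
  have lim0: "((\<lambda>x. 1 / \<phi> (1 / x)) \<longlongrightarrow> 0) (at 0)"
  proof -
    have "filterlim (\<lambda>x::complex. 1 / x) at_infinity (at 0)"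
      using filterlim_inverse_at_infinity[where 'a=complex] unfolding inverse_eq_divide[abs_def] .
    then have "filterlim (\<lambda>x. \<phi> (1 / x)) at_infinity (at 0)" by (rule filterlim_compose[OF inf])
    then show ?thesis using tendsto_divide_0[OF tendsto_const] by blast
  qed
  have "isCont g 0"
  proof -
    have "(g \<longlongrightarrow> 0) (at 0)"
      using lim0 by (rule Lim_transform_eventually) (auto simp: g_def eventually_at_filter)
    then show ?thesis by (simp add: isCont_def g_def)
  qed
  moreover have "isCont g x" if "x \<in> ?b" "x \<noteq> 0" for x
    using holomorphic_on_imp_differentiable_at[OF g1, of x] that
    by (auto intro!: field_differentiable_imp_continuous_at)
  ultimately have "continuous_on ?b g"
    unfolding continuous_on_eq_continuous_at[OF open_ball] by metis
  then have g: "g holomorphic_on ?b" by (rule no_isolated_singularity[where K="{0}"]) (use g1 in auto)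
  have "inj_on g ?b"
  proof (rule inj_onI)
    fix x y assume xy: "x \<in> ?b" "y \<in> ?b" "g x = g y"
    show "x = y"
    proof (cases "x = 0 \<or> y = 0")
      case True
      have "g u \<noteq> 0" if "u \<in> ?b - {0}" for u using nz[OF bd[OF that]] that by (simp add: g_def)
      then show ?thesis using True xy by (metis DiffI g_def singletonD)
    next
      case False
      then have "\<phi> (1 / x) = \<phi> (1 / y)" using xy by (simp add: g_def)
      then have "1 / x = 1 / y" using inj_onD[OF inj] bd[of x] bd[of y] xy False by blast
      then show ?thesis by simp
    qed
  qed
  then have d0: "deriv g 0 \<noteq> 0"
    using holomorphic_injective_imp_regular[OF g open_ball] B by simp
  define L where "L = deriv g 0"
  have L: "((\<lambda>x. g x / x) \<longlongrightarrow> L) (at 0)"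
  proof -
    have "(g has_field_derivative L) (at 0)" unfolding L_def using holomorphic_derivI[OF g open_ball] B by simp
    then show ?thesis by (simp add: has_field_derivative_iff g_def)
  qed
  have L2: "(deriv g \<longlongrightarrow> L) (at 0)"
  proof -
    have "continuous_on ?b (deriv g)" by (intro holomorphic_on_imp_continuous_on holomorphic_deriv g open_ball)
    then show ?thesis using B by (simp add: continuous_on_eq_continuous_at isCont_def L_def)
  qed
  have L3: "((\<lambda>x. deriv \<phi> (1 / x) * (g x / x)^2) \<longlongrightarrow> of_real \<kappa> * L^2) (at 0)"
  proof (intro tendsto_intros L)
    have "filterlim (\<lambda>x::complex. 1 / x) at_infinity (at 0)"
      using filterlim_inverse_at_infinity[where 'a=complex] unfolding inverse_eq_divide[abs_def] .
    then show "((\<lambda>x. deriv \<phi> (1 / x)) \<longlongrightarrow> of_real \<kappa>) (at 0)" by (rule filterlim_compose[OF \<kappa>(2)])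
  qed
  have "\<forall>\<^sub>F x in at 0. deriv g x = deriv \<phi> (1 / x) * (g x / x)^2"
  proof -
    have "\<forall>\<^sub>F x in at 0. x \<in> ?b - {0}"
      using B eventually_at_in_open[of ?b 0] by simp
    then show ?thesis
    proof eventually_elim
      case (elim x)
      have x0: "x \<noteq> 0" using elim by auto
      have "(\<phi> has_field_derivative deriv \<phi> (1 / x)) (at (1 / x))"
        using holomorphic_derivI[OF \<phi> opB] bd[OF elim] by simp
      then have "((\<lambda>x. \<phi> (1 / x)) has_field_derivative deriv \<phi> (1 / x) * (- 1 / x^2)) (at x)"
        using x0 by (intro DERIV_chain2[of \<phi>]) (auto intro!: derivative_eq_intros simp: power2_eq_square)
      from DERIV_inverse'[OF this nz[OF bd[OF elim]]]
      have "((\<lambda>x. 1 / \<phi> (1 / x)) has_field_derivative deriv \<phi> (1 / x) * (g x / x)^2) (at x)"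
        using x0 by (simp add: g_def inverse_eq_divide power2_eq_square divide_simps mult_ac)
      then have "(g has_field_derivative deriv \<phi> (1 / x) * (g x / x)^2) (at x)"
        by (rule has_field_derivative_transform_within_open[of _ _ _ "?b - {0}"]) (use elim in \<open>auto simp: g_def\<close>)
      then show ?case by (rule DERIV_imp_deriv)
    qed
  qed
  from Lim_transform_eventually[OF L2 this] have "L = of_real \<kappa> * L^2"
    using L3 by (intro tendsto_unique[of "at (0::complex)"]) auto
  then have Lk: "L = of_real (1 / \<kappa>)" using d0 \<kappa>(1) by (simp add: L_def power2_eq_square field_simps)
  have "((\<lambda>z. g (1 / z) / (1 / z)) \<longlongrightarrow> L) at_infinity"
  proof (rule filterlim_compose[OF L])
    show "filterlim (\<lambda>z::complex. 1 / z) (at 0) at_infinity"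
      using filterlim_inverse_at_iff[of "\<lambda>z. z" at_infinity] by (simp add: inverse_eq_divide filterlim_ident)
  qed
  moreover have "\<forall>\<^sub>F z in at_infinity. g (1 / z) / (1 / z) = z / \<phi> z"
    using eventually_at_infinity by (auto simp: g_def intro: exI[of _ 1])
  ultimately show ?thesis unfolding Lk by (rule Lim_transform_eventually)
qed

text \<open>The unit circle is a compact subset of the open image of \<open>\<phi>\<close>, so a
  whole annulus around it lies in the image. The extra neighbourhood \<open>U'\<close> confines the
  chart to the domain of another function, later \<open>V\<close>.\<close>

lemma exterior_chart_exists:
  assumes J: "analytic_Jordan_domain D" and E: "exterior_conformal_map D \<phi>"
    and U': "open U'" "- D \<subseteq> U'"
  obtains \<psi> \<rho> \<kappa> where "exterior_chart D \<phi> \<psi> \<rho> \<kappa>" "\<psi> ` {w. \<rho> < norm w} \<subseteq> U'" "(deriv \<phi> \<longlongrightarrow> of_real \<kappa>) at_infinity"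
proof -
  note D = Jordan_domain_frontier_exterior[OF J]
  obtain U1 \<kappa> where U1: "open U1" "- D \<subseteq> U1" "\<phi> holomorphic_on U1" "inj_on \<phi> U1"
    and ext: "\<phi> ` (- closure D) = {w. 1 < norm w}" and inf: "filterlim \<phi> at_infinity at_infinity"
    and \<kappa>: "0 < \<kappa>" "(deriv \<phi> \<longlongrightarrow> complex_of_real \<kappa>) at_infinity"
    using E by (auto simp: exterior_conformal_map_def)
  define U where "U = U1 \<inter> U'"
  have U: "open U" "- D \<subseteq> U" "\<phi> holomorphic_on U" "inj_on \<phi> U"
    using U1 U' by (auto simp: U_def intro: holomorphic_on_subset inj_on_subset)
  have clD: "closed (- D)" using D(1) by (simp add: closed_Compl)
  have cont: "continuous_on (- D) \<phi>"
    using holomorphic_on_imp_continuous_on[OF U(3)] U(2) continuous_on_subset by blast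
  have subD: "- closure D \<subseteq> - D" using closure_subset by auto
  \<comment> \<open>Known in the open exterior, this extends to the boundary because exterior points
    are dense there.\<close>
  have ge1: "1 \<le> norm (\<phi> z)" if "z \<in> - D" for z
  proof -
    have "closed {z \<in> - D. 1 \<le> norm (\<phi> z)}"
    proof -
      have "closed (- D \<inter> (\<lambda>z. norm (\<phi> z)) -` {1..})"
        by (intro continuous_closed_preimage continuous_intros cont clD closed_atLeast)
      moreover have "- D \<inter> (\<lambda>z. norm (\<phi> z)) -` {1..} = {z \<in> - D. 1 \<le> norm (\<phi> z)}" by auto
      ultimately show ?thesis by simp
    qed
    moreover have "- closure D \<subseteq> {z \<in> - D. 1 \<le> norm (\<phi> z)}" using ext subD by force
    ultimately have "closure (- closure D) \<subseteq> {z \<in> - D. 1 \<le> norm (\<phi> z)}" by (rule closure_minimal[rotated])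
    moreover have "- D \<subseteq> closure (- closure D)"
      using D(1,3) closure_subset[of "- closure D"] by (auto simp: frontier_def interior_open)
    ultimately show ?thesis using that by auto
  qed
  \<comment> \<open>Points of the unit circle will be approximated by \<open>(1 + 1/n) * w\<close>
    of modulus at most 2. Their preimages avoid the set where the image has modulus at least 3, so
    they stay in a fixed compact set.\<close>
  obtain B0 where B0: "\<And>z. B0 \<le> norm z \<Longrightarrow> 3 \<le> norm (\<phi> z)"
    using inf unfolding filterlim_at_infinity[OF order_refl] eventually_at_infinity by (metis zero_less_numeral)
  have img: "{w. 1 \<le> norm w} \<subseteq> \<phi> ` (- D)"
  proof
    fix w :: complex assume w: "w \<in> {w. 1 \<le> norm w}"
    show "w \<in> \<phi> ` (- D)"
    proof (cases "norm w = 1")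
      case False
      then have "w \<in> \<phi> ` (- closure D)" using w ext by auto
      then show ?thesis using subD by auto
    next
      case True
      let ?K = "\<phi> ` (- D \<inter> cball 0 B0)"
      have "compact ?K"
        by (intro compact_continuous_image continuous_on_subset[OF cont] closed_Int_compact clD) auto
      then have cl: "closed ?K" by (rule compact_imp_closed)
      have in_K: "u \<in> ?K" if u: "1 < norm u" "norm u < 3" for u :: complex
      proof -
        obtain z where z: "z \<in> - closure D" "u = \<phi> z" using ext u(1) by blast
        then have "norm z \<le> B0" using B0[of z] u(2) by (meson not_less linear order_less_le_trans)
        then show ?thesis using z subD by auto
      qed
      have "(\<lambda>n. (1 + 1 / of_nat (Suc n)) * w) \<longlonglongrightarrow> (1 + 0) * w"
        by (intro tendsto_intros LIMSEQ_Suc[OF lim_const_over_n])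
      moreover have "(1 + 1 / of_nat (Suc n)) * w \<in> ?K" for n
      proof -
        have "norm ((1 + 1 / of_nat (Suc n)) * w) = 1 + 1 / real (Suc n)"
          using True norm_of_real[of "1 + 1 / real (Suc n)", where 'a=complex] by (simp add: norm_mult)
        moreover have "0 < 1 / real (Suc n)" "1 / real (Suc n) \<le> 1" by auto
        ultimately show ?thesis by (intro in_K) linarith+
      qed
      ultimately have "(1 + 0) * w \<in> ?K" using closed_sequentially[OF cl, of "\<lambda>n. (1 + 1 / of_nat (Suc n)) * w"] by simp
      then show ?thesis by auto
    qed
  qed
  have opimg: "open (\<phi> ` U)" by (rule open_mapping_thm3[OF U(3,1,4)])
  have imgU: "w \<in> \<phi> ` U" if "1 \<le> norm w" for w :: complex
    using img U(2) that by blast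
  have "sphere 0 1 \<subseteq> \<phi> ` U" using imgU by auto
  then obtain e where e: "e > 0" "(\<Union>x\<in>sphere 0 1. ball x e) \<subseteq> \<phi> ` U"
    using compact_subset_open_imp_ball_epsilon_subset[OF _ opimg] by (metis compact_sphere)
  \<comment> \<open>The \<open>1/2\<close> only keeps \<open>\<rho>\<close> positive.\<close>
  define \<rho> where "\<rho> = max (1/2) (1 - e)"
  have \<rho>: "0 < \<rho>" "\<rho> < 1" using e by (auto simp: \<rho>_def)
  have annulus: "w \<in> \<phi> ` U" if "\<rho> < norm w" for w :: complex
  proof (cases "norm w < 1")
    case True
    have w0: "w \<noteq> 0" using that \<rho> by auto
    have "w / norm w - w = of_real (1 / norm w - 1) * w" using w0 by (simp add: field_simps)
    then have "norm (w / norm w - w) = \<bar>1 / norm w - 1\<bar> * norm w" by (simp only: norm_mult norm_of_real)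
    also have "\<dots> = 1 - norm w" using True w0 by (simp add: field_simps abs_if)
    also have "\<dots> < e" using that by (simp add: \<rho>_def)
    finally have "w \<in> ball (w / norm w) e" by (simp add: dist_norm)
    moreover have "w / norm w \<in> sphere 0 1" using w0 by (simp add: norm_divide)
    ultimately show ?thesis using e(2) by blast
  next
    case False
    then show ?thesis using imgU by auto
  qed
  obtain \<psi> where \<psi>: "\<psi> holomorphic_on (\<phi> ` U)" "\<And>z. z \<in> U \<Longrightarrow> deriv \<phi> z * deriv \<psi> (\<phi> z) = 1"
    "\<And>z. z \<in> U \<Longrightarrow> \<psi> (\<phi> z) = z"
    using holomorphic_has_inverse[OF U(3,1,4)] by metis
  have \<psi>U: "\<psi> w \<in> U \<and> \<phi> (\<psi> w) = w" if "\<rho> < norm w" for w :: complex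
    using annulus[OF that] \<psi>(3) by auto
  have inD: "\<psi> w \<in> D \<longleftrightarrow> norm w < 1" if "\<rho> < norm w" for w :: complex
  proof
    assume "\<psi> w \<in> D"
    show "norm w < 1"
    proof (rule ccontr)
      assume "\<not> norm w < 1"
      then obtain z where z: "z \<in> - D" "w = \<phi> z" using img by force
      then show False using \<psi>(3)[of z] U(2) \<open>\<psi> w \<in> D\<close> by auto
    qed
  next
    assume "norm w < 1"
    then show "\<psi> w \<in> D" using ge1[of "\<psi> w"] \<psi>U[OF that] by force
  qed
  have op: "open {w::complex. \<rho> < norm w}" by (intro open_Collect_less continuous_intros)
  have \<psi>hol: "\<psi> holomorphic_on {w. \<rho> < norm w}"
    using \<psi>(1) annulus by (auto intro: holomorphic_on_subset)
  obtain B1 where B1: "\<And>z. z \<in> D \<Longrightarrow> norm z \<le> B1" using D(2) bounded_iff by blast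
  define B where "B = max 1 (max B0 B1)"
  have ratio: "((\<lambda>z. z / \<phi> z) \<longlongrightarrow> of_real (1 / \<kappa>)) at_infinity"
  proof (rule exterior_map_ratio_at_infinity[of B, OF _ _ _ _ inf \<kappa>])
    have sub: "{z. B < norm z} \<subseteq> U" using B1 U(2) by (force simp: B_def)
    show "\<phi> holomorphic_on {z. B < norm z}" "inj_on \<phi> {z. B < norm z}"
      using sub U by (auto intro: holomorphic_on_subset inj_on_subset)
    show "\<phi> z \<noteq> 0" if "B < norm z" for z using B0[of z] that by (auto simp: B_def)
  qed (auto simp: B_def)
  have \<psi>inf: "filterlim \<psi> at_infinity at_infinity"
    unfolding filterlim_at_infinity[OF order_refl]
  proof (intro allI impI)
    fix r :: real assume "r > 0"
    have "compact (\<phi> ` (- D \<inter> cball 0 r))"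
      by (intro compact_continuous_image continuous_on_subset[OF cont] closed_Int_compact clD) auto
    then obtain M where M: "\<And>z. z \<in> - D \<inter> cball 0 r \<Longrightarrow> norm (\<phi> z) \<le> M"
      using compact_imp_bounded bounded_iff by (metis imageI)
    show "\<forall>\<^sub>F x in at_infinity. r \<le> norm (\<psi> x)"
      unfolding eventually_at_infinity
    proof (intro exI[of _ "max 1 (M + 1)"] allI impI)
      fix w :: complex assume w: "max 1 (M + 1) \<le> norm w"
      then have "\<rho> < norm w" using \<rho> by simp
      then have "\<psi> w \<in> - D" "\<phi> (\<psi> w) = w" using inD[of w] \<psi>U[of w] w by auto
      then show "r \<le> norm (\<psi> w)" using M[of "\<psi> w"] w by fastforce
    qed
  qed
  have ev: "\<forall>\<^sub>F w in at_infinity. \<rho> < norm (w::complex)"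
    unfolding eventually_at_infinity by (rule exI[of _ 1]) (use \<rho> in auto)
  have a1: "((\<lambda>w. \<psi> w / w) \<longlongrightarrow> of_real (1 / \<kappa>)) at_infinity"
  proof -
    have "((\<lambda>w. \<psi> w / \<phi> (\<psi> w)) \<longlongrightarrow> of_real (1 / \<kappa>)) at_infinity"
      by (rule filterlim_compose[OF ratio \<psi>inf])
    then show ?thesis
      by (rule Lim_transform_eventually) (use ev \<psi>U in \<open>auto elim: eventually_mono\<close>)
  qed
  have d1: "deriv \<phi> (\<psi> w) * deriv \<psi> w = 1" if "\<rho> < norm w" for w :: complex
    using \<psi>(2)[of "\<psi> w"] \<psi>U[OF that] by auto
  have a2: "(deriv \<psi> \<longlongrightarrow> of_real (1 / \<kappa>)) at_infinity"
  proof -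
    have "((\<lambda>w. 1 / deriv \<phi> (\<psi> w)) \<longlongrightarrow> 1 / of_real \<kappa>) at_infinity"
      using \<kappa>(1) by (intro tendsto_intros filterlim_compose[OF \<kappa>(2) \<psi>inf]) auto
    moreover have "\<forall>\<^sub>F w in at_infinity. 1 / deriv \<phi> (\<psi> w) = deriv \<psi> w"
      using ev by eventually_elim (use d1 in \<open>metis nonzero_mult_div_cancel_left mult_zero_left zero_neq_one mult.commute\<close>)
    ultimately show ?thesis by (simp add: Lim_transform_eventually)
  qed
  have "exterior_chart D \<phi> \<psi> \<rho> \<kappa>"
  proof
    show "\<phi> holomorphic_on \<psi> ` {w. \<rho> < norm w}" using U(3) \<psi>U by (auto intro: holomorphic_on_subset)
    show "1 \<le> norm (\<phi> z) \<and> \<psi> (\<phi> z) = z" if "z \<notin> D" for z using ge1[of z] \<psi>(3)[of z] U(2) that by auto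
  qed (use D \<rho> \<kappa> \<psi>hol \<psi>U inD d1 a1 a2 in auto)
  moreover have "\<psi> ` {w. \<rho> < norm w} \<subseteq> U'" using \<psi>U by (auto simp: U_def)
  ultimately show ?thesis using that \<kappa>(2) by blast
qed

section \<open>The end \<open>Re z \<longlonglongrightarrow> \<infinity>\<close> and the Cauchy
  kernel\<close>

abbreviation right_end :: "complex filter"
  where "right_end \<equiv> filtercomap Re at_top"

lemma eventually_right_end: "eventually P right_end \<longleftrightarrow> (\<exists>X. \<forall>z. Re z > X \<longrightarrow> P z)"
  by (simp add: eventually_filtercomap_at_top_dense)

lemma right_end_neq_bot [simp]: "right_end \<noteq> bot"
proof -
  have "\<exists>z. Re z > X" for X by (rule exI[of _ "Complex (X+1) 0"]) simp
  then show ?thesis by (simp add: trivial_limit_def eventually_right_end)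
qed

lemma filterlim_exp_right_end: "filterlim exp at_infinity right_end"
  unfolding filterlim_at_infinity[OF order_refl] eventually_right_end
proof (intro allI impI)
  fix r :: real assume "r > 0"
  show "\<exists>X. \<forall>z::complex. Re z > X \<longrightarrow> r \<le> norm (exp z)"
  proof (intro exI[of _ "ln r"] allI impI)
    fix z :: complex assume "Re z > ln r"
    then have "exp (ln r) \<le> exp (Re z)" by simp
    then show "r \<le> norm (exp z)" using \<open>r > 0\<close> by simp
  qed
qed

lemma vline_integral_right_end:
  assumes f: "periodic_holomorphic_on f {a<..}" and lim: "(f \<longlongrightarrow> L) right_end" and x: "x > a"
  shows "vline_integral f x = 2 * of_real pi * L"
  using vline_integral_limit[OF f _ x, of L] lim
  unfolding tendsto_iff eventually_right_end dist_norm by simp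

lemma vline_integral_add:
  assumes "continuous_on {0..2*pi} (\<lambda>t. f (Complex x t))" "continuous_on {0..2*pi} (\<lambda>t. g (Complex x t))"
  shows "vline_integral (\<lambda>z. f z + g z) x = vline_integral f x + vline_integral g x"
    and "vline_integral (\<lambda>z. f z - g z) x = vline_integral f x - vline_integral g x"
  unfolding vline_integral_def using assms
  by (auto intro!: integral_add integral_diff integrable_continuous_real)

lemma vline_integral_cmult: "vline_integral (\<lambda>z. c * f z) x = c * vline_integral f x"
  by (simp add: vline_integral_def)

lemma vline_integral_sum:
  assumes "\<And>k. k \<in> A \<Longrightarrow> continuous_on {0..2*pi} (\<lambda>t. f k (Complex x t))" "finite A"
  shows "vline_integral (\<lambda>z. \<Sum>k\<in>A. f k z) x = (\<Sum>k\<in>A. vline_integral (f k) x)"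
  unfolding vline_integral_def using assms by (intro integral_sum integrable_continuous_real) auto

lemma vline_integral_cong:
  assumes "\<And>z. Re z = x \<Longrightarrow> f z = g z" shows "vline_integral f x = vline_integral g x"
  unfolding vline_integral_def using assms by (intro integral_cong) auto

text \<open>The winding number of the circle \<open>|w| = exp x\<close> about \<open>exp z\<close>.
  The integrand tends to 1 at the right end and to 0 at the left end, and on either side of
  \<open>z\<close> the line can be moved to that end.\<close>

lemma vline_integral_Cauchy_kernel:
  assumes "x \<noteq> Re z"
  shows "vline_integral (\<lambda>u. exp u / (exp u - exp z)) x = (if x > Re z then 2 * of_real pi else 0)"
proof -
  let ?f = "\<lambda>u. exp u / (exp u - exp z)"
  have ne: "exp u \<noteq> exp z" if "Re u \<noteq> Re z" for u
    using that by (metis exp_inj_iff norm_exp_eq_Re)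
  have per: "periodic_holomorphic_on ?f I" if "Re z \<notin> I" for I
  proof -
    have "exp u - exp z \<noteq> 0" if "u \<in> vstrip I" for u
      using ne[of u] that \<open>Re z \<notin> I\<close> unfolding vstrip_def by (metis mem_Collect_eq right_minus_eq)
    then show ?thesis
      unfolding periodic_holomorphic_on_def exp_add_2pi by (auto intro!: holomorphic_intros)
  qed
  show ?thesis
  proof (cases "x > Re z")
    case True
    have "((\<lambda>u. 1 / (1 - exp z / u)) \<longlongrightarrow> 1 / (1 - 0)) at_infinity"
      by (intro tendsto_intros tendsto_divide_0[OF tendsto_const filterlim_ident]) auto
    from filterlim_compose[OF this filterlim_exp_right_end]
    have "((\<lambda>u. 1 / (1 - exp z / exp u)) \<longlongrightarrow> 1) right_end" by simp
    moreover have "(\<lambda>u. 1 / (1 - exp z / exp u)) = ?f" by (auto simp: fun_eq_iff divide_simps)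
    ultimately have "(?f \<longlongrightarrow> 1) right_end" by simp
    from vline_integral_right_end[OF per this, of "Re z" x] True show ?thesis by simp
  next
    case False
    have "vline_integral ?f x = of_real (2 * pi) * 0"
    proof (rule vline_integral_limit_left[OF per, of "Re z"])
      fix e :: real assume e: "e > 0"
      show "\<exists>X. \<forall>u. Re u < X \<longrightarrow> norm (?f u - 0) < e"
      proof (intro exI allI impI)
        fix u assume u: "Re u < Re z + ln (min (1/2) (e/2))"
        have "norm (exp u) = exp (Re u)" by simp
        also have "\<dots> < exp (Re z + ln (min (1/2) (e/2)))" using u by simp
        also have "\<dots> = norm (exp z) * min (1/2) (e/2)" using e by (simp add: exp_add)
        finally have q: "norm (exp u) < norm (exp z) * min (1/2) (e/2)" .
        have m: "norm (exp z) * min (1/2) (e/2) \<le> norm (exp z) * (1/2)" "norm (exp z) * min (1/2) (e/2) \<le> norm (exp z) * (e/2)"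
          by (intro mult_left_mono; simp)+
        have q: "norm (exp u) < norm (exp z) / 2" "norm (exp u) < norm (exp z) / 2 * e"
          using order_less_le_trans[OF q m(1)] order_less_le_trans[OF q m(2)] by (simp_all only: times_divide_eq_right times_divide_eq_left mult_1_right)
        have "norm (exp z) / 2 \<le> norm (exp u - exp z)"
          using q(1) norm_triangle_ineq2[of "exp z" "exp u"] by (simp only: norm_minus_commute)
        then have "norm (?f u) \<le> norm (exp u) / (norm (exp z) / 2)"
          by (simp only: norm_divide) (intro divide_left_mono mult_pos_pos, auto)
        also have "\<dots> < e" using q(2) by (simp add: field_simps)
        finally show "norm (?f u - 0) < e" by simp
      qed
    qed (use False assms in auto)
    then show ?thesis using False by simp
  qed
qed

lemma compact_open_separated:
  fixes C :: "complex set"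
  assumes "compact C" "open S" "C \<subseteq> S"
  obtains d where "d > 0" "\<And>x y. x \<in> C \<Longrightarrow> y \<notin> S \<Longrightarrow> d \<le> norm (x - y)"
proof -
  obtain e where e: "e > 0" "(\<Union>x\<in>C. ball x e) \<subseteq> S"
    using compact_subset_open_imp_ball_epsilon_subset[OF assms] by metis
  show ?thesis
    by (rule that[OF e(1)]) (use e(2) in \<open>force simp: dist_norm not_less[symmetric]\<close>)
qed

section \<open>The chart in strip coordinates\<close>

context exterior_chart
begin

definition width :: real where "width = - ln \<rho>"

definition strip_map :: "complex \<Rightarrow> complex" where "strip_map z = \<psi> (exp z)"

text \<open>A neighbourhood of the closed exterior when \<open>c > 0\<close>, bounded by the level
  curve \<open>|\<phi>| = exp (- c)\<close>.\<close>

definition region :: "real \<Rightarrow> complex set" where "region c = \<psi> ` {w. exp (- c) < norm w}"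

lemma width_pos: "width > 0" using \<rho> by (simp add: width_def)

lemma \<rho>_less_exp_iff: "\<rho> < exp x \<longleftrightarrow> - width < x"
proof -
  have "exp (- width) = \<rho>" using \<rho> by (simp add: width_def)
  then show ?thesis using exp_less_cancel_iff[of "- width" x] by simp
qed

lemma in_chart: "Re z > - width \<Longrightarrow> \<rho> < norm (exp z)" by (simp add: \<rho>_less_exp_iff)

lemma open_chart: "open {w::complex. r < norm w}"
  by (intro open_Collect_less continuous_intros)

lemma strip_map_periodic_holomorphic: "periodic_holomorphic_on strip_map {- width<..}"
proof -
  have "(\<psi> \<circ> exp) holomorphic_on vstrip {- width<..}"
    by (rule holomorphic_on_compose_gen[OF holomorphic_on_exp \<psi>_hol]) (use in_chart in \<open>auto simp: vstrip_def simp del: norm_exp_eq_Re\<close>)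
  then show ?thesis
    by (auto simp: periodic_holomorphic_on_def strip_map_def[abs_def] o_def exp_add_2pi)
qed

lemma deriv_strip_map:
  assumes "Re z > - width" shows "deriv strip_map z = deriv \<psi> (exp z) * exp z"
    "deriv \<phi> (strip_map z) * deriv strip_map z = exp z"
proof -
  have "(\<psi> has_field_derivative deriv \<psi> (exp z)) (at (exp z))"
    using holomorphic_derivI[OF \<psi>_hol open_chart] in_chart[OF assms] by simp
  then have "((\<lambda>z. \<psi> (exp z)) has_field_derivative deriv \<psi> (exp z) * exp z) (at z)"
    by (rule DERIV_chain2[OF _ DERIV_exp])
  then show 1: "deriv strip_map z = deriv \<psi> (exp z) * exp z"
    unfolding strip_map_def[abs_def] by (rule DERIV_imp_deriv)
  show "deriv \<phi> (strip_map z) * deriv strip_map z = exp z"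
    using deriv_\<phi>[OF in_chart[OF assms]] unfolding 1 strip_map_def by (metis mult.assoc mult_1)
qed

lemma \<phi>_strip_map: "Re z > - width \<Longrightarrow> \<phi> (strip_map z) = exp z"
  unfolding strip_map_def by (rule \<phi>_\<psi>[OF in_chart])

lemma inj_\<psi>: "inj_on \<psi> {w. \<rho> < norm w}"
  by (rule inj_on_inverseI[of _ \<phi>]) (use \<phi>_\<psi> in auto)

lemma inj_strip_map:
  assumes "c \<le> width" shows "inj_on strip_map (half_open_collar c)"
proof (rule inj_onI)
  fix x y assume xy: "x \<in> half_open_collar c" "y \<in> half_open_collar c" "strip_map x = strip_map y"
  then have "exp x = exp y" using assms \<phi>_strip_map[of x] \<phi>_strip_map[of y] by (auto simp: half_open_collar_def)
  then obtain n :: int where n: "x = y + of_int (2 * n) * of_real pi * \<i>" by (auto simp: exp_eq)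
  then have "Im x = Im y + 2 * pi * of_int n" by simp
  moreover have "\<bar>Im x - Im y\<bar> < 2 * pi" using xy by (auto simp: half_open_collar_def abs_less_iff)
  ultimately have "\<bar>2 * pi * of_int n\<bar> < 2 * pi * 1" by simp
  then have "\<bar>real_of_int n\<bar> < 1" by (simp only: abs_mult) (simp add: abs_mult)
  then have "n = 0" by linarith
  then show "x = y" using n by simp
qed

lemma strip_map_collar:
  assumes "c \<le> width"
  shows "strip_map ` half_open_collar c = \<psi> ` {w. exp (- c) < norm w \<and> norm w < 1}"
proof -
  have "exp ` half_open_collar c = {w::complex. exp (- c) < norm w \<and> norm w < 1}"
  proof (intro equalityI subsetI)
    fix w :: complex assume w: "w \<in> {w. exp (- c) < norm w \<and> norm w < 1}"
    then have w0: "w \<noteq> 0" by auto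
    have pos: "0 < norm w" using w0 by simp
    define z where "z = Complex (ln (norm w)) (Arg2pi w)"
    have "exp z = w"
      using Arg2pi_eq[of w] w0 unfolding z_def Complex_eq exp_add by (simp add: exp_of_real mult.commute)
    moreover have "z \<in> half_open_collar c"
      using w pos Arg2pi[of w] ln_less_cancel_iff[of "exp (- c)" "norm w"] ln_less_cancel_iff[of "norm w" 1]
      by (simp add: half_open_collar_def z_def)
    ultimately show "w \<in> exp ` half_open_collar c" by blast
  qed (auto simp: half_open_collar_def)
  then show ?thesis by (simp add: strip_map_def[abs_def] image_image[symmetric])
qed

lemma open_\<psi>_image: "open S \<Longrightarrow> S \<subseteq> {w. \<rho> < norm w} \<Longrightarrow> open (\<psi> ` S)"
  using open_mapping_thm3[of \<psi> S] \<psi>_hol inj_\<psi> by (meson holomorphic_on_subset inj_on_subset)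

lemma exp_minus_le: "c \<le> width \<Longrightarrow> exp (- c) < r \<Longrightarrow> \<rho> < r"
  using \<rho>_less_exp_iff[of "- c"] \<rho>_less_exp_iff[of "ln r"] exp_gt_zero[of "- c"]
  by (cases "c = width") (auto simp: width_def \<rho> intro: order.strict_trans)

lemma open_collar: "c \<le> width \<Longrightarrow> open (strip_map ` half_open_collar c)"
  unfolding strip_map_collar
  by (intro open_\<psi>_image open_Collect_conj open_Collect_less continuous_intros) (auto simp: exp_minus_le)

lemma collar_subset: "c \<le> width \<Longrightarrow> strip_map ` half_open_collar c \<subseteq> D"
  unfolding strip_map_collar using \<psi>_in_D exp_minus_le by auto

lemma open_region: "c \<le> width \<Longrightarrow> open (region c)"
  unfolding region_def by (intro open_\<psi>_image open_chart) (auto simp: exp_minus_le)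

lemma region_contains: "c > 0 \<Longrightarrow> - D \<subseteq> region c"
proof
  fix z assume c: "c > 0" and z: "z \<in> - D"
  then have "1 \<le> norm (\<phi> z)" "\<psi> (\<phi> z) = z" using \<psi>_\<phi> by auto
  moreover have "exp (- c) < 1" using c by simp
  ultimately have "exp (- c) < norm (\<phi> z)" "\<psi> (\<phi> z) = z" by (linarith, simp)
  then show "z \<in> region c" unfolding region_def by (intro image_eqI[of _ _ "\<phi> z"]) auto
qed

lemma region_eq: "region c = strip_map ` {z. Re z > - c}"
proof -
  have "exp ` {z. Re z > - c} = {w::complex. exp (- c) < norm w}"
  proof (intro equalityI subsetI)
    fix w :: complex assume w: "w \<in> {w. exp (- c) < norm w}"
    then have w0: "w \<noteq> 0" using exp_gt_zero[of "- c"] by auto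
    then have "exp (Ln w) = w" "Re (Ln w) = ln (norm w)" by auto
    moreover have "ln (norm w) > - c" using w w0 ln_less_cancel_iff[of "exp (- c)" "norm w"] by simp
    ultimately show "w \<in> exp ` {z. Re z > - c}" by (intro image_eqI[of _ _ "Ln w"]) auto
  qed auto
  then show ?thesis by (simp add: region_def strip_map_def[abs_def] image_image[symmetric])
qed

lemma collar_complement:
  assumes "0 < c" "c \<le> width"
  shows "D - strip_map ` half_open_collar c = - region c"
proof -
  have "\<psi> w \<in> D \<longleftrightarrow> norm w < 1" if "exp (- c) < norm w" for w
    using \<psi>_in_D exp_minus_le[OF assms(2) that] by simp
  then show ?thesis using region_contains[OF assms(1)] unfolding strip_map_collar[OF assms(2)] region_def by auto
qed

lemma strip_map_asymp:
  "((\<lambda>z. strip_map z / exp z) \<longlongrightarrow> of_real (1 / \<kappa>)) right_end"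
  "((\<lambda>z. deriv strip_map z / exp z) \<longlongrightarrow> of_real (1 / \<kappa>)) right_end"
  "filterlim strip_map at_infinity right_end"
  "filterlim \<psi> at_infinity at_infinity"
proof -
  show 1: "((\<lambda>z. strip_map z / exp z) \<longlongrightarrow> of_real (1 / \<kappa>)) right_end"
    unfolding strip_map_def by (rule filterlim_compose[OF \<psi>_asymp filterlim_exp_right_end])
  have "\<forall>\<^sub>F z in right_end. deriv \<psi> (exp z) = deriv strip_map z / exp z"
    unfolding eventually_right_end by (rule exI[of _ "- width"]) (use deriv_strip_map in auto)
  with filterlim_compose[OF deriv_\<psi>_asymp filterlim_exp_right_end]
  show "((\<lambda>z. deriv strip_map z / exp z) \<longlongrightarrow> of_real (1 / \<kappa>)) right_end"
    by (rule Lim_transform_eventually)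
  have "filterlim (\<lambda>w. (\<psi> w / w) * w) at_infinity at_infinity"
    using \<kappa> by (intro tendsto_mult_filterlim_at_infinity[OF \<psi>_asymp] filterlim_ident) simp
  moreover have "\<forall>\<^sub>F w in at_infinity. (\<psi> w / w) * w = \<psi> w"
    unfolding eventually_at_infinity by (rule exI[of _ 1]) auto
  ultimately show 4: "filterlim \<psi> at_infinity at_infinity"
    using filterlim_cong[OF refl refl] by fast
  show "filterlim strip_map at_infinity right_end"
    unfolding strip_map_def[abs_def] by (rule filterlim_compose[OF 4 filterlim_exp_right_end])
qed

lemma exists_norm_strip_map_gt: "\<exists>X\<ge>0. \<forall>z. Re z > X \<longrightarrow> norm (strip_map z) > r"
proof -
  have "\<forall>\<^sub>F z in right_end. \<bar>r\<bar> + 1 \<le> norm (strip_map z)"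
    using strip_map_asymp(3) unfolding filterlim_at_infinity[OF order_refl] by simp
  then obtain X where "\<forall>z. Re z > X \<longrightarrow> \<bar>r\<bar> + 1 \<le> norm (strip_map z)" unfolding eventually_right_end ..
  then show ?thesis by (intro exI[of _ "max 0 X"]) force
qed

text \<open>For points beyond the level \<open>c\<close> the Cauchy kernel stays bounded on the line
  \<open>- c2\<close>, which is closer to the boundary of \<open>D\<close>: that circle has a
  compact image inside the open region.\<close>

lemma separation_outer:
  assumes "0 < c2" "c2 < c" "c \<le> width"
  obtains d where "d > 0" "\<And>t z. z \<notin> region c \<Longrightarrow> d \<le> norm (strip_map (Complex (- c2) t) - z)"
proof -
  have "\<psi> ` sphere 0 (exp (- c2)) \<subseteq> region c" using assms by (auto simp: region_def)
  moreover have "compact (\<psi> ` sphere 0 (exp (- c2)))"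
    using assms by (intro compact_continuous_image continuous_on_subset[OF holomorphic_on_imp_continuous_on[OF \<psi>_hol]])
      (auto simp: \<rho>_less_exp_iff)
  ultimately obtain d where d: "d > 0" "\<And>x y. x \<in> \<psi> ` sphere 0 (exp (- c2)) \<Longrightarrow> y \<notin> region c \<Longrightarrow> d \<le> norm (x - y)"
    using compact_open_separated[OF _ open_region[OF assms(3)]] by metis
  show ?thesis by (rule that[OF d(1)]) (auto intro!: d(2) simp: strip_map_def)
qed

text \<open>The opposite case: the line \<open>- c1\<close> lies deeper in \<open>D\<close> than all
  points with \<open>Re z \<ge> - c\<close>. Its image is compact in the image of an open annulus
  that these points avoid.\<close>

lemma separation_inner:
  assumes "c < c1" "c1 < width"
  obtains d where "d > 0" "\<And>t z. Re z \<ge> - c \<Longrightarrow> d \<le> norm (strip_map (Complex (- c1) t) - strip_map z)"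
proof -
  let ?A = "{w::complex. \<rho> < norm w \<and> norm w < exp (- c)}"
  have "\<psi> ` sphere 0 (exp (- c1)) \<subseteq> \<psi> ` ?A" using assms by (intro image_mono) (auto simp: \<rho>_less_exp_iff)
  moreover have "compact (\<psi> ` sphere 0 (exp (- c1)))"
    using assms by (intro compact_continuous_image continuous_on_subset[OF holomorphic_on_imp_continuous_on[OF \<psi>_hol]])
      (auto simp: \<rho>_less_exp_iff)
  moreover have "open (\<psi> ` ?A)"
    by (intro open_\<psi>_image open_Collect_conj open_Collect_less continuous_intros) auto
  ultimately obtain d where d: "d > 0" "\<And>x y. x \<in> \<psi> ` sphere 0 (exp (- c1)) \<Longrightarrow> y \<notin> \<psi> ` ?A \<Longrightarrow> d \<le> norm (x - y)"
    using compact_open_separated[of "\<psi> ` sphere 0 (exp (- c1))" "\<psi> ` ?A"] by blast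
  have "strip_map z \<notin> \<psi> ` ?A" if "Re z \<ge> - c" for z
  proof
    assume "strip_map z \<in> \<psi> ` ?A"
    then obtain w where w: "w \<in> ?A" "\<psi> (exp z) = \<psi> w" by (auto simp: strip_map_def)
    have "\<rho> < norm (exp z)" using that assms by (intro in_chart) simp
    then have "exp z = w" using w \<phi>_\<psi> by (metis (mono_tags, lifting) mem_Collect_eq)
    then show False using w(1) that by auto
  qed
  then show ?thesis by (intro that[OF d(1)] d(2)) (auto simp: strip_map_def)
qed

end

section \<open>Approximating polynomials\<close>

locale weighted_chart = exterior_chart +
  fixes V :: "complex \<Rightarrow> complex" and v :: real
  assumes V_hol: "V holomorphic_on \<psi> ` {w. \<rho> < norm w}" and V_inf: "(V \<longlongrightarrow> of_real v) at_infinity"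
begin

definition strip_V :: "complex \<Rightarrow> complex" where "strip_V z = V (strip_map z)"

lemma strip_V_periodic_holomorphic: "periodic_holomorphic_on strip_V {- width<..}"
proof -
  have "(V \<circ> strip_map) holomorphic_on vstrip {- width<..}"
    by (rule holomorphic_on_compose_gen[OF periodic_holomorphic_onD(1)[OF strip_map_periodic_holomorphic] V_hol])
      (use in_chart in \<open>auto simp: vstrip_def strip_map_def simp del: norm_exp_eq_Re\<close>)
  then show ?thesis
    using periodic_holomorphic_onD(3)[OF strip_map_periodic_holomorphic]
    by (auto simp: periodic_holomorphic_on_def strip_V_def[abs_def] o_def)
qed

lemma strip_V_asymp: "(strip_V \<longlongrightarrow> of_real v) right_end"
  unfolding strip_V_def[abs_def] by (rule filterlim_compose[OF V_inf strip_map_asymp(3)])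

definition main_term :: "(complex \<Rightarrow> complex) \<Rightarrow> nat \<Rightarrow> complex \<Rightarrow> complex"
  where "main_term \<beta> N z = deriv \<phi> z * \<phi> z ^ N * exp (V z) * \<beta> (1 / \<phi> z)"

text \<open>The pullback of the differential \<open>main_term dz\<close>: the derivative of the
  chart cancels \<open>\<phi>'\<close> and supplies one factor \<open>exp z\<close>, hence the
  exponent \<open>N + 1\<close>.\<close>

definition strip_main :: "(complex \<Rightarrow> complex) \<Rightarrow> nat \<Rightarrow> complex \<Rightarrow> complex"
  where "strip_main \<beta> N z = exp (of_nat (N + 1) * z) * exp (strip_V z) * \<beta> (exp (- z))"

lemma main_term_strip_map:
  assumes "Re z > - width"
  shows "main_term \<beta> N (strip_map z) * deriv strip_map z = strip_main \<beta> N z"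
proof -
  have "main_term \<beta> N (strip_map z) * deriv strip_map z =
     (deriv \<phi> (strip_map z) * deriv strip_map z) * exp z ^ N * exp (V (strip_map z)) * \<beta> (1 / exp z)"
    by (simp add: main_term_def \<phi>_strip_map[OF assms] mult_ac)
  also have "\<dots> = exp z ^ (N + 1) * exp (V (strip_map z)) * \<beta> (1 / exp z)"
    unfolding deriv_strip_map(2)[OF assms] by simp
  also have "exp z ^ (N + 1) = exp (of_nat (N + 1) * z)" by (simp only: exp_of_nat_mult)
  finally show ?thesis by (simp add: strip_main_def strip_V_def exp_minus inverse_eq_divide)
qed

lemma strip_main_periodic_holomorphic:
  assumes \<beta>: "\<beta> holomorphic_on ball 0 (exp a)" and a: "a \<le> width"
  shows "periodic_holomorphic_on (strip_main \<beta> N) {- a<..}"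
proof -
  have V: "periodic_holomorphic_on strip_V {- a<..}"
    using a by (intro periodic_holomorphic_on_subset[OF strip_V_periodic_holomorphic]) auto
  have "(\<lambda>z. exp (strip_V z)) holomorphic_on vstrip {- a<..}"
    using periodic_holomorphic_onD(1)[OF V] by (intro holomorphic_intros)
  then have "periodic_holomorphic_on (\<lambda>z. exp (strip_V z)) {- a<..}"
    using periodic_holomorphic_onD(3)[OF V] by (auto simp: periodic_holomorphic_on_def)
  then show ?thesis
    unfolding strip_main_def[abs_def]
    using periodic_holomorphic_on_compose_exp_minus[of \<beta> "- a"] \<beta>
    by (intro periodic_holomorphic_on_intros(2) periodic_holomorphic_on_exp_nat) auto
qed

lemma strip_main_norm_le:
  assumes B: "\<And>x. x \<in> cball 0 (exp c1) \<Longrightarrow> norm (\<beta> x) \<le> B" and z: "Re z = - c'" "c' \<le> c1" "0 < c'"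
    and E: "norm (exp (strip_V z)) \<le> E"
  shows "norm (strip_main \<beta> N z) \<le> E * B * exp (- c' * real N)"
proof -
  have 1: "norm (exp (of_nat (N + 1) * z)) \<le> exp (- c' * real N)"
    using z by (simp add: algebra_simps)
  have 2: "norm (\<beta> (exp (- z))) \<le> B" using z by (intro B) auto
  have "norm (strip_main \<beta> N z) = norm (exp (of_nat (N + 1) * z)) * norm (exp (strip_V z)) * norm (\<beta> (exp (- z)))"
    unfolding strip_main_def by (simp only: norm_mult)
  also have "\<dots> \<le> exp (- c' * real N) * E * B"
    using 1 2 E order_trans[OF norm_ge_zero E] by (intro mult_mono) (auto simp del: norm_exp_eq_Re)
  finally show ?thesis by (simp add: mult_ac)
qed

lemma strip_main_asymp:
  assumes \<beta>: "\<beta> holomorphic_on ball 0 (exp a)" and \<beta>0: "\<beta> 0 = 1"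
  shows "((\<lambda>z. strip_main \<beta> N z / strip_map z ^ (N + 1)) \<longlongrightarrow> of_real (\<kappa> ^ (N + 1) * exp v)) right_end"
proof -
  have "isCont \<beta> 0" using holomorphic_on_imp_continuous_on[OF \<beta>] by (auto simp: continuous_on_eq_continuous_at)
  moreover have "((\<lambda>z. exp (- z)) \<longlongrightarrow> (0::complex)) right_end"
    using tendsto_inverse_0[THEN filterlim_compose, OF filterlim_exp_right_end] by (simp add: exp_minus)
  ultimately have "((\<lambda>z. \<beta> (exp (- z))) \<longlongrightarrow> 1) right_end"
    using isCont_tendsto_compose \<beta>0 by fastforce
  then have "((\<lambda>z. (1 / (strip_map z / exp z)) ^ (N + 1) * exp (strip_V z) * \<beta> (exp (- z)))
     \<longlongrightarrow> (1 / of_real (1 / \<kappa>)) ^ (N + 1) * exp (of_real v) * 1) right_end"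
    using \<kappa> by (intro tendsto_intros strip_map_asymp strip_V_asymp) auto
  moreover have "(1 / (strip_map z / exp z)) ^ (N + 1) * exp (strip_V z) * \<beta> (exp (- z)) =
     strip_main \<beta> N z / strip_map z ^ (N + 1)" for z
    unfolding strip_main_def exp_of_nat_mult by (simp add: power_divide)
  moreover have "(1 / of_real (1 / \<kappa>)) ^ (N + 1) * exp (of_real v) * 1 = (of_real (\<kappa> ^ (N + 1) * exp v) :: complex)"
    using \<kappa> by (simp add: exp_of_real)
  ultimately show ?thesis by (simp only:)
qed

text \<open>\<open>Q\<close> is the polynomial part of the Laurent expansion of the main term at
  infinity, represented as a Cauchy integral over any sufficiently distant line. The form with an
  existential \<open>X\<close> allows the line to depend on \<open>z\<close>; later it is moved
  inwards.\<close>

lemma polynomial_part: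
  assumes \<beta>: "\<beta> holomorphic_on ball 0 (exp a)" "\<beta> 0 = 1" and a: "0 < a" "a \<le> width"
  obtains Q X where "degree Q \<le> N" "coeff Q N = of_real (\<kappa> ^ (N + 1) * exp v)"
    "\<And>z. \<exists>X\<ge>0. (\<forall>u. Re u > X \<longrightarrow> strip_map u \<noteq> z) \<and>
        (\<forall>x>X. 2 * of_real pi * poly Q z = vline_integral (\<lambda>u. strip_main \<beta> N u / (strip_map u - z)) x)"
proof -
  obtain X0 where X0: "X0 \<ge> 0" "\<And>z. Re z > X0 \<Longrightarrow> norm (strip_map z) > 0"
    using exists_norm_strip_map_gt[of 0] by blast
  let ?G = "strip_main \<beta> N"
  have G: "periodic_holomorphic_on ?G {X<..}" and S: "periodic_holomorphic_on strip_map {X<..}" if "X \<ge> 0" for X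
    using periodic_holomorphic_on_subset[OF strip_main_periodic_holomorphic[OF \<beta>(1) a(2)], of "{X<..}"]
      periodic_holomorphic_on_subset[OF strip_map_periodic_holomorphic, of "{X<..}"] that a width_pos by auto
  have div: "periodic_holomorphic_on (\<lambda>u. f u / g u) {X<..}"
    if "periodic_holomorphic_on f {X<..}" "periodic_holomorphic_on g {X<..}" "\<And>u. Re u > X \<Longrightarrow> g u \<noteq> 0" for f g X
    using that by (auto simp: periodic_holomorphic_on_def vstrip_def intro!: holomorphic_intros)
  have pow: "periodic_holomorphic_on (\<lambda>u. f u ^ n) {X<..}" if "periodic_holomorphic_on f {X<..}" for f X n
    using that by (auto simp: periodic_holomorphic_on_def intro!: holomorphic_intros)
  \<comment> \<open>Laurent coefficients at infinity as integrals over one far line;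
    \<open>X0\<close> keeps \<open>strip_map\<close> away from zero.\<close>
  define A where "A = (\<lambda>k. vline_integral (\<lambda>u. ?G u / strip_map u ^ (k + 1)) (X0 + 1) / (2 * of_real pi))"
  have perA: "periodic_holomorphic_on (\<lambda>u. ?G u / strip_map u ^ (k + 1)) {X0<..}" for k
    using X0 by (intro div pow G S) auto
  have A: "2 * of_real pi * A k = vline_integral (\<lambda>u. ?G u / strip_map u ^ (k + 1)) x" if "x > X0" for k x
    using vline_integral_shift[OF _ _ perA, of "X0 + 1" x k] that by (simp add: A_def)
  define Q where "Q = (\<Sum>k\<le>N. monom (A k) k)"
  have Qc: "coeff Q k = (if k \<le> N then A k else 0)" for k
    unfolding Q_def by (simp add: coeff_sum)
  have "degree Q \<le> N" by (rule degree_le) (simp add: Qc)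
  moreover have "coeff Q N = of_real (\<kappa> ^ (N + 1) * exp v)"
    using vline_integral_right_end[OF perA strip_main_asymp[OF \<beta>], of "X0 + 1"] A[of "X0 + 1" N]
    by (simp add: Qc del: of_real_mult of_real_power)
  moreover have "\<exists>X\<ge>0. (\<forall>u. Re u > X \<longrightarrow> strip_map u \<noteq> z) \<and>
        (\<forall>x>X. 2 * of_real pi * poly Q z = vline_integral (\<lambda>u. ?G u / (strip_map u - z)) x)" for z
  proof -
    obtain X1 where X1: "X1 \<ge> 0" "\<And>u. Re u > X1 \<Longrightarrow> norm (strip_map u) > norm z"
      using exists_norm_strip_map_gt[of "norm z"] by blast
    define X where "X = max X0 X1"
    have X: "X \<ge> 0" "X \<ge> X0" using X0 X1 by (auto simp: X_def)
    have ne: "strip_map u \<noteq> z" "strip_map u \<noteq> 0" if "Re u > X" for u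
      using X1(2)[of u] X0(2)[of u] that by (auto simp: X_def)
    have p1: "periodic_holomorphic_on (\<lambda>u. ?G u / (strip_map u - z)) {X<..}"
      using ne X by (intro div G periodic_holomorphic_on_intros(3)[OF S periodic_holomorphic_on_intros(5)[OF G G]]) auto
    have p2: "periodic_holomorphic_on (\<lambda>u. ?G u / strip_map u ^ (N + 1) * (z ^ (N + 1) / (strip_map u - z))) {X<..}"
      using ne X
      by (intro div pow G S periodic_holomorphic_on_intros(2) periodic_holomorphic_on_intros(3)[OF S periodic_holomorphic_on_intros(5)[OF G G]]
         periodic_holomorphic_on_intros(5)[OF G G]) auto
    have "((\<lambda>w. z ^ (N + 1) / (w - z)) \<longlongrightarrow> 0) at_infinity"
      by (rule tendsto_divide_0[OF tendsto_const])
        (use tendsto_add_filterlim_at_infinity'[OF filterlim_ident tendsto_const[of "- z"]] in simp)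
    from filterlim_compose[OF this strip_map_asymp(3)]
    have "((\<lambda>u. ?G u / strip_map u ^ (N + 1) * (z ^ (N + 1) / (strip_map u - z))) \<longlongrightarrow> of_real (\<kappa> ^ (N + 1) * exp v) * 0) right_end"
      by (intro tendsto_mult strip_main_asymp[OF \<beta>])
    \<comment> \<open>The remainder of the finite geometric series for
      \<open>1 / (strip_map u - z)\<close> tends to zero at the right end, so it integrates to zero
      exactly.\<close>
    then have v0: "vline_integral (\<lambda>u. ?G u / strip_map u ^ (N + 1) * (z ^ (N + 1) / (strip_map u - z))) x = 0" if "x > X" for x
      using vline_integral_right_end[OF p2 _ that] by simp
    have "2 * of_real pi * poly Q z = vline_integral (\<lambda>u. ?G u / (strip_map u - z)) x" if x: "x > X" for x
    proof -
      have cl: "continuous_on {0..2*pi} (\<lambda>t. f (Complex x t))" if "periodic_holomorphic_on f {X<..}" for f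
        using x periodic_holomorphic_onD(2)[OF that] by (intro continuous_on_vline[of "{X<..}"]) auto
      have pk: "periodic_holomorphic_on (\<lambda>u. z ^ k * (?G u / strip_map u ^ (k + 1))) {X<..}" for k
        using X by (intro periodic_holomorphic_on_intros(2) periodic_holomorphic_on_intros(5)[OF G G] periodic_holomorphic_on_subset[OF perA]) auto
      have "2 * of_real pi * poly Q z = (\<Sum>k\<le>N. z ^ k * (2 * of_real pi * A k))"
        by (simp add: Q_def poly_sum poly_monom sum_distrib_left mult_ac)
      also have "\<dots> = (\<Sum>k\<le>N. vline_integral (\<lambda>u. z ^ k * (?G u / strip_map u ^ (k + 1))) x)"
        using A[of x] x X unfolding vline_integral_cmult by (intro sum.cong) auto
      also have "\<dots> = vline_integral (\<lambda>u. \<Sum>k\<le>N. z ^ k * (?G u / strip_map u ^ (k + 1))) x"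
        by (rule vline_integral_sum[symmetric]) (use cl[OF pk] in auto)
      also have "\<dots> = vline_integral (\<lambda>u. ?G u / (strip_map u - z) - ?G u / strip_map u ^ (N + 1) * (z ^ (N + 1) / (strip_map u - z))) x"
      proof (rule vline_integral_cong)
        fix u :: complex assume "Re u = x"
        then have n: "strip_map u \<noteq> z" "strip_map u \<noteq> 0" using ne x by auto
        define s where "s = strip_map u"
        have s: "s \<noteq> z" "s \<noteq> 0" using n by (auto simp: s_def)
        have "(\<Sum>k\<le>N. z ^ k / s ^ (k + 1)) = 1 / (s - z) - z ^ (N + 1) / (s ^ (N + 1) * (s - z))"
        proof -
          have "(\<Sum>k\<le>N. z ^ k / s ^ (k + 1)) = (\<Sum>k<Suc N. (z / s) ^ k) / s"
            by (simp add: sum_divide_distrib power_divide lessThan_Suc_atMost mult.commute)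
          also have "(\<Sum>k<Suc N. (z / s) ^ k) = (1 - (z / s) ^ Suc N) / (1 - z / s)"
            using s by (subst sum_gp_strict) auto
          also have "\<dots> / s = 1 / (s - z) - z ^ (N + 1) / (s ^ (N + 1) * (s - z))"
          proof -
            have "(1 - z / s) * s = s - z" using s by (simp add: field_simps)
            then have "(1 - (z / s) ^ Suc N) / (1 - z / s) / s = (1 - (z / s) ^ Suc N) / (s - z)"
              by (simp add: divide_divide_eq_left)
            then show ?thesis by (simp add: power_divide diff_divide_distrib)
          qed
          finally show ?thesis .
        qed
        then have "?G u * (\<Sum>k\<le>N. z ^ k / s ^ (k + 1)) = ?G u * (1 / (s - z) - z ^ (N + 1) / (s ^ (N + 1) * (s - z)))" by simp
        then show "(\<Sum>k\<le>N. z ^ k * (?G u / strip_map u ^ (k + 1))) =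
           ?G u / (strip_map u - z) - ?G u / strip_map u ^ (N + 1) * (z ^ (N + 1) / (strip_map u - z))"
          by (simp add: s_def sum_distrib_left right_diff_distrib mult_ac)
      qed
      also have "\<dots> = vline_integral (\<lambda>u. ?G u / (strip_map u - z)) x"
        using vline_integral_add(2)[OF cl[OF p1] cl[OF p2]] v0[OF x] by simp
      finally show ?thesis .
    qed
    then show ?thesis using X(1) ne(1) by blast
  qed
  ultimately show ?thesis using that by blast
qed

text \<open>For such \<open>z\<close> the kernel has no pole to the right of \<open>- c\<close>, so
  the line may be moved inside \<open>D\<close>, where the main term is exponentially small.\<close>

lemma polynomial_part_inside:
  assumes \<beta>: "\<beta> holomorphic_on ball 0 (exp a)" and a: "a \<le> width"
    and c: "0 < c2" "c2 < c" "c \<le> a" and z: "z \<notin> region c"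
    and Q: "\<exists>X\<ge>0. (\<forall>u. Re u > X \<longrightarrow> strip_map u \<noteq> z) \<and>
        (\<forall>x>X. 2 * of_real pi * q = vline_integral (\<lambda>u. strip_main \<beta> N u / (strip_map u - z)) x)"
  shows "2 * of_real pi * q = vline_integral (\<lambda>u. strip_main \<beta> N u / (strip_map u - z)) (- c2)"
proof -
  obtain X where X: "X \<ge> 0" "2 * of_real pi * q = vline_integral (\<lambda>u. strip_main \<beta> N u / (strip_map u - z)) (X + 1)"
    using Q by force
  have ne: "strip_map u \<noteq> z" if "Re u > - c" for u using z that by (auto simp: region_eq)
  have "strip_main \<beta> N holomorphic_on vstrip {-c<..}" "strip_map holomorphic_on vstrip {-c<..}"
    using c a
    by (auto simp: vstrip_def
        intro!: holomorphic_on_subset[OF periodic_holomorphic_onD(1)[OF strip_main_periodic_holomorphic[OF \<beta> a]]]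
          holomorphic_on_subset[OF periodic_holomorphic_onD(1)[OF strip_map_periodic_holomorphic]])
  then have "periodic_holomorphic_on (\<lambda>u. strip_main \<beta> N u / (strip_map u - z)) {-c<..}"
    using ne c a periodic_holomorphic_onD(3)[OF strip_main_periodic_holomorphic[OF \<beta> a]]
      periodic_holomorphic_onD(3)[OF strip_map_periodic_holomorphic]
    by (auto simp: periodic_holomorphic_on_def vstrip_def intro!: holomorphic_intros)
  from vline_integral_shift[OF _ _ this, of "X + 1" "- c2"] show ?thesis
    using X c by simp
qed

text \<open>Moving the line inwards past \<open>z\<close> picks up the residue, which is the main
  term itself. The pole is removed by subtracting a multiple of the model kernel of
  \<open>vline_integral_Cauchy_kernel\<close>; the rest is holomorphic and does not see the
  line.\<close>

lemma polynomial_part_outside: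
  assumes \<beta>: "\<beta> holomorphic_on ball 0 (exp a)" and a: "a \<le> width"
    and c: "c < c1" "c1 < a" and z: "Re z \<ge> - c"
    and Q: "\<exists>X\<ge>0. (\<forall>u. Re u > X \<longrightarrow> strip_map u \<noteq> strip_map z) \<and>
        (\<forall>x>X. 2 * of_real pi * q = vline_integral (\<lambda>u. strip_main \<beta> N u / (strip_map u - strip_map z)) x)"
  shows "2 * of_real pi * (q - main_term \<beta> N (strip_map z)) =
     vline_integral (\<lambda>u. strip_main \<beta> N u / (strip_map u - strip_map z)) (- c1)"
proof -
  define O1 where "O1 = {u::complex. exp (- a) < norm u}"
  define w where "w = exp z"
  have opO: "open O1" unfolding O1_def by (rule open_chart)
  have sub: "O1 \<subseteq> {u. \<rho> < norm u}" using exp_minus_le[OF a] by (auto simp: O1_def)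
  have wO: "w \<in> O1" using z c by (simp add: w_def O1_def)
  have h\<psi>: "\<psi> holomorphic_on O1" using \<psi>_hol sub holomorphic_on_subset by blast
  \<comment> \<open>The divided difference of \<open>\<psi>\<close>, without zeros by injectivity.
    It converts the kernel in \<open>\<psi> u\<close> into the kernel in \<open>u\<close>.\<close>
  define k where "k = (\<lambda>u. if u = w then deriv \<psi> w else (\<psi> u - \<psi> w) / (u - w))"
  have hk: "k holomorphic_on O1" unfolding k_def by (rule pole_lemma_open[OF h\<psi> opO])
  have k0: "k u \<noteq> 0" if "u \<in> O1" for u
  proof (cases "u = w")
    case True
    then show ?thesis using deriv_\<phi>[of w] wO sub by (auto simp: k_def)
  next
    case False
    then have "\<psi> u \<noteq> \<psi> w" using inj_onD[OF inj_\<psi>, of u w] that wO sub by auto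
    then show ?thesis using False by (simp add: k_def)
  qed
  define G where "G = (\<lambda>u. u ^ N * exp (V (\<psi> u)) * \<beta> (1 / u))"
  have hG: "G holomorphic_on O1"
  proof -
    have "(V \<circ> \<psi>) holomorphic_on O1" using sub by (intro holomorphic_on_compose_gen[OF h\<psi> V_hol]) auto
    moreover have "(\<beta> \<circ> (\<lambda>u. 1 / u)) holomorphic_on O1"
    proof (rule holomorphic_on_compose_gen[OF _ \<beta>])
      show "(\<lambda>u. 1 / u) holomorphic_on O1" by (intro holomorphic_intros) (auto simp: O1_def)
      show "(\<lambda>u. 1 / u) ` O1 \<subseteq> ball 0 (exp a)"
      proof clarsimp
        fix u assume u: "u \<in> O1"
        then have "exp (- a) < norm u" by (simp add: O1_def)
        then have "inverse (norm u) < inverse (exp (- a))" by (intro less_imp_inverse_less) auto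
        then show "norm (1 / u) < exp a" by (simp add: norm_divide exp_minus inverse_eq_divide)
      qed
    qed
    ultimately show ?thesis unfolding G_def o_def by (intro holomorphic_intros)
  qed
  have Gs: "strip_main \<beta> N u = exp u * G (exp u)" for u
    unfolding strip_main_def G_def strip_V_def strip_map_def
    by (simp add: exp_minus inverse_eq_divide exp_add distrib_right exp_of_nat_mult)
  define H where "H = (\<lambda>u. G u / k u)"
  have hH: "H holomorphic_on O1" unfolding H_def using k0 by (intro holomorphic_intros hG hk) auto
  \<comment> \<open>What remains of \<open>H u / (u - w)\<close> after its polar part
    \<open>H w / (u - w)\<close> is subtracted.\<close>
  define m where "m = (\<lambda>u. if u = w then deriv H w else (H u - H w) / (u - w))"
  have hm: "m holomorphic_on O1" unfolding m_def by (rule pole_lemma_open[OF hH opO])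
  have zw: "Re z > - width" using z c a by simp
  have Hw: "H w = main_term \<beta> N (strip_map z)"
  proof -
    have "main_term \<beta> N (strip_map z) * (deriv \<psi> w * w) = w * G w"
      using main_term_strip_map[OF zw, of \<beta> N] deriv_strip_map(1)[OF zw] Gs[of z] by (simp add: w_def)
    then have "main_term \<beta> N (strip_map z) * deriv \<psi> w = G w" using wO by (auto simp: w_def)
    then show ?thesis using k0[OF wO] by (simp add: H_def k_def field_simps)
  qed
  define Mf where "Mf = (\<lambda>u. exp u * m (exp u))"
  have perM: "periodic_holomorphic_on Mf {-a<..}"
  proof -
    have "(m \<circ> exp) holomorphic_on vstrip {-a<..}"
      by (rule holomorphic_on_compose_gen[OF holomorphic_on_exp hm]) (auto simp: vstrip_def O1_def)
    then show ?thesis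
      unfolding Mf_def periodic_holomorphic_on_def exp_add_2pi o_def by (auto intro!: holomorphic_intros)
  qed
  have Meq: "Mf u = strip_main \<beta> N u / (strip_map u - strip_map z) - H w * (exp u / (exp u - exp z))"
    if "Re u \<noteq> Re z" "Re u > - a" for u
  proof -
    have ne: "exp u \<noteq> w" using that(1) unfolding w_def by (metis exp_inj_iff norm_exp_eq_Re)
    have uO: "exp u \<in> O1" using that by (simp add: O1_def)
    have "k (exp u) = (strip_map u - strip_map z) / (exp u - w)"
      using ne by (simp add: k_def strip_map_def w_def)
    then have "H (exp u) / (exp u - w) = G (exp u) / (strip_map u - strip_map z)"
      using ne by (simp add: H_def)
    then have "Mf u = exp u * (G (exp u) / (strip_map u - strip_map z)) - exp u * (H w / (exp u - w))"
      using ne by (simp add: Mf_def m_def diff_divide_distrib right_diff_distrib)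
    then show ?thesis by (simp add: Gs w_def mult_ac)
  qed
  obtain X where X: "X \<ge> 0" "\<And>u. Re u > X \<Longrightarrow> strip_map u \<noteq> strip_map z"
    "\<And>x. x > X \<Longrightarrow> 2 * of_real pi * q = vline_integral (\<lambda>u. strip_main \<beta> N u / (strip_map u - strip_map z)) x"
    using Q by blast
  have cG: "continuous_on {0..2*pi} (\<lambda>t. strip_main \<beta> N (Complex x t) / (strip_map (Complex x t) - strip_map z))"
    if "x > - a" "\<And>t. strip_map (Complex x t) \<noteq> strip_map z" for x
    using that a periodic_holomorphic_onD(2)[OF strip_main_periodic_holomorphic[OF \<beta> a]]
      periodic_holomorphic_onD(2)[OF strip_map_periodic_holomorphic]
    by (intro continuous_intros continuous_on_vline[of "{-a<..}"] continuous_on_vline[of "{-width<..}" strip_map]) auto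
  have cK: "continuous_on {0..2*pi} (\<lambda>t. H w * (exp (Complex x t) / (exp (Complex x t) - exp z)))" if "x \<noteq> Re z" for x
  proof -
    have "exp (Complex x t) - exp z \<noteq> 0" for t
      using that by (metis complex.sel(1) exp_inj_iff norm_exp_eq_Re right_minus_eq)
    then show ?thesis by (intro continuous_intros) auto
  qed
  have split: "vline_integral Mf x = vline_integral (\<lambda>u. strip_main \<beta> N u / (strip_map u - strip_map z)) x
      - H w * (if x > Re z then 2 * of_real pi else 0)"
    if "x > - a" "x \<noteq> Re z" "\<And>t. strip_map (Complex x t) \<noteq> strip_map z" for x
  proof -
    have "vline_integral Mf x = vline_integral (\<lambda>u. strip_main \<beta> N u / (strip_map u - strip_map z) - H w * (exp u / (exp u - exp z))) x"
      using Meq that by (intro vline_integral_cong) auto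
    also have "\<dots> = vline_integral (\<lambda>u. strip_main \<beta> N u / (strip_map u - strip_map z)) x - vline_integral (\<lambda>u. H w * (exp u / (exp u - exp z))) x"
      using that by (intro vline_integral_add(2) cG cK) auto
    finally show ?thesis unfolding vline_integral_cmult vline_integral_Cauchy_kernel[OF that(2)] .
  qed
  define x where "x = max X (Re z) + 1"
  have x: "x > X" "x > Re z" "x > - a" using X z c by (auto simp: x_def)
  have "vline_integral Mf x = 2 * of_real pi * q - H w * (2 * of_real pi)"
    using split[of x] X(2,3) x by simp
  moreover have "vline_integral Mf (- c1) = vline_integral (\<lambda>u. strip_main \<beta> N u / (strip_map u - strip_map z)) (- c1)"
  proof -
    have "strip_map (Complex (- c1) t) \<noteq> strip_map z" for t
    proof
      assume "strip_map (Complex (- c1) t) = strip_map z"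
      then have "exp (Complex (- c1) t) = exp z" using \<phi>_strip_map[of "Complex (- c1) t"] \<phi>_strip_map[OF zw] c a by simp
      then show False using z c by (metis complex.sel(1) exp_inj_iff norm_exp_eq_Re not_less neg_less_iff_less)
    qed
    then show ?thesis using split[of "- c1"] c z by simp
  qed
  moreover have "vline_integral Mf x = vline_integral Mf (- c1)"
    using vline_integral_shift[OF _ _ perM, of x "- c1"] x c by simp
  ultimately show ?thesis unfolding Hw by (simp add: algebra_simps)
qed

text \<open>Two lines serve for two kinds of points: \<open>- c1\<close> for points outside the
  level \<open>c\<close>, at the price of a residue, and \<open>- c2\<close> for points inside it.
  The constant precedes the quantification over \<open>N\<close>, \<open>\<beta>\<close> and
  \<open>B\<close>, since \<open>\<beta>\<close> will depend on \<open>N\<close>.\<close>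

lemma approximating_polynomial:
  assumes c: "0 < c2" "c2 < c" "c < c1" "c1 < a" "a \<le> width"
  obtains C where "C \<ge> 0"
    "\<And>N \<beta> B. \<beta> holomorphic_on ball 0 (exp a) \<Longrightarrow> \<beta> 0 = 1 \<Longrightarrow> (\<And>x. x \<in> cball 0 (exp c1) \<Longrightarrow> norm (\<beta> x) \<le> B) \<Longrightarrow>
      \<exists>Q. degree Q \<le> N \<and> coeff Q N = of_real (\<kappa> ^ (N + 1) * exp v) \<and>
       (\<forall>z. Re z \<ge> - c \<longrightarrow> norm (poly Q (strip_map z) - main_term \<beta> N (strip_map z)) \<le> C * B * exp (- c1 * real N)) \<and>
       (\<forall>z. z \<notin> region c \<longrightarrow> norm (poly Q z) \<le> C * B * exp (- c2 * real N))"
proof -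
  obtain d1 where d1: "d1 > 0" "\<And>t z. Re z \<ge> - c \<Longrightarrow> d1 \<le> norm (strip_map (Complex (- c1) t) - strip_map z)"
    using separation_inner[of c c1] c by (metis order_less_le_trans)
  obtain d2 where d2: "d2 > 0" "\<And>t z. z \<notin> region c \<Longrightarrow> d2 \<le> norm (strip_map (Complex (- c2) t) - z)"
    using separation_outer[of c2 c] c by (metis less_imp_le order.trans)
  have "\<exists>E. \<forall>t\<in>{0..2*pi}. norm (exp (strip_V (Complex x t))) \<le> E" if "x > - width" for x
  proof -
    have "continuous_on {0..2*pi} (\<lambda>t. exp (strip_V (Complex x t)))"
      using that periodic_holomorphic_onD(2)[OF strip_V_periodic_holomorphic]
      by (intro continuous_intros continuous_on_vline[of "{-width<..}"]) auto
    then have "compact ((\<lambda>t. exp (strip_V (Complex x t))) ` {0..2*pi})" by (rule compact_continuous_image) simp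
    then show ?thesis using compact_imp_bounded bounded_iff by (metis imageI)
  qed
  then obtain E1 E2 where E1: "\<And>t. t \<in> {0..2*pi} \<Longrightarrow> norm (exp (strip_V (Complex (- c1) t))) \<le> E1"
    and E2: "\<And>t. t \<in> {0..2*pi} \<Longrightarrow> norm (exp (strip_V (Complex (- c2) t))) \<le> E2"
    using c by (metis neg_less_iff_less less_trans order_less_le_trans)
  define C where "C = max (E1 / d1) (E2 / d2)"
  have E0: "E1 \<ge> 0" "E2 \<ge> 0" using order_trans[OF norm_ge_zero E1[of 0]] order_trans[OF norm_ge_zero E2[of 0]] by auto
  then have C0: "C \<ge> 0" using d1(1) d2(1) by (simp add: C_def le_max_iff_disj)
  show ?thesis
  proof (rule that[OF C0])
    fix N \<beta> B
    assume \<beta>: "\<beta> holomorphic_on ball 0 (exp a)" "\<beta> 0 = 1" and B: "\<And>x. x \<in> cball 0 (exp c1) \<Longrightarrow> norm (\<beta> x) \<le> B"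
    have B0: "B \<ge> 0" using B[of 0] by (simp add: order_trans[OF norm_ge_zero])
    obtain Q where Q: "degree Q \<le> N" "coeff Q N = of_real (\<kappa> ^ (N + 1) * exp v)"
      "\<And>z. \<exists>X\<ge>0. (\<forall>u. Re u > X \<longrightarrow> strip_map u \<noteq> z) \<and>
        (\<forall>x>X. 2 * of_real pi * poly Q z = vline_integral (\<lambda>u. strip_main \<beta> N u / (strip_map u - z)) x)"
    proof (rule polynomial_part[OF \<beta>, of N])
      show "0 < a" "a \<le> width" using c by auto
    qed blast
    have bd: "norm q \<le> C * B * exp (- x * real N)"
      if q: "2 * of_real pi * q = vline_integral (\<lambda>u. strip_main \<beta> N u / (strip_map u - z)) (- x)"
        and x: "0 < x" "x \<le> c1" and d: "d > 0" "\<And>t. d \<le> norm (strip_map (Complex (- x) t) - z)" and EC: "E / d \<le> C"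
        and E: "\<And>t. t \<in> {0..2*pi} \<Longrightarrow> norm (exp (strip_V (Complex (- x) t))) \<le> E" for q x z d E
    proof -
      have xa: "x < a" using x c by simp
      have ne: "strip_map (Complex (- x) t) \<noteq> z" for t using d(1) d(2)[of t] by auto
      have "norm (vline_integral (\<lambda>u. strip_main \<beta> N u / (strip_map u - z)) (- x)) \<le> 2 * pi * (E * B * exp (- x * real N) / d)"
      proof (rule vline_integral_norm_le)
        show "continuous_on {0..2*pi} (\<lambda>t. strip_main \<beta> N (Complex (- x) t) / (strip_map (Complex (- x) t) - z))"
          using ne xa c periodic_holomorphic_onD(2)[OF strip_main_periodic_holomorphic[OF \<beta>(1) c(5)]]
            periodic_holomorphic_onD(2)[OF strip_map_periodic_holomorphic]
          by (intro continuous_intros continuous_on_vline[of "{-a<..}"] continuous_on_vline[of "{-width<..}" strip_map]) auto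
        fix t assume t: "t \<in> {0..2*pi}"
        have "norm (strip_main \<beta> N (Complex (- x) t)) \<le> E * B * exp (- x * real N)"
          using x by (intro strip_main_norm_le[OF B _ _ _ E[OF t]]) auto
        then show "norm (strip_main \<beta> N (Complex (- x) t) / (strip_map (Complex (- x) t) - z)) \<le> E * B * exp (- x * real N) / d"
          using d by (simp only: norm_divide) (intro frac_le, auto intro: order_trans[OF norm_ge_zero])
      qed
      moreover have "norm (vline_integral (\<lambda>u. strip_main \<beta> N u / (strip_map u - z)) (- x)) = 2 * pi * norm q"
        unfolding q[symmetric] by (simp add: norm_mult)
      ultimately have "2 * pi * norm q \<le> 2 * pi * ((E / d) * (B * exp (- x * real N)))" by simp
      then have "norm q \<le> (E / d) * (B * exp (- x * real N))" using pi_gt_zero by (simp only: mult_le_cancel_left_pos mult_pos_pos zero_less_numeral)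
      also have "\<dots> \<le> C * (B * exp (- x * real N))" using EC B0 by (intro mult_right_mono) auto
      finally show ?thesis by (simp add: mult_ac)
    qed
    have "norm (poly Q (strip_map z) - main_term \<beta> N (strip_map z)) \<le> C * B * exp (- c1 * real N)" if "Re z \<ge> - c" for z
      using polynomial_part_outside[OF \<beta>(1) c(5) c(3,4) that Q(3)] c d1 that E1
      by (intro bd[of _ "strip_map z" c1 d1 E1]) (auto simp: C_def)
    moreover have "norm (poly Q z) \<le> C * B * exp (- c2 * real N)" if "z \<notin> region c" for z
      using polynomial_part_inside[OF \<beta>(1) c(5) c(1,2) _ that Q(3)] c d2 that E2
      by (intro bd[of _ z c2 d2 E2]) (auto simp: C_def)
    ultimately show "\<exists>Q. degree Q \<le> N \<and> coeff Q N = of_real (\<kappa> ^ (N + 1) * exp v) \<and>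
       (\<forall>z. Re z \<ge> - c \<longrightarrow> norm (poly Q (strip_map z) - main_term \<beta> N (strip_map z)) \<le> C * B * exp (- c1 * real N)) \<and>
       (\<forall>z. z \<notin> region c \<longrightarrow> norm (poly Q z) \<le> C * B * exp (- c2 * real N))"
      using Q(1,2) by blast
  qed
qed

end

section \<open>The expansion coefficients\<close>

text \<open>\<open>R > 1\<close> gives absolute convergence on the unit circle, hence uniform
  convergence and termwise integration against the bounded \<open>g\<close>.\<close>

lemma integral_power_series_exp:
  fixes g :: "real \<Rightarrow> complex"
  assumes a: "\<And>X. norm X < R \<Longrightarrow> (\<lambda>m. a m * X ^ m) sums P X" and R: "R > 1" and g: "continuous_on {0..2*pi} g"
  shows "(\<lambda>m. a m * integral {0..2*pi} (\<lambda>t. g t * exp (- (of_nat m * Complex 0 t)))) sums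
     integral {0..2*pi} (\<lambda>t. g t * P (exp (- Complex 0 t)))"
proof -
  obtain r where r: "1 < r" "r < R" using R dense by blast
  have "summable (\<lambda>m. a m * of_real r ^ m)" using a[of "of_real r"] r by (auto simp: sums_iff)
  then have "summable (\<lambda>m. norm (a m * 1 ^ m))" by (rule powser_insidea) (use r in simp)
  then have sm: "summable (\<lambda>m. norm (a m))" by simp
  define f where "f = (\<lambda>m t. a m * exp (- Complex 0 t) ^ m)"
  have ul: "uniform_limit {0..2*pi} (\<lambda>n t. \<Sum>m<n. f m t) (\<lambda>t. suminf (\<lambda>m. f m t)) sequentially"
    by (rule Weierstrass_m_test[OF _ sm]) (auto simp: f_def norm_mult norm_power)
  have su: "suminf (\<lambda>m. f m t) = P (exp (- Complex 0 t))" for t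
    using a[of "exp (- Complex 0 t)"] R unfolding f_def by (simp add: sums_iff)
  have bg: "bounded (g ` {0..2*pi})" using compact_continuous_image[OF g] compact_imp_bounded by blast
  have bs: "bounded ((\<lambda>t. suminf (\<lambda>m. f m t)) ` {0..2*pi})"
  proof -
    have "norm (suminf (\<lambda>m. f m t)) \<le> suminf (\<lambda>m. norm (a m))" for t
      by (rule norm_suminf_le[OF _ sm]) (simp add: f_def norm_mult norm_power)
    then show ?thesis by (auto simp: bounded_iff)
  qed
  have ul2: "uniform_limit {0..2*pi} (\<lambda>n t. g t * (\<Sum>m<n. f m t)) (\<lambda>t. g t * P (exp (- Complex 0 t))) sequentially"
    using bounded_bilinear.bounded_uniform_limit[OF bounded_bilinear_mult uniform_limit_const ul bs bg] by (simp add: su)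
  have cf: "continuous_on {0..2*pi} (\<lambda>t. g t * (\<Sum>m<n. f m t))" for n
    unfolding f_def by (intro continuous_intros g)
  obtain I J where I: "\<And>n. ((\<lambda>t. g t * (\<Sum>m<n. f m t)) has_integral I n) {0..2*pi}"
    and J: "((\<lambda>t. g t * P (exp (- Complex 0 t))) has_integral J) {0..2*pi}" and lim: "I \<longlonglongrightarrow> J"
    by (rule uniform_limit_integral[OF ul2 cf trivial_limit_sequentially]) blast
  have "I n = (\<Sum>m<n. a m * integral {0..2*pi} (\<lambda>t. g t * exp (- (of_nat m * Complex 0 t))))" for n
  proof -
    have "((\<lambda>t. \<Sum>m<n. a m * (g t * exp (- (of_nat m * Complex 0 t)))) has_integral
       (\<Sum>m<n. a m * integral {0..2*pi} (\<lambda>t. g t * exp (- (of_nat m * Complex 0 t))))) {0..2*pi}"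
      by (intro has_integral_sum has_integral_mult_right integrable_integral integrable_continuous_real continuous_intros g) auto
    moreover have "(\<Sum>m<n. a m * (g t * exp (- (of_nat m * Complex 0 t)))) = g t * (\<Sum>m<n. f m t)" for t
    proof -
      have "exp (- (of_nat m * Complex 0 t)) = exp (- Complex 0 t) ^ m" for m
        by (metis exp_of_nat_mult mult_minus_right)
      then show ?thesis by (simp add: f_def sum_distrib_left mult_ac)
    qed
    ultimately have "((\<lambda>t. g t * (\<Sum>m<n. f m t)) has_integral
       (\<Sum>m<n. a m * integral {0..2*pi} (\<lambda>t. g t * exp (- (of_nat m * Complex 0 t))))) {0..2*pi}" by (simp only:)
    then show ?thesis using I[of n] has_integral_unique by blast
  qed
  then have "I = (\<lambda>n. \<Sum>m<n. a m * integral {0..2*pi} (\<lambda>t. g t * exp (- (of_nat m * Complex 0 t))))" by (rule ext)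
  then show ?thesis using lim integral_unique[OF J] by (simp only: sums_def)
qed

section \<open>Projection to strictly negative Fourier modes\<close>

definition neg_coeff :: "(complex \<Rightarrow> complex) \<Rightarrow> nat \<Rightarrow> complex"
  where "neg_coeff f m = (if m = 0 then 0 else vline_integral (\<lambda>z. f z * exp (of_nat m * z)) 0 / (2 * of_real pi))"

text \<open>Written as a power series in \<open>X = exp (- z)\<close>, which is
  \<open>1 / \<phi>\<close> on the domain. The zero mode is excluded, and that makes the
  coefficients vanish at infinity.\<close>

definition neg_part :: "(complex \<Rightarrow> complex) \<Rightarrow> complex \<Rightarrow> complex"
  where "neg_part f X = (\<Sum>m. neg_coeff f m * X ^ m)"

text \<open>Shift the line to \<open>- s\<close>, where \<open>exp (m z)\<close> has modulus
  \<open>exp (- s m)\<close>. This decay is what lets the negative part continue to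
  \<open>Re z > - \<delta>\<close>.\<close>

lemma neg_coeff_bound:
  assumes f: "periodic_holomorphic_on f {-\<delta><..<\<delta>}" and s: "0 < s" "s < \<delta>"
  shows "\<exists>C. \<forall>m. norm (neg_coeff f m) \<le> C * exp (- s * real m)"
proof -
  have cont: "continuous_on {0..2*pi} (\<lambda>t. f (Complex (- s) t))"
    using s by (intro continuous_on_vline[OF periodic_holomorphic_onD(2)[OF f]]) auto
  then have "bounded ((\<lambda>t. f (Complex (- s) t)) ` {0..2*pi})" using compact_continuous_image compact_imp_bounded by blast
  then obtain C where C: "\<And>t. t \<in> {0..2*pi} \<Longrightarrow> norm (f (Complex (- s) t)) \<le> C" unfolding bounded_iff by blast
  have C0: "C \<ge> 0" using order_trans[OF norm_ge_zero C[of 0]] by simp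
  have "norm (neg_coeff f m) \<le> C * exp (- s * real m)" for m
  proof (cases "m = 0")
    case False
    have per: "periodic_holomorphic_on (\<lambda>z. f z * exp (of_nat m * z)) {-\<delta><..<\<delta>}"
      by (intro periodic_holomorphic_on_intros(2) f periodic_holomorphic_on_exp_nat)
    have "vline_integral (\<lambda>z. f z * exp (of_nat m * z)) 0 = vline_integral (\<lambda>z. f z * exp (of_nat m * z)) (- s)"
      using s by (intro vline_integral_shift[OF _ _ per]) auto
    also have "norm \<dots> \<le> 2 * pi * (C * exp (- s * real m))"
    proof (rule vline_integral_norm_le)
      show "continuous_on {0..2*pi} (\<lambda>t. f (Complex (- s) t) * exp (of_nat m * Complex (- s) t))"
        by (intro continuous_intros cont)
      fix t assume "t \<in> {0..2*pi}"
      then show "norm (f (Complex (- s) t) * exp (of_nat m * Complex (- s) t)) \<le> C * exp (- s * real m)"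
        using C by (simp add: norm_mult mult.commute mult_right_mono)
    qed
    finally show ?thesis using False by (simp add: neg_coeff_def norm_divide norm_mult field_simps)
  qed (use C0 in \<open>simp add: neg_coeff_def\<close>)
  then show ?thesis by blast
qed

lemma neg_part_sums:
  assumes f: "periodic_holomorphic_on f {-\<delta><..<\<delta>}" and X: "norm X < exp \<delta>" and \<delta>: "\<delta> > 0"
  shows "(\<lambda>m. neg_coeff f m * X ^ m) sums neg_part f X"
proof -
  \<comment> \<open>A radius beyond both \<open>norm X\<close> and 1, so that \<open>ln y\<close> is
    an admissible shift.\<close>
  obtain y where y: "max 1 (norm X) < y" "y < exp \<delta>" using X \<delta> dense[of "max 1 (norm X)" "exp \<delta>"] by auto
  define s where "s = ln y"
  have s: "0 < s" "s < \<delta>" "exp s = y" using y ln_less_cancel_iff[of y "exp \<delta>"] by (auto simp: s_def)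
  obtain C where C: "\<And>m. norm (neg_coeff f m) \<le> C * exp (- s * real m)" using neg_coeff_bound[OF f s(1,2)] by blast
  have C0: "C \<ge> 0" using order_trans[OF norm_ge_zero C[of 0]] by simp
  have "summable (\<lambda>m. C * (norm X / y) ^ m)" using y by (intro summable_mult summable_geometric) auto
  have "norm (neg_coeff f m * X ^ m) \<le> C * (norm X / y) ^ m" for m
  proof -
    have "exp (- s * real m) = (1 / y) ^ m"
      using exp_of_nat_mult[of m "- s"] s(3) by (simp add: exp_minus inverse_eq_divide mult.commute)
    then have "norm (neg_coeff f m * X ^ m) \<le> C * (1 / y) ^ m * norm X ^ m"
      using C[of m] by (simp add: norm_mult norm_power mult_right_mono)
    then show ?thesis by (simp add: power_divide)
  qed
  then have "summable (\<lambda>m. neg_coeff f m * X ^ m)" using \<open>summable (\<lambda>m. C * (norm X / y) ^ m)\<close>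
    by (rule summable_comparison_test'[where N=0, rotated])
  then show ?thesis unfolding neg_part_def by (rule summable_sums)
qed

lemma neg_part_holomorphic:
  assumes f: "periodic_holomorphic_on f {-\<delta><..<\<delta>}" and \<delta>: "\<delta> > 0"
  shows "neg_part f holomorphic_on ball 0 (exp \<delta>)" "neg_part f 0 = 0"
proof -
  show "neg_part f holomorphic_on ball 0 (exp \<delta>)"
    by (rule power_series_holomorphic[of 0 "exp \<delta>" "neg_coeff f"]) (use neg_part_sums[OF f _ \<delta>] in auto)
  have "(\<lambda>m. neg_coeff f m * 0 ^ m) sums neg_coeff f 0" by (rule powser_sums_zero)
  then show "neg_part f 0 = 0" using neg_part_sums[OF f _ \<delta>, of 0] sums_unique2 by (fastforce simp: neg_coeff_def)
qed

lemma vline_integral_exp_int: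
  assumes "n \<noteq> 0" shows "vline_integral (\<lambda>z. exp (of_int n * z)) 0 = 0"
proof -
  have "((\<lambda>t. exp (of_int n * Complex 0 t)) has_integral
      (exp (of_int n * Complex 0 (2*pi)) / (of_int n * \<i>) - exp (of_int n * Complex 0 0) / (of_int n * \<i>))) {0..2*pi}"
  proof (rule fundamental_theorem_of_calculus)
    fix t
    have "((\<lambda>z. exp (of_int n * z) / (of_int n * \<i>)) has_field_derivative exp (of_int n * Complex 0 t) / \<i>) (at (Complex 0 t))"
      using assms by (auto intro!: derivative_eq_intros simp: field_simps)
    from has_vector_derivative_vline(1)[OF this]
    show "((\<lambda>t. exp (of_int n * Complex 0 t) / (of_int n * \<i>)) has_vector_derivative exp (of_int n * Complex 0 t)) (at t within {0..2*pi})"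
      by simp
  qed simp
  moreover have "exp (of_int n * Complex 0 (2*pi)) = 1"
  proof -
    show ?thesis by (subst exp_eq_1) (auto intro!: exI[of _ n])
  qed
  moreover have "Complex 0 0 = 0" by (simp add: complex_eq_iff)
  ultimately show ?thesis unfolding vline_integral_def by (simp add: integral_unique)
qed

text \<open>Integration against \<open>exp (m z)\<close> picks out the mode
  \<open>exp (- m z)\<close>, where \<open>f\<close> and its negative part agree for
  \<open>m > 0\<close>.\<close>

lemma neg_part_moment:
  assumes f: "periodic_holomorphic_on f {-\<delta><..<\<delta>}" and \<delta>: "\<delta> > 0" and m: "m > 0"
  shows "vline_integral (\<lambda>z. (f z - neg_part f (exp (- z))) * exp (of_nat m * z)) 0 = 0"
proof -
  have cf: "continuous_on {0..2*pi} (\<lambda>t. f (Complex 0 t))"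
    using \<delta> by (intro continuous_on_vline[OF periodic_holomorphic_onD(2)[OF f]]) auto
  have cn: "continuous_on {0..2*pi} (\<lambda>t. neg_part f (exp (- Complex 0 t)))"
    using continuous_on_vline[OF periodic_holomorphic_onD(2)[OF periodic_holomorphic_on_compose_exp_minus[of "neg_part f" "- \<delta>"]]]
      neg_part_holomorphic[OF f \<delta>] \<delta> by simp
  have "(\<lambda>j. neg_coeff f j * integral {0..2*pi} (\<lambda>t. exp (of_nat m * Complex 0 t) * exp (- (of_nat j * Complex 0 t)))) sums
     integral {0..2*pi} (\<lambda>t. exp (of_nat m * Complex 0 t) * neg_part f (exp (- Complex 0 t)))"
    by (rule integral_power_series_exp[of "exp \<delta>"]) (use neg_part_sums[OF f _ \<delta>] \<delta> in \<open>auto intro!: continuous_intros\<close>)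
  moreover have "integral {0..2*pi} (\<lambda>t. exp (of_nat m * Complex 0 t) * exp (- (of_nat j * Complex 0 t))) = (if j = m then 2 * of_real pi else 0)" for j
  proof -
    have "integral {0..2*pi} (\<lambda>t. exp (of_nat m * Complex 0 t) * exp (- (of_nat j * Complex 0 t))) = vline_integral (\<lambda>z. exp (of_int (int m - int j) * z)) 0"
      unfolding vline_integral_def by (intro integral_cong) (simp add: exp_add[symmetric] algebra_simps)
    then show ?thesis using vline_integral_exp_int[of "int m - int j"] by (auto simp: vline_integral_def scaleR_conv_of_real)
  qed
  ultimately have s1: "(\<lambda>j. neg_coeff f j * (if j = m then 2 * of_real pi else 0)) sums
     integral {0..2*pi} (\<lambda>t. exp (of_nat m * Complex 0 t) * neg_part f (exp (- Complex 0 t)))" by simp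
  have "(\<lambda>j. neg_coeff f j * (if j = m then 2 * of_real pi else 0)) = (\<lambda>j. if j = m then neg_coeff f m * (2 * of_real pi) else 0)" by auto
  then have "integral {0..2*pi} (\<lambda>t. exp (of_nat m * Complex 0 t) * neg_part f (exp (- Complex 0 t))) = neg_coeff f m * (2 * of_real pi)"
    using s1 sums_single[of m "\<lambda>j. neg_coeff f m * (2 * of_real pi)"] sums_unique2 by (metis (no_types))
  then have "vline_integral (\<lambda>z. neg_part f (exp (- z)) * exp (of_nat m * z)) 0 = vline_integral (\<lambda>z. f z * exp (of_nat m * z)) 0"
    using m by (simp add: vline_integral_def neg_coeff_def mult.commute)
  moreover have "vline_integral (\<lambda>z. (f z - neg_part f (exp (- z))) * exp (of_nat m * z)) 0 =
     vline_integral (\<lambda>z. f z * exp (of_nat m * z)) 0 - vline_integral (\<lambda>z. neg_part f (exp (- z)) * exp (of_nat m * z)) 0"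
    unfolding left_diff_distrib by (rule vline_integral_add(2)) (auto intro!: continuous_intros cf cn)
  ultimately show ?thesis by simp
qed

text \<open>On the axis \<open>cnj (P (exp (- z)))\<close> is a series in \<open>exp (m z)\<close>,
  and \<open>P 0 = 0\<close> leaves only \<open>m > 0\<close>. The integral is conjugated so that
  \<open>P\<close> itself, not its conjugate, is expanded.\<close>

lemma boundary_pairing_zero:
  assumes g: "continuous_on {0..2*pi} (\<lambda>t. g (Complex 0 t))"
    and mom: "\<And>m. m > 0 \<Longrightarrow> vline_integral (\<lambda>z. g z * exp (of_nat m * z)) 0 = 0"
    and P: "P holomorphic_on ball 0 R" "R > 1" "P 0 = 0"
  shows "vline_integral (\<lambda>z. g z * cnj (P (exp (- z)))) 0 = 0"
proof -
  define a where "a = (\<lambda>m. (deriv ^^ m) P 0 / fact m)"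
  have a: "(\<lambda>m. a m * X ^ m) sums P X" if "norm X < R" for X
    using holomorphic_power_series[OF P(1), of X] that by (simp add: a_def)
  have "(\<lambda>m. a m * integral {0..2*pi} (\<lambda>t. cnj (g (Complex 0 t)) * exp (- (of_nat m * Complex 0 t)))) sums
     integral {0..2*pi} (\<lambda>t. cnj (g (Complex 0 t)) * P (exp (- Complex 0 t)))"
    by (rule integral_power_series_exp[OF _ P(2)], erule a, rule continuous_on_cnj[OF g])
  moreover have "a m * integral {0..2*pi} (\<lambda>t. cnj (g (Complex 0 t)) * exp (- (of_nat m * Complex 0 t))) = 0" for m
  proof (cases "m = 0")
    case True
    then show ?thesis using P(3) by (simp add: a_def)
  next
    case False
    have "cnj (exp (of_nat m * Complex 0 t)) = exp (- (of_nat m * Complex 0 t))" for t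
    proof -
      have "cnj (of_nat m * Complex 0 t) = - (of_nat m * Complex 0 t)" by (simp add: complex_eq_iff)
      then show ?thesis by (metis exp_cnj)
    qed
    then have "integral {0..2*pi} (\<lambda>t. cnj (g (Complex 0 t)) * exp (- (of_nat m * Complex 0 t))) =
       integral {0..2*pi} (\<lambda>t. cnj (g (Complex 0 t) * exp (of_nat m * Complex 0 t)))" by simp
    also have "\<dots> = cnj (vline_integral (\<lambda>z. g z * exp (of_nat m * z)) 0)"
      unfolding vline_integral_def by (rule integral_cnj[symmetric])
    finally show ?thesis using mom[of m] False by simp
  qed
  ultimately have "integral {0..2*pi} (\<lambda>t. cnj (g (Complex 0 t)) * P (exp (- Complex 0 t))) = 0"
    using sums_unique2[OF _ sums_zero] by simp
  then have "cnj (integral {0..2*pi} (\<lambda>t. cnj (g (Complex 0 t)) * P (exp (- Complex 0 t)))) = 0" by simp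
  then show ?thesis unfolding vline_integral_def integral_cnj by simp
qed

lemma dseq_funpow_periodic_holomorphic:
  assumes "open I" "\<And>k. periodic_holomorphic_on (f k) I"
  shows "periodic_holomorphic_on ((dseq ^^ l) f k) I"
  by (induction l arbitrary: k) (auto intro: assms dseq_periodic_holomorphic)

text \<open>Each application of \<open>dseq\<close> looks one index ahead. Sequences may therefore
  be truncated without changing the terms that are used.\<close>

lemma dseq_funpow_local:
  assumes "\<And>k. k \<le> j + l \<Longrightarrow> f k = g k"
  shows "(dseq ^^ l) f j = (dseq ^^ l) g j"
  using assms
proof (induction l arbitrary: j)
  case (Suc l)
  have "(dseq ^^ l) f j = (dseq ^^ l) g j" "(dseq ^^ l) f (j + 1) = (dseq ^^ l) g (j + 1)"
    by (rule Suc.IH; rule Suc.prems; simp)+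
  then show ?case by (simp add: dseq_def[abs_def])
qed simp

text \<open>Integration by parts turns the pairing of the ansatz with a polynomial of lower degree into
  boundary integrals over the axis, ordered by powers of \<open>1/N\<close>. The recursion makes the strictly
  negative Fourier modes of the \<open>n\<close>-th one vanish, which are the only ones seen by such polynomials.\<close>

function expansion_coeff :: "(nat \<Rightarrow> complex \<Rightarrow> complex) \<Rightarrow> nat \<Rightarrow> complex \<Rightarrow> complex" where
  "expansion_coeff h n = (if n = 0 then (\<lambda>X. 1) else
     (\<lambda>X. - neg_part (\<lambda>z. exp (- z) * (\<Sum>l\<in>{1..n}. (- 1) ^ l *
        (dseq ^^ l) (\<lambda>k z. exp z * expansion_coeff h (n - l) (exp (- z)) * h k z) 0 z)) X))"
  by auto
termination by (relation "Wellfounded.measure snd") auto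

declare expansion_coeff.simps [simp del]

lemma expansion_coeff_0: "expansion_coeff h 0 = (\<lambda>X. 1)"
  by (simp add: expansion_coeff.simps)

text \<open>The factor \<open>exp z\<close> completes \<open>exp (N z)\<close> to the
  \<open>exp ((N + 1) z)\<close> of \<open>strip_main\<close>.\<close>

definition coeff_seq :: "(nat \<Rightarrow> complex \<Rightarrow> complex) \<Rightarrow> nat \<Rightarrow> nat \<Rightarrow> complex \<Rightarrow> complex"
  where "coeff_seq h j k z = exp z * expansion_coeff h j (exp (- z)) * h k z"

context
  fixes \<delta> :: real and h :: "nat \<Rightarrow> complex \<Rightarrow> complex"
  assumes \<delta>: "\<delta> > 0" and h: "\<And>k. periodic_holomorphic_on (h k) {-\<delta><..<\<delta>}"
    and h0: "\<And>z. z \<in> vstrip {-\<delta><..<\<delta>} \<Longrightarrow> h 0 z = 1"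
begin

lemma coeff_seq_periodic_holomorphic:
  assumes "expansion_coeff h j holomorphic_on ball 0 (exp \<delta>)"
  shows "periodic_holomorphic_on (coeff_seq h j k) {-\<delta><..<\<delta>}"
proof -
  have "periodic_holomorphic_on (\<lambda>z. expansion_coeff h j (exp (- z))) {-\<delta><..}"
    using periodic_holomorphic_on_compose_exp_minus[of _ "- \<delta>"] assms by simp
  then have "periodic_holomorphic_on (\<lambda>z. expansion_coeff h j (exp (- z))) {-\<delta><..<\<delta>}"
    by (rule periodic_holomorphic_on_subset) auto
  then show ?thesis
    unfolding coeff_seq_def[abs_def]
    by (intro periodic_holomorphic_on_intros(2) h periodic_holomorphic_on_exp)
qed

text \<open>What the earlier coefficients contribute to the boundary term of order \<open>n\<close>,
  freed from the common factor \<open>exp z\<close>.\<close>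

definition rhs :: "nat \<Rightarrow> complex \<Rightarrow> complex"
  where "rhs n z = exp (- z) * (\<Sum>l\<in>{1..n}. (- 1) ^ l * (dseq ^^ l) (coeff_seq h (n - l)) 0 z)"

lemma expansion_coeff_Suc: "n > 0 \<Longrightarrow> expansion_coeff h n = (\<lambda>X. - neg_part (rhs n) X)"
  by (subst expansion_coeff.simps) (simp add: rhs_def[abs_def] coeff_seq_def[abs_def])

lemma expansion_coeff_holomorphic: "expansion_coeff h n holomorphic_on ball 0 (exp \<delta>)"
  and rhs_periodic_holomorphic: "periodic_holomorphic_on (rhs n) {-\<delta><..<\<delta>}"
proof -
  have rhs: "periodic_holomorphic_on (rhs n) {-\<delta><..<\<delta>}"
    if "\<And>j. j < n \<Longrightarrow> expansion_coeff h j holomorphic_on ball 0 (exp \<delta>)" for n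
    unfolding rhs_def[abs_def]
    by (intro periodic_holomorphic_on_intros(2) periodic_holomorphic_on_sum periodic_holomorphic_on_exp
        dseq_funpow_periodic_holomorphic coeff_seq_periodic_holomorphic that
        periodic_holomorphic_on_intros(5)[OF h[of 0] h[of 0]]) auto
  have *: "expansion_coeff h n holomorphic_on ball 0 (exp \<delta>)" for n
  proof (induction n rule: less_induct)
    case (less n)
    show ?case
    proof (cases "n = 0")
      case False
      then show ?thesis
        using neg_part_holomorphic(1)[OF rhs[OF less] \<delta>]
        by (simp add: expansion_coeff_Suc holomorphic_on_minus)
    qed (simp add: expansion_coeff_0)
  qed
  then show "expansion_coeff h n holomorphic_on ball 0 (exp \<delta>)" .
  show "periodic_holomorphic_on (rhs n) {-\<delta><..<\<delta>}" by (rule rhs) (rule *)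
qed

lemma expansion_coeff_at_0: "n > 0 \<Longrightarrow> expansion_coeff h n 0 = 0"
  using neg_part_holomorphic(2)[OF rhs_periodic_holomorphic \<delta>] by (simp add: expansion_coeff_Suc)

lemma coeff_seq_per: "periodic_holomorphic_on (coeff_seq h j k) {-\<delta><..<\<delta>}"
  by (rule coeff_seq_periodic_holomorphic[OF expansion_coeff_holomorphic])

text \<open>On the axis the three exponentials multiply to 1, and the boundary term becomes the
  pairing of \<open>g\<close> with \<open>P\<close>. By the recursion \<open>g\<close> has no
  strictly negative modes, and \<open>P\<close> pairs with no others.\<close>

lemma coeff_seq_cancellation:
  assumes P: "P holomorphic_on ball 0 R" "R > 1" "P 0 = 0"
  shows "vline_integral (\<lambda>z. exp (of_nat N * z) * (\<Sum>l\<le>n. (- 1) ^ l * (dseq ^^ l) (coeff_seq h (n - l)) 0 z) *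
     cnj (exp (of_nat (N + 1) * z) * P (exp (- z)))) 0 = 0"
proof -
  \<comment> \<open>The new coefficient stands here with factor 1 because it is multiplied by
    \<open>h 0\<close>, which is 1.\<close>
  define g where "g = (\<lambda>z. rhs n z + expansion_coeff h n (exp (- z)))"
  have ce: "periodic_holomorphic_on (\<lambda>z. expansion_coeff h n (exp (- z))) {-\<delta><..<\<delta>}"
    by (rule periodic_holomorphic_on_subset[OF periodic_holomorphic_on_compose_exp_minus[of _ "- \<delta>"]])
      (use expansion_coeff_holomorphic in auto)
  have pg: "periodic_holomorphic_on g {-\<delta><..<\<delta>}"
    unfolding g_def by (intro periodic_holomorphic_on_intros(1) rhs_periodic_holomorphic ce)
  have mom: "vline_integral (\<lambda>z. g z * exp (of_nat m * z)) 0 = 0" if "m > 0" for m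
  proof (cases "n = 0")
    case True
    then have "g = (\<lambda>z. 1)" by (simp add: g_def rhs_def expansion_coeff_0)
    then show ?thesis using vline_integral_exp_int[of "int m"] that by simp
  next
    case False
    then show ?thesis using neg_part_moment[OF rhs_periodic_holomorphic[of n] \<delta> that]
      by (simp add: g_def expansion_coeff_Suc)
  qed
  have "vline_integral (\<lambda>z. g z * cnj (P (exp (- z)))) 0 = 0"
    using \<delta> by (intro boundary_pairing_zero[OF _ mom P] continuous_on_vline[OF periodic_holomorphic_onD(2)[OF pg]]) auto
  moreover have "exp (of_nat N * z) * (\<Sum>l\<le>n. (- 1) ^ l * (dseq ^^ l) (coeff_seq h (n - l)) 0 z) *
     cnj (exp (of_nat (N + 1) * z) * P (exp (- z))) = g z * cnj (P (exp (- z)))" if z: "Re z = 0" for z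
  proof -
    have "z \<in> vstrip {-\<delta><..<\<delta>}" using z \<delta> by (simp add: vstrip_def)
    have "{..n} = insert 0 {1..n}" by auto
    then have "(\<Sum>l\<le>n. (- 1) ^ l * (dseq ^^ l) (coeff_seq h (n - l)) 0 z) =
        coeff_seq h n 0 z + (\<Sum>l\<in>{1..n}. (- 1) ^ l * (dseq ^^ l) (coeff_seq h (n - l)) 0 z)" by simp
    also have "\<dots> = exp z * g z"
      using h0[OF \<open>z \<in> _\<close>] by (simp add: g_def rhs_def coeff_seq_def exp_minus algebra_simps)
    finally have 1: "(\<Sum>l\<le>n. (- 1) ^ l * (dseq ^^ l) (coeff_seq h (n - l)) 0 z) = exp z * g z" .
    have "cnj z = - z" using z by (simp add: complex_eq_iff)
    then have 2: "cnj (exp (of_nat (N + 1) * z)) = exp (- (of_nat (N + 1) * z))" by (simp add: exp_cnj)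
    have "exp (of_nat N * z) * exp z * exp (- (of_nat (N + 1) * z)) = 1"
      unfolding exp_add[symmetric] by (simp add: algebra_simps)
    then have "exp (of_nat N * z) * exp z * exp (- (of_nat (N + 1) * z)) * (g z * cnj (P (exp (- z)))) = g z * cnj (P (exp (- z)))" by simp
    then show ?thesis unfolding 1 complex_cnj_mult 2 by (simp only: mult_ac)
  qed
  then have "vline_integral (\<lambda>z. exp (of_nat N * z) * (\<Sum>l\<le>n. (- 1) ^ l * (dseq ^^ l) (coeff_seq h (n - l)) 0 z) *
     cnj (exp (of_nat (N + 1) * z) * P (exp (- z)))) 0 = vline_integral (\<lambda>z. g z * cnj (P (exp (- z)))) 0"
    by (rule vline_integral_cong)
  ultimately show ?thesis by simp
qed

end

section \<open>Bounds for the remainders of integration by parts\<close>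

lemma vline_pair_norm_le:
  assumes "continuous_on {0..2*pi} (\<lambda>t. e (Complex x t))" "continuous_on {0..2*pi} (\<lambda>t. q (Complex x t))"
    and B: "\<And>t. t \<in> {0..2*pi} \<Longrightarrow> norm (e (Complex x t)) \<le> B"
  shows "norm (vline_integral (\<lambda>z. e z * cnj (q z)) x) \<le> B * integral {0..2*pi} (\<lambda>t. norm (q (Complex x t)))"
proof -
  have "norm (vline_integral (\<lambda>z. e z * cnj (q z)) x) \<le> integral {0..2*pi} (\<lambda>t. B * norm (q (Complex x t)))"
    unfolding vline_integral_def
    by (rule integral_norm_bound_integral)
      (use B in \<open>auto intro!: integrable_continuous_real continuous_intros assms(1,2) mult_right_mono simp: norm_mult\<close>)
  then show ?thesis by simp
qed

lemma vstrip_sup_bound: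
  fixes g :: "complex \<Rightarrow> complex"
  assumes "continuous_on (vstrip I) g" "{-c..0} \<subseteq> I"
  obtains B where "B \<ge> 0" "\<And>x t. x \<in> {-c..0} \<Longrightarrow> t \<in> {0..2*pi} \<Longrightarrow> norm (g (Complex x t)) \<le> B"
proof -
  have "compact ((\<lambda>(x, t). g (Complex x t)) ` ({-c..0} \<times> {0..2*pi}))"
    using continuous_on_vstrip_pair[OF assms] by (intro compact_continuous_image compact_Times) auto
  from compact_imp_bounded[OF this]
  obtain B where B: "\<And>p. p \<in> (\<lambda>(x, t). g (Complex x t)) ` ({-c..0} \<times> {0..2*pi}) \<Longrightarrow> norm p \<le> B"
    unfolding bounded_iff by blast
  show ?thesis
    by (rule that[of "max B 0"]) (use B in \<open>force intro: order_trans[of _ B]\<close>)+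
qed

text \<open>One term of the exponential series. It turns exponential smallness, and powers of
  \<open>Re z\<close> next to \<open>exp (N * Re z)\<close>, into powers of
  \<open>1/N\<close>.\<close>

lemma exp_minus_power_le:
  assumes "N > 0" "y \<ge> 0"
  shows "exp (- (real N * y)) * y ^ k \<le> fact k / real N ^ k"
proof -
  have "(real N * y) ^ k /\<^sub>R fact k \<le> exp (real N * y)"
    using sum_le_suminf[OF summable_exp_generic, of "{k}" "real N * y"] assms by (simp add: exp_def)
  then have "(real N * y) ^ k \<le> fact k * exp (real N * y)" by (simp add: field_simps)
  then have "real N ^ k * (exp (- (real N * y)) * y ^ k) \<le> fact k"
    by (simp add: exp_minus power_mult_distrib field_simps)
  then show ?thesis using assms by (simp add: field_simps)
qed

text \<open>The shape, in the strip coordinate, of a polynomial of degree less than \<open>N\<close> times the derivative of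
  the chart and an outer function; then \<open>P\<close> vanishes at \<open>0\<close>.\<close>

definition transplant :: "nat \<Rightarrow> (complex \<Rightarrow> complex) \<Rightarrow> complex \<Rightarrow> complex"
  where "transplant N P z = exp (of_nat (N + 1) * z) * P (exp (- z))"

definition strip_L1 :: "real \<Rightarrow> (complex \<Rightarrow> complex) \<Rightarrow> real"
  where "strip_L1 c q = integral {-c..0} (\<lambda>x. integral {0..2*pi} (\<lambda>t. norm (q (Complex x t))))"

lemma transplant_periodic_holomorphic:
  assumes "P holomorphic_on ball 0 (exp \<delta>)"
  shows "periodic_holomorphic_on (transplant N P) {-\<delta><..}"
  unfolding transplant_def[abs_def]
  using periodic_holomorphic_on_compose_exp_minus[of P "- \<delta>"] assms
  by (intro periodic_holomorphic_on_intros(2) periodic_holomorphic_on_exp_nat) auto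

lemma strip_L1_mono:
  assumes q: "continuous_on (vstrip I) q" and I: "{-c'..0} \<subseteq> I" and x: "- c' \<le> x1" "x2 \<le> 0"
  shows "integral {x1..x2} (\<lambda>x. integral {0..2*pi} (\<lambda>t. norm (q (Complex x t)))) \<le> strip_L1 c' q"
proof -
  have "continuous_on {-c'..0} (\<lambda>x. integral {0..2*pi} (\<lambda>t. norm (q (Complex x t))))"
    by (rule vline_norm_integral_continuous[OF q I])
  then have i: "(\<lambda>x. integral {0..2*pi} (\<lambda>t. norm (q (Complex x t)))) integrable_on {-c'..0}"
    "(\<lambda>x. integral {0..2*pi} (\<lambda>t. norm (q (Complex x t)))) integrable_on {x1..x2}"
    using x by (auto intro!: integrable_continuous_real intro: continuous_on_subset)
  have nn: "0 \<le> integral {0..2*pi} (\<lambda>t. norm (q (Complex x t)))" if "x \<in> {-c'..0}" for x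
  proof -
    have "continuous_on {0..2*pi} (\<lambda>t. q (Complex x t))" using I that by (intro continuous_on_vline[OF q]) auto
    then show ?thesis
      by (intro integral_nonneg integrable_continuous_real continuous_intros) auto
  qed
  show ?thesis unfolding strip_L1_def by (rule integral_subset_le[OF _ i(2,1)]) (use nn x in auto)
qed

lemma strip_L1_nonneg:
  assumes q: "continuous_on (vstrip I) q" and I: "{-c'..0} \<subseteq> I"
  shows "0 \<le> strip_L1 c' q"
  using strip_L1_mono[OF q I, of 1 0] by (cases "c' \<ge> 0") (auto simp: strip_L1_def)

text \<open>The exponential factor has modulus at least \<open>exp ((N + 1) * x1)\<close> on the
  averaging window, so it can be divided out before the averaged Cauchy formula is applied to
  \<open>P\<close>.\<close>

lemma transplant_norm_le:
  assumes P: "P holomorphic_on ball 0 (exp \<delta>)" and x: "- \<delta> < - c'" "- c' \<le> x1" "x1 < x2" "x2 < y" "y \<le> Re z" "x2 \<le> 0"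
  shows "norm (P (exp (- z))) * (2 * pi * (x2 - x1) * (1 - exp (x2 - y))) \<le> exp (- real (N + 1) * x1) * strip_L1 c' (transplant N P)"
proof -
  note cont = periodic_holomorphic_onD(2)[OF transplant_periodic_holomorphic[OF P, of N]]
  have contP: "continuous_on (vstrip {-\<delta><..}) (\<lambda>z. P (exp (- z)))"
    using periodic_holomorphic_onD(2)[OF periodic_holomorphic_on_compose_exp_minus[of P "- \<delta>"]] P by simp
  have sub: "{x1..x2} \<subseteq> {-\<delta><..}" "{-c'..0} \<subseteq> {-\<delta><..}" using x by auto
  have "norm (P (exp (- z))) * (2 * pi * (x2 - x1) * (1 - exp (x2 - y)))
     \<le> integral {x1..x2} (\<lambda>x. integral {0..2*pi} (\<lambda>t. norm (P (exp (- Complex x t)))))"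
    using P x by (intro norm_le_vstrip_average[of _ "- \<delta>"]) auto
  also have "\<dots> \<le> integral {x1..x2} (\<lambda>x. exp (- real (N + 1) * x1) * integral {0..2*pi} (\<lambda>t. norm (transplant N P (Complex x t))))"
  proof (rule integral_le)
    show "(\<lambda>x. integral {0..2*pi} (\<lambda>t. norm (P (exp (- Complex x t))))) integrable_on {x1..x2}"
      by (intro integrable_continuous_real vline_norm_integral_continuous[OF contP sub(1)])
    show "(\<lambda>x. exp (- real (N + 1) * x1) * integral {0..2*pi} (\<lambda>t. norm (transplant N P (Complex x t)))) integrable_on {x1..x2}"
      by (intro integrable_continuous_real continuous_intros vline_norm_integral_continuous[OF cont sub(1)])
    fix x' assume x': "x' \<in> {x1..x2}"
    then have xI: "x' \<in> {-\<delta><..}" using sub by auto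
    have "integral {0..2*pi} (\<lambda>t. norm (P (exp (- Complex x' t)))) \<le> integral {0..2*pi} (\<lambda>t. exp (- real (N + 1) * x1) * norm (transplant N P (Complex x' t)))"
    proof (rule integral_le)
      show "(\<lambda>t. norm (P (exp (- Complex x' t)))) integrable_on {0..2*pi}"
        "(\<lambda>t. exp (- real (N + 1) * x1) * norm (transplant N P (Complex x' t))) integrable_on {0..2*pi}"
        using continuous_on_vline[OF contP xI] continuous_on_vline[OF cont xI]
        by (auto intro!: integrable_continuous_real continuous_intros)
      fix t
      have "real (N + 1) * x1 \<le> real (N + 1) * x'" using x' by (intro mult_left_mono) auto
      then have "0 \<le> - real (N + 1) * x1 + real (N + 1) * x'" by linarith
      then have "1 \<le> exp (- real (N + 1) * x1) * exp (real (N + 1) * x')" unfolding exp_add[symmetric]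
        by (simp only: one_le_exp_iff)
      then have "norm (P (exp (- Complex x' t))) * 1 \<le> norm (P (exp (- Complex x' t))) * (exp (- real (N + 1) * x1) * exp (real (N + 1) * x'))"
        by (intro mult_left_mono) auto
      then show "norm (P (exp (- Complex x' t))) \<le> exp (- real (N + 1) * x1) * norm (transplant N P (Complex x' t))"
        by (simp add: transplant_def norm_mult mult_ac)
    qed
    then show "integral {0..2*pi} (\<lambda>t. norm (P (exp (- Complex x' t)))) \<le> exp (- real (N + 1) * x1) * integral {0..2*pi} (\<lambda>t. norm (transplant N P (Complex x' t)))"
      by simp
  qed
  also have "\<dots> = exp (- real (N + 1) * x1) * integral {x1..x2} (\<lambda>x. integral {0..2*pi} (\<lambda>t. norm (transplant N P (Complex x t))))"
    by simp
  also have "\<dots> \<le> exp (- real (N + 1) * x1) * strip_L1 c' (transplant N P)"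
    using x by (intro mult_left_mono strip_L1_mono[OF cont sub(2)]) auto
  finally show ?thesis .
qed

text \<open>The window for the averaging lies between \<open>- c'\<close> and \<open>- c\<close>;
  comparing the exponential at \<open>- c\<close> with its value at \<open>- c'\<close> costs
  \<open>exp (N * (c' - c))\<close>.\<close>

lemma transplant_inner_bound:
  assumes c: "0 < c" "c < c'" "c' < \<delta>"
  obtains C where "C \<ge> 0" "\<And>N P t. P holomorphic_on ball 0 (exp \<delta>) \<Longrightarrow>
    norm (transplant N P (Complex (- c) t)) \<le> C * exp (real N * (c' - c)) * strip_L1 c' (transplant N P)"
proof -
  \<comment> \<open>The midpoint keeps a fixed distance from \<open>- c\<close>, so the constant
    \<open>k\<close> is positive and independent of \<open>N\<close>.\<close>
  define x2 where "x2 = - (c + c') / 2"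
  define k where "k = 2 * pi * (x2 - (- c')) * (1 - exp (x2 - (- c)))"
  have "x2 - (- c') > 0" "x2 - (- c) < 0" using c by (auto simp: x2_def field_simps)
  then have k: "k > 0" unfolding k_def by (intro mult_pos_pos) auto
  have "norm (transplant N P (Complex (- c) t)) \<le> (exp (c' - c) / k) * exp (real N * (c' - c)) * strip_L1 c' (transplant N P)"
    if P: "P holomorphic_on ball 0 (exp \<delta>)" for N P t
  proof -
    have "norm (P (exp (- Complex (- c) t))) * k \<le> exp (- real (N + 1) * - c') * strip_L1 c' (transplant N P)"
      unfolding k_def using c by (intro transplant_norm_le[OF P]) (auto simp: x2_def)
    then have "norm (P (exp (- Complex (- c) t))) \<le> exp (real (N + 1) * c') * strip_L1 c' (transplant N P) / k"
      using k by (simp add: field_simps)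
    then have "exp (- real (N + 1) * c) * norm (P (exp (- Complex (- c) t))) \<le>
      exp (- real (N + 1) * c) * (exp (real (N + 1) * c') * strip_L1 c' (transplant N P) / k)"
      by (intro mult_left_mono) auto
    also have "\<dots> = (exp (- real (N + 1) * c) * exp (real (N + 1) * c')) / k * strip_L1 c' (transplant N P)" by simp
    also have "exp (- real (N + 1) * c) * exp (real (N + 1) * c') = exp (c' - c) * exp (real N * (c' - c))"
      unfolding exp_add[symmetric] by (simp add: algebra_simps)
    finally have le: "exp (- real (N + 1) * c) * norm (P (exp (- Complex (- c) t))) \<le>
       exp (c' - c) * exp (real N * (c' - c)) / k * strip_L1 c' (transplant N P)" .
    have "norm (transplant N P (Complex (- c) t)) = exp (- real (N + 1) * c) * norm (P (exp (- Complex (- c) t)))"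
      by (simp add: transplant_def norm_mult algebra_simps)
    then show ?thesis using le by simp
  qed
  then show ?thesis using k by (intro that[of "exp (c' - c) / k"]) auto
qed

text \<open>The constant is independent of \<open>N\<close> because \<open>exp (N z)\<close> has
  modulus at most 1 for \<open>Re z \<le> 0\<close>.\<close>

lemma osc_integral_norm_le:
  assumes g: "\<And>k. periodic_holomorphic_on (g k) I" and c: "0 \<le> c" "c \<le> c'" "{-c'..0} \<subseteq> I"
  obtains C where "C \<ge> 0" "\<And>N q. periodic_holomorphic_on q I \<Longrightarrow> norm (osc_integral K N c q g) \<le> C * strip_L1 c' q"
proof -
  have sub: "{-c..0} \<subseteq> I" using c by auto
  have "\<exists>B. B \<ge> 0 \<and> (\<forall>x\<in>{-c..0}. \<forall>t\<in>{0..2*pi}. norm (g k (Complex x t)) \<le> B)" for k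
    using vstrip_sup_bound[OF periodic_holomorphic_onD(2)[OF g[of k]] sub] by metis
  then obtain B where B: "\<And>k. B k \<ge> 0" "\<And>k x t. x \<in> {-c..0} \<Longrightarrow> t \<in> {0..2*pi} \<Longrightarrow> norm (g k (Complex x t)) \<le> B k"
    by metis
  have "norm (osc_integral K N c q g) \<le> (\<Sum>k<K. (2 * c) ^ k * B k) * strip_L1 c' q"
    if q: "periodic_holomorphic_on q I" for N q
  proof -
    have contq: "continuous_on (vstrip I) q" using periodic_holomorphic_onD(2)[OF q] .
    have contg: "continuous_on (vstrip I) (\<lambda>z. exp (of_nat N * z) * g k z)" for k
      by (intro continuous_intros periodic_holomorphic_onD(2)[OF g])
    have cm: "continuous_on {-c..0} (vline_integral (\<lambda>z. exp (of_nat N * z) * g k z * cnj (q z)))" for k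
      by (rule vline_integral_continuous[of I, OF _ sub]) (rule continuous_on_mult[OF contg continuous_on_cnj[OF contq]])
    have cn: "continuous_on {-c..0} (\<lambda>x. integral {0..2*pi} (\<lambda>t. norm (q (Complex x t))))"
      by (rule vline_norm_integral_continuous[OF contq sub])
    have "norm (integral {-c..0} (\<lambda>x. of_real ((2 * x) ^ k) * vline_integral (\<lambda>z. exp (of_nat N * z) * g k z * cnj (q z)) x))
       \<le> (2 * c) ^ k * B k * strip_L1 c' q" for k
    proof -
      have "norm (integral {-c..0} (\<lambda>x. of_real ((2 * x) ^ k) * vline_integral (\<lambda>z. exp (of_nat N * z) * g k z * cnj (q z)) x))
        \<le> integral {-c..0} (\<lambda>x. ((2 * c) ^ k * B k) * integral {0..2*pi} (\<lambda>t. norm (q (Complex x t))))"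
      proof (rule integral_norm_bound_integral)
        show "(\<lambda>x. of_real ((2 * x) ^ k) * vline_integral (\<lambda>z. exp (of_nat N * z) * g k z * cnj (q z)) x) integrable_on {-c..0}"
          by (intro integrable_continuous_real continuous_intros cm)
        show "(\<lambda>x. ((2 * c) ^ k * B k) * integral {0..2*pi} (\<lambda>t. norm (q (Complex x t)))) integrable_on {-c..0}"
          by (intro integrable_continuous_real continuous_intros cn)
        fix x assume x: "x \<in> {-c..0}"
        then have xI: "x \<in> I" using sub by auto
        have "norm (vline_integral (\<lambda>z. exp (of_nat N * z) * g k z * cnj (q z)) x) \<le> B k * integral {0..2*pi} (\<lambda>t. norm (q (Complex x t)))"
        proof (rule vline_pair_norm_le)
          fix t assume t: "t \<in> {0..2*pi}"
          have "real N * x \<le> 0" using x by (simp add: mult_nonneg_nonpos)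
          then have "exp (real N * x) \<le> 1" by simp
          then have "exp (real N * x) * norm (g k (Complex x t)) \<le> 1 * B k" using B(2)[OF x t] by (intro mult_mono) auto
          then show "norm (exp (of_nat N * Complex x t) * g k (Complex x t)) \<le> B k" by (simp add: norm_mult)
        qed (use continuous_on_vline[OF contg xI] continuous_on_vline[OF contq xI] in auto)
        moreover have "norm (complex_of_real ((2 * x) ^ k)) \<le> (2 * c) ^ k"
        proof -
          have "\<bar>2 * x\<bar> ^ k \<le> (2 * c) ^ k" using x by (intro power_mono) auto
          then show ?thesis by (simp only: norm_of_real power_abs)
        qed
        ultimately show "norm (of_real ((2 * x) ^ k) * vline_integral (\<lambda>z. exp (of_nat N * z) * g k z * cnj (q z)) x)
            \<le> (2 * c) ^ k * B k * integral {0..2*pi} (\<lambda>t. norm (q (Complex x t)))"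
          unfolding norm_mult using c(1) by (subst mult.assoc) (intro mult_mono, auto)
      qed
      also have "\<dots> = (2 * c) ^ k * B k * integral {-c..0} (\<lambda>x. integral {0..2*pi} (\<lambda>t. norm (q (Complex x t))))" by simp
      also have "\<dots> \<le> (2 * c) ^ k * B k * strip_L1 c' q"
        using c B(1) by (intro mult_left_mono strip_L1_mono[OF contq c(3)]) auto
      finally show ?thesis .
    qed
    then show ?thesis
      unfolding osc_integral_def sum_distrib_right by (intro sum_norm_le) auto
  qed
  then show ?thesis using B(1) c(1) by (intro that[of "\<Sum>k<K. (2 * c) ^ k * B k"]) (auto intro!: sum_nonneg)
qed

text \<open>The gain \<open>exp (- N c)\<close> on the inner edge against the loss
  \<open>exp (N (c' - c))\<close> of the previous estimate leaves
  \<open>exp (- N (2 c - c'))\<close>.\<close>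

lemma inner_term_norm_le:
  assumes g: "\<And>k. periodic_holomorphic_on (g k) {-\<delta><..<\<delta>}" and c: "0 < c" "c < c'" "c' < \<delta>"
  obtains C where "C \<ge> 0" "\<And>N P. P holomorphic_on ball 0 (exp \<delta>) \<Longrightarrow>
     norm (inner_term K N c (transplant N P) g) \<le> C * exp (- (real N * (2 * c - c'))) * strip_L1 c' (transplant N P)"
proof -
  have sub: "{-c..0} \<subseteq> {-\<delta><..<\<delta>}" "{-c'..0} \<subseteq> {-\<delta><..}" using c by auto
  obtain C where C: "C \<ge> 0" "\<And>N P t. P holomorphic_on ball 0 (exp \<delta>) \<Longrightarrow>
    norm (transplant N P (Complex (- c) t)) \<le> C * exp (real N * (c' - c)) * strip_L1 c' (transplant N P)"
    using transplant_inner_bound[OF c] by blast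
  have "\<exists>B. B \<ge> 0 \<and> (\<forall>x\<in>{-c..0}. \<forall>t\<in>{0..2*pi}. norm (g k (Complex x t)) \<le> B)" for k
    using vstrip_sup_bound[OF periodic_holomorphic_onD(2)[OF g[of k]] sub(1)] by metis
  then obtain B where B: "\<And>k. B k \<ge> 0" "\<And>k x t. x \<in> {-c..0} \<Longrightarrow> t \<in> {0..2*pi} \<Longrightarrow> norm (g k (Complex x t)) \<le> B k"
    by metis
  have "norm (inner_term K N c (transplant N P) g) \<le> (\<Sum>k<K. (2 * c) ^ k * B k * (2 * pi * C)) * exp (- (real N * (2 * c - c'))) * strip_L1 c' (transplant N P)"
    if P: "P holomorphic_on ball 0 (exp \<delta>)" for N P
  proof -
    let ?q = "transplant N P"
    note contq = periodic_holomorphic_onD(2)[OF transplant_periodic_holomorphic[OF P, of N]]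
    have L: "strip_L1 c' ?q \<ge> 0" by (rule strip_L1_nonneg[OF contq sub(2)])
    have cq: "continuous_on {0..2*pi} (\<lambda>t. ?q (Complex (- c) t))" using c by (intro continuous_on_vline[OF contq]) auto
    have cg: "continuous_on {0..2*pi} (\<lambda>t. g k (Complex (- c) t))" for k
      using c by (intro continuous_on_vline[OF periodic_holomorphic_onD(2)[OF g]]) auto
    have iq: "integral {0..2*pi} (\<lambda>t. norm (?q (Complex (- c) t))) \<le> 2 * pi * (C * exp (real N * (c' - c)) * strip_L1 c' ?q)"
    proof -
      have "integral {0..2*pi} (\<lambda>t. norm (?q (Complex (- c) t))) \<le> integral {0..2*pi} (\<lambda>t. C * exp (real N * (c' - c)) * strip_L1 c' ?q)"
        by (intro integral_le integrable_continuous_real continuous_intros cq C(2)[OF P])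
      then show ?thesis by (simp add: mult_ac)
    qed
    have "norm (of_real ((2 * (- c)) ^ k) * vline_integral (\<lambda>z. exp (of_nat N * z) * g k z * cnj (?q z)) (- c))
       \<le> (2 * c) ^ k * B k * (2 * pi * C) * exp (- (real N * (2 * c - c'))) * strip_L1 c' ?q" for k
    proof -
      have "norm (vline_integral (\<lambda>z. exp (of_nat N * z) * g k z * cnj (?q z)) (- c)) \<le>
          (exp (- (real N * c)) * B k) * integral {0..2*pi} (\<lambda>t. norm (?q (Complex (- c) t)))"
      proof (rule vline_pair_norm_le)
        fix t assume "t \<in> {0..2*pi}"
        then show "norm (exp (of_nat N * Complex (- c) t) * g k (Complex (- c) t)) \<le> exp (- (real N * c)) * B k"
          using B(2)[of "- c" t k] c by (simp add: norm_mult)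
      qed (auto intro!: continuous_intros cq cg)
      also have "\<dots> \<le> (exp (- (real N * c)) * B k) * (2 * pi * (C * exp (real N * (c' - c)) * strip_L1 c' ?q))"
        using B(1) by (intro mult_left_mono iq) auto
      also have "\<dots> = B k * (2 * pi * C) * (exp (- (real N * c)) * exp (real N * (c' - c))) * strip_L1 c' ?q" by simp
      also have "exp (- (real N * c)) * exp (real N * (c' - c)) = exp (- (real N * (2 * c - c')))"
        unfolding exp_add[symmetric] by (simp add: algebra_simps)
      finally have 1: "norm (vline_integral (\<lambda>z. exp (of_nat N * z) * g k z * cnj (?q z)) (- c)) \<le>
         B k * (2 * pi * C) * exp (- (real N * (2 * c - c'))) * strip_L1 c' ?q" .
      have "norm (complex_of_real ((2 * (- c)) ^ k)) = (2 * c) ^ k" using c by (simp add: norm_power norm_mult power_mult_distrib)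
      then show ?thesis unfolding norm_mult
        using mult_left_mono[OF 1, of "(2 * c) ^ k"] c by (simp add: mult_ac)
    qed
    then show ?thesis
      unfolding inner_term_def sum_distrib_right by (intro sum_norm_le) auto
  qed
  then show ?thesis using B(1) c C(1) by (intro that[of "\<Sum>k<K. (2 * c) ^ k * B k * (2 * pi * C)"]) (auto intro!: sum_nonneg mult_nonneg_nonneg)
qed

text \<open>Collects the boundary terms by total order \<open>n = j + l\<close>, the form in which
  they cancel.\<close>

lemma sum_triangle:
  fixes G :: "nat \<Rightarrow> nat \<Rightarrow> complex"
  shows "(\<Sum>j\<le>M. \<Sum>l<Suc M - j. G j l) = (\<Sum>n\<le>M. \<Sum>l\<le>n. G (n - l) l)"
proof (induction M)
  case (Suc M)
  have "(\<Sum>j\<le>Suc M. \<Sum>l<Suc (Suc M) - j. G j l) = (\<Sum>j\<le>M. (\<Sum>l<Suc M - j. G j l) + G j (Suc M - j)) + G (Suc M) 0"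
    by (simp add: Suc_diff_le)
  also have "\<dots> = (\<Sum>n\<le>M. \<Sum>l\<le>n. G (n - l) l) + (\<Sum>j\<le>Suc M. G j (Suc M - j))"
    by (simp add: sum.distrib Suc.IH)
  also have "(\<Sum>j\<le>Suc M. G j (Suc M - j)) = (\<Sum>l\<le>Suc M. G (Suc M - l) l)"
    by (rule sum.reindex_bij_witness[of _ "\<lambda>l. Suc M - l" "\<lambda>l. Suc M - l"]) auto
  finally show ?case by simp
qed simp

section \<open>Orthogonality estimates\<close>

text \<open>The boundary terms on the axis of total order at most \<open>M\<close> cancel by the
  recursion. The inner edge terms are exponentially small, and what is left carries the full power
  of \<open>1/N\<close>.\<close>

lemma expansion_osc_sum_bound:
  assumes \<delta>: "\<delta> > 0" and h: "\<And>k. periodic_holomorphic_on (h k) {-\<delta><..<\<delta>}"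
    and h0: "\<And>z. z \<in> vstrip {-\<delta><..<\<delta>} \<Longrightarrow> h 0 z = 1"
    and c: "0 < c" "c < c'" "c' < 2 * c" "c' < \<delta>"
    and f: "f = (\<lambda>j k. if k < Suc M then coeff_seq h j k else (\<lambda>z. 0))"
  obtains C where "C \<ge> 0" "\<And>N P. N > 0 \<Longrightarrow> P holomorphic_on ball 0 (exp \<delta>) \<Longrightarrow> P 0 = 0 \<Longrightarrow>
     norm (\<Sum>j\<le>M. osc_integral (Suc M) N c (transplant N P) (f j) / of_nat N ^ j) \<le>
       C / real N ^ Suc M * strip_L1 c' (transplant N P)"
proof -
  let ?I = "{-\<delta><..<\<delta>}"
  have I: "open ?I" "convex ?I" by auto
  have sub: "{-c..0} \<subseteq> ?I" "{-c'..0} \<subseteq> ?I" "{-c'..0} \<subseteq> {-\<delta><..}" using c by auto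
  have fper: "periodic_holomorphic_on (f j k) ?I" for j k
    using coeff_seq_per[where \<delta>=\<delta> and h=h, OF \<delta> h h0, of j k] periodic_holomorphic_on_intros(5)[OF h[of 0] h[of 0], of 0] by (simp add: f)
  have fz: "k \<ge> Suc M \<Longrightarrow> f j k = (\<lambda>z. 0)" for j k by (simp add: f)
  have dper: "periodic_holomorphic_on ((dseq ^^ l) (f j) k) ?I" for l j k
    by (rule dseq_funpow_periodic_holomorphic[OF I(1) fper])
  define Q1 where "Q1 = (\<lambda>j l C. C \<ge> 0 \<and> (\<forall>N q. periodic_holomorphic_on q ?I \<longrightarrow>
     norm (osc_integral (Suc M) N c q ((dseq ^^ l) (f j))) \<le> C * strip_L1 c' q))"
  have "\<exists>C. Q1 j l C" for j l
    unfolding Q1_def using osc_integral_norm_le[of "(dseq ^^ l) (f j)" ?I c c', OF dper _ _ sub(2)] c by (metis less_imp_le)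
  then obtain C1 where "\<And>j l. Q1 j l (C1 j l)" by metis
  then have C1: "\<And>j l. C1 j l \<ge> 0" "\<And>j l N q. periodic_holomorphic_on q ?I \<Longrightarrow>
      norm (osc_integral (Suc M) N c q ((dseq ^^ l) (f j))) \<le> C1 j l * strip_L1 c' q" unfolding Q1_def by blast+
  define Q2 where "Q2 = (\<lambda>j l C. C \<ge> 0 \<and> (\<forall>N P. P holomorphic_on ball 0 (exp \<delta>) \<longrightarrow>
     norm (inner_term (Suc M) N c (transplant N P) ((dseq ^^ l) (f j))) \<le> C * exp (- (real N * (2 * c - c'))) * strip_L1 c' (transplant N P)))"
  have "\<exists>C. Q2 j l C" for j l
    unfolding Q2_def using inner_term_norm_le[of "(dseq ^^ l) (f j)" \<delta> c c', OF dper c(1,2,4)] by metis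
  then obtain C2 where "\<And>j l. Q2 j l (C2 j l)" by metis
  then have C2: "\<And>j l. C2 j l \<ge> 0" "\<And>j l N P. P holomorphic_on ball 0 (exp \<delta>) \<Longrightarrow>
     norm (inner_term (Suc M) N c (transplant N P) ((dseq ^^ l) (f j))) \<le> C2 j l * exp (- (real N * (2 * c - c'))) * strip_L1 c' (transplant N P)"
    unfolding Q2_def by blast+
  define \<eta> where "\<eta> = 2 * c - c'"
  have \<eta>: "\<eta> > 0" using c by (simp add: \<eta>_def)
  define D where "D = fact (Suc M) / \<eta> ^ Suc M"
  have D0: "D \<ge> 0" using \<eta> by (simp add: D_def)
  define C where "C = (\<Sum>j\<le>M. \<Sum>l<Suc M - j. C2 j l * D) + (\<Sum>j\<le>M. C1 j (Suc M - j))"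
  have C0: "C \<ge> 0" unfolding C_def using C1(1) C2(1) D0 by (intro add_nonneg_nonneg sum_nonneg mult_nonneg_nonneg) auto
  have main: "norm (\<Sum>j\<le>M. osc_integral (Suc M) N c (transplant N P) (f j) / of_nat N ^ j) \<le>
       C / real N ^ Suc M * strip_L1 c' (transplant N P)"
    if N: "N > 0" and P: "P holomorphic_on ball 0 (exp \<delta>)" "P 0 = 0" for N P
  proof -
    let ?q = "transplant N P" and ?n = "of_nat N :: complex"
    have q: "periodic_holomorphic_on ?q ?I"
      by (rule periodic_holomorphic_on_subset[OF transplant_periodic_holomorphic[OF P(1)]]) auto
    define L where "L = strip_L1 c' ?q"
    have L: "L \<ge> 0" unfolding L_def
      by (rule strip_L1_nonneg[OF periodic_holomorphic_onD(2)[OF q] sub(2)])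
    have N0: "?n \<noteq> 0" using N by simp
    define A where "A = (\<lambda>j l. vline_integral (\<lambda>z. exp (?n * z) * (dseq ^^ l) (f j) 0 z * cnj (?q z)) 0)"
    define In where "In = (\<lambda>j l. inner_term (Suc M) N c ?q ((dseq ^^ l) (f j)))"
    define Os where "Os = (\<lambda>j. osc_integral (Suc M) N c ?q ((dseq ^^ (Suc M - j)) (f j)))"
    \<comment> \<open>Expanding the \<open>j\<close>-th term to depth \<open>Suc M - j\<close>
      compensates its prefactor \<open>1 / N ^ j\<close>, so all remainders have the same
      order.\<close>
    have osc: "osc_integral (Suc M) N c ?q (f j) =
        (\<Sum>l<Suc M - j. (- 1) ^ l / ?n ^ (l + 1) * (A j l / 2 - In j l / 2)) + (- 1) ^ (Suc M - j) / ?n ^ (Suc M - j) * Os j" for j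
      unfolding A_def In_def Os_def
      by (rule osc_integral_expansion[OF I fper q _ sub(1) _ fz N]) (use c in auto)
    define G where "G = (\<lambda>j l. (- 1) ^ l / ?n ^ (j + l + 1) * A j l)"
    have "osc_integral (Suc M) N c ?q (f j) / ?n ^ j = (\<Sum>l<Suc M - j. G j l) / 2
        - (\<Sum>l<Suc M - j. (- 1) ^ l / ?n ^ (j + l + 1) * In j l) / 2 + (- 1) ^ (Suc M - j) / ?n ^ Suc M * Os j" if j: "j \<le> M" for j
    proof -
      have 1: "(\<Sum>l<Suc M - j. (- 1) ^ l / ?n ^ (l + 1) * (A j l / 2 - In j l / 2)) / ?n ^ j =
          (\<Sum>l<Suc M - j. G j l) / 2 - (\<Sum>l<Suc M - j. (- 1) ^ l / ?n ^ (j + l + 1) * In j l) / 2"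
        unfolding sum_divide_distrib sum_subtractf[symmetric] G_def
        by (intro sum.cong refl) (use N0 in \<open>simp add: field_simps power_add\<close>)
      have 2: "(- 1) ^ (Suc M - j) / ?n ^ (Suc M - j) * Os j / ?n ^ j = (- 1) ^ (Suc M - j) / ?n ^ Suc M * Os j"
      proof -
        have "?n ^ Suc M = ?n ^ (Suc M - j) * ?n ^ j" using j by (simp add: power_add[symmetric])
        then show ?thesis by simp
      qed
      show ?thesis unfolding osc add_divide_distrib 1 2 ..
    qed
    then have "(\<Sum>j\<le>M. osc_integral (Suc M) N c ?q (f j) / ?n ^ j) =
       (\<Sum>j\<le>M. (\<Sum>l<Suc M - j. G j l) / 2 - (\<Sum>l<Suc M - j. (- 1) ^ l / ?n ^ (j + l + 1) * In j l) / 2 + (- 1) ^ (Suc M - j) / ?n ^ Suc M * Os j)"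
      by (intro sum.cong) auto
    also have "\<dots> = (\<Sum>j\<le>M. \<Sum>l<Suc M - j. G j l) / 2 - (\<Sum>j\<le>M. \<Sum>l<Suc M - j. (- 1) ^ l / ?n ^ (j + l + 1) * In j l) / 2
        + (\<Sum>j\<le>M. (- 1) ^ (Suc M - j) / ?n ^ Suc M * Os j)"
      by (simp add: sum.distrib sum_subtractf sum_divide_distrib)
    also have "(\<Sum>j\<le>M. \<Sum>l<Suc M - j. G j l) = 0"
    proof -
      have "(\<Sum>l\<le>n. G (n - l) l) = 0" if n: "n \<le> M" for n
      proof -
        have "(\<Sum>l\<le>n. G (n - l) l) = (\<Sum>l\<le>n. 1 / ?n ^ (n + 1) * ((- 1) ^ l * A (n - l) l))"
          unfolding G_def by (intro sum.cong) auto
        also have "\<dots> = 1 / ?n ^ (n + 1) * (\<Sum>l\<le>n. (- 1) ^ l * A (n - l) l)" by (simp only: sum_distrib_left)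
        also have "(\<Sum>l\<le>n. (- 1) ^ l * A (n - l) l) = (\<Sum>l\<le>n. vline_integral (\<lambda>z. (- 1) ^ l * (exp (?n * z) * (dseq ^^ l) (f (n - l)) 0 z * cnj (?q z))) 0)"
          unfolding A_def vline_integral_cmult ..
        also have "\<dots> = vline_integral (\<lambda>z. \<Sum>l\<le>n. (- 1) ^ l * (exp (?n * z) * (dseq ^^ l) (f (n - l)) 0 z * cnj (?q z))) 0"
          using \<delta> by (intro vline_integral_sum[symmetric] continuous_intros
             continuous_on_vline[OF periodic_holomorphic_onD(2)[OF dper]] continuous_on_vline[OF periodic_holomorphic_onD(2)[OF q]]) auto
        also have "\<dots> = vline_integral (\<lambda>z. exp (?n * z) * (\<Sum>l\<le>n. (- 1) ^ l * (dseq ^^ l) (coeff_seq h (n - l)) 0 z) *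
            cnj (exp (of_nat (N + 1) * z) * P (exp (- z)))) 0"
        proof (rule vline_integral_cong)
          fix z :: complex
          \<comment> \<open>Entry 0 after \<open>l\<close> applications involves indices up to
            \<open>l \<le> M\<close> only, below the truncation.\<close>
          have "(dseq ^^ l) (f (n - l)) 0 = (dseq ^^ l) (coeff_seq h (n - l)) 0" if "l \<le> n" for l
            using that n by (intro dseq_funpow_local) (auto simp: f)
          then have "(\<Sum>l\<le>n. (- 1) ^ l * (exp (?n * z) * (dseq ^^ l) (f (n - l)) 0 z * cnj (?q z))) =
             (\<Sum>l\<le>n. exp (?n * z) * ((- 1) ^ l * (dseq ^^ l) (coeff_seq h (n - l)) 0 z) * cnj (?q z))"
            by (intro sum.cong) auto
          then show "(\<Sum>l\<le>n. (- 1) ^ l * (exp (?n * z) * (dseq ^^ l) (f (n - l)) 0 z * cnj (?q z))) =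
             exp (?n * z) * (\<Sum>l\<le>n. (- 1) ^ l * (dseq ^^ l) (coeff_seq h (n - l)) 0 z) * cnj (exp (of_nat (N + 1) * z) * P (exp (- z)))"
            unfolding transplant_def by (simp only: sum_distrib_left sum_distrib_right)
        qed
        also have "\<dots> = 0" using \<delta> by (intro coeff_seq_cancellation[where \<delta>=\<delta> and h=h, OF \<delta> h h0 P(1) _ P(2)]) auto
        finally show ?thesis by simp
      qed
      then show ?thesis unfolding sum_triangle by simp
    qed
    finally have eq: "(\<Sum>j\<le>M. osc_integral (Suc M) N c ?q (f j) / ?n ^ j) =
       - (\<Sum>j\<le>M. \<Sum>l<Suc M - j. (- 1) ^ l / ?n ^ (j + l + 1) * In j l) / 2 + (\<Sum>j\<le>M. (- 1) ^ (Suc M - j) / ?n ^ Suc M * Os j)" by simp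
    have ex: "exp (- (real N * \<eta>)) \<le> D / real N ^ Suc M"
    proof -
      have "exp (- (real N * \<eta>)) * \<eta> ^ Suc M \<le> fact (Suc M) / real N ^ Suc M"
        using \<eta> by (intro exp_minus_power_le[OF N]) auto
      moreover have "\<eta> ^ Suc M > 0" using \<eta> by simp
      ultimately have "exp (- (real N * \<eta>)) \<le> fact (Suc M) / real N ^ Suc M / \<eta> ^ Suc M"
        by (simp only: pos_le_divide_eq)
      then show ?thesis by (simp add: D_def mult.commute)
    qed
    have n1: "norm ((- 1) ^ l / ?n ^ (j + l + 1) * In j l) \<le> C2 j l * D / real N ^ Suc M * L" for j l
    proof -
      have "1 \<le> real N ^ (j + l + 1)" using N by (intro one_le_power) auto
      then have "norm ((- 1) ^ l / ?n ^ (j + l + 1) * In j l) \<le> norm (In j l)"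
        using mult_left_mono[of 1 "real N ^ (j + l + 1)" "norm (In j l)"] N
        by (simp add: norm_mult norm_divide norm_power divide_le_eq)
      also have "\<dots> \<le> C2 j l * exp (- (real N * \<eta>)) * L" unfolding In_def L_def \<eta>_def by (rule C2(2)[OF P(1)])
      also have "\<dots> \<le> C2 j l * (D / real N ^ Suc M) * L"
        using ex C2(1) L by (intro mult_right_mono mult_left_mono) auto
      finally show ?thesis by simp
    qed
    have n2: "norm ((- 1) ^ (Suc M - j) / ?n ^ Suc M * Os j) \<le> C1 j (Suc M - j) / real N ^ Suc M * L" for j
    proof -
      have "norm (Os j) \<le> C1 j (Suc M - j) * L" unfolding Os_def L_def by (rule C1(2)[OF q])
      then have "norm (Os j) / real N ^ Suc M \<le> C1 j (Suc M - j) * L / real N ^ Suc M" by (rule divide_right_mono) simp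
      then show ?thesis by (simp add: norm_mult norm_divide norm_power del: power_Suc)
    qed
    have "norm (\<Sum>j\<le>M. osc_integral (Suc M) N c ?q (f j) / ?n ^ j) \<le>
       norm (\<Sum>j\<le>M. \<Sum>l<Suc M - j. (- 1) ^ l / ?n ^ (j + l + 1) * In j l) / 2 + norm (\<Sum>j\<le>M. (- 1) ^ (Suc M - j) / ?n ^ Suc M * Os j)"
      unfolding eq by (rule order_trans[OF norm_triangle_ineq]) (simp add: norm_divide)
    also have "\<dots> \<le> norm (\<Sum>j\<le>M. \<Sum>l<Suc M - j. (- 1) ^ l / ?n ^ (j + l + 1) * In j l) + norm (\<Sum>j\<le>M. (- 1) ^ (Suc M - j) / ?n ^ Suc M * Os j)"
      by simp
    also have "\<dots> \<le> (\<Sum>j\<le>M. \<Sum>l<Suc M - j. C2 j l * D / real N ^ Suc M * L) + (\<Sum>j\<le>M. C1 j (Suc M - j) / real N ^ Suc M * L)"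
      by (intro add_mono sum_norm_le n1 n2)
    also have "\<dots> = C / real N ^ Suc M * L"
      unfolding C_def by (simp only: add_divide_distrib distrib_right sum_divide_distrib sum_distrib_right)
    finally show ?thesis unfolding L_def .
  qed
  show ?thesis by (rule that[OF C0 main])
qed

text \<open>The weight is replaced by its expansion in \<open>2 Re z\<close> up to order
  \<open>M\<close>; the sum so obtained is the previous estimate. The remainder is of order
  \<open>|Re z| ^ (M + 1)\<close>, which the exponential converts into
  \<open>1 / N ^ (M + 1)\<close>.\<close>

lemma oscillatory_estimate:
  assumes \<delta>: "\<delta> > 0" and h: "\<And>k. periodic_holomorphic_on (h k) {-\<delta><..<\<delta>}"
    and h0: "\<And>z. z \<in> vstrip {-\<delta><..<\<delta>} \<Longrightarrow> h 0 z = 1"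
    and ax: "axis_expansion F (vstrip {-\<delta><..<\<delta>}) h Cx"
    and F: "continuous_on (vstrip {-c..0}) F"
    and c: "0 < c" "c < c'" "c' < 2 * c" "c' < \<delta>"
  obtains C where "C \<ge> 0" "\<And>N P. N > 0 \<Longrightarrow> P holomorphic_on ball 0 (exp \<delta>) \<Longrightarrow> P 0 = 0 \<Longrightarrow>
     norm (integral {-c..0} (vline_integral (\<lambda>z. exp (of_nat (N + 1) * z) *
        (\<Sum>j\<le>M. expansion_coeff h j (exp (- z)) / of_nat N ^ j) * F z * cnj (transplant N P z)))) \<le>
       C / real N ^ Suc M * strip_L1 c' (transplant N P)"
proof -
  let ?I = "{-\<delta><..<\<delta>}"
  have sub: "{-c..0} \<subseteq> ?I" "{-c'..0} \<subseteq> ?I" using c by auto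
  define f where "f = (\<lambda>j k. if k < Suc M then coeff_seq h j k else (\<lambda>z. 0))"
  obtain C1 where C1: "C1 \<ge> 0" "\<And>N P. N > 0 \<Longrightarrow> P holomorphic_on ball 0 (exp \<delta>) \<Longrightarrow> P 0 = 0 \<Longrightarrow>
     norm (\<Sum>j\<le>M. osc_integral (Suc M) N c (transplant N P) (f j) / of_nat N ^ j) \<le>
       C1 / real N ^ Suc M * strip_L1 c' (transplant N P)"
    using expansion_osc_sum_bound[where \<delta>=\<delta> and h=h, OF \<delta> h h0 c f_def] by blast
  have eper: "periodic_holomorphic_on (\<lambda>z. expansion_coeff h j (exp (- z))) ?I" for j
    by (rule periodic_holomorphic_on_subset[OF periodic_holomorphic_on_compose_exp_minus[of _ "- \<delta>"]])
      (use expansion_coeff_holomorphic[where \<delta>=\<delta> and h=h, OF \<delta> h h0] in auto)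
  note econt = periodic_holomorphic_onD(2)[OF eper]
  have "\<exists>B. B \<ge> 0 \<and> (\<forall>x\<in>{-c..0}. \<forall>t\<in>{0..2*pi}. norm (expansion_coeff h j (exp (- Complex x t))) \<le> B)" for j
    using vstrip_sup_bound[OF econt[of j] sub(1)] by metis
  then obtain B where B: "\<And>j. B j \<ge> 0"
    "\<And>j x t. x \<in> {-c..0} \<Longrightarrow> t \<in> {0..2*pi} \<Longrightarrow> norm (expansion_coeff h j (exp (- Complex x t))) \<le> B j" by metis
  define r where "r = (\<lambda>z. F z - (\<Sum>k<Suc M. h k z * of_real (2 * Re z) ^ k))"
  have r: "norm (r z) \<le> \<bar>Cx (Suc M)\<bar> * \<bar>Re z\<bar> ^ Suc M" if "z \<in> vstrip ?I" for z
  proof -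
    have "norm (r z) \<le> Cx (Suc M) * \<bar>Re z\<bar> ^ Suc M" using ax that unfolding axis_expansion_def r_def by blast
    also have "\<dots> \<le> \<bar>Cx (Suc M)\<bar> * \<bar>Re z\<bar> ^ Suc M" by (intro mult_right_mono) auto
    finally show ?thesis .
  qed
  have vsub: "vstrip {-c..0} \<subseteq> vstrip ?I" using sub by (auto simp: vstrip_def)
  have hcont: "continuous_on (vstrip {-c..0}) (h k)" for k
    using continuous_on_subset[OF periodic_holomorphic_onD(2)[OF h] vsub] .
  have rcont: "continuous_on (vstrip {-c..0}) r"
    unfolding r_def by (intro continuous_intros F hcont)
  define C where "C = C1 + (\<Sum>j\<le>M. B j) * \<bar>Cx (Suc M)\<bar> * fact (Suc M)"
  have C0: "C \<ge> 0" unfolding C_def using C1(1) B(1) by (intro add_nonneg_nonneg mult_nonneg_nonneg sum_nonneg) auto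
  show ?thesis
  proof (rule that[OF C0])
    fix N :: nat and P assume N: "N > 0" and P: "P holomorphic_on ball 0 (exp \<delta>)" "P 0 = 0"
    let ?q = "transplant N P" and ?n = "of_nat N :: complex"
    let ?b = "\<lambda>z. \<Sum>j\<le>M. expansion_coeff h j (exp (- z)) / ?n ^ j"
    have q: "periodic_holomorphic_on ?q ?I"
      by (rule periodic_holomorphic_on_subset[OF transplant_periodic_holomorphic[OF P(1)]]) auto
    note qcont = periodic_holomorphic_onD(2)[OF q]
    define L where "L = strip_L1 c' ?q"
    have L: "L \<ge> 0" unfolding L_def by (rule strip_L1_nonneg[OF qcont sub(2)])
    define e where "e = (\<lambda>z. exp (of_nat (N + 1) * z) * ?b z * r z)"
    have econt': "continuous_on (vstrip {-c..0}) e"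
      unfolding e_def using N by (intro continuous_intros rcont continuous_on_subset[OF econt vsub]) auto
    have qcont': "continuous_on (vstrip {-c..0}) ?q" by (rule continuous_on_subset[OF qcont vsub])
    have fper: "periodic_holomorphic_on (f j k) ?I" for j k
      using coeff_seq_per[where \<delta>=\<delta> and h=h, OF \<delta> h h0, of j k] periodic_holomorphic_on_intros(5)[OF h[of 0] h[of 0], of 0] by (simp add: f_def)
    have fcont: "continuous_on (vstrip {-c..0}) (\<lambda>z. exp (?n * z) * f j k z * cnj (?q z))" for j k
      by (intro continuous_intros qcont' continuous_on_subset[OF periodic_holomorphic_onD(2)[OF fper] vsub])
    let ?m = "\<lambda>j k. vline_integral (\<lambda>z. exp (?n * z) * f j k z * cnj (?q z))"
    have eq: "vline_integral (\<lambda>z. exp (of_nat (N + 1) * z) * ?b z * F z * cnj (?q z)) x =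
       (\<Sum>j\<le>M. \<Sum>k<Suc M. (1 / ?n ^ j) * (of_real ((2 * x) ^ k) * ?m j k x)) + vline_integral (\<lambda>z. e z * cnj (?q z)) x"
      if x: "x \<in> {-c..0}" for x
    proof -
      have "exp (of_nat (N + 1) * z) * ?b z * F z * cnj (?q z) =
        (\<Sum>j\<le>M. \<Sum>k<Suc M. (1 / ?n ^ j * of_real ((2 * x) ^ k)) * (exp (?n * z) * f j k z * cnj (?q z))) + e z * cnj (?q z)"
        if z: "Re z = x" for z
      proof -
        have "(\<Sum>j\<le>M. \<Sum>k<Suc M. (1 / ?n ^ j * of_real ((2 * x) ^ k)) * (exp (?n * z) * f j k z * cnj (?q z))) =
          (\<Sum>j\<le>M. \<Sum>k<Suc M. (exp (?n * z) * exp z) * (expansion_coeff h j (exp (- z)) / ?n ^ j) * (h k z * of_real (2 * x) ^ k) * cnj (?q z))"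
          by (intro sum.cong refl) (simp add: f_def coeff_seq_def mult_ac)
        also have "\<dots> = (exp (?n * z) * exp z) * ?b z * (\<Sum>k<Suc M. h k z * of_real (2 * x) ^ k) * cnj (?q z)"
          by (simp only: sum_distrib_left sum_distrib_right) (rule sum.swap)
        also have "exp (?n * z) * exp z = exp (of_nat (N + 1) * z)" unfolding exp_add[symmetric] by (simp add: algebra_simps)
        finally show ?thesis unfolding e_def r_def z by (simp add: algebra_simps)
      qed
      then have "vline_integral (\<lambda>z. exp (of_nat (N + 1) * z) * ?b z * F z * cnj (?q z)) x =
        vline_integral (\<lambda>z. (\<Sum>j\<le>M. \<Sum>k<Suc M. (1 / ?n ^ j * of_real ((2 * x) ^ k)) * (exp (?n * z) * f j k z * cnj (?q z))) + e z * cnj (?q z)) x"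
        by (rule vline_integral_cong)
      also have "\<dots> = vline_integral (\<lambda>z. \<Sum>j\<le>M. \<Sum>k<Suc M. (1 / ?n ^ j * of_real ((2 * x) ^ k)) * (exp (?n * z) * f j k z * cnj (?q z))) x
          + vline_integral (\<lambda>z. e z * cnj (?q z)) x"
        by (intro vline_integral_add(1) continuous_on_sum continuous_on_mult continuous_on_const continuous_on_cnj
           continuous_on_vline[OF fcont x] continuous_on_vline[OF econt' x] continuous_on_vline[OF qcont' x])
      also have "vline_integral (\<lambda>z. \<Sum>j\<le>M. \<Sum>k<Suc M. (1 / ?n ^ j * of_real ((2 * x) ^ k)) * (exp (?n * z) * f j k z * cnj (?q z))) x =
         (\<Sum>j\<le>M. \<Sum>k<Suc M. vline_integral (\<lambda>z. (1 / ?n ^ j * of_real ((2 * x) ^ k)) * (exp (?n * z) * f j k z * cnj (?q z))) x)"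
      proof -
        have tz: "continuous_on {0..2*pi} (\<lambda>t. (1 / ?n ^ j * of_real ((2 * x) ^ k)) *
            (exp (?n * Complex x t) * f j k (Complex x t) * cnj (?q (Complex x t))))" for j k
          by (rule continuous_on_mult[OF continuous_on_const continuous_on_vline[OF fcont x]])
        show ?thesis
          by (subst vline_integral_sum[OF continuous_on_sum[OF tz] finite_atMost])
            (rule sum.cong[OF refl vline_integral_sum[OF tz finite_lessThan]])
      qed
      finally show ?thesis unfolding vline_integral_cmult by (simp add: mult.assoc)
    qed
    have mc: "continuous_on {-c..0} (?m j k)" for j k by (rule vline_integral_continuous[OF fcont]) auto
    have tc: "continuous_on {-c..0} (\<lambda>x. (1 / ?n ^ j) * (of_real ((2 * x) ^ k) * ?m j k x))" for j k
      by (intro continuous_on_mult[OF continuous_on_const] continuous_on_mult[OF _ mc] continuous_intros)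
    have rc: "continuous_on {-c..0} (vline_integral (\<lambda>z. e z * cnj (?q z)))"
      by (rule vline_integral_continuous[of "{-c..0}"]) (auto intro!: continuous_intros econt' qcont')
    have "integral {-c..0} (vline_integral (\<lambda>z. exp (of_nat (N + 1) * z) * ?b z * F z * cnj (?q z))) =
       integral {-c..0} (\<lambda>x. (\<Sum>j\<le>M. \<Sum>k<Suc M. (1 / ?n ^ j) * (of_real ((2 * x) ^ k) * ?m j k x)) + vline_integral (\<lambda>z. e z * cnj (?q z)) x)"
      by (rule integral_cong[OF eq])
    also have "\<dots> = integral {-c..0} (\<lambda>x. \<Sum>j\<le>M. \<Sum>k<Suc M. (1 / ?n ^ j) * (of_real ((2 * x) ^ k) * ?m j k x)) + integral {-c..0} (vline_integral (\<lambda>z. e z * cnj (?q z)))"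
      by (rule integral_add; intro integrable_continuous_real continuous_on_sum tc rc)
    also have "integral {-c..0} (\<lambda>x. \<Sum>j\<le>M. \<Sum>k<Suc M. (1 / ?n ^ j) * (of_real ((2 * x) ^ k) * ?m j k x)) =
      (\<Sum>j\<le>M. \<Sum>k<Suc M. integral {-c..0} (\<lambda>x. (1 / ?n ^ j) * (of_real ((2 * x) ^ k) * ?m j k x)))"
      by (subst integral_sum[OF finite_atMost integrable_continuous_real[OF continuous_on_sum[OF tc]]])
        (rule sum.cong[OF refl integral_sum[OF finite_lessThan integrable_continuous_real[OF tc]]])
    also have "\<dots> = (\<Sum>j\<le>M. osc_integral (Suc M) N c ?q (f j) / ?n ^ j)"
      unfolding osc_integral_def sum_divide_distrib integral_mult_right by simp
    finally have split: "integral {-c..0} (vline_integral (\<lambda>z. exp (of_nat (N + 1) * z) * ?b z * F z * cnj (?q z))) =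
      (\<Sum>j\<le>M. osc_integral (Suc M) N c ?q (f j) / ?n ^ j) + integral {-c..0} (vline_integral (\<lambda>z. e z * cnj (?q z)))" .
    define E where "E = (\<Sum>j\<le>M. B j) * \<bar>Cx (Suc M)\<bar> * (fact (Suc M) / real N ^ Suc M)"
    have E0: "E \<ge> 0" unfolding E_def using B(1) by (intro mult_nonneg_nonneg sum_nonneg) auto
    have rem: "norm (integral {-c..0} (vline_integral (\<lambda>z. e z * cnj (?q z)))) \<le> E * L"
    proof -
      have "norm (integral {-c..0} (vline_integral (\<lambda>z. e z * cnj (?q z)))) \<le> integral {-c..0} (\<lambda>x. E * integral {0..2*pi} (\<lambda>t. norm (?q (Complex x t))))"
      proof (rule integral_norm_bound_integral)
        show "vline_integral (\<lambda>z. e z * cnj (?q z)) integrable_on {-c..0}" by (intro integrable_continuous_real rc)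
        show "(\<lambda>x. E * integral {0..2*pi} (\<lambda>t. norm (?q (Complex x t)))) integrable_on {-c..0}"
          by (intro integrable_continuous_real continuous_intros vline_norm_integral_continuous[OF qcont sub(1)])
        fix x assume x: "x \<in> {-c..0}"
        show "norm (vline_integral (\<lambda>z. e z * cnj (?q z)) x) \<le> E * integral {0..2*pi} (\<lambda>t. norm (?q (Complex x t)))"
        proof (rule vline_pair_norm_le[OF continuous_on_vline[OF econt' x] continuous_on_vline[OF qcont' x]])
          fix t assume t: "t \<in> {0..2*pi}"
          let ?z = "Complex x t"
          have bb: "norm (?b ?z) \<le> (\<Sum>j\<le>M. B j)"
          proof (rule sum_norm_le)
            fix j
            have "1 \<le> real N ^ j" using N by (intro one_le_power) auto
            then have "norm (expansion_coeff h j (exp (- ?z)) / ?n ^ j) \<le> norm (expansion_coeff h j (exp (- ?z)))"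
              by (simp add: norm_divide norm_power divide_le_eq mult_right_le_one_le mult_le_cancel_left1)
            also have "\<dots> \<le> B j" by (rule B(2)[OF x t])
            finally show "norm (expansion_coeff h j (exp (- ?z)) / ?n ^ j) \<le> B j" .
          qed
          have x0: "- x \<ge> 0" "\<bar>x\<bar> = - x" using x by auto
          have ex: "norm (exp (of_nat (N + 1) * ?z)) * \<bar>x\<bar> ^ Suc M \<le> fact (Suc M) / real N ^ Suc M"
          proof -
            have "norm (exp (of_nat (N + 1) * ?z)) = exp (x + real N * x)" by (simp add: algebra_simps)
            also have "\<dots> \<le> exp (- (real N * - x))" using x by simp
            finally have "norm (exp (of_nat (N + 1) * ?z)) * \<bar>x\<bar> ^ Suc M \<le> exp (- (real N * - x)) * (- x) ^ Suc M"
              unfolding x0(2) using zero_le_power[OF x0(1), of "Suc M"] by (rule mult_right_mono)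
            also have "\<dots> \<le> fact (Suc M) / real N ^ Suc M" by (rule exp_minus_power_le[OF N x0(1)])
            finally show ?thesis .
          qed
          have "norm (r ?z) \<le> \<bar>Cx (Suc M)\<bar> * \<bar>x\<bar> ^ Suc M" using r[of ?z] x sub by auto
          then have "norm (e ?z) \<le> norm (exp (of_nat (N + 1) * ?z)) * (\<Sum>j\<le>M. B j) * (\<bar>Cx (Suc M)\<bar> * \<bar>x\<bar> ^ Suc M)"
            unfolding e_def norm_mult[of "_ * _"] norm_mult[of "exp _"] using bb B(1)
            by (intro mult_mono) (auto intro!: sum_nonneg mult_nonneg_nonneg)
          also have "\<dots> = (\<Sum>j\<le>M. B j) * \<bar>Cx (Suc M)\<bar> * (norm (exp (of_nat (N + 1) * ?z)) * \<bar>x\<bar> ^ Suc M)" by (simp only: mult_ac)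
          also have "\<dots> \<le> E" unfolding E_def using B(1) by (intro mult_left_mono ex mult_nonneg_nonneg sum_nonneg) auto
          finally show "norm (e ?z) \<le> E" .
        qed
      qed
      also have "\<dots> = E * integral {-c..0} (\<lambda>x. integral {0..2*pi} (\<lambda>t. norm (?q (Complex x t))))" by simp
      also have "\<dots> \<le> E * L" unfolding L_def using c E0 by (intro mult_left_mono strip_L1_mono[OF qcont sub(2)]) auto
      finally show ?thesis .
    qed
    have "norm (integral {-c..0} (vline_integral (\<lambda>z. exp (of_nat (N + 1) * z) * ?b z * F z * cnj (?q z)))) \<le> C1 / real N ^ Suc M * L + E * L"
      unfolding split using C1(2)[OF N P] rem unfolding L_def by (intro norm_triangle_le) auto
    also have "\<dots> = C / real N ^ Suc M * L" by (simp add: C_def E_def add_divide_distrib algebra_simps)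
    finally show "norm (integral {-c..0} (vline_integral (\<lambda>z. exp (of_nat (N + 1) * z) * ?b z * F z * cnj (?q z)))) \<le>
       C / real N ^ Suc M * strip_L1 c' ?q" unfolding L_def .
  qed
qed

section \<open>Weighted norms of polynomials on the domain\<close>

lemma le_sqrt_of_AM_GM:
  fixes A S a b :: real
  assumes le: "\<And>t. t > 0 \<Longrightarrow> A \<le> a * t + b * S / t" and nn: "a \<ge> 0" "b \<ge> 0" "S \<ge> 0"
  shows "A \<le> (a + b) * sqrt S"
proof (cases "S = 0")
  case True
  have "A \<le> 0"
  proof (rule field_le_epsilon)
    fix e :: real assume "e > 0"
    then have "A \<le> a * (e / (a + 1))" using le[of "e / (a + 1)"] nn True by simp
    also have "\<dots> \<le> e" using nn \<open>e > 0\<close> by (simp add: field_simps)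
    finally show "A \<le> 0 + e" by simp
  qed
  then show ?thesis using True by simp
next
  case False
  then have "sqrt S > 0" "S / sqrt S = sqrt S" using nn by (auto simp: real_div_sqrt)
  then show ?thesis using le[of "sqrt S"] by (simp only: distrib_right times_divide_eq_right[symmetric])
qed

lemma set_integrable_bounded:
  fixes u :: "complex \<Rightarrow> 'b::{banach, second_countable_topology}"
  assumes A: "A \<in> sets borel" "bounded A" and u: "continuous_on A u" "\<And>z. z \<in> A \<Longrightarrow> norm (u z) \<le> B"
  shows "set_integrable lborel A u"
  unfolding set_integrable_def
proof (rule integrableI_bounded_set[where A=A and B=B])
  show "A \<in> sets lborel" using A by simp
  show "emeasure lborel A < \<infinity>" using emeasure_bounded_finite[OF A(2)] by simp
  show "(\<lambda>x. indicator A x *\<^sub>R u x) \<in> borel_measurable lborel"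
    using borel_measurable_continuous_on_indicator[OF A(1) u(1)] by simp
  show "AE x in lborel. x \<in> A \<longrightarrow> norm (indicator A x *\<^sub>R u x) \<le> B" using u(2) by simp
qed auto

lemma integral_of_real_ivl:
  fixes f :: "real \<Rightarrow> real"
  assumes "continuous_on {a..b} f"
  shows "integral {a..b} (\<lambda>x. complex_of_real (f x)) = of_real (integral {a..b} f)"
  by (intro integral_unique has_integral_of_real integrable_integral integrable_continuous_real assms)

text \<open>The weight is expanded on the open strip of half-width \<open>\<delta>\<close>, but
  bounds use the closed collar of width \<open>c' < \<delta>\<close>, on which the weight is
  continuous and positive. \<open>h 0 = 1\<close> encodes that
  \<open>\<omega> * exp (2 Re V)\<close> is 1 on the boundary.\<close>

locale orthogonality_chart = weighted_chart +
  fixes \<omega> :: "complex \<Rightarrow> real" and \<delta> c' :: real and h :: "nat \<Rightarrow> complex \<Rightarrow> complex" and Cx :: "nat \<Rightarrow> real"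
  assumes \<omega>_cont: "continuous_on D \<omega>" and \<omega>_nonneg: "\<And>z. z \<in> D \<Longrightarrow> 0 \<le> \<omega> z"
    and c': "0 < c'" "c' < \<delta>" "\<delta> \<le> width"
    and \<omega>_strip_cont: "continuous_on (strip_map ` vstrip {-c'..0}) \<omega>"
    and \<omega>_strip_pos: "\<And>z. z \<in> vstrip {-c'..0} \<Longrightarrow> 0 < \<omega> (strip_map z)"
    and h_per: "\<And>k. periodic_holomorphic_on (h k) {-\<delta><..<\<delta>}"
    and h_0: "\<And>z. z \<in> vstrip {-\<delta><..<\<delta>} \<Longrightarrow> h 0 z = 1"
    and h_exp: "axis_expansion (\<lambda>z. of_real (\<omega> (strip_map z) * exp (2 * Re (strip_V z)))) (vstrip {-\<delta><..<\<delta>}) h Cx"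
begin

text \<open>Taken against \<open>lborel\<close>; the normalization \<open>1 / pi\<close> of
  \<open>dA\<close> is restored in \<open>weighted_inner_self\<close>.\<close>

definition sq_norm :: "(complex \<Rightarrow> complex) \<Rightarrow> real"
  where "sq_norm q = (LINT z:D|lborel. (norm (q z))\<^sup>2 * \<omega> z)"

lemma \<delta>_pos: "\<delta> > 0" using c' by simp

lemma c'_width: "c' < width" using c' by simp

lemma D_measurable [measurable]: "D \<in> sets borel" using open_D by simp

lemma vstrip_c'_subset: "vstrip {-c'..0} \<subseteq> vstrip {-width<..}"
  using c'_width by (auto simp: vstrip_def)

lemma strip_map_cont: "continuous_on (vstrip {-width<..}) strip_map"
  by (rule periodic_holomorphic_onD(2)[OF strip_map_periodic_holomorphic])

lemma strip_V_cont: "continuous_on (vstrip {-width<..}) strip_V"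
  by (rule periodic_holomorphic_onD(2)[OF strip_V_periodic_holomorphic])

lemma deriv_strip_map_cont: "continuous_on (vstrip {-width<..}) (deriv strip_map)"
  by (rule periodic_holomorphic_onD(2)[OF periodic_holomorphic_on_deriv[OF _ strip_map_periodic_holomorphic]]) simp

lemma strip_weight_cont: "continuous_on (vstrip {-c'..0}) (\<lambda>z. \<omega> (strip_map z))"
  by (rule continuous_on_compose2[OF \<omega>_strip_cont continuous_on_subset[OF strip_map_cont vstrip_c'_subset]]) auto

text \<open>Continuity on the open set \<open>D\<close> alone gives no bound. The collar is covered
  by its compact closure in the strip, the rest of \<open>D\<close> is compact.\<close>

lemma \<omega>_bounded: obtains B where "B > 0" "\<And>z. z \<in> D \<Longrightarrow> \<omega> z \<le> B"
proof -
  have "continuous_on (vstrip {-c'..0}) (\<lambda>z. complex_of_real (\<omega> (strip_map z)))"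
    by (intro continuous_intros strip_weight_cont)
  then obtain B1 where B1: "\<And>x t. x \<in> {-c'..0} \<Longrightarrow> t \<in> {0..2*pi} \<Longrightarrow> norm (complex_of_real (\<omega> (strip_map (Complex x t)))) \<le> B1"
    using vstrip_sup_bound[of "{-c'..0}" _ c'] by blast
  have comp: "compact (- region c')"
    using open_region[of c'] collar_complement[of c'] c' c'_width bounded_D
    by (metis Diff_subset bounded_subset closed_Compl compact_eq_bounded_closed less_imp_le)
  have sub: "- region c' \<subseteq> D" using region_contains c' by blast
  have "bounded (\<omega> ` (- region c'))"
    by (intro compact_imp_bounded compact_continuous_image continuous_on_subset[OF \<omega>_cont sub] comp)
  then obtain B2 where B2: "\<And>z. z \<in> - region c' \<Longrightarrow> norm (\<omega> z) \<le> B2" unfolding bounded_iff by blast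
  show ?thesis
  proof (rule that[of "max 1 (max B1 B2)"])
    fix z assume z: "z \<in> D"
    show "\<omega> z \<le> max 1 (max B1 B2)"
    proof (cases "z \<in> - region c'")
      case True
      then show ?thesis using B2[of z] by auto
    next
      case False
      then have "z \<in> strip_map ` half_open_collar c'" using collar_complement[of c'] c' c'_width z by auto
      then obtain u where u: "u \<in> half_open_collar c'" "z = strip_map u" by auto
      then have "norm (complex_of_real (\<omega> (strip_map (Complex (Re u) (Im u))))) \<le> B1"
        by (intro B1) (auto simp: half_open_collar_def)
      then show ?thesis using u by auto
    qed
  qed simp
qed

lemma bounded_cont_on_D:
  fixes q :: "complex \<Rightarrow> complex"
  assumes "continuous_on UNIV q"
  obtains B where "B \<ge> 0" "\<And>z. z \<in> D \<Longrightarrow> norm (q z) \<le> B"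
proof -
  have "bounded (q ` closure D)"
    using bounded_D assms by (intro compact_imp_bounded compact_continuous_image) (auto intro: continuous_on_subset)
  then obtain B where "\<And>z. z \<in> closure D \<Longrightarrow> norm (q z) \<le> B" unfolding bounded_iff by blast
  then have B: "norm (q z) \<le> B" if "z \<in> D" for z using closure_subset that by blast
  show ?thesis
    by (rule that[of "max 0 B"]) (use B in \<open>auto simp: le_max_iff_disj\<close>)
qed

lemma sq_norm_integrable:
  assumes q: "continuous_on UNIV q"
  shows "set_integrable lborel D (\<lambda>z. (norm (q z))\<^sup>2 * \<omega> z)" "set_integrable lborel D (\<lambda>z. norm (q z) * \<omega> z)"
    "sq_norm q \<ge> 0"
proof -
  obtain B where B: "B \<ge> 0" "\<And>z. z \<in> D \<Longrightarrow> norm (q z) \<le> B" using bounded_cont_on_D[OF q] by blast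
  obtain W where W: "W > 0" "\<And>z. z \<in> D \<Longrightarrow> \<omega> z \<le> W" using \<omega>_bounded by blast
  have c: "continuous_on D q" using q continuous_on_subset by blast
  show "set_integrable lborel D (\<lambda>z. (norm (q z))\<^sup>2 * \<omega> z)"
  proof (rule set_integrable_bounded[OF D_measurable bounded_D])
    show "continuous_on D (\<lambda>z. (norm (q z))\<^sup>2 * \<omega> z)" by (intro continuous_intros c \<omega>_cont)
    fix z assume z: "z \<in> D"
    then show "norm ((norm (q z))\<^sup>2 * \<omega> z) \<le> B\<^sup>2 * W"
      using B W \<omega>_nonneg by (simp add: abs_mult mult_mono power_mono)
  qed
  show "set_integrable lborel D (\<lambda>z. norm (q z) * \<omega> z)"
  proof (rule set_integrable_bounded[OF D_measurable bounded_D])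
    show "continuous_on D (\<lambda>z. norm (q z) * \<omega> z)" by (intro continuous_intros c \<omega>_cont)
    fix z assume z: "z \<in> D"
    then show "norm (norm (q z) * \<omega> z) \<le> B * W"
      using B W \<omega>_nonneg by (simp add: abs_mult mult_mono)
  qed
  show "sq_norm q \<ge> 0"
    unfolding sq_norm_def set_lebesgue_integral_def
    by (intro integral_nonneg_AE AE_I2) (auto simp: indicator_def \<omega>_nonneg)
qed

lemma weighted_inner_self:
  assumes q: "continuous_on UNIV q"
  shows "weighted_inner D \<omega> q q = of_real (sq_norm q / pi)"
proof -
  have eq: "q z * cnj (q z) * of_real (\<omega> z) = of_real ((norm (q z))\<^sup>2 * \<omega> z)" for z
    unfolding of_real_mult complex_norm_square ..
  have "set_integrable lborel D (\<lambda>z. complex_of_real ((norm (q z))\<^sup>2 * \<omega> z))"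
    using sq_norm_integrable(1)[OF q] unfolding set_integrable_def
    by (auto simp: scaleR_conv_of_real simp flip: of_real_mult dest: integrable_of_real[where 'a=complex])
  from set_integrable_dA(2)[OF this] show ?thesis
    unfolding weighted_inner_def eq sq_norm_def set_integral_complex_of_real by simp
qed

text \<open>Cauchy-Schwarz in the guise of \<open>2 n \<le> t + n^2 / t\<close> with a free
  parameter \<open>t\<close>, optimized at the end by \<open>le_sqrt_of_AM_GM\<close>.\<close>

lemma L1_norm_le:
  obtains K where "K \<ge> 0" "\<And>q. continuous_on UNIV q \<Longrightarrow> (LINT z:D|lborel. norm (q z) * \<omega> z) \<le> K * sqrt (sq_norm q)"
proof -
  obtain W where W: "W > 0" "\<And>z. z \<in> D \<Longrightarrow> \<omega> z \<le> W" using \<omega>_bounded by blast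
  define m where "m = measure lborel D"
  have fin: "emeasure lborel D < \<infinity>" using emeasure_bounded_finite[OF bounded_D] by simp
  have "(LINT z:D|lborel. norm (q z) * \<omega> z) \<le> (W * m / 2 + 1 / 2) * sqrt (sq_norm q)" if q: "continuous_on UNIV q" for q
  proof (rule le_sqrt_of_AM_GM)
    fix t :: real assume t: "t > 0"
    have iW: "set_integrable lborel D (\<lambda>z. W * t / 2)"
      using fin by (intro set_integrable_bounded[OF D_measurable bounded_D, of _ "W * t / 2"]) (use W t in auto)
    have i2: "set_integrable lborel D (\<lambda>z. (norm (q z))\<^sup>2 * \<omega> z / (2 * t))"
      using sq_norm_integrable(1)[OF q] by simp
    have "(LINT z:D|lborel. norm (q z) * \<omega> z) \<le> (LINT z:D|lborel. W * t / 2 + (norm (q z))\<^sup>2 * \<omega> z / (2 * t))"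
    proof (rule set_integral_mono[OF sq_norm_integrable(2)[OF q] set_integral_add(1)[OF iW i2]])
      fix z assume z: "z \<in> D"
      define n where "n = norm (q z)"
      have "2 * t * n \<le> t * t + n * n" using sum_squares_bound[of t n] by (simp add: power2_eq_square)
      then have "n \<le> t / 2 + n\<^sup>2 / (2 * t)" using t by (simp add: field_simps power2_eq_square)
      then have "n * \<omega> z \<le> (t / 2 + n\<^sup>2 / (2 * t)) * \<omega> z" using \<omega>_nonneg[OF z] by (rule mult_right_mono)
      also have "\<dots> = t / 2 * \<omega> z + n\<^sup>2 * \<omega> z / (2 * t)" by (simp add: distrib_right)
      also have "t / 2 * \<omega> z \<le> t / 2 * W" using W(2)[OF z] t by (intro mult_left_mono) auto
      finally show "norm (q z) * \<omega> z \<le> W * t / 2 + (norm (q z))\<^sup>2 * \<omega> z / (2 * t)" by (simp add: n_def mult.commute)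
    qed
    also have "\<dots> = W * m / 2 * t + 1 / 2 * sq_norm q / t"
      unfolding set_integral_add(2)[OF iW i2] sq_norm_def m_def
      using fin t by (subst set_integral_const) (auto simp: mult.commute)
    finally show "(LINT z:D|lborel. norm (q z) * \<omega> z) \<le> W * m / 2 * t + 1 / 2 * sq_norm q / t" .
  qed (use W q in \<open>auto simp: m_def sq_norm_integrable\<close>)
  then show ?thesis using W by (intro that[of "W * m / 2 + 1 / 2"]) (auto simp: m_def)
qed

lemma error_integral_le:
  assumes A: "A \<in> sets borel" "A \<subseteq> D" and e: "continuous_on A e" "\<And>z. z \<in> A \<Longrightarrow> norm (e z) \<le> \<epsilon>" "\<epsilon> \<ge> 0"
    and q: "continuous_on UNIV q"
  shows "set_integrable lborel A (\<lambda>z. e z * cnj (q z) * of_real (\<omega> z))"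
    "norm (LINT z:A|lborel. e z * cnj (q z) * of_real (\<omega> z)) \<le> \<epsilon> * (LINT z:D|lborel. norm (q z) * \<omega> z)"
proof -
  obtain B where B: "B \<ge> 0" "\<And>z. z \<in> D \<Longrightarrow> norm (q z) \<le> B" using bounded_cont_on_D[OF q] by blast
  obtain W where W: "W > 0" "\<And>z. z \<in> D \<Longrightarrow> \<omega> z \<le> W" using \<omega>_bounded by blast
  have bA: "bounded A" using bounded_D A(2) bounded_subset by blast
  have le: "norm (e z * cnj (q z) * of_real (\<omega> z)) \<le> \<epsilon> * (norm (q z) * \<omega> z)" if z: "z \<in> A" for z
  proof -
    have "norm (e z * cnj (q z) * of_real (\<omega> z)) = norm (e z) * (norm (q z) * \<omega> z)"
      using \<omega>_nonneg[of z] z A(2) by (auto simp: norm_mult)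
    also have "\<dots> \<le> \<epsilon> * (norm (q z) * \<omega> z)" using e(2)[OF z] \<omega>_nonneg[of z] z A(2) by (intro mult_right_mono) auto
    finally show ?thesis .
  qed
  show i: "set_integrable lborel A (\<lambda>z. e z * cnj (q z) * of_real (\<omega> z))"
  proof (rule set_integrable_bounded[OF A(1) bA])
    show "continuous_on A (\<lambda>z. e z * cnj (q z) * of_real (\<omega> z))"
      using A(2) by (intro continuous_intros e(1) continuous_on_subset[OF q] continuous_on_subset[OF \<omega>_cont]) auto
    fix z assume z: "z \<in> A"
    have "norm (q z) * \<omega> z \<le> B * W" using B W \<omega>_nonneg z A(2) by (intro mult_mono) auto
    then show "norm (e z * cnj (q z) * of_real (\<omega> z)) \<le> \<epsilon> * (B * W)"
      using le[OF z] e(3) mult_left_mono order_trans by blast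
  qed
  have i2: "set_integrable lborel D (\<lambda>z. \<epsilon> * (norm (q z) * \<omega> z))" using sq_norm_integrable(2)[OF q] by simp
  have i3: "set_integrable lborel A (\<lambda>z. \<epsilon> * (norm (q z) * \<omega> z))" by (rule set_integrable_subset[OF i2]) (use A in auto)
  have "norm (LINT z:A|lborel. e z * cnj (q z) * of_real (\<omega> z)) \<le> (LINT z:A|lborel. norm (e z * cnj (q z) * of_real (\<omega> z)))"
    by (rule set_integral_norm_bound[OF i])
  also have "\<dots> \<le> (LINT z:A|lborel. \<epsilon> * (norm (q z) * \<omega> z))"
    by (rule set_integral_mono[OF set_integrable_norm[OF i] i3 le])
  also have "\<dots> \<le> (LINT z:D|lborel. \<epsilon> * (norm (q z) * \<omega> z))"
  proof -
    have "(LINT z:A|lborel. \<epsilon> * (norm (q z) * \<omega> z)) \<le> (LINT z:D|lborel. \<epsilon> * (norm (q z) * \<omega> z))"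
      unfolding set_lebesgue_integral_def
    proof (rule integral_mono)
      show "integrable lborel (\<lambda>z. indicator A z *\<^sub>R (\<epsilon> * (norm (q z) * \<omega> z)))" "integrable lborel (\<lambda>z. indicator D z *\<^sub>R (\<epsilon> * (norm (q z) * \<omega> z)))"
        using i3 i2 by (auto simp: set_integrable_def)
      fix z show "indicator A z *\<^sub>R (\<epsilon> * (norm (q z) * \<omega> z)) \<le> indicator D z *\<^sub>R (\<epsilon> * (norm (q z) * \<omega> z))"
        using A(2) \<omega>_nonneg[of z] e(3) by (auto simp: indicator_def)
    qed
    then show ?thesis .
  qed
  also have "\<dots> = \<epsilon> * (LINT z:D|lborel. norm (q z) * \<omega> z)" by simp
  finally show "norm (LINT z:A|lborel. e z * cnj (q z) * of_real (\<omega> z)) \<le> \<epsilon> * (LINT z:D|lborel. norm (q z) * \<omega> z)" .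
qed

text \<open>\<open>P\<close> encodes \<open>q\<close> times the derivative of the chart times
  \<open>exp (- V)\<close>. In a pairing with the ansatz the two factors \<open>exp V\<close> then
  join the weight to form \<open>\<omega> * exp (2 Re V)\<close>.\<close>

definition matches :: "nat \<Rightarrow> (complex \<Rightarrow> complex) \<Rightarrow> (complex \<Rightarrow> complex) \<Rightarrow> bool"
  where "matches N P q \<longleftrightarrow> P holomorphic_on ball 0 (exp width) \<and> P 0 = 0 \<and>
    (\<forall>z. Re z > - width \<longrightarrow> transplant N P z = q (strip_map z) * deriv strip_map z * exp (- strip_V z))"

text \<open>In \<open>X = 1 / w\<close> the degree bound makes
  \<open>X ^ N * q (\<psi> (1 / X))\<close> tend to 0, so the singularity at 0 is removable with
  value 0. That is how the degree condition becomes \<open>P 0 = 0\<close>.\<close>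

lemma transplant_polynomial:
  assumes "degree q < N"
  obtains P where "matches N P (poly q)"
proof -
  define f where "f = (\<lambda>X. X ^ N * poly q (\<psi> (1 / X)) * deriv \<psi> (1 / X) * exp (- V (\<psi> (1 / X))))"
  define P where "P = (\<lambda>X. if X = 0 then 0 else f X)"
  let ?b = "ball 0 (exp width) :: complex set"
  have in1: "\<rho> < norm (1 / X)" if "X \<in> ?b - {0}" for X
  proof -
    have "norm X < exp width" "norm X > 0" using that by auto
    then have "inverse (exp width) < inverse (norm X)" by (intro less_imp_inverse_less)
    moreover have "inverse (exp width) = \<rho>" using \<rho> by (simp add: width_def exp_minus)
    ultimately show ?thesis by (simp add: norm_divide inverse_eq_divide)
  qed
  have f: "f holomorphic_on ?b - {0}"
  proof -
    have i: "(\<lambda>X. 1 / X) holomorphic_on ?b - {0}" by (intro holomorphic_intros) auto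
    have im: "(\<lambda>X. 1 / X) ` (?b - {0}) \<subseteq> {w. \<rho> < norm w}" using in1 by auto
    have 1: "(\<lambda>X. \<psi> (1 / X)) holomorphic_on ?b - {0}"
      using holomorphic_on_compose_gen[OF i \<psi>_hol im] by (simp add: o_def)
    have 2: "(\<lambda>X. deriv \<psi> (1 / X)) holomorphic_on ?b - {0}"
      using holomorphic_on_compose_gen[OF i holomorphic_deriv[OF \<psi>_hol open_chart] im] by (simp add: o_def)
    have 3: "(\<lambda>X. V (\<psi> (1 / X))) holomorphic_on ?b - {0}"
      using holomorphic_on_compose_gen[OF 1 V_hol, unfolded o_def] in1 by blast
    show ?thesis unfolding f_def poly_altdef by (intro holomorphic_intros 1 2 3)
  qed
  have P1: "P holomorphic_on ?b - {0}" by (rule holomorphic_transform[OF f]) (auto simp: P_def)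
  have inf: "filterlim (\<lambda>X::complex. 1 / X) at_infinity (at 0)"
    using filterlim_inverse_at_infinity[where 'a=complex] unfolding inverse_eq_divide[abs_def] .
  have lim: "(f \<longlongrightarrow> 0) (at 0)"
  proof -
    have a: "((\<lambda>X. \<psi> (1 / X) * X) \<longlongrightarrow> of_real (1 / \<kappa>)) (at 0)"
      using filterlim_compose[OF \<psi>_asymp inf] by simp
    have "((\<lambda>X. \<Sum>i\<le>degree q. coeff q i * (\<psi> (1 / X) * X) ^ i * X ^ (N - i)) \<longlongrightarrow> (\<Sum>i\<le>degree q. coeff q i * of_real (1 / \<kappa>) ^ i * 0 ^ (N - i))) (at 0)"
      by (intro tendsto_intros a)
    moreover have "(\<Sum>i\<le>degree q. coeff q i * of_real (1 / \<kappa>) ^ i * 0 ^ (N - i)) = (0::complex)"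
      using assms by (intro sum.neutral) auto
    moreover have "(\<Sum>i\<le>degree q. coeff q i * (\<psi> (1 / X) * X) ^ i * X ^ (N - i)) = X ^ N * poly q (\<psi> (1 / X))" for X
      unfolding poly_altdef sum_distrib_left
    proof (intro sum.cong refl)
      fix i assume "i \<in> {..degree q}"
      then have "X ^ N = X ^ i * X ^ (N - i)" using assms by (simp add: power_add[symmetric])
      then show "coeff q i * (\<psi> (1 / X) * X) ^ i * X ^ (N - i) = X ^ N * (coeff q i * \<psi> (1 / X) ^ i)"
        by (simp add: power_mult_distrib mult_ac)
    qed
    ultimately have l1: "((\<lambda>X. X ^ N * poly q (\<psi> (1 / X))) \<longlongrightarrow> 0) (at 0)" by simp
    have l2: "((\<lambda>X. deriv \<psi> (1 / X)) \<longlongrightarrow> of_real (1 / \<kappa>)) (at 0)" by (rule filterlim_compose[OF deriv_\<psi>_asymp inf])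
    have l3: "((\<lambda>X. V (\<psi> (1 / X))) \<longlongrightarrow> of_real v) (at 0)"
      by (rule filterlim_compose[OF V_inf filterlim_compose[OF strip_map_asymp(4) inf]])
    have "(f \<longlongrightarrow> 0 * of_real (1 / \<kappa>) * exp (- of_real v)) (at 0)"
      unfolding f_def by (intro tendsto_mult[OF tendsto_mult[OF l1 l2]] tendsto_exp tendsto_minus l3)
    then show ?thesis by simp
  qed
  have "isCont P 0"
  proof -
    have "(P \<longlongrightarrow> 0) (at 0)"
      using lim by (rule Lim_transform_eventually) (auto simp: P_def eventually_at_filter)
    then show ?thesis by (simp add: isCont_def P_def)
  qed
  moreover have "isCont P x" if "x \<in> ?b" "x \<noteq> 0" for x
    using holomorphic_on_imp_differentiable_at[OF P1, of x] that
    by (auto intro!: field_differentiable_imp_continuous_at)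
  ultimately have "continuous_on ?b P" unfolding continuous_on_eq_continuous_at[OF open_ball] by metis
  then have P: "P holomorphic_on ?b" by (rule no_isolated_singularity[where K="{0}"]) (use P1 in auto)
  have "transplant N P z = poly q (strip_map z) * deriv strip_map z * exp (- strip_V z)" if z: "Re z > - width" for z
  proof -
    have "transplant N P z = exp (of_nat (N + 1) * z) * exp (- z) ^ N * (poly q (\<psi> (exp z)) * deriv \<psi> (exp z) * exp (- V (\<psi> (exp z))))"
      by (simp add: transplant_def P_def f_def exp_minus divide_inverse)
    also have "exp (of_nat (N + 1) * z) * exp (- z) ^ N = exp z"
      unfolding exp_of_nat_mult[symmetric] exp_add[symmetric] by (simp add: algebra_simps)
    finally show ?thesis
      unfolding deriv_strip_map(1)[OF z] strip_V_def strip_map_def by (simp add: mult_ac)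
  qed
  then have "matches N P (poly q)" using P by (simp add: matches_def P_def)
  then show ?thesis by (rule that)
qed

text \<open>On the compact collar the transplanted weight is bounded below, so the unweighted
  \<open>L^1\<close> norm there is controlled by the weighted \<open>L^2\<close> norm on all of
  \<open>D\<close>.\<close>

lemma strip_L1_le:
  obtains K where "K \<ge> 0" "\<And>N P q. continuous_on UNIV q \<Longrightarrow> matches N P q \<Longrightarrow> strip_L1 c' (transplant N P) \<le> K * sqrt (sq_norm q)"
proof -
  define Om where "Om = (\<lambda>z. \<omega> (strip_map z) * exp (2 * Re (strip_V z)))"
  have Om_cont: "continuous_on (vstrip {-c'..0}) Om"
    unfolding Om_def by (intro continuous_intros strip_weight_cont continuous_on_subset[OF strip_V_cont vstrip_c'_subset])
  have Om_pos: "Om z > 0" if "z \<in> vstrip {-c'..0}" for z using \<omega>_strip_pos[OF that] by (simp add: Om_def)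
  obtain B where B: "B \<ge> 0" "\<And>x t. x \<in> {-c'..0} \<Longrightarrow> t \<in> {0..2*pi} \<Longrightarrow> norm (complex_of_real (1 / Om (Complex x t))) \<le> B"
    by (rule vstrip_sup_bound[of "{-c'..0}" "\<lambda>z. complex_of_real (1 / Om z)" c'])
      (use Om_pos in \<open>force intro!: continuous_intros Om_cont\<close>)+
  have "strip_L1 c' (transplant N P) \<le> (pi * c' + B / 2) * sqrt (sq_norm q)"
    if q: "continuous_on UNIV q" and m: "matches N P q" for N P q
  proof (rule le_sqrt_of_AM_GM)
    fix t :: real assume t: "t > 0"
    let ?T = "transplant N P"
    have contT: "continuous_on (vstrip {-width<..}) ?T"
      using periodic_holomorphic_onD(2)[OF transplant_periodic_holomorphic[of P width N]] m by (simp add: matches_def)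
    have sub: "{-c'..0} \<subseteq> {-width<..}" using c'_width by auto
    define f where "f = (\<lambda>z. complex_of_real ((norm (q z))\<^sup>2 * \<omega> z))"
    have fcont: "continuous_on (strip_map ` vstrip {-c'..0}) f"
      unfolding f_def by (intro continuous_intros \<omega>_strip_cont continuous_on_subset[OF q]) auto
    note col = collar_integral[of "{-width<..}" c' strip_map f, OF _ sub periodic_holomorphic_onD(1)[OF strip_map_periodic_holomorphic]
        inj_strip_map open_collar fcont]
    define g where "g = (\<lambda>z. (norm (deriv strip_map z))\<^sup>2 * ((norm (q (strip_map z)))\<^sup>2 * \<omega> (strip_map z)))"
    have gcont: "continuous_on (vstrip {-c'..0}) g"
      unfolding g_def
      by (intro continuous_intros strip_weight_cont continuous_on_subset[OF deriv_strip_map_cont vstrip_c'_subset]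
          continuous_on_compose2[OF q continuous_on_subset[OF strip_map_cont vstrip_c'_subset]]) auto
    \<comment> \<open>The modulus of \<open>exp (- V)\<close>, squared, cancels the factor
      \<open>exp (2 Re V)\<close> in \<open>Om\<close>; the squared derivative of the chart is the
      Jacobian.\<close>
    have geq: "(norm (?T z))\<^sup>2 * Om z = g z" if "z \<in> vstrip {-c'..0}" for z
    proof -
      have "Re z > - width" using that c'_width by (auto simp: vstrip_def)
      then have T: "?T z = q (strip_map z) * deriv strip_map z * exp (- strip_V z)" using m by (simp add: matches_def)
      have "exp (- Re (strip_V z)) * exp (- Re (strip_V z)) * exp (2 * Re (strip_V z)) = 1"
        unfolding exp_add[symmetric] by simp
      then show ?thesis unfolding T g_def Om_def norm_mult power_mult_distrib norm_exp_eq_Re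
        by (simp add: power2_eq_square mult_ac)
    qed
    have gc2: "continuous_on ({-c'..0} \<times> cbox 0 (2*pi)) (\<lambda>(x, s). g (Complex x s))"
      unfolding split_beta by (rule continuous_on_compose2[OF gcont]) (auto intro!: continuous_intros)
    have gi: "continuous_on {-c'..0} (\<lambda>x. integral {0..2*pi} (\<lambda>s. g (Complex x s)))"
      using integral_continuous_on_param[OF gc2] by simp
    have g_int: "integral {-c'..0} (\<lambda>x. integral {0..2*pi} (\<lambda>s. g (Complex x s))) \<le> sq_norm q"
    proof -
      have cm: "continuous_on {0..2*pi} (\<lambda>s. g (Complex x s))" if "x \<in> {-c'..0}" for x
        using that by (intro continuous_on_compose2[OF gcont]) (auto intro!: continuous_intros)
      have "(LINT z:strip_map ` half_open_collar c'|lborel. f z) =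
         integral {-c'..0} (\<lambda>x. integral {0..2*pi} (\<lambda>s. complex_of_real (g (Complex x s))))"
        using col(2) c' c'_width by (simp add: g_def f_def)
      also have "\<dots> = integral {-c'..0} (\<lambda>x. complex_of_real (integral {0..2*pi} (\<lambda>s. g (Complex x s))))"
        using cm by (intro integral_cong integral_of_real_ivl)
      also have "\<dots> = complex_of_real (integral {-c'..0} (\<lambda>x. integral {0..2*pi} (\<lambda>s. g (Complex x s))))"
        by (rule integral_of_real_ivl[OF gi])
      finally have "(LINT z:strip_map ` half_open_collar c'|lborel. (norm (q z))\<^sup>2 * \<omega> z) =
          integral {-c'..0} (\<lambda>x. integral {0..2*pi} (\<lambda>s. g (Complex x s)))"
        unfolding f_def set_integral_complex_of_real by (simp only: of_real_eq_iff)
      moreover have "(LINT z:strip_map ` half_open_collar c'|lborel. (norm (q z))\<^sup>2 * \<omega> z) \<le> sq_norm q"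
        unfolding sq_norm_def set_lebesgue_integral_def
      proof (rule integral_mono)
        have i: "set_integrable lborel D (\<lambda>z. (norm (q z))\<^sup>2 * \<omega> z)" by (rule sq_norm_integrable[OF q])
        then show "integrable lborel (\<lambda>z. indicator D z *\<^sub>R ((norm (q z))\<^sup>2 * \<omega> z))" by (simp add: set_integrable_def)
        have "set_integrable lborel (strip_map ` half_open_collar c') (\<lambda>z. (norm (q z))\<^sup>2 * \<omega> z)"
          by (rule set_integrable_subset[OF i]) (use open_collar[of c'] collar_subset[of c'] c'_width in auto)
        then show "integrable lborel (\<lambda>z. indicator (strip_map ` half_open_collar c') z *\<^sub>R ((norm (q z))\<^sup>2 * \<omega> z))"
          by (simp add: set_integrable_def)
        fix z show "indicator (strip_map ` half_open_collar c') z *\<^sub>R ((norm (q z))\<^sup>2 * \<omega> z) \<le> indicator D z *\<^sub>R ((norm (q z))\<^sup>2 * \<omega> z)"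
          using collar_subset[of c'] c'_width \<omega>_nonneg[of z] by (auto simp: indicator_def)
      qed
      ultimately show ?thesis by simp
    qed
    have pt: "norm (?T z) \<le> t / 2 + B / (2 * t) * g z" if z: "z = Complex x s" "x \<in> {-c'..0}" "s \<in> {0..2*pi}" for z x s
    proof -
      define n where "n = norm (?T z)"
      have zv: "z \<in> vstrip {-c'..0}" using z by simp
      have "2 * t * n \<le> t * t + n * n" using sum_squares_bound[of t n] by (simp add: power2_eq_square)
      then have 1: "n \<le> t / 2 + n\<^sup>2 / (2 * t)" using t by (simp add: field_simps power2_eq_square)
      have "1 / Om z \<le> B" using B(2)[OF z(2,3)] z(1) abs_ge_self[of "1 / Om z"] unfolding norm_of_real by simp
      then have "1 \<le> B * Om z" using Om_pos[OF zv] by (simp add: divide_le_eq)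
      then have "n\<^sup>2 * 1 \<le> n\<^sup>2 * (B * Om z)" by (intro mult_left_mono) auto
      also have "\<dots> = B * g z" using geq[OF zv] by (simp add: n_def mult_ac)
      finally have "n\<^sup>2 / (2 * t) \<le> B * g z / (2 * t)" using t by (intro divide_right_mono) auto
      then show ?thesis using 1 by (simp add: n_def)
    qed
    have gl: "continuous_on {0..2*pi} (\<lambda>s. g (Complex x s))" if "x \<in> {-c'..0}" for x
      by (rule continuous_on_compose2[OF gcont]) (use that in \<open>auto intro!: continuous_intros\<close>)
    have "strip_L1 c' ?T \<le> integral {-c'..0} (\<lambda>x. 2 * pi * (t / 2) + B / (2 * t) * integral {0..2*pi} (\<lambda>s. g (Complex x s)))"
      unfolding strip_L1_def
    proof (rule integral_le)
      show "(\<lambda>x. integral {0..2*pi} (\<lambda>s. norm (?T (Complex x s)))) integrable_on {-c'..0}"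
        by (intro integrable_continuous_real vline_norm_integral_continuous[OF contT sub])
      show "(\<lambda>x. 2 * pi * (t / 2) + B / (2 * t) * integral {0..2*pi} (\<lambda>s. g (Complex x s))) integrable_on {-c'..0}"
        by (intro integrable_continuous_real continuous_intros gi)
      fix x assume x: "x \<in> {-c'..0}"
      have "integral {0..2*pi} (\<lambda>s. norm (?T (Complex x s))) \<le> integral {0..2*pi} (\<lambda>s. t / 2 + B / (2 * t) * g (Complex x s))"
        using x sub by (intro integral_le integrable_continuous_real continuous_intros gl continuous_on_vline[OF contT] pt[OF refl]) auto
      also have "\<dots> = 2 * pi * (t / 2) + B / (2 * t) * integral {0..2*pi} (\<lambda>s. g (Complex x s))"
        using t by (subst integral_add) (auto intro!: integrable_continuous_real continuous_intros gl x)
      finally show "integral {0..2*pi} (\<lambda>s. norm (?T (Complex x s))) \<le> 2 * pi * (t / 2) + B / (2 * t) * integral {0..2*pi} (\<lambda>s. g (Complex x s))" .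
    qed
    also have "\<dots> = 2 * pi * (t / 2) * c' + B / (2 * t) * integral {-c'..0} (\<lambda>x. integral {0..2*pi} (\<lambda>s. g (Complex x s)))"
      using c' t by (subst integral_add) (auto intro!: integrable_continuous_real continuous_intros gi)
    also have "\<dots> \<le> 2 * pi * (t / 2) * c' + B / (2 * t) * sq_norm q"
      using g_int B(1) t by (intro add_left_mono mult_left_mono) auto
    finally show "strip_L1 c' ?T \<le> pi * c' * t + B / 2 * sq_norm q / t" by (simp add: mult_ac)
  qed (use c' B(1) q in \<open>auto simp: sq_norm_integrable\<close>)
  then show ?thesis using c' B(1) by (intro that[of "pi * c' + B / 2"]) auto
qed

end

section \<open>Almost orthogonality of the ansatz\<close>

context weighted_chart
begin

lemma main_term_holomorphic:
  assumes \<beta>: "\<beta> holomorphic_on ball 0 (exp a)" and a: "a \<le> width"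
  shows "main_term \<beta> N holomorphic_on region a"
proof -
  have op: "open (\<psi> ` {w. \<rho> < norm w})" by (intro open_\<psi>_image open_chart) auto
  have sub: "region a \<subseteq> \<psi> ` {w. \<rho> < norm w}" unfolding region_def using exp_minus_le[OF a] by auto
  have \<phi>h: "\<phi> holomorphic_on region a" and d\<phi>: "deriv \<phi> holomorphic_on region a" and V: "V holomorphic_on region a"
    using holomorphic_on_subset[OF \<phi>_hol sub] holomorphic_on_subset[OF holomorphic_deriv[OF \<phi>_hol op] sub]
      holomorphic_on_subset[OF V_hol sub] by auto
  have \<phi>n: "exp (- a) < norm (\<phi> z)" if "z \<in> region a" for z
    using that exp_minus_le[OF a] \<phi>_\<psi> by (auto simp: region_def)
  have \<phi>0: "\<phi> z \<noteq> 0" if "z \<in> region a" for z using \<phi>n[OF that] exp_gt_zero[of "- a"] by auto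
  have "(\<beta> \<circ> (\<lambda>z. 1 / \<phi> z)) holomorphic_on region a"
  proof (rule holomorphic_on_compose_gen[OF _ \<beta>])
    show "(\<lambda>z. 1 / \<phi> z) holomorphic_on region a" using \<phi>0 by (intro holomorphic_intros \<phi>h) auto
    show "(\<lambda>z. 1 / \<phi> z) ` region a \<subseteq> ball 0 (exp a)"
    proof clarify
      fix z assume z: "z \<in> region a"
      have "inverse (norm (\<phi> z)) < inverse (exp (- a))" using \<phi>n[OF z] by (intro less_imp_inverse_less) auto
      then show "1 / \<phi> z \<in> ball 0 (exp a)" by (simp add: norm_divide exp_minus inverse_eq_divide)
    qed
  qed
  then show ?thesis unfolding main_term_def[abs_def] o_def by (intro holomorphic_intros \<phi>h d\<phi> V)
qed

end

context orthogonality_chart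
begin

definition trunc_series :: "nat \<Rightarrow> nat \<Rightarrow> complex \<Rightarrow> complex"
  where "trunc_series M N X = (\<Sum>j\<le>M. expansion_coeff h j X / of_nat N ^ j)"

lemma coeff_holomorphic: "expansion_coeff h j holomorphic_on ball 0 (exp \<delta>)"
  by (rule expansion_coeff_holomorphic[where \<delta>=\<delta> and h=h, OF \<delta>_pos h_per h_0])

lemma trunc_series_holomorphic: "N > 0 \<Longrightarrow> trunc_series M N holomorphic_on ball 0 (exp \<delta>)"
  unfolding trunc_series_def[abs_def] by (intro holomorphic_intros coeff_holomorphic) auto

lemma trunc_series_0: "trunc_series M N 0 = 1"
proof -
  have z: "expansion_coeff h j 0 = 0" if "j > 0" for j
    by (rule expansion_coeff_at_0[where \<delta>=\<delta> and h=h, OF \<delta>_pos h_per h_0 that])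
  have "(\<Sum>j\<le>M. expansion_coeff h j 0 / of_nat N ^ j) = (\<Sum>j\<in>{0}. expansion_coeff h j 0 / of_nat N ^ j)"
    by (rule sum.mono_neutral_right) (auto simp: z)
  then show ?thesis by (simp add: trunc_series_def expansion_coeff_0)
qed

lemma coeff_bounded:
  assumes "a < \<delta>"
  obtains B where "\<And>j. B j \<ge> 0" "\<And>j X. norm X \<le> exp a \<Longrightarrow> norm (expansion_coeff h j X) \<le> B j"
proof -
  have "\<exists>B. B \<ge> 0 \<and> (\<forall>X. norm X \<le> exp a \<longrightarrow> norm (expansion_coeff h j X) \<le> B)" for j
  proof -
    have "exp a < exp \<delta>" using assms by simp
    have "cball 0 (exp a) \<subseteq> ball (0::complex) (exp \<delta>)"
    proof
      fix x :: complex assume "x \<in> cball 0 (exp a)"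
      then have "norm x \<le> exp a" by simp
      then show "x \<in> ball 0 (exp \<delta>)" unfolding mem_ball_0 using \<open>exp a < exp \<delta>\<close> by (rule order_le_less_trans)
    qed
    then have "bounded (expansion_coeff h j ` cball 0 (exp a))"
      using holomorphic_on_imp_continuous_on[OF coeff_holomorphic[of j]]
      by (intro compact_imp_bounded compact_continuous_image) (auto intro: continuous_on_subset)
    then obtain B where B: "\<And>X. X \<in> cball 0 (exp a) \<Longrightarrow> norm (expansion_coeff h j X) \<le> B" unfolding bounded_iff by blast
    then have "0 \<le> B" using order_trans[OF norm_ge_zero B[of 0]] by simp
    then show ?thesis using B by (intro exI[of _ B]) auto
  qed
  then show ?thesis using that by metis
qed

lemma trunc_series_bounded:
  assumes B: "\<And>j. B j \<ge> 0" "\<And>j X. norm X \<le> exp a \<Longrightarrow> norm (expansion_coeff h j X) \<le> B j"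
    and N: "N > 0" and X: "norm X \<le> exp a"
  shows "norm (trunc_series M N X) \<le> (\<Sum>j\<le>M. B j)"
  unfolding trunc_series_def
proof (rule sum_norm_le)
  fix j
  have "1 \<le> real N ^ j" using N by (intro one_le_power) auto
  then have "norm (expansion_coeff h j X / of_nat N ^ j) \<le> norm (expansion_coeff h j X)"
    using mult_left_mono[of 1 "real N ^ j" "norm (expansion_coeff h j X)"] N
    by (simp add: norm_divide norm_power divide_le_eq)
  then show "norm (expansion_coeff h j X / of_nat N ^ j) \<le> B j" using B(2)[OF X, of j] by linarith
qed

text \<open>The Jacobian is \<open>S * cnj S\<close> with \<open>S\<close> the derivative of the
  chart: one factor turns the main term into \<open>strip_main\<close>, the other turns
  \<open>q\<close> into its transplant, and \<open>exp V * cnj (exp V)\<close> joins the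
  weight.\<close>

lemma main_term_pairing:
  assumes c: "0 < c" "c \<le> c'" and q: "continuous_on UNIV q" and m: "matches N P q"
    and \<beta>: "\<beta> holomorphic_on ball 0 (exp \<delta>)"
  shows "set_integrable lborel (strip_map ` half_open_collar c) (\<lambda>z. main_term \<beta> N z * cnj (q z) * of_real (\<omega> z))"
    and "(LINT z:strip_map ` half_open_collar c|lborel. main_term \<beta> N z * cnj (q z) * of_real (\<omega> z)) =
      integral {-c..0} (vline_integral (\<lambda>z. exp (of_nat (N + 1) * z) * \<beta> (exp (- z)) *
        of_real (\<omega> (strip_map z) * exp (2 * Re (strip_V z))) * cnj (transplant N P z)))"
proof -
  have cw: "c < width" using c c'_width by simp
  have sub: "{-c..0} \<subseteq> {-width<..}" using cw by auto
  let ?f = "\<lambda>z. main_term \<beta> N z * cnj (q z) * of_real (\<omega> z)"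
  have sub2: "strip_map ` vstrip {-c..0} \<subseteq> region \<delta>" "strip_map ` vstrip {-c..0} \<subseteq> strip_map ` vstrip {-c'..0}"
    using c c' by (auto simp: region_eq vstrip_def)
  have fc: "continuous_on (strip_map ` vstrip {-c..0}) ?f"
    using holomorphic_on_imp_continuous_on[OF main_term_holomorphic[OF \<beta> c'(3)]] q \<omega>_strip_cont sub2
    by (intro continuous_intros) (auto intro: continuous_on_subset)
  note col = collar_integral[of "{-width<..}" c strip_map ?f, OF _ sub periodic_holomorphic_onD(1)[OF strip_map_periodic_holomorphic]
        inj_strip_map open_collar fc]
  show "set_integrable lborel (strip_map ` half_open_collar c) ?f" using col(1) cw by simp
  have pt: "of_real ((norm (deriv strip_map z))\<^sup>2) * ?f (strip_map z) = exp (of_nat (N + 1) * z) * \<beta> (exp (- z)) *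
        of_real (\<omega> (strip_map z) * exp (2 * Re (strip_V z))) * cnj (transplant N P z)" if z: "Re z > - width" for z
  proof -
    define S where "S = deriv strip_map z"
    define E where "E = exp (strip_V z)"
    have T: "transplant N P z = q (strip_map z) * S * exp (- strip_V z)" using m z by (simp add: matches_def S_def)
    have TE: "q (strip_map z) * S = transplant N P z * E" unfolding T E_def by (simp add: exp_minus)
    have mt: "main_term \<beta> N (strip_map z) * S = exp (of_nat (N + 1) * z) * E * \<beta> (exp (- z))"
      using main_term_strip_map[OF z, of \<beta> N] by (simp add: S_def E_def strip_main_def)
    have EE: "E * cnj E = of_real (exp (2 * Re (strip_V z)))"
    proof -
      have "E * cnj E = of_real ((norm E)\<^sup>2)" by (rule complex_norm_square[symmetric])
      also have "(norm E)\<^sup>2 = exp (2 * Re (strip_V z))" by (simp add: E_def power2_eq_square exp_add[symmetric])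
      finally show ?thesis .
    qed
    have "of_real ((norm S)\<^sup>2) * ?f (strip_map z) = (main_term \<beta> N (strip_map z) * S) * cnj (q (strip_map z) * S) * of_real (\<omega> (strip_map z))"
      unfolding complex_norm_square by (simp add: mult_ac)
    also have "\<dots> = exp (of_nat (N + 1) * z) * \<beta> (exp (- z)) * (of_real (\<omega> (strip_map z)) * (E * cnj E)) * cnj (transplant N P z)"
      unfolding mt TE by (simp add: mult_ac)
    finally show ?thesis unfolding EE S_def by simp
  qed
  have "(LINT z:strip_map ` half_open_collar c|lborel. ?f z) =
     integral {-c..0} (\<lambda>x. integral {0..2*pi} (\<lambda>t. of_real ((norm (deriv strip_map (Complex x t)))\<^sup>2) * ?f (strip_map (Complex x t))))"
    using col(2) cw by simp
  also have "\<dots> = integral {-c..0} (vline_integral (\<lambda>z. exp (of_nat (N + 1) * z) * \<beta> (exp (- z)) *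
        of_real (\<omega> (strip_map z) * exp (2 * Re (strip_V z))) * cnj (transplant N P z)))"
    unfolding vline_integral_def using cw by (intro integral_cong pt) auto
  finally show "(LINT z:strip_map ` half_open_collar c|lborel. ?f z) = integral {-c..0} (vline_integral (\<lambda>z. exp (of_nat (N + 1) * z) * \<beta> (exp (- z)) *
        of_real (\<omega> (strip_map z) * exp (2 * Re (strip_V z))) * cnj (transplant N P z)))" .
qed

lemma weighted_inner_diff:
  assumes "continuous_on UNIV f" "continuous_on UNIV g" "continuous_on UNIV q"
  shows "weighted_inner D \<omega> (\<lambda>z. a * f z - g z) q = a * weighted_inner D \<omega> f q - weighted_inner D \<omega> g q"
proof -
  have i: "set_integrable lborel D (\<lambda>z. u z * cnj (q z) * of_real (\<omega> z))" if u: "continuous_on UNIV u" for u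
  proof -
    obtain B where "B \<ge> 0" "\<And>z. z \<in> D \<Longrightarrow> norm (u z) \<le> B" using bounded_cont_on_D[OF u] by blast
    then show ?thesis using u by (intro error_integral_le(1)[of D u B q] assms(3)) (auto intro: continuous_on_subset)
  qed
  note if' = set_integrable_dA(1)[OF i[OF assms(1)]] and ig = set_integrable_dA(1)[OF i[OF assms(2)]]
  have "weighted_inner D \<omega> (\<lambda>z. a * f z - g z) q = (LINT z:D|dA. a * (f z * cnj (q z) * of_real (\<omega> z)) - g z * cnj (q z) * of_real (\<omega> z))"
    unfolding weighted_inner_def by (simp add: left_diff_distrib mult.assoc)
  also have "\<dots> = a * weighted_inner D \<omega> f q - weighted_inner D \<omega> g q"
    unfolding weighted_inner_def using if' ig by (subst set_integral_diff(2)) auto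
  finally show ?thesis .
qed

text \<open>The level \<open>c\<close> used below; the factor lies between \<open>1/2\<close> and 1,
  as \<open>c < c' < 2 * c\<close> demands.\<close>

definition inner_width :: real where "inner_width = 3 / 4 * c'"

text \<open>The rescaled orthogonal polynomial and \<open>Q\<close> have the same leading
  coefficient, so their difference \<open>r\<close> has degree below \<open>N\<close> and is an
  admissible test polynomial. It is orthogonal to \<open>p\<close>, hence its squared norm is, up to
  sign, its pairing with \<open>Q\<close>, which is at most a small constant times the norm of
  \<open>r\<close>.\<close>

lemma projection_estimate:
  obtains K a where "K \<ge> 0" "a > 0"
    "\<And>N p. N > 0 \<Longrightarrow> monic_orthogonal_poly D \<omega> N p \<Longrightarrow> \<exists>Q P.
       (\<forall>z. Re z \<ge> - inner_width \<longrightarrow> norm (poly Q (strip_map z) - main_term (trunc_series M N) N (strip_map z)) \<le> K * exp (- (inner_width + a) * real N)) \<and>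
       matches N P (\<lambda>z. of_real (\<kappa> ^ (N + 1) * exp v) * poly p z - poly Q z) \<and>
       strip_L1 c' (transplant N P) \<le> K / real N ^ Suc M"
proof -
  \<comment> \<open>The fractions realize \<open>c2 < c < c1 < c' < \<delta>\<close> together with
    \<open>c' < 2 * c\<close>; the gap between \<open>c1\<close> and \<open>c\<close> is the
    exponential gain \<open>a\<close>.\<close>
  define c where "c = 3 / 4 * c'"
  define c1 where "c1 = 7 / 8 * c'"
  define c2 where "c2 = c' / 2"
  have c: "0 < c2" "c2 < c" "c < c1" "c1 < \<delta>" "\<delta> \<le> width" using c' by (auto simp: c_def c1_def c2_def)
  have cc: "0 < c" "c < c'" "c' < 2 * c" "c' < \<delta>" using c' by (auto simp: c_def)
  obtain C1 where C1: "C1 \<ge> 0"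
    "\<And>N \<beta> B. \<beta> holomorphic_on ball 0 (exp \<delta>) \<Longrightarrow> \<beta> 0 = 1 \<Longrightarrow> (\<And>x. x \<in> cball 0 (exp c1) \<Longrightarrow> norm (\<beta> x) \<le> B) \<Longrightarrow>
      \<exists>Q. degree Q \<le> N \<and> coeff Q N = of_real (\<kappa> ^ (N + 1) * exp v) \<and>
       (\<forall>z. Re z \<ge> - c \<longrightarrow> norm (poly Q (strip_map z) - main_term \<beta> N (strip_map z)) \<le> C1 * B * exp (- c1 * real N)) \<and>
       (\<forall>z. z \<notin> region c \<longrightarrow> norm (poly Q z) \<le> C1 * B * exp (- c2 * real N))"
    using approximating_polynomial[OF c] by blast
  obtain Bj where Bj: "\<And>j. Bj j \<ge> 0" "\<And>j X. norm X \<le> exp c1 \<Longrightarrow> norm (expansion_coeff h j X) \<le> Bj j"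
    using coeff_bounded[OF c(4)] by blast
  define B where "B = (\<Sum>j\<le>M. Bj j)"
  have B0: "B \<ge> 0" unfolding B_def using Bj(1) by (intro sum_nonneg)
  let ?F = "\<lambda>z. complex_of_real (\<omega> (strip_map z) * exp (2 * Re (strip_V z)))"
  have Fc: "continuous_on (vstrip {-c..0}) ?F"
  proof -
    have "vstrip {-c..0} \<subseteq> vstrip {-c'..0}" using cc by (auto simp: vstrip_def)
    then show ?thesis
      using continuous_on_subset[OF strip_weight_cont] continuous_on_subset[OF strip_V_cont] vstrip_c'_subset
      by (intro continuous_intros) blast+
  qed
  obtain C2 where C2: "C2 \<ge> 0" "\<And>N P. N > 0 \<Longrightarrow> P holomorphic_on ball 0 (exp \<delta>) \<Longrightarrow> P 0 = 0 \<Longrightarrow>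
     norm (integral {-c..0} (vline_integral (\<lambda>z. exp (of_nat (N + 1) * z) *
        (\<Sum>j\<le>M. expansion_coeff h j (exp (- z)) / of_nat N ^ j) * ?F z * cnj (transplant N P z)))) \<le>
       C2 / real N ^ Suc M * strip_L1 c' (transplant N P)"
    using oscillatory_estimate[where \<delta>=\<delta> and h=h and F="?F" and Cx=Cx and M=M, OF \<delta>_pos h_per h_0 h_exp Fc cc] by blast
  obtain K1 where K1: "K1 \<ge> 0" "\<And>q. continuous_on UNIV q \<Longrightarrow> (LINT z:D|lborel. norm (q z) * \<omega> z) \<le> K1 * sqrt (sq_norm q)"
    using L1_norm_le by blast
  obtain K2 where K2: "K2 \<ge> 0" "\<And>N P q. continuous_on UNIV q \<Longrightarrow> matches N P q \<Longrightarrow> strip_L1 c' (transplant N P) \<le> K2 * sqrt (sq_norm q)"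
    using strip_L1_le by blast
  define E2 where "E2 = fact (Suc M) / c2 ^ Suc M"
  have E2: "exp (- c2 * real N) \<le> E2 / real N ^ Suc M" if N: "N > 0" for N
  proof -
    have "exp (- (real N * c2)) * c2 ^ Suc M \<le> fact (Suc M) / real N ^ Suc M"
      using c by (intro exp_minus_power_le[OF N]) auto
    moreover have "c2 ^ Suc M > 0" using c by simp
    ultimately have "exp (- (real N * c2)) \<le> fact (Suc M) / real N ^ Suc M / c2 ^ Suc M"
      by (simp only: pos_le_divide_eq)
    then show ?thesis by (simp add: E2_def mult.commute)
  qed
  define K3 where "K3 = C2 * K2 + 2 * (C1 * B * E2 * K1)"
  have E20: "E2 \<ge> 0" using c by (simp add: E2_def)
  have K3: "K3 \<ge> 0" unfolding K3_def using C1(1) C2(1) K1(1) K2(1) B0 E20 by simp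
  define K where "K = max (C1 * B) (K2 * K3)"
  have main: "\<exists>Q P.
       (\<forall>z. Re z \<ge> - c \<longrightarrow> norm (poly Q (strip_map z) - main_term (trunc_series M N) N (strip_map z)) \<le> K * exp (- c1 * real N)) \<and>
       matches N P (\<lambda>z. of_real (\<kappa> ^ (N + 1) * exp v) * poly p z - poly Q z) \<and>
       strip_L1 c' (transplant N P) \<le> K / real N ^ Suc M"
    if N: "N > 0" and p: "monic_orthogonal_poly D \<omega> N p" for N p
  proof -
    define \<beta> where "\<beta> = trunc_series M N"
    have \<beta>: "\<beta> holomorphic_on ball 0 (exp \<delta>)" "\<beta> 0 = 1" "\<And>x. x \<in> cball 0 (exp c1) \<Longrightarrow> norm (\<beta> x) \<le> B"
      using trunc_series_holomorphic[OF N] trunc_series_0 trunc_series_bounded[OF Bj N] by (auto simp: \<beta>_def B_def)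
    define lam where "lam = complex_of_real (\<kappa> ^ (N + 1) * exp v)"
    obtain Q where Q: "degree Q \<le> N" "coeff Q N = lam"
       "\<And>z. Re z \<ge> - c \<Longrightarrow> norm (poly Q (strip_map z) - main_term \<beta> N (strip_map z)) \<le> C1 * B * exp (- c1 * real N)"
       "\<And>z. z \<notin> region c \<Longrightarrow> norm (poly Q z) \<le> C1 * B * exp (- c2 * real N)"
      using C1(2)[OF \<beta>, of N] unfolding lam_def by blast
    have pp: "degree p = N" "coeff p N = 1" "\<And>q. degree q < N \<Longrightarrow> weighted_inner D \<omega> (poly p) (poly q) = 0"
      using p unfolding monic_orthogonal_poly_def by auto
    define r where "r = smult lam p - Q"
    have polyr: "poly r = (\<lambda>z. lam * poly p z - poly Q z)" by (auto simp: r_def)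
    have "degree r \<le> N" unfolding r_def using Q(1) pp(1) by (intro degree_diff_le) (auto intro: order_trans[OF degree_smult_le])
    moreover have "coeff r N = 0" using Q(2) pp(2) by (simp add: r_def)
    ultimately have dr: "degree r < N"
      using N by (metis degree_0 leading_coeff_0_iff order_le_less)
    have cont: "continuous_on UNIV (poly s)" for s :: "complex poly" by (intro continuous_intros)
    obtain P where P: "matches N P (poly r)" using transplant_polynomial[OF dr] by blast
    have P': "P holomorphic_on ball 0 (exp \<delta>)" "P 0 = 0"
      using P c(5) holomorphic_on_subset[of P "ball 0 (exp width)" "ball 0 (exp \<delta>)"]
      by (auto simp: matches_def subset_ball)
    define S where "S = sq_norm (poly r)"
    have S0: "S \<ge> 0" unfolding S_def by (rule sq_norm_integrable(3)[OF cont])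
    define \<epsilon> where "\<epsilon> = C1 * B * exp (- c2 * real N)"
    have \<epsilon>0: "\<epsilon> \<ge> 0" using C1(1) B0 by (simp add: \<epsilon>_def)
    define \<Gamma> where "\<Gamma> = strip_map ` half_open_collar c"
    have cw: "c \<le> width" using c by simp
    have \<Gamma>: "\<Gamma> \<in> sets borel" "\<Gamma> \<subseteq> D" "open \<Gamma>"
      using open_collar[OF cw] collar_subset[OF cw] by (auto simp: \<Gamma>_def)
    have D\<Gamma>: "D - \<Gamma> = - region c" unfolding \<Gamma>_def using collar_complement[OF cc(1) cw] .
    define L where "L = (LINT z:D|lborel. norm (poly r z) * \<omega> z)"
    have L: "L \<le> K1 * sqrt S" unfolding L_def S_def by (rule K1(2)[OF cont])
    have mt: "continuous_on \<Gamma> (main_term \<beta> N)"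
      using c cc by (intro holomorphic_on_imp_continuous_on holomorphic_on_subset[OF main_term_holomorphic[OF \<beta>(1) c(5)]])
        (auto simp: \<Gamma>_def region_eq half_open_collar_def)
    have e1: "norm (poly Q z - main_term \<beta> N z) \<le> \<epsilon>" if z\<Gamma>: "z \<in> \<Gamma>" for z
    proof -
      obtain u where u: "u \<in> half_open_collar c" "z = strip_map u" using z\<Gamma> by (auto simp: \<Gamma>_def)
      then have "norm (poly Q z - main_term \<beta> N z) \<le> C1 * B * exp (- c1 * real N)" using Q(3)[of u] by (auto simp: half_open_collar_def)
      also have "\<dots> \<le> \<epsilon>" unfolding \<epsilon>_def using C1(1) B0 c by (intro mult_left_mono) (auto intro!: mult_right_mono)
      finally show ?thesis .
    qed
    note i1 = error_integral_le[OF \<Gamma>(1,2) continuous_on_diff[OF continuous_on_subset[OF cont subset_UNIV] mt] e1 \<epsilon>0 cont[of r]]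
    have e2: "norm (poly Q z) \<le> \<epsilon>" if "z \<in> D - \<Gamma>" for z using Q(4)[of z] that unfolding D\<Gamma> \<epsilon>_def by auto
    have D\<Gamma>m: "D - \<Gamma> \<in> sets borel" using \<Gamma>(1) D_measurable by auto
    note i2 = error_integral_le[OF D\<Gamma>m Diff_subset continuous_on_subset[OF cont[of Q] subset_UNIV] e2 \<epsilon>0 cont[of r]]
    note i3 = main_term_pairing[OF cc(1) less_imp_le[OF cc(2)] cont P \<beta>(1)]
    have I1: "(LINT z:\<Gamma>|lborel. poly Q z * cnj (poly r z) * of_real (\<omega> z)) =
      (LINT z:\<Gamma>|lborel. main_term \<beta> N z * cnj (poly r z) * of_real (\<omega> z)) +
      (LINT z:\<Gamma>|lborel. (poly Q z - main_term \<beta> N z) * cnj (poly r z) * of_real (\<omega> z))"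
      and I1i: "set_integrable lborel \<Gamma> (\<lambda>z. poly Q z * cnj (poly r z) * of_real (\<omega> z))"
    proof -
      have eq: "main_term \<beta> N z * cnj (poly r z) * of_real (\<omega> z) + (poly Q z - main_term \<beta> N z) * cnj (poly r z) * of_real (\<omega> z)
         = poly Q z * cnj (poly r z) * of_real (\<omega> z)" for z by (simp add: algebra_simps)
      show "(LINT z:\<Gamma>|lborel. poly Q z * cnj (poly r z) * of_real (\<omega> z)) =
        (LINT z:\<Gamma>|lborel. main_term \<beta> N z * cnj (poly r z) * of_real (\<omega> z)) +
        (LINT z:\<Gamma>|lborel. (poly Q z - main_term \<beta> N z) * cnj (poly r z) * of_real (\<omega> z))"
        using set_integral_add(2)[OF i3(1)[folded \<Gamma>_def] i1(1)] unfolding eq .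
      show "set_integrable lborel \<Gamma> (\<lambda>z. poly Q z * cnj (poly r z) * of_real (\<omega> z))"
        using set_integral_add(1)[OF i3(1)[folded \<Gamma>_def] i1(1)] unfolding eq .
    qed
    \<comment> \<open>On the collar \<open>Q\<close> is the main term up to an exponential error; on
      the rest of \<open>D\<close> it is itself exponentially small.\<close>
    have "D = \<Gamma> \<union> (D - \<Gamma>)" using \<Gamma>(2) by auto
    then have I2: "(LINT z:D|lborel. poly Q z * cnj (poly r z) * of_real (\<omega> z)) =
       (LINT z:\<Gamma>|lborel. poly Q z * cnj (poly r z) * of_real (\<omega> z)) + (LINT z:D - \<Gamma>|lborel. poly Q z * cnj (poly r z) * of_real (\<omega> z))"
      and I2i: "set_integrable lborel D (\<lambda>z. poly Q z * cnj (poly r z) * of_real (\<omega> z))"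
      using set_integral_Un[OF _ I1i i2(1)] set_integrable_Un[OF I1i i2(1)] \<Gamma>(1) D\<Gamma>m by auto
    have J: "norm (LINT z:D|lborel. poly Q z * cnj (poly r z) * of_real (\<omega> z)) \<le> K3 / real N ^ Suc M * sqrt S"
    proof -
      have "norm (LINT z:D|lborel. poly Q z * cnj (poly r z) * of_real (\<omega> z)) \<le>
        norm (LINT z:\<Gamma>|lborel. main_term \<beta> N z * cnj (poly r z) * of_real (\<omega> z)) + \<epsilon> * L + \<epsilon> * L"
        unfolding I2 I1 using i1(2) i2(2) unfolding L_def
        by (intro order_trans[OF norm_triangle_ineq] add_mono order_trans[OF norm_triangle_ineq]) auto
      also have "norm (LINT z:\<Gamma>|lborel. main_term \<beta> N z * cnj (poly r z) * of_real (\<omega> z)) \<le> C2 / real N ^ Suc M * strip_L1 c' (transplant N P)"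
        using C2(2)[OF N P'] i3(2) unfolding \<Gamma>_def \<beta>_def trunc_series_def by simp
      also have "\<dots> \<le> C2 / real N ^ Suc M * (K2 * sqrt S)"
        unfolding S_def using C2(1) by (intro mult_left_mono K2(2)[OF cont P]) auto
      also have "\<epsilon> * L \<le> C1 * B * (E2 / real N ^ Suc M) * (K1 * sqrt S)"
      proof -
        have "\<epsilon> \<le> C1 * B * (E2 / real N ^ Suc M)" unfolding \<epsilon>_def using E2[OF N] C1(1) B0 by (intro mult_left_mono) auto
        then show ?thesis using L \<epsilon>0 K1(1) S0 C1(1) B0 E20
          by (intro order_trans[OF mult_left_mono[OF L \<epsilon>0]] mult_right_mono) auto
      qed
      finally have "norm (LINT z:D|lborel. poly Q z * cnj (poly r z) * of_real (\<omega> z)) \<le>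
        C2 / real N ^ Suc M * (K2 * sqrt S) + C1 * B * (E2 / real N ^ Suc M) * (K1 * sqrt S) + C1 * B * (E2 / real N ^ Suc M) * (K1 * sqrt S)"
        by simp
      also have "\<dots> = K3 / real N ^ Suc M * sqrt S" using N by (simp add: K3_def field_simps)
      finally show ?thesis .
    qed
    have "weighted_inner D \<omega> (poly r) (poly r) = lam * weighted_inner D \<omega> (poly p) (poly r) - weighted_inner D \<omega> (poly Q) (poly r)"
      using weighted_inner_diff[OF cont[of p] cont[of Q] cont[of r], of lam] unfolding polyr .
    also have "weighted_inner D \<omega> (poly p) (poly r) = 0" by (rule pp(3)[OF dr])
    also have "weighted_inner D \<omega> (poly Q) (poly r) = (LINT z:D|lborel. poly Q z * cnj (poly r z) * of_real (\<omega> z)) / of_real pi"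
      unfolding weighted_inner_def by (rule set_integrable_dA(2)[OF I2i])
    finally have "of_real (S / pi) = - (LINT z:D|lborel. poly Q z * cnj (poly r z) * of_real (\<omega> z)) / of_real pi"
      unfolding weighted_inner_self[OF cont] S_def by simp
    then have "of_real S = - (LINT z:D|lborel. poly Q z * cnj (poly r z) * of_real (\<omega> z))" by (simp add: field_simps)
    then have "S = norm (LINT z:D|lborel. poly Q z * cnj (poly r z) * of_real (\<omega> z))"
      using S0 by (metis abs_of_nonneg norm_minus_cancel norm_of_real)
    then have "sqrt S * sqrt S \<le> K3 / real N ^ Suc M * sqrt S" using J S0 by simp
    \<comment> \<open>Division by the norm of \<open>r\<close>; the case of norm zero is
      trivial.\<close>
    then have "sqrt S \<le> K3 / real N ^ Suc M"
    proof (cases "sqrt S = 0")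
      case True
      then show ?thesis using K3 by simp
    next
      case False
      then have "sqrt S > 0" using S0 by (simp add: order_less_le)
      then show ?thesis using \<open>sqrt S * sqrt S \<le> K3 / real N ^ Suc M * sqrt S\<close> by (simp only: mult_le_cancel_right_pos)
    qed
    then have "strip_L1 c' (transplant N P) \<le> K2 * (K3 / real N ^ Suc M)"
      using K2 mult_left_mono[OF _ K2(1)] K2(2)[OF cont P] unfolding S_def by (meson order_trans)
    also have "\<dots> \<le> K / real N ^ Suc M" unfolding K_def by (simp add: divide_right_mono)
    finally have 1: "strip_L1 c' (transplant N P) \<le> K / real N ^ Suc M" .
    have "norm (poly Q (strip_map z) - main_term (trunc_series M N) N (strip_map z)) \<le> K * exp (- c1 * real N)" if "Re z \<ge> - c" for z
    proof -
      have "C1 * B * exp (- c1 * real N) \<le> K * exp (- c1 * real N)" unfolding K_def by (intro mult_right_mono) auto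
      then show ?thesis using Q(3)[OF that] unfolding \<beta>_def by linarith
    qed
    then show ?thesis using 1 P unfolding polyr lam_def by blast
  qed
  have K0: "K \<ge> 0" unfolding K_def using C1(1) B0 by (simp add: le_max_iff_disj)
  have "inner_width = c" "inner_width + (c1 - c) = c1" by (auto simp: inner_width_def c_def)
  then show ?thesis using main c(3) by (intro that[OF K0, of "c1 - c"]) auto
qed

end

section \<open>From mean-square to pointwise estimates\<close>

lemma one_minus_exp_ge:
  assumes "0 \<le> t" "t \<le> (1::real)" shows "t / 2 \<le> 1 - exp (- t)"
proof -
  have "exp (- t) \<le> 1 / (1 + t)"
    using exp_ge_add_one_self[of t] assms by (simp add: exp_minus inverse_eq_divide frac_le)
  moreover have "t / 2 \<le> 1 - 1 / (1 + t)" using assms by (simp add: field_simps mult_left_le)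
  ultimately show ?thesis by linarith
qed

context exterior_chart
begin

text \<open>The limit controls a neighbourhood of infinity; what remains is a compact
  annulus.\<close>

lemma chart_bounded:
  fixes f :: "complex \<Rightarrow> complex"
  assumes f: "continuous_on {w. \<rho> < norm w} f" "(f \<longlongrightarrow> L) at_infinity" and r: "r > \<rho>"
  obtains B where "B \<ge> 0" "\<And>w. r \<le> norm w \<Longrightarrow> norm (f w) \<le> B"
proof -
  have "\<forall>\<^sub>F w in at_infinity. dist (f w) L < 1" using f(2) by (rule tendstoD) simp
  then obtain X where X: "\<And>w. X \<le> norm w \<Longrightarrow> dist (f w) L < 1" unfolding eventually_at_infinity by blast
  have "compact {w::complex. r \<le> norm w \<and> norm w \<le> X}"
  proof -
    have "{w::complex. r \<le> norm w \<and> norm w \<le> X} = cball 0 X - ball 0 r" by auto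
    then show ?thesis by (simp add: compact_diff)
  qed
  moreover have "continuous_on {w. r \<le> norm w \<and> norm w \<le> X} f" using r by (intro continuous_on_subset[OF f(1)]) auto
  ultimately have "bounded (f ` {w. r \<le> norm w \<and> norm w \<le> X})" using compact_continuous_image compact_imp_bounded by blast
  then obtain B where B: "\<And>w. r \<le> norm w \<Longrightarrow> norm w \<le> X \<Longrightarrow> norm (f w) \<le> B" unfolding bounded_iff by blast
  show ?thesis
  proof (rule that[of "max (max 0 B) (norm L + 1)"])
    fix w :: complex assume w: "r \<le> norm w"
    show "norm (f w) \<le> max (max 0 B) (norm L + 1)"
    proof (cases "norm w \<le> X")
      case True
      then show ?thesis using B[OF w] by simp
    next
      case False
      then have "norm (f w - L) < 1" using X[of w] by (simp add: dist_norm)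
      then have "norm (f w) \<le> norm L + 1" using norm_triangle_sub[of "f w" L] by simp
      then show ?thesis by simp
    qed
  qed simp
qed

text \<open>Translates distance from the closed exterior into depth in the strip:
  \<open>\<phi>\<close> is Lipschitz near the boundary, so \<open>|\<phi> z| \<ge> 1 - L e\<close>,
  and a logarithm gives the bound for \<open>Re u\<close>.\<close>

lemma near_boundary:
  obtains \<eta> L where "\<eta> > 0" "L > 0"
    "\<And>z e. 0 \<le> e \<Longrightarrow> e < \<eta> \<Longrightarrow> infdist z (- D) \<le> e \<Longrightarrow> \<exists>u. z = strip_map u \<and> Re u \<ge> - (L * e)"
proof -
  define a where "a = width / 2"
  have a: "0 < a" "a \<le> width" using width_pos by (auto simp: a_def)
  obtain R where R: "\<And>z. z \<in> D \<Longrightarrow> norm z \<le> R" using bounded_D bounded_iff by blast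
  \<comment> \<open>Contains the nearest exterior point of every point of \<open>D\<close> at
    distance at most 1 from the exterior.\<close>
  define K where "K = - D \<inter> cball 0 (R + 1)"
  have K: "compact K" unfolding K_def using open_D by (intro closed_Int_compact) auto
  have "K \<subseteq> region a" unfolding K_def using region_contains[OF a(1)] by auto
  then obtain e0 where e0: "e0 > 0" "(\<Union>x\<in>K. cball x e0) \<subseteq> region a"
    using compact_subset_open_imp_cball_epsilon_subset[OF K open_region[OF a(2)]] by metis
  have cmpS: "compact (\<Union>x\<in>K. cball x e0)"
  proof -
    have "(\<Union>x\<in>K. cball x e0) = {x + y |x y. x \<in> K \<and> y \<in> cball 0 e0}"
    proof (intro equalityI subsetI)
      fix z assume "z \<in> (\<Union>x\<in>K. cball x e0)"
      then obtain x where x: "x \<in> K" "dist x z \<le> e0" by auto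
      then show "z \<in> {x + y |x y. x \<in> K \<and> y \<in> cball 0 e0}"
        by (intro CollectI exI[of _ x] exI[of _ "z - x"]) (auto simp: dist_norm norm_minus_commute)
    next
      fix z assume "z \<in> {x + y |x y. x \<in> K \<and> y \<in> cball 0 e0}"
      then obtain x y where "z = x + y" "x \<in> K" "norm y \<le> e0" by auto
      then show "z \<in> (\<Union>x\<in>K. cball x e0)" by (intro UN_I[of x]) (auto simp: dist_norm)
    qed
    then show ?thesis using compact_sums[OF K compact_cball[of 0 e0]] by simp
  qed
  have opi: "open (\<psi> ` {w. \<rho> < norm w})" by (intro open_\<psi>_image open_chart) auto
  have sub: "region a \<subseteq> \<psi> ` {w. \<rho> < norm w}" unfolding region_def using exp_minus_le[OF a(2)] by auto
  have "bounded (deriv \<phi> ` (\<Union>x\<in>K. cball x e0))"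
    using e0(2) sub
    by (intro compact_imp_bounded compact_continuous_image cmpS
        continuous_on_subset[OF holomorphic_on_imp_continuous_on[OF holomorphic_deriv[OF \<phi>_hol opi]]]) auto
  then obtain B where B: "\<And>x. x \<in> (\<Union>x\<in>K. cball x e0) \<Longrightarrow> norm (deriv \<phi> x) \<le> B" unfolding bounded_iff by blast
  define L where "L = max 1 B"
  have L: "L \<ge> 1" by (simp add: L_def)
  \<comment> \<open>The last bound gives \<open>L * e \<le> 1/2\<close>, where
    \<open>ln (1 - y) \<ge> - 2 * y\<close> holds; it is the origin of the constant
    \<open>2 * L\<close>.\<close>
  define \<eta> where "\<eta> = min (min 1 e0) (1 / (2 * L))"
  have \<eta>: "\<eta> > 0" using e0(1) L by (simp add: \<eta>_def)
  have "\<exists>u. z = strip_map u \<and> Re u \<ge> - (2 * L * e)" if e: "0 \<le> e" "e < \<eta>" and z: "infdist z (- D) \<le> e" for z e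
  proof -
    have lift: "\<exists>u. z = strip_map u \<and> Re u = ln (norm (\<phi> z))" if "\<psi> (\<phi> z) = z" "\<phi> z \<noteq> 0"
      using that by (intro exI[of _ "Ln (\<phi> z)"]) (simp add: strip_map_def)
    show ?thesis
    proof (cases "z \<in> D")
      case False
      then have "1 \<le> norm (\<phi> z)" "\<psi> (\<phi> z) = z" using \<psi>_\<phi> by auto
      then obtain u where "z = strip_map u" "Re u = ln (norm (\<phi> z))" using lift by force
      moreover have "ln (norm (\<phi> z)) \<ge> 0" using \<open>1 \<le> norm (\<phi> z)\<close> by simp
      moreover have "- (2 * L * e) \<le> 0" using e L by simp
      ultimately show ?thesis by (intro exI[of _ u]) linarith
    next
      case True
      have ne: "- D \<noteq> {}" using bounded_D not_bounded_UNIV by (metis Compl_empty_eq double_complement)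
      obtain z' where z': "z' \<in> - D" "dist z z' = infdist z (- D)"
        using infdist_attains_inf[of "- D" z] open_D ne by (metis closed_Compl)
      have d: "norm (z - z') \<le> e" using z' z by (simp add: dist_norm)
      have "norm z' \<le> norm z + norm (z - z')" using norm_triangle_sub[of z' z] by (simp add: norm_minus_commute)
      also have "\<dots> \<le> R + 1" using R[OF True] d e by (simp add: \<eta>_def)
      finally have zK: "z' \<in> K" using z'(1) by (simp add: K_def)
      have ee: "e \<le> e0" using e by (simp add: \<eta>_def)
      have zin: "z \<in> cball z' e0" using d ee by (simp add: dist_norm norm_minus_commute)
      have "norm (\<phi> z - \<phi> z') \<le> L * norm (z - z')"
      proof (rule field_differentiable_bound[of "cball z' e0" \<phi> "deriv \<phi>"])
        fix x assume x: "x \<in> cball z' e0"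
        then have "x \<in> \<psi> ` {w. \<rho> < norm w}" using zK e0(2) sub by blast
        then show "(\<phi> has_field_derivative deriv \<phi> x) (at x within cball z' e0)"
          using holomorphic_derivI[OF \<phi>_hol opi] has_field_derivative_at_within by blast
        show "norm (deriv \<phi> x) \<le> L" using B[of x] x zK by (force simp: L_def)
      qed (use zin e0(1) in auto)
      also have "\<dots> \<le> L * e" using d L by (intro mult_left_mono) auto
      finally have "norm (\<phi> z - \<phi> z') \<le> L * e" .
      moreover have "1 \<le> norm (\<phi> z')" using \<psi>_\<phi> z'(1) by auto
      ultimately have n: "1 - L * e \<le> norm (\<phi> z)" using norm_triangle_sub[of "\<phi> z'" "\<phi> z"] by (simp add: norm_minus_commute)
      have Le: "L * e \<le> 1/2" "0 \<le> L * e"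
      proof -
        have "e \<le> 1 / (2 * L)" using e by (simp add: \<eta>_def)
        then show "L * e \<le> 1/2" using L by (simp add: field_simps)
      qed (use e L in auto)
      have "z \<in> region a" using zin zK e0(2) by blast
      then have "\<psi> (\<phi> z) = z" using exp_minus_le[OF a(2)] \<phi>_\<psi> by (auto simp: region_def)
      moreover have "\<phi> z \<noteq> 0" using n Le by auto
      ultimately obtain u where u: "z = strip_map u" "Re u = ln (norm (\<phi> z))" using lift by blast
      have "- (2 * (L * e)) \<le> ln (1 - L * e)"
      proof -
        define y where "y = L * e"
        have y: "0 \<le> y" "y \<le> 1/2" using Le by (auto simp: y_def)
        have "1 / (1 - y) \<le> 1 + 2 * y"
        proof -
          have "1 \<le> (1 + 2 * y) * (1 - y)" using y mult_nonneg_nonneg[of y "1 - 2 * y"] by (simp add: algebra_simps)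
          then show ?thesis using y by (simp add: divide_le_eq)
        qed
        also have "\<dots> \<le> exp (2 * y)" by (rule exp_ge_add_one_self)
        finally have "1 / (1 - y) \<le> exp (2 * y)" .
        then have "ln (1 / (1 - y)) \<le> ln (exp (2 * y))" using y by (subst ln_le_cancel_iff) auto
        then have "ln (1 / (1 - y)) \<le> 2 * y" by simp
        then show ?thesis using y by (simp add: ln_div y_def)
      qed
      also have "ln (1 - L * e) \<le> ln (norm (\<phi> z))" using n Le \<open>\<phi> z \<noteq> 0\<close> by simp
      finally show ?thesis using u by (intro exI[of _ u]) simp
    qed
  qed
  then show ?thesis using L by (intro that[OF \<eta>, of "2 * L"]) auto
qed

end

context orthogonality_chart
begin

lemma inner_width_bounds: "0 < inner_width" "inner_width < \<delta>" "inner_width < width" "inner_width < c'"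
  using c' by (auto simp: inner_width_def)

text \<open>The expression is the reciprocal of \<open>\<phi>' * \<phi> ^ N * exp V\<close> in the
  strip. Its growth is no worse than \<open>exp (N * inner_width)\<close>, less than the decay of
  the approximation error of \<open>Q\<close>.\<close>

lemma leading_factor_bound:
  obtains E where "E \<ge> 0" "\<And>N z. Re z \<ge> - inner_width \<Longrightarrow>
     norm (deriv strip_map z * exp (- (of_nat (N + 1) * z)) * exp (- strip_V z)) \<le> E * exp (real N * inner_width)"
proof -
  let ?f = "\<lambda>w. deriv \<psi> w * exp (- V (\<psi> w))"
  have "(V \<circ> \<psi>) holomorphic_on {w. \<rho> < norm w}" by (rule holomorphic_on_compose_gen[OF \<psi>_hol V_hol]) auto
  then have c: "continuous_on {w. \<rho> < norm w} ?f"
    using holomorphic_on_imp_continuous_on[OF holomorphic_deriv[OF \<psi>_hol open_chart]]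
      holomorphic_on_imp_continuous_on[of "V \<circ> \<psi>"]
    by (intro continuous_intros) (auto simp: o_def)
  have l: "(?f \<longlongrightarrow> of_real (1 / \<kappa>) * exp (- of_real v)) at_infinity"
    by (intro tendsto_intros deriv_\<psi>_asymp filterlim_compose[OF V_inf strip_map_asymp(4)])
  have "\<rho> < exp (- inner_width)" using inner_width_bounds by (simp add: \<rho>_less_exp_iff)
  from chart_bounded[OF c l this] obtain E where E: "E \<ge> 0" "\<And>w. exp (- inner_width) \<le> norm w \<Longrightarrow> norm (?f w) \<le> E" by blast
  have "norm (deriv strip_map z * exp (- (of_nat (N + 1) * z)) * exp (- strip_V z)) \<le> E * exp (real N * inner_width)"
    if z: "Re z \<ge> - inner_width" for N z
  proof -
    have zw: "Re z > - width" using z inner_width_bounds by simp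
    have "exp z * exp (- (of_nat (N + 1) * z)) = exp (- (of_nat N * z))"
      unfolding exp_add[symmetric] by (simp add: algebra_simps)
    then have "deriv strip_map z * exp (- (of_nat (N + 1) * z)) * exp (- strip_V z) = ?f (exp z) * exp (- (of_nat N * z))"
      unfolding deriv_strip_map(1)[OF zw] strip_V_def strip_map_def by (metis (no_types, lifting) mult.assoc mult.commute)
    also have "norm \<dots> = norm (?f (exp z)) * exp (real N * - Re z)" by (simp only: norm_mult norm_exp_eq_Re) simp
    also have "\<dots> \<le> E * exp (real N * inner_width)"
    proof (intro mult_mono)
      show "exp (real N * - Re z) \<le> exp (real N * inner_width)" using z by (simp only: exp_le_cancel_iff) (intro mult_left_mono, auto)
    qed (use z E in \<open>auto intro!: E(2)\<close>)
    finally show ?thesis .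
  qed
  then show ?thesis using that E(1) by blast
qed

text \<open>The averaging window has width \<open>1/N\<close> and lies \<open>1/N\<close> beyond the
  depth \<open>s = A ln N / N\<close>. At that depth dividing by the exponential costs
  \<open>exp ((N + 1) (s + 2 / N)) \<le> exp 4 * N powr (2 * A)\<close>, and the window and the
  kernel together cost \<open>N ^ 2\<close>.\<close>

lemma transplant_pointwise:
  assumes A: "A > 0" and N: "N \<ge> 1" and small: "A * ln (real N) / real N + 2 / real N \<le> c'"
    and P: "P holomorphic_on ball 0 (exp width)" and z: "Re z \<ge> - (A * ln (real N) / real N)"
  shows "norm (P (exp (- z))) \<le> exp 4 * real N ^ (nat \<lceil>2 * A\<rceil> + 2) * strip_L1 c' (transplant N P)"
proof -
  define s where "s = A * ln (real N) / real N"
  have N0: "real N \<ge> 1" using N by simp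
  have s0: "s \<ge> 0" using A N0 by (simp add: s_def)
  define L where "L = strip_L1 c' (transplant N P)"
  have sub: "{-c'..0} \<subseteq> {-width<..}" using c'_width by auto
  have L0: "L \<ge> 0" unfolding L_def
    by (rule strip_L1_nonneg[OF periodic_holomorphic_onD(2)[OF transplant_periodic_holomorphic[OF P]] sub])
  define x1 where "x1 = - s - 2 / real N"
  define x2 where "x2 = - s - 1 / real N"
  have x12: "x2 - x1 = 1 / real N" "x2 - (- s) = - (1 / real N)" by (auto simp: x1_def x2_def field_simps)
  have "norm (P (exp (- z))) * (2 * pi * (x2 - x1) * (1 - exp (x2 - (- s)))) \<le> exp (- real (N + 1) * x1) * strip_L1 c' (transplant N P)"
  proof (rule transplant_norm_le[OF P])
    show "- width < - c'" using c'_width by simp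
    show "- c' \<le> x1" using small by (simp add: x1_def s_def)
    show "x1 < x2" "x2 < - s" using N0 by (auto simp: x1_def x2_def divide_strict_right_mono)
    show "- s \<le> Re z" using z by (simp add: s_def)
    have "1 / real N \<ge> 0" by simp
    then show "x2 \<le> 0" using s0 unfolding x2_def by linarith
  qed
  also have "exp (- real (N + 1) * x1) \<le> exp 4 * real N ^ nat \<lceil>2 * A\<rceil>"
  proof -
    have "- x1 = s + 2 / real N" by (simp add: x1_def)
    then have "- real (N + 1) * x1 = real (N + 1) * (s + 2 / real N)" by (metis minus_mult_commute)
    also have "\<dots> \<le> (2 * real N) * (s + 2 / real N)" using N0 s0 by (intro mult_right_mono) auto
    also have "\<dots> = 2 * A * ln (real N) + 4" using N0 by (simp add: s_def field_simps)
    finally have "exp (- real (N + 1) * x1) \<le> exp (2 * A * ln (real N) + 4)" by simp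
    also have "\<dots> = exp 4 * real N powr (2 * A)" using N0 by (simp add: exp_add powr_def mult.commute)
    also have "real N powr (2 * A) \<le> real N powr real (nat \<lceil>2 * A\<rceil>)" using N0 A by (intro powr_mono) linarith+
    also have "\<dots> = real N ^ nat \<lceil>2 * A\<rceil>" using N0 by (simp add: powr_realpow)
    finally show ?thesis by simp
  qed
  finally have le: "norm (P (exp (- z))) * (2 * pi * (1 / real N) * (1 - exp (- (1 / real N)))) \<le> exp 4 * real N ^ nat \<lceil>2 * A\<rceil> * L"
    using L0 unfolding x12 L_def by (simp only: mult_right_mono)
  have "1 / real N / 2 \<le> 1 - exp (- (1 / real N))" using N0 by (intro one_minus_exp_ge) auto
  then have "2 * pi * (1 / real N) * (1 / real N / 2) \<le> 2 * pi * (1 / real N) * (1 - exp (- (1 / real N)))"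
    using N0 by (intro mult_left_mono) auto
  moreover have "1 / real N ^ 2 \<le> 2 * pi * (1 / real N) * (1 / real N / 2)"
    using pi_gt3 N0 by (simp add: power2_eq_square divide_right_mono)
  ultimately have "1 / real N ^ 2 \<le> 2 * pi * (1 / real N) * (1 - exp (- (1 / real N)))" by linarith
  then have "norm (P (exp (- z))) * (1 / real N ^ 2) \<le> exp 4 * real N ^ nat \<lceil>2 * A\<rceil> * L"
    using le mult_left_mono[OF _ norm_ge_zero[of "P (exp (- z))"]] order_trans by blast
  then have "norm (P (exp (- z))) \<le> exp 4 * real N ^ nat \<lceil>2 * A\<rceil> * L * real N ^ 2" using N0 by (simp add: field_simps)
  then show ?thesis unfolding L_def power_add by (simp only: mult_ac)
qed

text \<open>The polynomial is \<open>Q\<close> plus the correction encoded by \<open>P\<close>, and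
  \<open>Q\<close> is the ansatz plus an exponentially small error. Everything is divided by the
  leading factor. The quantifier over \<open>p\<close> is inside, so one constant serves all
  \<open>N\<close>.\<close>

lemma pointwise_expansion:
  assumes A: "A > 0"
  shows "\<exists>K. \<forall>\<^sub>F N in sequentially. \<forall>p. monic_orthogonal_poly D \<omega> N p \<longrightarrow>
     (\<forall>z. Re z \<ge> - (A * ln (real N) / real N) \<longrightarrow> Re z > - inner_width \<and>
      (\<exists>R. norm R \<le> K / real N ^ (k + 1) \<and>
        poly p (strip_map z) = of_real (1 / (\<kappa> ^ (N + 1) * exp v)) * deriv \<phi> (strip_map z) * \<phi> (strip_map z) ^ N * exp (V (strip_map z)) *
          ((\<Sum>j\<le>k. expansion_coeff h j (1 / \<phi> (strip_map z)) / of_nat N ^ j) + R)))"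
proof -
  \<comment> \<open>The power of \<open>N\<close> lost in \<open>transplant_pointwise\<close>; the
    ansatz is taken \<open>m\<close> orders longer to absorb it.\<close>
  define m where "m = nat \<lceil>2 * A\<rceil> + 2"
  define M where "M = k + m"
  obtain K a where K: "K \<ge> 0" and a: "a > 0" and proj:
    "\<And>N p. N > 0 \<Longrightarrow> monic_orthogonal_poly D \<omega> N p \<Longrightarrow> \<exists>Q P.
       (\<forall>z. Re z \<ge> - inner_width \<longrightarrow> norm (poly Q (strip_map z) - main_term (trunc_series M N) N (strip_map z)) \<le> K * exp (- (inner_width + a) * real N)) \<and>
       matches N P (\<lambda>z. of_real (\<kappa> ^ (N + 1) * exp v) * poly p z - poly Q z) \<and>
       strip_L1 c' (transplant N P) \<le> K / real N ^ Suc M"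
    using projection_estimate[of M] by blast
  obtain Bj where Bj: "\<And>j. Bj j \<ge> 0" "\<And>j X. norm X \<le> exp inner_width \<Longrightarrow> norm (expansion_coeff h j X) \<le> Bj j"
    using coeff_bounded[OF inner_width_bounds(2)] by blast
  obtain E where E: "E \<ge> 0" "\<And>N z. Re z \<ge> - inner_width \<Longrightarrow>
     norm (deriv strip_map z * exp (- (of_nat (N + 1) * z)) * exp (- strip_V z)) \<le> E * exp (real N * inner_width)"
    using leading_factor_bound by blast
  define Ea where "Ea = fact (k + 1) / a ^ (k + 1)"
  have Ea: "exp (- a * real N) \<le> Ea / real N ^ (k + 1)" if N: "N > 0" for N
  proof -
    have "exp (- (real N * a)) * a ^ (k + 1) \<le> fact (k + 1) / real N ^ (k + 1)"
      using a by (intro exp_minus_power_le[OF N]) auto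
    moreover have "a ^ (k + 1) > 0" using a by simp
    ultimately have "exp (- (real N * a)) \<le> fact (k + 1) / real N ^ (k + 1) / a ^ (k + 1)"
      by (simp only: pos_le_divide_eq)
    then show ?thesis by (simp add: Ea_def mult.commute)
  qed
  define KK where "KK = (\<Sum>j\<in>{k<..M}. Bj j) + K * E * Ea + exp 4 * K"
  have lim: "(\<lambda>N. A * ln (real N) / real N + 2 / real N) \<longlonglongrightarrow> 0"
    by real_asymp
  have ev: "\<forall>\<^sub>F N in sequentially. A * ln (real N) / real N + 2 / real N < inner_width"
    using lim inner_width_bounds(1) by (auto dest: order_tendstoD)
  have "\<forall>\<^sub>F N in sequentially. \<forall>p. monic_orthogonal_poly D \<omega> N p \<longrightarrow>
     (\<forall>z. Re z \<ge> - (A * ln (real N) / real N) \<longrightarrow> Re z > - inner_width \<and>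
      (\<exists>R. norm R \<le> KK / real N ^ (k + 1) \<and>
        poly p (strip_map z) = of_real (1 / (\<kappa> ^ (N + 1) * exp v)) * deriv \<phi> (strip_map z) * \<phi> (strip_map z) ^ N * exp (V (strip_map z)) *
          ((\<Sum>j\<le>k. expansion_coeff h j (1 / \<phi> (strip_map z)) / of_nat N ^ j) + R)))"
    using ev eventually_gt_at_top[of 0]
  proof eventually_elim
    case (elim N)
    have N: "N > 0" "real N \<ge> 1" using elim by auto
    show ?case
    proof (intro allI impI)
      fix p z assume p: "monic_orthogonal_poly D \<omega> N p" and z: "Re z \<ge> - (A * ln (real N) / real N)"
      have "A * ln (real N) / real N < inner_width" using elim(1) N by (smt (verit) divide_nonneg_nonneg)
      then have z1: "Re z > - inner_width" using z by linarith
      then have zw: "Re z > - width" using inner_width_bounds by linarith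
      obtain Q P where Q: "\<And>z. Re z \<ge> - inner_width \<Longrightarrow> norm (poly Q (strip_map z) - main_term (trunc_series M N) N (strip_map z)) \<le> K * exp (- (inner_width + a) * real N)"
        and P: "matches N P (\<lambda>z. of_real (\<kappa> ^ (N + 1) * exp v) * poly p z - poly Q z)"
        and L: "strip_L1 c' (transplant N P) \<le> K / real N ^ Suc M"
        using proj[OF N(1) p] by blast
      define lam where "lam = complex_of_real (\<kappa> ^ (N + 1) * exp v)"
      have lam0: "lam \<noteq> 0" using \<kappa> by (simp add: lam_def)
      define x where "x = strip_map z"
      define D0 where "D0 = deriv \<phi> x * \<phi> x ^ N * exp (V x)"
      \<comment> \<open>The reciprocal of the leading factor \<open>D0\<close>, in strip
        coordinates.\<close>
      define G where "G = deriv strip_map z * exp (- (of_nat (N + 1) * z)) * exp (- strip_V z)"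
      have DG: "D0 * G = 1"
      proof -
        have "D0 * G = (deriv \<phi> x * deriv strip_map z) * exp z ^ N * exp (- (of_nat (N + 1) * z)) * (exp (V x) * exp (- strip_V z))"
          unfolding D0_def G_def x_def \<phi>_strip_map[OF zw] by (simp only: mult_ac)
        also have "deriv \<phi> x * deriv strip_map z = exp z" unfolding x_def by (rule deriv_strip_map(2)[OF zw])
        also have "exp z * exp z ^ N * exp (- (of_nat (N + 1) * z)) = 1"
          unfolding exp_of_nat_mult[symmetric] exp_add[symmetric] by (simp add: algebra_simps)
        also have "exp (V x) * exp (- strip_V z) = 1" unfolding strip_V_def x_def by (simp add: exp_minus)
        finally show ?thesis by simp
      qed
      have rP: "lam * poly p x - poly Q x = D0 * P (exp (- z))"
      proof -
        have "exp (of_nat (N + 1) * z) * P (exp (- z)) = (lam * poly p x - poly Q x) * deriv strip_map z * exp (- strip_V z)"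
          using P zw unfolding matches_def transplant_def lam_def x_def by blast
        then have "exp (- (of_nat (N + 1) * z)) * (exp (of_nat (N + 1) * z) * P (exp (- z))) = (lam * poly p x - poly Q x) * G"
          unfolding G_def by (simp add: mult_ac)
        then have "P (exp (- z)) = (lam * poly p x - poly Q x) * G"
          by (simp add: mult.assoc[symmetric] exp_add[symmetric])
        then have "D0 * P (exp (- z)) = (lam * poly p x - poly Q x) * (D0 * G)" by (simp add: mult_ac)
        then show ?thesis using DG by simp
      qed
      define e1 where "e1 = poly Q x - main_term (trunc_series M N) N x"
      have e1: "norm e1 \<le> K * exp (- (inner_width + a) * real N)" unfolding e1_def x_def using z1 by (intro Q) simp
      define X where "X = 1 / \<phi> x"
      have X: "norm X \<le> exp inner_width"
        unfolding X_def x_def \<phi>_strip_map[OF zw] using z1 by (simp add: norm_divide divide_le_eq exp_add[symmetric])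
      have mt: "main_term (trunc_series M N) N x = D0 * trunc_series M N X" by (simp add: main_term_def D0_def X_def)
      \<comment> \<open>Three sources of error: the surplus terms of the ansatz, the error of
        \<open>Q\<close>, and the correction to the orthogonal polynomial.\<close>
      define R where "R = (\<Sum>j\<in>{k<..M}. expansion_coeff h j X / of_nat N ^ j) + e1 * G + P (exp (- z))"
      have "lam * poly p x = D0 * (trunc_series M N X + e1 * G + P (exp (- z)))"
      proof -
        have "D0 * (trunc_series M N X + e1 * G + P (exp (- z))) = D0 * trunc_series M N X + e1 * (D0 * G) + D0 * P (exp (- z))"
          by (simp add: algebra_simps)
        then show ?thesis using rP mt unfolding DG e1_def by (simp add: algebra_simps)
      qed
      also have "trunc_series M N X = (\<Sum>j\<le>k. expansion_coeff h j X / of_nat N ^ j) + (\<Sum>j\<in>{k<..M}. expansion_coeff h j X / of_nat N ^ j)"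
      proof -
        have "{..M} = {..k} \<union> {k<..M}" by (auto simp: M_def)
        then show ?thesis unfolding trunc_series_def by (metis (no_types, lifting) sum.union_disjoint finite_atMost finite_greaterThanAtMost ivl_disj_int_one(3))
      qed
      finally have eq: "lam * poly p x = D0 * ((\<Sum>j\<le>k. expansion_coeff h j X / of_nat N ^ j) + R)"
        unfolding R_def by (simp only: add.assoc)
      then have fin: "poly p x = of_real (1 / (\<kappa> ^ (N + 1) * exp v)) * deriv \<phi> x * \<phi> x ^ N * exp (V x) *
          ((\<Sum>j\<le>k. expansion_coeff h j (1 / \<phi> x) / of_nat N ^ j) + R)"
      proof -
        have "poly p x = (1 / lam) * (lam * poly p x)" using lam0 by simp
        also have "1 / lam = of_real (1 / (\<kappa> ^ (N + 1) * exp v))" by (simp add: lam_def)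
        finally show ?thesis unfolding eq D0_def X_def by (simp only: mult.assoc)
      qed
      have n1: "norm (\<Sum>j\<in>{k<..M}. expansion_coeff h j X / of_nat N ^ j) \<le> (\<Sum>j\<in>{k<..M}. Bj j) / real N ^ (k + 1)"
        unfolding sum_divide_distrib
      proof (rule sum_norm_le)
        fix j assume j: "j \<in> {k<..M}"
        have "real N ^ (k + 1) \<le> real N ^ j" using j N by (intro power_increasing) auto
        then show "norm (expansion_coeff h j X / of_nat N ^ j) \<le> Bj j / real N ^ (k + 1)"
          unfolding norm_divide norm_power norm_of_nat using Bj(1)[of j] Bj(2)[OF X, of j] N by (intro frac_le) auto
      qed
      have n2: "norm (e1 * G) \<le> K * E * Ea / real N ^ (k + 1)"
      proof -
        have "norm (e1 * G) \<le> (K * exp (- (inner_width + a) * real N)) * (E * exp (real N * inner_width))"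
          unfolding norm_mult[of e1] using e1 E(2)[of z N, folded G_def] z1 K by (intro mult_mono) auto
        also have "\<dots> = K * E * (exp (- (inner_width + a) * real N) * exp (real N * inner_width))" by (simp only: mult_ac)
        also have "exp (- (inner_width + a) * real N) * exp (real N * inner_width) = exp (- a * real N)"
          unfolding exp_add[symmetric] by (simp add: algebra_simps)
        also have "K * E * exp (- a * real N) \<le> K * E * (Ea / real N ^ (k + 1))"
          using Ea[OF N(1)] K E(1) by (intro mult_left_mono) auto
        finally show ?thesis by simp
      qed
      have n3: "norm (P (exp (- z))) \<le> exp 4 * K / real N ^ (k + 1)"
      proof -
        have "norm (P (exp (- z))) \<le> exp 4 * real N ^ (nat \<lceil>2 * A\<rceil> + 2) * strip_L1 c' (transplant N P)"
          using P elim(1) inner_width_bounds(4) N by (intro transplant_pointwise[OF A _ _ _ z]) (auto simp: matches_def)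
        also have "\<dots> \<le> exp 4 * real N ^ m * (K / real N ^ Suc M)"
          unfolding m_def using L N by (intro mult_left_mono) auto
        also have "real N ^ Suc M = real N ^ m * real N ^ (k + 1)" by (simp add: M_def power_add)
        finally show ?thesis using N by simp
      qed
      have "norm R \<le> KK / real N ^ (k + 1)"
        unfolding R_def KK_def add_divide_distrib
        by (intro order_trans[OF norm_triangle_ineq] add_mono n1 n2 n3)
      then show "Re z > - inner_width \<and> (\<exists>R. norm R \<le> KK / real N ^ (k + 1) \<and>
        poly p (strip_map z) = of_real (1 / (\<kappa> ^ (N + 1) * exp v)) * deriv \<phi> (strip_map z) * \<phi> (strip_map z) ^ N * exp (V (strip_map z)) *
          ((\<Sum>j\<le>k. expansion_coeff h j (1 / \<phi> (strip_map z)) / of_nat N ^ j) + R))"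
        using z1 fin unfolding x_def by blast
    qed
  qed
  then show ?thesis by blast
qed

lemma expansion_exists:
  assumes \<phi>_inf: "filterlim \<phi> at_infinity at_infinity"
    and P: "\<And>N. monic_orthogonal_poly D \<omega> N (P N)"
    and lc: "\<And>N. lc N = of_real (1 / (\<kappa> ^ (N + 1) * exp v))"
  shows "\<exists>U. \<exists>B :: nat \<Rightarrow> complex \<Rightarrow> complex.
            open U \<and> - D \<subseteq> U \<and>
            (\<forall>j. B j holomorphic_on U \<and> bounded (B j ` U)) \<and>
            (\<forall>z\<in>U. B 0 z = 1) \<and>
            (\<forall>j\<ge>1. (B j \<longlongrightarrow> 0) at_infinity) \<and>
            (\<forall>(k::nat) (A::real). A > 0 \<longrightarrow>
               (\<exists>K::real. \<forall>\<^sub>F N in sequentially. \<forall>z.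
                  infdist z (- D) \<le> A * ln (real N) / real N \<longrightarrow>
                  z \<in> U \<and>
                  (\<exists>R::complex. norm R \<le> K / real N ^ (k + 1) \<and>
                     poly (P N) z = lc N * deriv \<phi> z * \<phi> z ^ N * exp (V z) *
                       ((\<Sum>j\<le>k. B j z / of_nat N ^ j) + R))))"
proof -
  define U where "U = region inner_width"
  define B where "B = (\<lambda>j z. expansion_coeff h j (1 / \<phi> z))"
  have iw: "inner_width \<le> width" using inner_width_bounds by simp
  have sub: "U \<subseteq> \<psi> ` {w. \<rho> < norm w}" unfolding U_def region_def using exp_minus_le[OF iw] by auto
  have \<phi>n: "exp (- inner_width) < norm (\<phi> z)" if "z \<in> U" for z
    using that exp_minus_le[OF iw] \<phi>_\<psi> by (auto simp: U_def region_def)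
  have X: "norm (1 / \<phi> z) < exp inner_width" if "z \<in> U" for z
  proof -
    have "inverse (norm (\<phi> z)) < inverse (exp (- inner_width))" using \<phi>n[OF that] by (intro less_imp_inverse_less) auto
    then show ?thesis by (simp add: norm_divide exp_minus inverse_eq_divide)
  qed
  have hol: "B j holomorphic_on U" for j
  proof -
    have "(expansion_coeff h j \<circ> (\<lambda>z. 1 / \<phi> z)) holomorphic_on U"
    proof (rule holomorphic_on_compose_gen[OF _ coeff_holomorphic])
      have "\<phi> z \<noteq> 0" if "z \<in> U" for z using \<phi>n[OF that] exp_gt_zero[of "- inner_width"] by auto
      then show "(\<lambda>z. 1 / \<phi> z) holomorphic_on U" by (intro holomorphic_intros holomorphic_on_subset[OF \<phi>_hol sub]) auto
      have "exp inner_width < exp \<delta>" using inner_width_bounds by simp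
      then show "(\<lambda>z. 1 / \<phi> z) ` U \<subseteq> ball 0 (exp \<delta>)" using X by (force intro: less_trans)
    qed
    then show ?thesis by (simp add: B_def o_def)
  qed
  obtain Bj where Bj: "\<And>j. 0 \<le> Bj j" "\<And>j X. norm X \<le> exp inner_width \<Longrightarrow> norm (expansion_coeff h j X) \<le> Bj j"
    using coeff_bounded[OF inner_width_bounds(2)] by blast
  have bdd: "bounded (B j ` U)" for j
    unfolding bounded_iff B_def by (intro exI[of _ "Bj j"] ballI) (metis (no_types, lifting) Bj(2) X imageE less_imp_le)
  have lim: "(B j \<longlongrightarrow> 0) at_infinity" if "j \<ge> 1" for j
  proof -
    have "isCont (expansion_coeff h j) 0"
      using holomorphic_on_imp_continuous_on[OF coeff_holomorphic[of j]] by (auto simp: continuous_on_eq_continuous_at)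
    moreover have "((\<lambda>z. 1 / \<phi> z) \<longlongrightarrow> 0) at_infinity" by (rule tendsto_divide_0[OF tendsto_const \<phi>_inf])
    ultimately have "((\<lambda>z. expansion_coeff h j (1 / \<phi> z)) \<longlongrightarrow> expansion_coeff h j 0) at_infinity"
      by (rule isCont_tendsto_compose)
    then show ?thesis
      using expansion_coeff_at_0[where \<delta>=\<delta> and h=h, OF \<delta>_pos h_per h_0, of j] that by (simp add: B_def)
  qed
  obtain \<eta> L where \<eta>: "\<eta> > 0" "L > 0"
    "\<And>z e. 0 \<le> e \<Longrightarrow> e < \<eta> \<Longrightarrow> infdist z (- D) \<le> e \<Longrightarrow> \<exists>u. z = strip_map u \<and> Re u \<ge> - (L * e)"
    using near_boundary by blast
  have main: "\<exists>K::real. \<forall>\<^sub>F N in sequentially. \<forall>z. infdist z (- D) \<le> A * ln (real N) / real N \<longrightarrow>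
                  z \<in> U \<and> (\<exists>R::complex. norm R \<le> K / real N ^ (k + 1) \<and>
                     poly (P N) z = lc N * deriv \<phi> z * \<phi> z ^ N * exp (V z) * ((\<Sum>j\<le>k. B j z / of_nat N ^ j) + R))"
    if A: "A > 0" for k A
  proof -
    \<comment> \<open>Distance \<open>e\<close> in the plane may mean depth \<open>L * e\<close> in
      the strip, so the pointwise expansion is invoked with \<open>L * A\<close>.\<close>
    have LA: "L * A > 0" using \<eta>(2) A by simp
    obtain K where K: "\<forall>\<^sub>F N in sequentially. \<forall>p. monic_orthogonal_poly D \<omega> N p \<longrightarrow>
     (\<forall>z. Re z \<ge> - (L * A * ln (real N) / real N) \<longrightarrow> Re z > - inner_width \<and>
      (\<exists>R. norm R \<le> K / real N ^ (k + 1) \<and>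
        poly p (strip_map z) = of_real (1 / (\<kappa> ^ (N + 1) * exp v)) * deriv \<phi> (strip_map z) * \<phi> (strip_map z) ^ N * exp (V (strip_map z)) *
          ((\<Sum>j\<le>k. expansion_coeff h j (1 / \<phi> (strip_map z)) / of_nat N ^ j) + R)))"
      using pointwise_expansion[OF LA, of k] by blast
    have "(\<lambda>N. A * ln (real N) / real N) \<longlonglongrightarrow> 0" by real_asymp
    then have ev: "\<forall>\<^sub>F N in sequentially. A * ln (real N) / real N < \<eta>" using \<eta>(1) by (auto dest: order_tendstoD)
    have "\<forall>\<^sub>F N in sequentially. \<forall>z. infdist z (- D) \<le> A * ln (real N) / real N \<longrightarrow>
                  z \<in> U \<and> (\<exists>R::complex. norm R \<le> K / real N ^ (k + 1) \<and>
                     poly (P N) z = lc N * deriv \<phi> z * \<phi> z ^ N * exp (V z) * ((\<Sum>j\<le>k. B j z / of_nat N ^ j) + R))"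
      using K ev eventually_gt_at_top[of 0]
    proof eventually_elim
      case (elim N)
      show ?case
      proof (intro allI impI)
        fix z assume z: "infdist z (- D) \<le> A * ln (real N) / real N"
        have "0 \<le> A * ln (real N) / real N" using A elim(3) by simp
        then obtain u where u: "z = strip_map u" "Re u \<ge> - (L * (A * ln (real N) / real N))" using \<eta>(3)[OF _ elim(2) z] by blast
        then have "Re u \<ge> - (L * A * ln (real N) / real N)" by (simp add: mult.assoc)
        then have "Re u > - inner_width \<and> (\<exists>R. norm R \<le> K / real N ^ (k + 1) \<and>
          poly (P N) z = of_real (1 / (\<kappa> ^ (N + 1) * exp v)) * deriv \<phi> z * \<phi> z ^ N * exp (V z) *
          ((\<Sum>j\<le>k. expansion_coeff h j (1 / \<phi> z) / of_nat N ^ j) + R))"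
          using elim(1) P unfolding u(1) by blast
        moreover have "z \<in> U" if "Re u > - inner_width" using that unfolding U_def region_eq u(1) by blast
        ultimately show "z \<in> U \<and> (\<exists>R::complex. norm R \<le> K / real N ^ (k + 1) \<and>
                     poly (P N) z = lc N * deriv \<phi> z * \<phi> z ^ N * exp (V z) * ((\<Sum>j\<le>k. B j z / of_nat N ^ j) + R))"
          unfolding lc B_def by blast
      qed
    qed
    then show ?thesis by blast
  qed
  show ?thesis
  proof (intro exI[of _ U] exI[of _ B] conjI allI impI)
    show "open U" unfolding U_def by (rule open_region[OF iw])
    show "- D \<subseteq> U" unfolding U_def by (rule region_contains[OF inner_width_bounds(1)])
    show "\<forall>z\<in>U. B 0 z = 1" by (simp add: B_def expansion_coeff_0)
  qed (use hol bdd lim main in auto)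
qed

end

section \<open>The weight in the chart\<close>

text \<open>All terms of positive degree shrink at least by the factor \<open>t = norm w / s\<close>
  compared with their values at the corner \<open>(s, s)\<close>, where the series converges
  absolutely. This gives a Lipschitz bound at \<open>a\<close>.\<close>

lemma real_analytic_on_imp_isCont:
  assumes f: "real_analytic_on f S" and a: "a \<in> S"
  shows "isCont f a"
proof -
  obtain r and c :: "nat \<times> nat \<Rightarrow> real" where r: "r > 0" and c: "\<And>x y. \<bar>x\<bar> < r \<Longrightarrow> \<bar>y\<bar> < r \<Longrightarrow>
       ((\<lambda>(m, n). c (m, n) * x ^ m * y ^ n) has_sum f (a + Complex x y)) UNIV"
    using f a unfolding real_analytic_on_def by blast
  define s where "s = r / 2"
  have s: "s > 0" "s < r" using r by (auto simp: s_def)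
  define T where "T = (\<lambda>x y (m, n). c (m, n) * x ^ m * y ^ n)"
  have T: "(T x y has_sum f (a + Complex x y)) UNIV" if "\<bar>x\<bar> < r" "\<bar>y\<bar> < r" for x y
    using c[OF that] by (simp add: T_def)
  have "T s s summable_on UNIV" using T[of s s] s by (auto simp: summable_on_def)
  then have "(\<lambda>p. \<bar>T s s p\<bar>) summable_on UNIV" using summable_on_iff_abs_summable_on_real by fastforce
  then obtain B where B: "((\<lambda>p. \<bar>T s s p\<bar>) has_sum B) UNIV" by (auto simp: summable_on_def)
  have le: "\<bar>f (a + w) - f a\<bar> \<le> norm w / s * B" if w: "norm w < s" for w
  proof -
    define t where "t = norm w / s"
    have t: "0 \<le> t" "t \<le> 1" "t * s = norm w" using s w by (auto simp: t_def)
    have xy: "\<bar>Re w\<bar> \<le> t * s" "\<bar>Im w\<bar> \<le> t * s" using abs_Re_le_cmod[of w] abs_Im_le_cmod[of w] t by auto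
    have "(T (Re w) (Im w) has_sum f (a + w)) UNIV" using T[of "Re w" "Im w"] xy t w s by simp
    moreover have "(T 0 0 has_sum f a) UNIV" using T[of 0 0] r by (simp add: Complex_eq)
    ultimately have d: "((\<lambda>p. T (Re w) (Im w) p - T 0 0 p) has_sum f (a + w) - f a) UNIV" 
      using has_sum_add[OF _ has_sum_uminusI] by fastforce
    have tm: "\<bar>T (Re w) (Im w) p - T 0 0 p\<bar> \<le> t * \<bar>T s s p\<bar>" for p
    proof (cases p)
      case (Pair m n)
      show ?thesis
      proof (cases "m = 0 \<and> n = 0")
        case True
        then show ?thesis using t by (simp add: T_def Pair)
      next
        case False
        have "\<bar>Re w\<bar> ^ m * \<bar>Im w\<bar> ^ n \<le> (t * s) ^ m * (t * s) ^ n"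
          using xy t s by (intro mult_mono power_mono) auto
        also have "\<dots> = t ^ (m + n) * (s ^ m * s ^ n)" by (simp add: power_mult_distrib power_add)
        also have "t ^ (m + n) \<le> t" using t False power_decreasing[of 1 "m + n" t] by force
        finally have "\<bar>Re w\<bar> ^ m * \<bar>Im w\<bar> ^ n \<le> t * (s ^ m * s ^ n)" using s by (simp add: mult_right_mono)
        then have "\<bar>c p\<bar> * (\<bar>Re w\<bar> ^ m * \<bar>Im w\<bar> ^ n) \<le> \<bar>c p\<bar> * (t * (s ^ m * s ^ n))" by (intro mult_left_mono) auto
        then have "\<bar>T (Re w) (Im w) p\<bar> \<le> t * \<bar>T s s p\<bar>" using s by (simp add: T_def Pair abs_mult power_abs mult_ac)
        moreover have "T 0 0 p = 0" using False by (auto simp: T_def Pair power_0_left)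
        ultimately show ?thesis by simp
      qed
    qed
    note bnd = has_sum_cmult_right[OF B, of t]
    have "f (a + w) - f a \<le> t * B" by (rule has_sum_mono[OF d bnd]) (use tm in \<open>auto simp: abs_le_iff\<close>)
    moreover have "f a - f (a + w) \<le> t * B"
      using has_sum_mono[OF has_sum_uminusI[OF d] bnd] tm by (auto simp: abs_le_iff)
    ultimately show ?thesis by (simp add: t_def abs_le_iff)
  qed
  have "((\<lambda>w. f (a + w) - f a) \<longlongrightarrow> 0) (at 0)"
  proof (rule Lim_null_comparison[where g="\<lambda>w. norm w / s * B"])
    show "\<forall>\<^sub>F w in at 0. norm (f (a + w) - f a) \<le> norm w / s * B"
      unfolding eventually_at using s le by (intro exI[of _ s]) auto
    have "((\<lambda>w::complex. norm w / s * B) \<longlongrightarrow> norm (0::complex) / s * B) (at 0)" using s by (intro tendsto_intros) auto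
    then show "((\<lambda>w::complex. norm w / s * B) \<longlongrightarrow> 0) (at 0)" by simp
  qed
  then have "((\<lambda>w. f (a + w)) \<longlongrightarrow> f a) (at 0)" by (simp add: LIM_zero_iff)
  then show ?thesis unfolding isCont_iff .
qed

context exterior_chart
begin

text \<open>Radial approach from inside: \<open>\<psi> (r w)\<close> lies in \<open>D\<close> for
  \<open>r < 1\<close>, while the limit does not.\<close>

lemma \<psi>_in_frontier:
  assumes w: "norm w = 1" shows "\<psi> w \<in> frontier D"
proof -
  have "((\<lambda>r. \<psi> (of_real r * w)) \<longlongrightarrow> \<psi> (of_real 1 * w)) (at_left 1)"
  proof -
    have "isCont \<psi> w"
      using holomorphic_on_imp_continuous_on[OF \<psi>_hol] open_chart w \<rho> by (simp add: continuous_on_eq_continuous_at)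
    then have "isCont \<psi> (of_real 1 * w)" by simp
    moreover have "((\<lambda>r. of_real r * w) \<longlongrightarrow> of_real 1 * w) (at_left 1)" by (intro tendsto_intros)
    ultimately show ?thesis by (rule isCont_tendsto_compose)
  qed
  moreover have "\<forall>\<^sub>F r in at_left 1. \<psi> (of_real r * w) \<in> closure D"
  proof (rule eventually_at_leftI[of \<rho>])
    fix r assume "r \<in> {\<rho><..<1}"
    then show "\<psi> (of_real r * w) \<in> closure D"
      using \<psi>_in_D[of "of_real r * w"] w \<rho> closure_subset by (auto simp: norm_mult)
  qed (use \<rho> in auto)
  ultimately have "\<psi> (of_real 1 * w) \<in> closure D" by (intro Lim_in_closed_set[OF closed_closure _ trivial_limit_at_left_real])
  moreover have "\<psi> w \<notin> D" using \<psi>_in_D[of w] w \<rho> by simp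
  ultimately show ?thesis using open_D by (simp add: frontier_def interior_open)
qed

lemma strip_map_in_frontier: "Re z = 0 \<Longrightarrow> strip_map z \<in> frontier D"
  unfolding strip_map_def by (rule \<psi>_in_frontier) simp

text \<open>The unit circle is compact, so a neighbourhood of the boundary of \<open>D\<close> pulls
  back to a strip of uniform width about the axis.\<close>

lemma strip_map_near_axis:
  assumes W: "open W" "frontier D \<subseteq> W"
  obtains e where "e > 0" "e \<le> width" "\<And>z. \<bar>Re z\<bar> < e \<Longrightarrow> strip_map z \<in> W"
proof -
  have "open ({w. \<rho> < norm w} \<inter> \<psi> -` W)"
    using holomorphic_on_imp_continuous_on[OF \<psi>_hol] by (intro continuous_open_preimage open_chart W)
  moreover have "sphere 0 1 \<subseteq> {w. \<rho> < norm w} \<inter> \<psi> -` W" using \<psi>_in_frontier W(2) \<rho> by fastforce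
  ultimately obtain e where e: "e > 0" "(\<Union>x\<in>sphere 0 1. ball x e) \<subseteq> {w. \<rho> < norm w} \<inter> \<psi> -` W"
    using compact_subset_open_imp_ball_epsilon_subset by (metis compact_sphere)
  have "strip_map z \<in> W" if z: "\<bar>Re z\<bar> < ln (1 + e)" for z
  proof -
    define x where "x = exp (of_real (Re z) :: complex)"
    define u where "u = exp (\<i> * of_real (Im z))"
    have ex: "exp z = x * u" unfolding x_def u_def exp_add[symmetric] using complex_eq[of z] by simp
    have u: "norm u = 1" by (simp add: u_def)
    have "exp (Re z) < 1 + e"
    proof -
      have "exp (Re z) < exp (ln (1 + e))" using z by (subst exp_less_cancel_iff) auto
      then show ?thesis using e(1) by simp
    qed
    moreover have "exp (Re z) > 1 - e"
    proof -
      have "exp (- Re z) < exp (ln (1 + e))" using z by (subst exp_less_cancel_iff) auto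
      then have "exp (- Re z) < 1 + e" using e(1) by simp
      then have "(1 - e) * exp (- Re z) < 1"
      proof (cases "e < 1")
        case True
        then have "(1 - e) * exp (- Re z) < (1 - e) * (1 + e)" using \<open>exp (- Re z) < 1 + e\<close> by (intro mult_strict_left_mono) auto
        also have "\<dots> \<le> 1" by (simp add: algebra_simps)
        finally show ?thesis .
      next
        case False
        then have "(1 - e) * exp (- Re z) \<le> 0" by (simp add: mult_nonpos_nonneg)
        then show ?thesis by simp
      qed
      then show ?thesis by (simp add: exp_minus field_simps)
    qed
    ultimately have "\<bar>exp (Re z) - 1\<bar> < e" by simp
    moreover have "norm (u - exp z) = \<bar>exp (Re z) - 1\<bar>"
    proof -
      have "exp z - u = of_real (exp (Re z) - 1) * u" by (simp add: ex x_def exp_of_real algebra_simps)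
      then have "norm (exp z - u) = \<bar>exp (Re z) - 1\<bar>" using u by (simp only: norm_mult norm_of_real) simp
      then show ?thesis by (simp add: norm_minus_commute)
    qed
    ultimately have "exp z \<in> ball u e" by (simp add: dist_norm)
    then have "exp z \<in> (\<Union>x\<in>sphere 0 1. ball x e)" using u by auto
    then show ?thesis using e(2) unfolding strip_map_def by blast
  qed
  then show ?thesis using e(1) width_pos by (intro that[of "min (ln (1 + e)) width"]) auto
qed

end

context weighted_chart
begin

text \<open>Local expansions of \<open>\<omega> * exp (2 Re V)\<close> at the axis points are glued
  along the axis. The boundary condition for \<open>V\<close> makes the function 1 on the axis, so
  \<open>h 0\<close> is 1 there and hence everywhere.\<close>

lemma orthogonality_chart_exists:
  assumes \<omega>: "admissible_weight D \<omega>" and VB: "\<And>z. z \<in> frontier D \<Longrightarrow> 2 * Re (V z) = - ln (\<omega> z)"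
  obtains \<delta> c' h C where "orthogonality_chart D \<phi> \<psi> \<rho> \<kappa> V v \<omega> \<delta> c' h C"
proof -
  obtain W where \<omega>1: "continuous_on D \<omega>" "\<And>z. z \<in> D \<Longrightarrow> 0 \<le> \<omega> z"
    and W: "open W" "frontier D \<subseteq> W" "\<And>z. z \<in> W \<Longrightarrow> 0 < \<omega> z" "real_analytic_on (\<lambda>z. ln (\<omega> z)) W"
    using \<omega> unfolding admissible_weight_def by blast
  obtain e where e: "e > 0" "e \<le> width" "\<And>z. \<bar>Re z\<bar> < e \<Longrightarrow> strip_map z \<in> W"
    using strip_map_near_axis[OF W(1,2)] by blast
  \<comment> \<open>Written through \<open>ln \<omega>\<close>, the function assumed real-analytic,
    and with \<open>strip_V z + cnj (strip_V z)\<close> for \<open>2 Re V\<close>, ready for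
    polarization.\<close>
  define F where "F = (\<lambda>z. exp (of_real (ln (\<omega> (strip_map z))) + strip_V z + cnj (strip_V z)))"
  have Fper: "F (z + 2 * of_real pi * \<i>) = F z" for z by (simp add: F_def strip_V_def strip_map_def exp_add)
  have loc: "\<exists>e>0. \<exists>h C. axis_expansion F (ball (Complex 0 t) e) h C" for t
  proof -
    have "strip_map (Complex 0 t) \<in> W" using strip_map_in_frontier[of "Complex 0 t"] W(2) by auto
    then obtain r and c :: "nat \<times> nat \<Rightarrow> real" where r: "r > 0" and c: "\<And>x y. \<bar>x\<bar> < r \<Longrightarrow> \<bar>y\<bar> < r \<Longrightarrow>
       ((\<lambda>(m, n). c (m, n) * x ^ m * y ^ n) has_sum ln (\<omega> (strip_map (Complex 0 t) + Complex x y))) UNIV"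
      using W(4) unfolding real_analytic_on_def by blast
    show ?thesis unfolding F_def
    proof (rule analytic_weight_local_expansion[where g="\<lambda>z. ln (\<omega> z)" and \<Psi>=strip_map and c=c, OF _ _ _ _ _ r c])
      show "open (vstrip {-width<..})" "Complex 0 t \<in> vstrip {-width<..}" using width_pos open_vstrip[of "{-width<..}"] by (auto simp: vstrip_def)
      show "strip_map holomorphic_on vstrip {-width<..}" "strip_V holomorphic_on vstrip {-width<..}"
        using strip_map_periodic_holomorphic strip_V_periodic_holomorphic by (auto dest: periodic_holomorphic_onD)
    qed auto
  qed
  obtain d h C where d: "d > 0" and h: "\<And>k. periodic_holomorphic_on (h k) {-d<..<d}"
    and ex: "axis_expansion F (vstrip {-d<..<d}) h C"
    using axis_expansion_glue[OF Fper loc] by blast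
  define \<delta> where "\<delta> = min d e"
  have \<delta>: "0 < \<delta>" "\<delta> \<le> d" "\<delta> \<le> e" "\<delta> \<le> width" using d e by (auto simp: \<delta>_def)
  have sub: "vstrip {-\<delta><..<\<delta>} \<subseteq> vstrip {-d<..<d}" using \<delta> by (auto simp: vstrip_def)
  have inW: "strip_map z \<in> W" if "z \<in> vstrip {-\<delta><..<\<delta>}" for z using that \<delta> e(3)[of z] by (auto simp: vstrip_def)
  have FF: "F z = of_real (\<omega> (strip_map z) * exp (2 * Re (strip_V z)))" if "z \<in> vstrip {-\<delta><..<\<delta>}" for z
  proof -
    have "of_real (ln (\<omega> (strip_map z))) + strip_V z + cnj (strip_V z) = of_real (ln (\<omega> (strip_map z)) + 2 * Re (strip_V z))"
      by (simp add: complex_add_cnj add.assoc)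
    then have "F z = of_real (exp (ln (\<omega> (strip_map z)) + 2 * Re (strip_V z)))" unfolding F_def by (simp only: exp_of_real)
    then show ?thesis using W(3)[OF inW[OF that]] by (simp add: exp_add)
  qed
  have ex': "axis_expansion (\<lambda>z. of_real (\<omega> (strip_map z) * exp (2 * Re (strip_V z)))) (vstrip {-\<delta><..<\<delta>}) h C"
    using axis_expansion_subset[OF ex sub] unfolding axis_expansion_def by (simp add: FF)
  have hper: "periodic_holomorphic_on (h k) {-\<delta><..<\<delta>}" for k
    using h[of k] \<delta>(2) unfolding periodic_holomorphic_on_def using sub by (auto intro: holomorphic_on_subset[OF _ sub])
  have h0: "h 0 z = 1" if z: "z \<in> vstrip {-\<delta><..<\<delta>}" for z
  proof -
    \<comment> \<open>For \<open>Re u = 0\<close> the remainder bound of order 1 is zero, so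
      \<open>h 0\<close> equals the weight function there.\<close>
    have axis: "h 0 u - 1 = 0" if u: "Re u = 0" for u
    proof -
      have uS: "u \<in> vstrip {-\<delta><..<\<delta>}" using u \<delta> by (simp add: vstrip_def)
      then have "norm (of_real (\<omega> (strip_map u) * exp (2 * Re (strip_V u))) - (\<Sum>k<1. h k u * of_real (2 * Re u) ^ k)) \<le> C 1 * \<bar>Re u\<bar> ^ 1"
        using ex' unfolding axis_expansion_def by blast
      then have "h 0 u = of_real (\<omega> (strip_map u) * exp (2 * Re (strip_V u)))" using u by simp
      also have "2 * Re (strip_V u) = - ln (\<omega> (strip_map u))" unfolding strip_V_def by (rule VB[OF strip_map_in_frontier[OF u]])
      also have "\<omega> (strip_map u) * exp (- ln (\<omega> (strip_map u))) = 1" using W(3)[OF inW[OF uS]] by (simp add: exp_minus)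
      finally show ?thesis by simp
    qed
    have "h 0 z - 1 = 0"
    proof (rule analytic_continuation[of "\<lambda>z. h 0 z - 1" "vstrip {-\<delta><..<\<delta>}" "{u. Re u = 0}" 0])
      show "(\<lambda>z. h 0 z - 1) holomorphic_on vstrip {-\<delta><..<\<delta>}"
        using periodic_holomorphic_onD(1)[OF hper[of 0]] by (intro holomorphic_intros)
      show "connected (vstrip {-\<delta><..<\<delta>})" by (intro convex_connected convex_vstrip) auto
      show "{u. Re u = 0} \<subseteq> vstrip {-\<delta><..<\<delta>}" "0 \<in> vstrip {-\<delta><..<\<delta>}" using \<delta> by (auto simp: vstrip_def)
      show "(0::complex) islimpt {u. Re u = 0}"
        unfolding islimpt_approachable
      proof (intro allI impI)
        fix r :: real assume "r > 0"
        then show "\<exists>x'\<in>{u. Re u = 0}. x' \<noteq> (0::complex) \<and> dist x' 0 < r"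
          by (intro bexI[of _ "Complex 0 (r / 2)"]) (auto simp: complex_eq_iff dist_norm cmod_def)
      qed
    qed (use z axis in \<open>auto simp: open_vstrip\<close>)
    then show ?thesis by simp
  qed
  have \<omega>cont: "continuous_on W \<omega>"
  proof -
    have "continuous_on W (\<lambda>z. exp (ln (\<omega> z)))"
      using real_analytic_on_imp_isCont[OF W(4)] by (intro continuous_intros continuous_at_imp_continuous_on) auto
    then show ?thesis using W(3) by (simp cong: continuous_on_cong)
  qed
  have hs: "z \<in> vstrip {-\<delta><..<\<delta>}" if "z \<in> vstrip {-(\<delta>/2)..0}" for z using that \<delta> by (auto simp: vstrip_def)
  have "orthogonality_chart D \<phi> \<psi> \<rho> \<kappa> V v \<omega> \<delta> (\<delta> / 2) h C"
  proof
    show "continuous_on (strip_map ` vstrip {-(\<delta>/2)..0}) \<omega>" using hs inW by (intro continuous_on_subset[OF \<omega>cont]) auto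
    show "0 < \<omega> (strip_map z)" if "z \<in> vstrip {-(\<delta>/2)..0}" for z using W(3) inW hs[OF that] by blast
  qed (use \<omega>1 \<delta> hper h0 ex' in auto)
  then show ?thesis by (rule that)
qed

end

lemma at_inf_eq: "(f \<longlongrightarrow> L) at_infinity \<Longrightarrow> at_inf f = L"
  unfolding at_inf_def by (rule tendsto_Lim) (simp_all add: trivial_limit_at_infinity)

lemma leading_const_eq:
  assumes "(deriv \<phi> \<longlongrightarrow> of_real \<kappa>) at_infinity" "\<kappa> > 0" "(V \<longlongrightarrow> of_real v) at_infinity"
  shows "leading_const \<phi> V N = of_real (1 / (\<kappa> ^ (N + 1) * exp v))"
proof -
  have "(of_real \<kappa> :: complex) powi (- int N - 1) = of_real (1 / \<kappa> ^ (N + 1))"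
  proof -
    have "- int N - 1 = - int (N + 1)" by simp
    then show ?thesis by (simp only: power_int_minus power_int_of_nat) (simp add: inverse_eq_divide)
  qed
  moreover have "exp (- of_real v :: complex) = of_real (1 / exp v)"
    by (simp add: exp_minus inverse_eq_divide exp_of_real)
  ultimately show ?thesis
    unfolding leading_const_def at_inf_eq[OF assms(1)] at_inf_eq[OF assms(3)] by simp
qed

section \<open>Logarithmic capacity\<close>

lemma Lagrange_leading_coeff:
  fixes p :: "'a :: field poly"
  assumes A: "finite A" "card A = Suc n" and p: "degree p \<le> n"
  shows "(\<Sum>a\<in>A. poly p a / (\<Prod>y\<in>A-{a}. a - y)) = coeff p n"
proof -
  define m where "m = (\<lambda>a. \<Prod>y\<in>A-{a}. [:- y, 1:])"
  define q where "q = (\<Sum>a\<in>A. smult (poly p a / (\<Prod>y\<in>A-{a}. a - y)) (m a))"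
  have deg: "degree (m a) = n" "coeff (m a) n = 1" if "a \<in> A" for a
  proof -
    have "degree (m a) = (\<Sum>y\<in>A-{a}. degree [:- y, 1:])" unfolding m_def by (rule degree_prod_eq_sum_degree) simp
    also have "\<dots> = n" using that A by simp
    finally show d: "degree (m a) = n" .
    have "lead_coeff (m a) = 1" unfolding m_def lead_coeff_prod by simp
    then show "coeff (m a) n = 1" using d by simp
  qed
  have "poly p x = poly q x" if x: "x \<in> A" for x
  proof -
    have "poly q x = (\<Sum>a\<in>A. poly p a / (\<Prod>y\<in>A-{a}. a - y) * (\<Prod>y\<in>A-{a}. x - y))"
      by (simp add: q_def m_def poly_sum poly_prod)
    also have "\<dots> = (\<Sum>a\<in>A. if a = x then poly p x else 0)"
    proof (rule sum.cong)
      fix a assume a: "a \<in> A"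
      show "poly p a / (\<Prod>y\<in>A-{a}. a - y) * (\<Prod>y\<in>A-{a}. x - y) = (if a = x then poly p x else 0)"
        using A x by (auto simp: prod_zero_iff)
    qed simp
    also have "\<dots> = poly p x" using A x by simp
    finally show ?thesis ..
  qed
  moreover have "degree q \<le> n" unfolding q_def
    by (intro degree_sum_le A order_trans[OF degree_smult_le]) (simp add: deg)
  ultimately have "p = q" using A p by (intro poly_eqI_degree[of A]) auto
  then have "coeff p n = coeff q n" by simp
  also have "\<dots> = (\<Sum>a\<in>A. poly p a / (\<Prod>y\<in>A-{a}. a - y) * coeff (m a) n)" by (simp add: q_def coeff_sum)
  also have "\<dots> = (\<Sum>a\<in>A. poly p a / (\<Prod>y\<in>A-{a}. a - y))" by (intro sum.cong) (auto simp: deg)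
  finally show ?thesis ..
qed

text \<open>Lagrange interpolation of a monic polynomial of degree \<open>n\<close> at \<open>n + 1\<close> points yields a point whose
  distances to the others have a small product; remove it and iterate (Fekete).\<close>

lemma discrete_energy_bound:
  fixes T :: "nat \<Rightarrow> complex poly" and E :: "complex set"
  assumes T: "\<And>n. degree (T n) \<le> n" "\<And>n. coeff (T n) n = 1" "\<And>n z. z \<in> E \<Longrightarrow> norm (poly (T n) z) \<le> K * q ^ n"
    and K: "K > 0" "q > 0"
  shows "finite A \<Longrightarrow> A \<subseteq> E \<Longrightarrow>
    (\<Sum>a\<in>A. \<Sum>y\<in>A-{a}. ln (dist a y)) \<le> (\<Sum>j<card A. 2 * (ln (real (j + 1)) + ln K + real j * ln q))"
proof (induction "card A" arbitrary: A)
  case 0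
  then show ?case by simp
next
  case (Suc n)
  have cA: "card A = Suc n" using Suc.hyps(2) by simp
  have "\<exists>a\<in>A. (\<Prod>y\<in>A-{a}. dist a y) \<le> real (n + 1) * (K * q ^ n)"
  proof (rule ccontr)
    assume "\<not> ?thesis"
    then have *: "real (n + 1) * (K * q ^ n) < (\<Prod>y\<in>A-{a}. dist a y)" if "a \<in> A" for a using that by force
    have "(1::real) = norm (\<Sum>a\<in>A. poly (T n) a / (\<Prod>y\<in>A-{a}. a - y))"
      by (subst Lagrange_leading_coeff[OF Suc.prems(1) cA T(1)]) (simp add: T(2))
    also have "\<dots> < (\<Sum>a\<in>A. 1 / real (n + 1))"
    proof (rule order_le_less_trans[OF norm_sum], rule sum_strict_mono)
      fix a assume a: "a \<in> A"
      have Kn: "0 < K * q ^ n" using K by simp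
      then have "0 < real (n + 1) * (K * q ^ n)" by simp
      then have p: "0 < (\<Prod>y\<in>A-{a}. dist a y)" using *[OF a] by linarith
      have "norm (poly (T n) a / (\<Prod>y\<in>A-{a}. a - y)) = norm (poly (T n) a) / (\<Prod>y\<in>A-{a}. dist a y)"
        by (simp add: norm_divide prod_norm dist_norm)
      also have "\<dots> \<le> K * q ^ n / (\<Prod>y\<in>A-{a}. dist a y)" using T(3)[of a n] a Suc.prems p by (intro divide_right_mono) auto
      also have "\<dots> < 1 / real (n + 1)" using *[OF a] p by (simp add: field_simps)
      finally show "norm (poly (T n) a / (\<Prod>y\<in>A-{a}. a - y)) < 1 / real (n + 1)" .
    qed (use Suc.prems cA in auto)
    also have "\<dots> = 1" using cA by simp
    finally show False by simp
  qed
  then obtain a where a: "a \<in> A" "(\<Prod>y\<in>A-{a}. dist a y) \<le> real (n + 1) * (K * q ^ n)" by blast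
  let ?B = "A - {a}"
  have finB: "finite ?B" and cB: "card ?B = n" using Suc.prems a cA by auto
  have p: "0 < (\<Prod>y\<in>?B. dist a y)" by (intro prod_pos) auto
  have s: "(\<Sum>y\<in>?B. ln (dist a y)) \<le> ln (real (n + 1)) + ln K + real n * ln q"
  proof -
    have "(\<Sum>y\<in>?B. ln (dist a y)) = ln (\<Prod>y\<in>?B. dist a y)" by (subst ln_prod) (use finB in auto)
    also have "\<dots> \<le> ln (real (n + 1) * (K * q ^ n))" using a(2) p by (subst ln_le_cancel_iff) auto
    also have "\<dots> = ln (real (n + 1)) + ln K + real n * ln q" using K by (simp add: ln_mult ln_realpow)
    finally show ?thesis .
  qed
  have "(\<Sum>x\<in>A. \<Sum>y\<in>A-{x}. ln (dist x y)) = (\<Sum>y\<in>?B. ln (dist a y)) + (\<Sum>x\<in>?B. \<Sum>y\<in>A-{x}. ln (dist x y))"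
    using Suc.prems a(1) by (simp add: sum.remove)
  also have "(\<Sum>x\<in>?B. \<Sum>y\<in>A-{x}. ln (dist x y)) = (\<Sum>x\<in>?B. ln (dist x a) + (\<Sum>y\<in>?B-{x}. ln (dist x y)))"
  proof (rule sum.cong)
    fix x assume x: "x \<in> ?B"
    have "(\<Sum>y\<in>A-{x}. ln (dist x y)) = ln (dist x a) + (\<Sum>y\<in>A-{x}-{a}. ln (dist x y))"
      using x a(1) Suc.prems by (intro sum.remove) auto
    moreover have "A - {x} - {a} = ?B - {x}" by auto
    ultimately show "(\<Sum>y\<in>A-{x}. ln (dist x y)) = ln (dist x a) + (\<Sum>y\<in>?B-{x}. ln (dist x y))" by simp
  qed simp
  also have "\<dots> = (\<Sum>y\<in>?B. ln (dist a y)) + (\<Sum>x\<in>?B. \<Sum>y\<in>?B-{x}. ln (dist x y))"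
    by (simp add: sum.distrib dist_commute)
  also have "(\<Sum>x\<in>?B. \<Sum>y\<in>?B-{x}. ln (dist x y)) \<le> (\<Sum>j<n. 2 * (ln (real (j + 1)) + ln K + real j * ln q))"
    using Suc.hyps(1)[of ?B] cB finB Suc.prems by auto
  finally show ?case using s unfolding cA by simp
qed

text \<open>Average the discrete inequality over \<open>n\<close> independent points distributed by
  \<open>\<mu>\<close>. Every ordered pair of different coordinates has law
  \<open>\<mu> \<Otimes>\<^sub>M \<mu>\<close>, and the points are almost surely distinct, so they
  form an \<open>n\<close>-element set.\<close>

lemma integral_pairwise_sum_bound:
  fixes \<mu> :: "complex measure" and g :: "complex \<times> complex \<Rightarrow> real"
  assumes \<mu>: "prob_space \<mu>" "sets \<mu> = sets borel"
    and g: "integrable (\<mu> \<Otimes>\<^sub>M \<mu>) g" and ne: "AE p in \<mu> \<Otimes>\<^sub>M \<mu>. fst p \<noteq> snd p" and E: "AE x in \<mu>. x \<in> E"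
    and C: "\<And>A. finite A \<Longrightarrow> A \<subseteq> E \<Longrightarrow> card A = n \<Longrightarrow> (\<Sum>a\<in>A. \<Sum>y\<in>A-{a}. g (a, y)) \<le> C"
  shows "real n * (real n - 1) * (\<integral>p. g p \<partial>(\<mu> \<Otimes>\<^sub>M \<mu>)) \<le> C"
proof (cases "n = 0")
  case True
  then show ?thesis using C[of "{}"] by simp
next
  case False
  interpret \<mu>: prob_space \<mu> by fact
  interpret P: product_prob_space "\<lambda>_::nat. \<mu>" "{..<n}" by unfold_locales
  let ?P = "Pi\<^sub>M {..<n} (\<lambda>_. \<mu>)"
  have comp: "distr ?P \<mu> (\<lambda>x. x i) = \<mu>" if "i < n" for i using P.PiM_component[of i] that by simp
  have meas: "(\<lambda>x. (x i, x j)) \<in> ?P \<rightarrow>\<^sub>M \<mu> \<Otimes>\<^sub>M \<mu>" if "i < n" "j < n" for i j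
    using that by (intro measurable_Pair measurable_component_singleton) auto
  \<comment> \<open>Checked on rectangles, whose preimages are cylinders over the two coordinates
    \<open>i\<close> and \<open>j\<close>.\<close>
  have pair: "distr ?P (\<mu> \<Otimes>\<^sub>M \<mu>) (\<lambda>x. (x i, x j)) = \<mu> \<Otimes>\<^sub>M \<mu>" if ij: "i < n" "j < n" "i \<noteq> j" for i j
  proof (rule sym, rule pair_measure_eqI)
    fix A B assume AB: "A \<in> sets \<mu>" "B \<in> sets \<mu>"
    let ?X = "\<lambda>k. if k = i then A else B"
    have "(\<lambda>x. (x i, x j)) -` (A \<times> B) \<inter> space ?P = prod_emb {..<n} (\<lambda>_. \<mu>) {i, j} (Pi\<^sub>E {i, j} ?X)"
      using ij by (auto simp: prod_emb_def space_PiM PiE_def Pi_def)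
    then have "emeasure (distr ?P (\<mu> \<Otimes>\<^sub>M \<mu>) (\<lambda>x. (x i, x j))) (A \<times> B) = emeasure ?P (prod_emb {..<n} (\<lambda>_. \<mu>) {i, j} (Pi\<^sub>E {i, j} ?X))"
      using AB by (subst emeasure_distr[OF meas[OF ij(1,2)]]) auto
    also have "\<dots> = (\<Prod>k\<in>{i, j}. emeasure \<mu> (?X k))" using ij AB by (intro P.emeasure_PiM_emb) auto
    also have "\<dots> = emeasure \<mu> A * emeasure \<mu> B" using ij by simp
    finally show "emeasure \<mu> A * emeasure \<mu> B = emeasure (distr ?P (\<mu> \<Otimes>\<^sub>M \<mu>) (\<lambda>x. (x i, x j))) (A \<times> B)" ..
  qed (auto intro: \<mu>.sigma_finite_measure_axioms)
  have int: "integrable ?P (\<lambda>x. g (x i, x j))" "(\<integral>x. g (x i, x j) \<partial>?P) = (\<integral>p. g p \<partial>(\<mu> \<Otimes>\<^sub>M \<mu>))"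
    if ij: "i < n" "j < n" "i \<noteq> j" for i j
  proof -
    have gm: "g \<in> borel_measurable (\<mu> \<Otimes>\<^sub>M \<mu>)" using g by auto
    have "integrable (distr ?P (\<mu> \<Otimes>\<^sub>M \<mu>) (\<lambda>x. (x i, x j))) g" unfolding pair[OF ij] by (rule g)
    then show "integrable ?P (\<lambda>x. g (x i, x j))" by (subst (asm) integrable_distr_eq[OF meas[OF ij(1,2)] gm])
    have "(\<integral>p. g p \<partial>(\<mu> \<Otimes>\<^sub>M \<mu>)) = (\<integral>p. g p \<partial>(distr ?P (\<mu> \<Otimes>\<^sub>M \<mu>) (\<lambda>x. (x i, x j))))" unfolding pair[OF ij] ..
    also have "\<dots> = (\<integral>x. g (x i, x j) \<partial>?P)" by (rule integral_distr[OF meas[OF ij(1,2)] gm])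
    finally show "(\<integral>x. g (x i, x j) \<partial>?P) = (\<integral>p. g p \<partial>(\<mu> \<Otimes>\<^sub>M \<mu>))" ..
  qed
  have distinct: "AE x in ?P. x i \<noteq> x j" if ij: "i < n" "j < n" "i \<noteq> j" for i j
  proof -
    have "AE p in distr ?P (\<mu> \<Otimes>\<^sub>M \<mu>) (\<lambda>x. (x i, x j)). fst p \<noteq> snd p" unfolding pair[OF ij] by (rule ne)
    then have "AE x in ?P. fst (x i, x j) \<noteq> snd (x i, x j)" by (rule AE_distrD[OF meas[OF ij(1,2)]])
    then show ?thesis by simp
  qed
  have inE: "AE x in ?P. x i \<in> E" if i: "i < n" for i
  proof -
    have "AE p in distr ?P \<mu> (\<lambda>x. x i). p \<in> E" unfolding comp[OF i] by (rule E)
    then show ?thesis using i by (intro AE_distrD[of "\<lambda>x. x i" ?P \<mu>]) auto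
  qed
  have ae: "AE x in ?P. (\<forall>i\<in>{..<n}. \<forall>j\<in>{..<n}-{i}. x i \<noteq> x j) \<and> (\<forall>i\<in>{..<n}. x i \<in> E)"
    using distinct inE by (intro AE_conjI AE_finite_allI) auto
  have "(\<integral>x. (\<Sum>i<n. \<Sum>j\<in>{..<n}-{i}. g (x i, x j)) \<partial>?P) \<le> C"
  proof (rule P.integral_le_const)
    show "integrable ?P (\<lambda>x. \<Sum>i<n. \<Sum>j\<in>{..<n}-{i}. g (x i, x j))" by (intro Bochner_Integration.integrable_sum int) auto
    show "AE x in ?P. (\<Sum>i<n. \<Sum>j\<in>{..<n}-{i}. g (x i, x j)) \<le> C"
      using ae
    proof eventually_elim
      case (elim x)
      have inj: "inj_on x {..<n}" using elim by (auto simp: inj_on_def)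
      have "(\<Sum>i<n. \<Sum>j\<in>{..<n}-{i}. g (x i, x j)) = (\<Sum>a\<in>x ` {..<n}. \<Sum>y\<in>x ` {..<n} - {a}. g (a, y))"
      proof (subst sum.reindex[OF inj], unfold o_def, intro sum.cong)
        fix i assume i: "i \<in> {..<n}"
        have "x ` {..<n} - {x i} = x ` ({..<n} - {i})" using inj i by (auto simp: inj_on_def)
        moreover have "inj_on x ({..<n} - {i})" using inj by (auto simp: inj_on_def)
        ultimately show "(\<Sum>j\<in>{..<n}-{i}. g (x i, x j)) = (\<Sum>y\<in>x ` {..<n} - {x i}. g (x i, y))" by (simp add: sum.reindex)
      qed simp
      also have "\<dots> \<le> C" using elim inj by (intro C) (auto simp: card_image)
      finally show ?case .
    qed
  qed
  also have "(\<integral>x. (\<Sum>i<n. \<Sum>j\<in>{..<n}-{i}. g (x i, x j)) \<partial>?P) = (\<Sum>i<n. \<Sum>j\<in>{..<n}-{i}. (\<integral>p. g p \<partial>(\<mu> \<Otimes>\<^sub>M \<mu>)))"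
  proof -
    have "(\<integral>x. (\<Sum>j\<in>{..<n}-{i}. g (x i, x j)) \<partial>?P) = (\<Sum>j\<in>{..<n}-{i}. (\<integral>p. g p \<partial>(\<mu> \<Otimes>\<^sub>M \<mu>)))" if "i < n" for i
      using that int by (subst Bochner_Integration.integral_sum) (auto intro!: sum.cong)
    moreover have "(\<integral>x. (\<Sum>i<n. \<Sum>j\<in>{..<n}-{i}. g (x i, x j)) \<partial>?P) = (\<Sum>i<n. (\<integral>x. (\<Sum>j\<in>{..<n}-{i}. g (x i, x j)) \<partial>?P))"
      by (intro Bochner_Integration.integral_sum Bochner_Integration.integrable_sum int) auto
    ultimately show ?thesis by simp
  qed
  also have "\<dots> = real n * (real n - 1) * (\<integral>p. g p \<partial>(\<mu> \<Otimes>\<^sub>M \<mu>))" using False by (simp add: of_nat_diff)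
  finally show ?thesis .
qed

section \<open>Energies as integrals over the product measure\<close>

definition log_pos :: "complex \<Rightarrow> complex \<Rightarrow> ennreal" where
  "log_pos z w = (if z = w then \<infinity> else ennreal (- ln (dist z w)))"

lemma log_pos_measurable [measurable]: "case_prod log_pos \<in> borel_measurable (borel \<Otimes>\<^sub>M borel)"
proof -
  have "{p :: complex \<times> complex. fst p = snd p} \<in> sets (borel \<Otimes>\<^sub>M borel)"
    unfolding borel_prod by (intro borel_closed closed_Collect_eq continuous_intros)
  then have [measurable]: "Measurable.pred (borel \<Otimes>\<^sub>M borel) (\<lambda>p :: complex \<times> complex. fst p = snd p)"
    by (simp add: pred_def space_pair_measure)
  show ?thesis unfolding log_pos_def[abs_def] case_prod_beta by measurable
qed

text \<open>Bounded support makes the integral \<open>B\<close> finite, so the energy can be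
  infinite only through \<open>A\<close>. If it is finite, the diagonal, where the integrand of
  \<open>A\<close> is infinite, is a null set, and the value \<open>ln 0 = 0\<close> there does no
  harm.\<close>

lemma log_energy_finite:
  fixes \<mu> :: "complex measure"
  assumes \<mu>: "prob_space \<mu>" "sets \<mu> = sets borel"
    and K: "AE x in \<mu>. x \<in> K" "bounded K" and fin: "log_energy \<mu> \<noteq> \<infinity>"
  shows "integrable (\<mu> \<Otimes>\<^sub>M \<mu>) (\<lambda>p. ln (dist (fst p) (snd p)))"
    and "AE p in \<mu> \<Otimes>\<^sub>M \<mu>. fst p \<noteq> snd p"
    and "real_of_ereal (log_energy \<mu>) = - (\<integral>p. ln (dist (fst p) (snd p)) \<partial>(\<mu> \<Otimes>\<^sub>M \<mu>))"
proof -
  interpret \<mu>: prob_space \<mu> by fact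
  interpret PP: pair_prob_space \<mu> \<mu> ..
  have [measurable_cong]: "sets \<mu> = sets borel" by fact
  have lm: "case_prod log_pos \<in> borel_measurable (\<mu> \<Otimes>\<^sub>M \<mu>)" by measurable
  let ?g = "\<lambda>p :: complex \<times> complex. ln (dist (fst p) (snd p))"
  have gm: "?g \<in> borel_measurable (\<mu> \<Otimes>\<^sub>M \<mu>)" by measurable
  define A where "A = (\<integral>\<^sup>+p. log_pos (fst p) (snd p) \<partial>(\<mu> \<Otimes>\<^sub>M \<mu>))"
  define B where "B = (\<integral>\<^sup>+p. ennreal (?g p) \<partial>(\<mu> \<Otimes>\<^sub>M \<mu>))"
  have A: "(\<integral>\<^sup>+z. \<integral>\<^sup>+w. log_pos z w \<partial>\<mu> \<partial>\<mu>) = A"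
    using \<mu>.nn_integral_fst[OF lm] by (simp add: A_def case_prod_beta')
  have B: "(\<integral>\<^sup>+z. \<integral>\<^sup>+w. ennreal (ln (dist z w)) \<partial>\<mu> \<partial>\<mu>) = B"
    using \<mu>.nn_integral_fst[of "\<lambda>p. ennreal (?g p)" \<mu>] gm by (simp add: B_def)
  have en: "log_energy \<mu> = enn2ereal A - enn2ereal B"
    unfolding log_energy_def A[symmetric] B[symmetric] log_pos_def[abs_def] ..
  obtain R where R: "R > 1" "\<And>x y. x \<in> K \<Longrightarrow> y \<in> K \<Longrightarrow> dist x y \<le> R"
  proof -
    obtain e where "\<And>x y. x \<in> K \<Longrightarrow> y \<in> K \<Longrightarrow> dist x y \<le> e" using K(2) unfolding bounded_two_points by blast
    then show ?thesis using that[of "max 2 e"] by (meson dual_order.strict_trans1 le_max_iff_disj max.cobounded1 one_less_numeral_iff semiring_norm(76) order.refl)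
  qed
  have BR: "B \<le> ennreal (ln R)"
  proof -
    have "(\<integral>\<^sup>+w. ennreal (ln (dist z w)) \<partial>\<mu>) \<le> ennreal (ln R)" if z: "z \<in> K" for z
    proof -
      have "(\<integral>\<^sup>+w. ennreal (ln (dist z w)) \<partial>\<mu>) \<le> (\<integral>\<^sup>+w. ennreal (ln R) \<partial>\<mu>)"
      proof (rule nn_integral_mono_AE)
        show "AE w in \<mu>. ennreal (ln (dist z w)) \<le> ennreal (ln R)"
          using K(1)
        proof eventually_elim
          case (elim w)
          show ?case
          proof (cases "dist z w = 0")
            case False
            then have "ln (dist z w) \<le> ln R" using R(2)[OF z elim] R(1) by (subst ln_le_cancel_iff) (auto simp: zero_less_dist_iff)
            then show ?thesis by (rule ennreal_leI)
          qed (use R in auto)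
        qed
      qed
      then show ?thesis by (simp add: \<mu>.emeasure_space_1)
    qed
    then have "(\<integral>\<^sup>+z. \<integral>\<^sup>+w. ennreal (ln (dist z w)) \<partial>\<mu> \<partial>\<mu>) \<le> (\<integral>\<^sup>+z. ennreal (ln R) \<partial>\<mu>)"
      using K(1) by (intro nn_integral_mono_AE) auto
    then show ?thesis unfolding B by (simp add: \<mu>.emeasure_space_1)
  qed
  then have Bfin: "B \<noteq> \<infinity>" by (cases B) (auto simp: top_unique)
  have Afin: "A \<noteq> \<infinity>"
  proof
    assume "A = \<infinity>"
    then have "log_energy \<mu> = \<infinity>" unfolding en using Bfin by (cases B) auto
    then show False using fin by simp
  qed
  have AEf: "AE p in \<mu> \<Otimes>\<^sub>M \<mu>. log_pos (fst p) (snd p) \<noteq> \<infinity>"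
    using lm Afin unfolding A_def by (intro nn_integral_PInf_AE) (auto simp: case_prod_beta)
  then show ne: "AE p in \<mu> \<Otimes>\<^sub>M \<mu>. fst p \<noteq> snd p" by eventually_elim (auto simp: log_pos_def)
  have A2: "A = (\<integral>\<^sup>+p. ennreal (- ?g p) \<partial>(\<mu> \<Otimes>\<^sub>M \<mu>))" unfolding A_def
    using ne by (intro nn_integral_cong_AE) (auto elim!: eventually_mono simp: log_pos_def)
  show int: "integrable (\<mu> \<Otimes>\<^sub>M \<mu>) ?g"
    unfolding real_integrable_def using gm Afin Bfin A2 by (simp add: B_def)
  have "(\<integral>p. ?g p \<partial>(\<mu> \<Otimes>\<^sub>M \<mu>)) = enn2real B - enn2real A"
    unfolding real_lebesgue_integral_def[OF int] B_def A2 ..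
  moreover have "real_of_ereal (log_energy \<mu>) = enn2real A - enn2real B"
    unfolding en using Afin Bfin by (cases A; cases B) (auto simp: enn2ereal_ennreal)
  ultimately show "real_of_ereal (log_energy \<mu>) = - (\<integral>p. ?g p \<partial>(\<mu> \<Otimes>\<^sub>M \<mu>))" by simp
qed

text \<open>The averaged bound reads \<open>n (n - 1) L \<le> n (n - 1) ln q + O(n ln n)\<close>;
  dividing by \<open>n (n - 1)\<close> and letting \<open>n\<close> grow gives
  \<open>L \<le> ln q\<close>.\<close>

lemma log_energy_ge:
  fixes T :: "nat \<Rightarrow> complex poly" and \<mu> :: "complex measure"
  assumes T: "\<And>n. degree (T n) \<le> n" "\<And>n. coeff (T n) n = 1" "\<And>n z. z \<in> E \<Longrightarrow> norm (poly (T n) z) \<le> C * q ^ n"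
    and C: "C > 0" "q > 0"
    and \<mu>: "prob_space \<mu>" "sets \<mu> = sets borel" and E: "AE x in \<mu>. x \<in> E" "bounded E" and fin: "log_energy \<mu> \<noteq> \<infinity>"
  shows "real_of_ereal (log_energy \<mu>) \<ge> - ln q"
proof -
  define L where "L = (\<integral>p. ln (dist (fst p) (snd p)) \<partial>(\<mu> \<Otimes>\<^sub>M \<mu>))"
  note en = log_energy_finite[OF \<mu> E fin]
  have *: "real n * (real n - 1) * L \<le> (\<Sum>j<n. 2 * (ln (real (j + 1)) + ln C + real j * ln q))" for n
    unfolding L_def
  proof (rule integral_pairwise_sum_bound[OF \<mu> en(1,2) E(1)])
    fix A assume "finite A" "A \<subseteq> E" "card A = n"
    then show "(\<Sum>a\<in>A. \<Sum>y\<in>A-{a}. ln (dist (fst (a, y)) (snd (a, y)))) \<le> (\<Sum>j<n. 2 * (ln (real (j + 1)) + ln C + real j * ln q))"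
      using discrete_energy_bound[where E=E and A=A, OF T C] by simp
  qed
  have le: "L \<le> ln q + 2 * (ln (real n) + ln C) / (real n - 1)" if n: "n \<ge> 2" for n
  proof -
    have "(\<Sum>j<n. 2 * (ln (real (j + 1)) + ln C + real j * ln q)) \<le> (\<Sum>j<n. 2 * (ln (real n) + ln C) + 2 * ln q * real j)"
      using n by (intro sum_mono) (auto simp: algebra_simps)
    also have "\<dots> = 2 * real n * (ln (real n) + ln C) + 2 * ln q * (\<Sum>j<n. real j)"
      by (simp add: sum.distrib sum_distrib_left algebra_simps)
    also have "(\<Sum>j<n. real j) = real n * (real n - 1) / 2"
      by (induction n) (auto simp: field_simps)
    finally have "real n * (real n - 1) * L \<le> 2 * real n * (ln (real n) + ln C) + 2 * ln q * (real n * (real n - 1) / 2)"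
      using *[of n] by (rule order_trans[rotated])
    also have "\<dots> = real n * (2 * (ln (real n) + ln C) + ln q * (real n - 1))" by (simp add: field_simps)
    finally have "real n * ((real n - 1) * L) \<le> real n * (2 * (ln (real n) + ln C) + ln q * (real n - 1))" by (simp only: mult.assoc)
    then have "(real n - 1) * L \<le> 2 * (ln (real n) + ln C) + ln q * (real n - 1)" using n by (simp add: mult_le_cancel_left_pos)
    then show ?thesis using n by (simp add: field_simps)
  qed
  have "(\<lambda>n. ln q + 2 * (ln (real n) + ln C) / (real n - 1)) \<longlonglongrightarrow> ln q" by real_asymp
  then have "L \<le> ln q" by (rule tendsto_lowerbound) (use le in \<open>auto simp: eventually_at_top_linorder intro!: exI[of _ 2]\<close>)
  then show ?thesis using en(3) by (simp add: L_def)
qed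

text \<open>The energy is a difference of two integrals. Adding \<open>m\<close>, an upper bound for
  the logarithm on the support, turns it into one nonnegative integral \<open>I\<close>, with
  \<open>A + m = I + B\<close>; then \<open>A - B = I - m \<le> a\<close>.\<close>

lemma log_energy_le:
  fixes \<mu> :: "complex measure"
  assumes \<mu>: "prob_space \<mu>" "sets \<mu> = sets borel"
    and K: "AE x in \<mu>. x \<in> K" "\<And>x y. x \<in> K \<Longrightarrow> y \<in> K \<Longrightarrow> dist x y \<le> exp m" and m: "m \<ge> 0"
    and diag: "\<And>z. AE w in \<mu>. z \<noteq> w"
    and le: "(\<integral>\<^sup>+z. \<integral>\<^sup>+w. ennreal (m - ln (dist z w)) \<partial>\<mu> \<partial>\<mu>) \<le> ennreal (a + m)" and a: "a + m \<ge> 0"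
  shows "log_energy \<mu> \<noteq> \<infinity>" "real_of_ereal (log_energy \<mu>) \<le> a"
proof -
  interpret \<mu>: prob_space \<mu> by fact
  have [measurable_cong]: "sets \<mu> = sets borel" by fact
  define B where "B = (\<integral>\<^sup>+z. \<integral>\<^sup>+w. ennreal (ln (dist z w)) \<partial>\<mu> \<partial>\<mu>)"
  define A where "A = (\<integral>\<^sup>+z. \<integral>\<^sup>+w. log_pos z w \<partial>\<mu> \<partial>\<mu>)"
  define I where "I = (\<integral>\<^sup>+z. \<integral>\<^sup>+w. ennreal (m - ln (dist z w)) \<partial>\<mu> \<partial>\<mu>)"
  have dm: "dist z w = 0 \<or> ln (dist z w) \<le> m" if "z \<in> K" "w \<in> K" for z w
  proof -
    have "ln (dist z w) \<le> ln (exp m)" if "dist z w \<noteq> 0"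
      using K(2)[OF \<open>z \<in> K\<close> \<open>w \<in> K\<close>] that by (subst ln_le_cancel_iff) (auto simp: zero_less_dist_iff)
    then show ?thesis by auto
  qed
  have inner: "(\<integral>\<^sup>+w. log_pos z w \<partial>\<mu>) + ennreal m = (\<integral>\<^sup>+w. ennreal (m - ln (dist z w)) \<partial>\<mu>) + (\<integral>\<^sup>+w. ennreal (ln (dist z w)) \<partial>\<mu>)"
    "(\<integral>\<^sup>+w. ennreal (ln (dist z w)) \<partial>\<mu>) \<le> ennreal m"
    if z: "z \<in> K" for z
  proof -
    note d = diag[of z]
    have [measurable]: "log_pos z \<in> borel_measurable \<mu>"
      using measurable_Pair2[OF log_pos_measurable, of z] by simp
    have "(\<integral>\<^sup>+w. log_pos z w \<partial>\<mu>) + ennreal m = (\<integral>\<^sup>+w. log_pos z w + ennreal m \<partial>\<mu>)"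
      by (subst nn_integral_add) (auto simp: \<mu>.emeasure_space_1)
    also have "\<dots> = (\<integral>\<^sup>+w. ennreal (m - ln (dist z w)) + ennreal (ln (dist z w)) \<partial>\<mu>)"
    proof (rule nn_integral_cong_AE)
      show "AE w in \<mu>. log_pos z w + ennreal m = ennreal (m - ln (dist z w)) + ennreal (ln (dist z w))"
        using d K(1)
      proof eventually_elim
        case (elim w)
        have l: "ln (dist z w) \<le> m" using dm[OF z elim(2)] elim(1) by simp
        show ?case
        proof (cases "ln (dist z w) \<ge> 0")
          case True
          then show ?thesis using elim l m by (simp add: log_pos_def ennreal_neg flip: ennreal_plus)
        next
          case False
          then show ?thesis using elim l m by (simp add: log_pos_def ennreal_neg flip: ennreal_plus)
        qed
      qed
    qed
    also have "\<dots> = (\<integral>\<^sup>+w. ennreal (m - ln (dist z w)) \<partial>\<mu>) + (\<integral>\<^sup>+w. ennreal (ln (dist z w)) \<partial>\<mu>)"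
      by (subst nn_integral_add) auto
    finally show "(\<integral>\<^sup>+w. log_pos z w \<partial>\<mu>) + ennreal m = (\<integral>\<^sup>+w. ennreal (m - ln (dist z w)) \<partial>\<mu>) + (\<integral>\<^sup>+w. ennreal (ln (dist z w)) \<partial>\<mu>)" .
    have "(\<integral>\<^sup>+w. ennreal (ln (dist z w)) \<partial>\<mu>) \<le> (\<integral>\<^sup>+w. ennreal m \<partial>\<mu>)"
      using K(1) by (intro nn_integral_mono_AE) (auto elim!: eventually_mono intro!: ennreal_leI dest!: dm[OF z] simp: m)
    then show "(\<integral>\<^sup>+w. ennreal (ln (dist z w)) \<partial>\<mu>) \<le> ennreal m" by (simp add: \<mu>.emeasure_space_1)
  qed
  have m1: "(\<lambda>z. \<integral>\<^sup>+w. log_pos z w \<partial>\<mu>) \<in> borel_measurable \<mu>"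
    by (rule \<mu>.borel_measurable_nn_integral) measurable
  have m2: "(\<lambda>z. \<integral>\<^sup>+w. ennreal (m - ln (dist z w)) \<partial>\<mu>) \<in> borel_measurable \<mu>"
    "(\<lambda>z. \<integral>\<^sup>+w. ennreal (ln (dist z w)) \<partial>\<mu>) \<in> borel_measurable \<mu>"
    by (rule \<mu>.borel_measurable_nn_integral; measurable)+
  have "A + ennreal m = (\<integral>\<^sup>+z. (\<integral>\<^sup>+w. log_pos z w \<partial>\<mu>) + ennreal m \<partial>\<mu>)"
    unfolding A_def using m1 by (subst nn_integral_add) (auto simp: \<mu>.emeasure_space_1)
  also have "\<dots> = (\<integral>\<^sup>+z. (\<integral>\<^sup>+w. ennreal (m - ln (dist z w)) \<partial>\<mu>) + (\<integral>\<^sup>+w. ennreal (ln (dist z w)) \<partial>\<mu>) \<partial>\<mu>)"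
    using K(1) by (intro nn_integral_cong_AE) (auto elim!: eventually_mono intro: inner)
  also have "\<dots> = I + B" unfolding I_def B_def using m2 by (subst nn_integral_add) auto
  finally have eq: "A + ennreal m = I + B" .
  have "B \<le> (\<integral>\<^sup>+z. ennreal m \<partial>\<mu>)" unfolding B_def
    using K(1) by (intro nn_integral_mono_AE) (auto elim!: eventually_mono intro: inner)
  then have Bm: "B \<le> ennreal m" by (simp add: \<mu>.emeasure_space_1)
  obtain b where b: "B = ennreal b" "b \<ge> 0" using Bm by (cases B) (auto simp: top_unique)
  obtain i where i: "I = ennreal i" "i \<ge> 0" "i \<le> a + m" using le a unfolding I_def[symmetric] by (cases I) (auto simp: top_unique)
  have "A + ennreal m = ennreal (i + b)" unfolding eq i b using i b by simp
  then obtain a' where a': "A = ennreal a'" "a' \<ge> 0" by (cases A) auto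
  with \<open>A + ennreal m = ennreal (i + b)\<close> have s: "a' + m = i + b" using m i b by (simp flip: ennreal_plus)
  have "log_energy \<mu> = enn2ereal A - enn2ereal B" unfolding log_energy_def A_def B_def log_pos_def[abs_def] ..
  then have "log_energy \<mu> = ereal (a' - b)" using a' b by (simp add: enn2ereal_ennreal)
  then show "log_energy \<mu> \<noteq> \<infinity>" "real_of_ereal (log_energy \<mu>) \<le> a" using s i by auto
qed

section \<open>The capacity of the chart domain\<close>

context exterior_chart
begin

text \<open>The approximating polynomials for \<open>V = 0\<close> and \<open>\<beta> = 1\<close>
  have leading coefficient \<open>\<kappa> ^ (n + 1)\<close> and are bounded on \<open>D\<close>
  uniformly in \<open>n\<close>, because \<open>|\<phi>| < 1\<close> in the collar. Normalizing them
  gives the rate \<open>1 / \<kappa>\<close>.\<close>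

lemma Chebyshev_polynomials:
  obtains T :: "nat \<Rightarrow> complex poly" and C where "C > 0" "\<And>n. degree (T n) \<le> n" "\<And>n. coeff (T n) n = 1"
    "\<And>n z. z \<in> D \<Longrightarrow> norm (poly (T n) z) \<le> C * (1 / \<kappa>) ^ n"
proof -
  interpret W: weighted_chart D \<phi> \<psi> \<rho> \<kappa> "\<lambda>_. 0" 0 by unfold_locales auto
  let ?w = width
  have w: "0 < ?w / 4" "?w / 4 < ?w / 2" "?w / 2 < 3 / 4 * ?w" "3 / 4 * ?w < ?w" "?w \<le> ?w" using width_pos by auto
  obtain C where C: "C \<ge> 0" "\<And>N. \<exists>Q. degree Q \<le> N \<and> coeff Q N = of_real (\<kappa> ^ (N + 1) * exp 0) \<and>
       (\<forall>z. Re z \<ge> - (?w / 2) \<longrightarrow> norm (poly Q (strip_map z) - W.main_term (\<lambda>_. 1) N (strip_map z)) \<le> C * 1 * exp (- (3 / 4 * ?w) * real N)) \<and>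
       (\<forall>z. z \<notin> region (?w / 2) \<longrightarrow> norm (poly Q z) \<le> C * 1 * exp (- (?w / 4) * real N))"
  proof -
    obtain C where "C \<ge> 0" "\<And>N \<beta> B. \<beta> holomorphic_on ball 0 (exp ?w) \<Longrightarrow> \<beta> 0 = 1 \<Longrightarrow> (\<And>x. x \<in> cball 0 (exp (3 / 4 * ?w)) \<Longrightarrow> norm (\<beta> x) \<le> B) \<Longrightarrow>
      \<exists>Q. degree Q \<le> N \<and> coeff Q N = of_real (\<kappa> ^ (N + 1) * exp 0) \<and>
       (\<forall>z. Re z \<ge> - (?w / 2) \<longrightarrow> norm (poly Q (strip_map z) - W.main_term \<beta> N (strip_map z)) \<le> C * B * exp (- (3 / 4 * ?w) * real N)) \<and>
       (\<forall>z. z \<notin> region (?w / 2) \<longrightarrow> norm (poly Q z) \<le> C * B * exp (- (?w / 4) * real N))"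
      using W.approximating_polynomial[OF w] by blast
    note C = this
    show ?thesis
      by (rule that[OF C(1)], rule C(2)) auto
  qed
  have "\<exists>Q. \<forall>N. degree (Q N) \<le> N \<and> coeff (Q N) N = of_real (\<kappa> ^ (N + 1) * exp 0) \<and>
       (\<forall>z. Re z \<ge> - (?w / 2) \<longrightarrow> norm (poly (Q N) (strip_map z) - W.main_term (\<lambda>_. 1) N (strip_map z)) \<le> C * 1 * exp (- (3 / 4 * ?w) * real N)) \<and>
       (\<forall>z. z \<notin> region (?w / 2) \<longrightarrow> norm (poly (Q N) z) \<le> C * 1 * exp (- (?w / 4) * real N))"
    by (rule choice) (use C(2) in blast)
  then obtain Q where Q: "\<And>N. degree (Q N) \<le> N" "\<And>N. coeff (Q N) N = of_real (\<kappa> ^ (N + 1) * exp 0)"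
    "\<And>N z. Re z \<ge> - (?w / 2) \<Longrightarrow> norm (poly (Q N) (strip_map z) - W.main_term (\<lambda>_. 1) N (strip_map z)) \<le> C * 1 * exp (- (3 / 4 * ?w) * real N)"
    "\<And>N z. z \<notin> region (?w / 2) \<Longrightarrow> norm (poly (Q N) z) \<le> C * 1 * exp (- (?w / 4) * real N)"
    by blast
  \<comment> \<open>The closed annulus over the collar; it is compact, which bounds the factor
    \<open>\<phi>'\<close> of the main term.\<close>
  define S where "S = {w :: complex. exp (- (?w / 2)) \<le> norm w \<and> norm w \<le> 1}"
  have "compact S"
  proof -
    have "S = cball 0 1 - ball 0 (exp (- (?w / 2)))" by (auto simp: S_def)
    then show ?thesis by (simp add: compact_diff)
  qed
  moreover have "continuous_on S (\<lambda>w. deriv \<phi> (\<psi> w))"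
  proof (rule continuous_on_compose2[of "\<psi> ` {w. \<rho> < norm w}" "deriv \<phi>" S \<psi>])
    show "continuous_on (\<psi> ` {w. \<rho> < norm w}) (deriv \<phi>)"
      by (intro holomorphic_on_imp_continuous_on holomorphic_deriv \<phi>_hol open_\<psi>_image open_chart) auto
    have "- width < - (?w / 2)" using width_pos by simp
    then have "S \<subseteq> {w. \<rho> < norm w}" using \<rho>_less_exp_iff[of "- (?w / 2)"] by (auto simp: S_def)
    then show "continuous_on S \<psi>" "\<psi> ` S \<subseteq> \<psi> ` {w. \<rho> < norm w}"
      using continuous_on_subset[OF holomorphic_on_imp_continuous_on[OF \<psi>_hol]] by auto
  qed
  ultimately have "bounded ((\<lambda>w. deriv \<phi> (\<psi> w)) ` S)" using compact_continuous_image compact_imp_bounded by blast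
  then obtain E where E: "\<And>w. w \<in> S \<Longrightarrow> norm (deriv \<phi> (\<psi> w)) \<le> E" unfolding bounded_iff by blast
  have E0: "E \<ge> 0" using order_trans[OF norm_ge_zero E[of 1]] width_pos by (simp add: S_def)
  define C' where "C' = (E + C + 1) / \<kappa>"
  define T where "T = (\<lambda>n. smult (of_real (1 / \<kappa> ^ (n + 1))) (Q n))"
  have bound: "norm (poly (Q n) z) \<le> E + C" if z: "z \<in> D" for n z
  proof (cases "z \<in> region (?w / 2)")
    case False
    have "norm (poly (Q n) z) \<le> C * 1 * exp (- (?w / 4) * real n)" by (rule Q(4)[OF False])
    also have "\<dots> \<le> C" using C(1) width_pos by (simp add: mult_left_le)
    finally show ?thesis using E0 by simp
  next
    case True
    then obtain u where u: "z = strip_map u" "Re u > - (?w / 2)" unfolding region_eq by auto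
    then have uw: "Re u > - width" using width_pos by simp
    have nu: "norm (exp u) < 1" using z \<psi>_in_D[of "exp u"] in_chart[OF uw] u(1) by (simp add: strip_map_def)
    have "norm (deriv \<phi> z) \<le> E" unfolding u(1) strip_map_def using u(2) nu by (intro E) (auto simp: S_def)
    moreover have "norm (\<phi> z ^ n) \<le> 1" unfolding u(1) \<phi>_strip_map[OF uw] norm_power using nu by (intro power_le_one) auto
    ultimately have "norm (W.main_term (\<lambda>_. 1) n z) \<le> E * 1" unfolding W.main_term_def
      using E0 mult_mono[of "norm (deriv \<phi> z)" E "norm (\<phi> z ^ n)" 1] by (simp add: norm_mult)
    moreover have "norm (poly (Q n) z - W.main_term (\<lambda>_. 1) n z) \<le> C * 1 * exp (- (3 / 4 * ?w) * real n)"
      unfolding u(1) by (rule Q(3)) (use u(2) in simp)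
    moreover have "C * 1 * exp (- (3 / 4 * ?w) * real n) \<le> C" using C(1) width_pos by (simp add: mult_left_le)
    ultimately show ?thesis using norm_triangle_sub[of "poly (Q n) z" "W.main_term (\<lambda>_. 1) n z"] by linarith
  qed
  show ?thesis
  proof (rule that[of C' T])
    show "C' > 0" using E0 C(1) \<kappa> by (simp add: C'_def)
    show "degree (T n) \<le> n" for n unfolding T_def by (rule order_trans[OF degree_smult_le Q(1)])
    show "coeff (T n) n = 1" for n using \<kappa> by (simp add: T_def Q(2))
    show "norm (poly (T n) z) \<le> C' * (1 / \<kappa>) ^ n" if "z \<in> D" for n z
    proof -
      have "norm (poly (T n) z) = (1 / \<kappa> ^ (n + 1)) * norm (poly (Q n) z)"
        using \<kappa> by (simp add: T_def norm_mult norm_divide norm_power)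
      also have "\<dots> \<le> (1 / \<kappa> ^ (n + 1)) * (E + C + 1)" using bound[OF that, of n] \<kappa> by (intro mult_left_mono) auto
      also have "\<dots> = C' * (1 / \<kappa>) ^ n" using \<kappa> by (simp add: C'_def field_simps)
      finally show ?thesis .
    qed
  qed
qed

text \<open>With \<open>X = 1 / w\<close> the function
  \<open>X * (\<psi> (1 / X) - \<psi> v)\<close> has no zeros in the disk
  \<open>|X| < 1 / |v|\<close> and the value \<open>1 / \<kappa>\<close> at 0. The logarithm of its
  modulus is harmonic, and the mean value property gives \<open>- ln \<kappa>\<close>; the factor
  \<open>X\<close> accounts for \<open>x\<close>.\<close>

lemma log_potential_mean:
  assumes x: "- width < x0" "x0 < x"
  shows "((\<lambda>t. ln (dist (strip_map (Complex x0 s)) (strip_map (Complex x t)))) has_integral 2 * pi * (x - ln \<kappa>)) {0..2 * pi}"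
proof -
  define v where "v = exp (Complex x0 s)"
  have v: "norm v = exp x0" "\<rho> < norm v" "v \<noteq> 0" using x(1) by (auto simp: v_def \<rho>_less_exp_iff)
  define G where "G = (\<lambda>X. if X = 0 then of_real (1 / \<kappa>) else X * (\<psi> (1 / X) - \<psi> v))"
  let ?b = "ball 0 (1 / norm v) :: complex set"
  have inv: "norm v < norm (1 / X)" if "X \<in> ?b - {0}" for X
    using that v(3) by (simp add: norm_divide field_simps)
  have nz: "G X \<noteq> 0" if "X \<in> ?b" for X
  proof (cases "X = 0")
    case True
    then show ?thesis using \<kappa> by (simp add: G_def)
  next
    case False
    then have i: "norm v < norm (1 / X)" using inv that by auto
    have "\<psi> (1 / X) \<noteq> \<psi> v"
    proof
      assume "\<psi> (1 / X) = \<psi> v"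
      then have "1 / X = v" using \<phi>_\<psi>[of "1 / X"] \<phi>_\<psi>[of v] v(2) less_trans[OF v(2) i] by metis
      then show False using i by simp
    qed
    then show ?thesis using False by (simp add: G_def)
  qed
  have hol0: "G holomorphic_on ?b - {0}"
  proof -
    have "(\<psi> \<circ> (\<lambda>X. 1 / X)) holomorphic_on ?b - {0}"
    proof (rule holomorphic_on_compose_gen[OF _ \<psi>_hol])
      show "(\<lambda>X::complex. 1 / X) holomorphic_on ?b - {0}" by (intro holomorphic_intros) auto
      show "(\<lambda>X. 1 / X) ` (?b - {0}) \<subseteq> {w. \<rho> < norm w}" using inv v(2) by (auto intro: less_trans)
    qed
    then have "(\<lambda>X. X * ((\<psi> \<circ> (\<lambda>X. 1 / X)) X - \<psi> v)) holomorphic_on ?b - {0}" by (intro holomorphic_intros)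
    then show ?thesis by (rule holomorphic_transform) (auto simp: G_def)
  qed
  have cont0: "isCont G 0"
  proof -
    have "filterlim (\<lambda>X::complex. 1 / X) at_infinity (at 0)"
      using filterlim_inverse_at_infinity[where 'a=complex] unfolding inverse_eq_divide[abs_def] .
    then have "((\<lambda>X. \<psi> (1 / X) / (1 / X)) \<longlongrightarrow> of_real (1 / \<kappa>)) (at 0)" by (rule filterlim_compose[OF \<psi>_asymp])
    then have "((\<lambda>X. \<psi> (1 / X) / (1 / X) - X * \<psi> v) \<longlongrightarrow> of_real (1 / \<kappa>) - 0 * \<psi> v) (at 0)" by (intro tendsto_intros)
    then have "((\<lambda>X. \<psi> (1 / X) / (1 / X) - X * \<psi> v) \<longlongrightarrow> G 0) (at 0)" by (simp add: G_def)
    then have "(G \<longlongrightarrow> G 0) (at 0)"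
      by (rule Lim_transform_eventually) (auto simp: G_def eventually_at_filter algebra_simps)
    then show ?thesis by (simp add: isCont_def)
  qed
  have "isCont G X" if "X \<in> ?b" for X
  proof (cases "X = 0")
    case False
    then show ?thesis using holomorphic_on_imp_differentiable_at[OF hol0, of X] that
      by (auto intro!: field_differentiable_imp_continuous_at)
  qed (use cont0 in simp)
  then have "continuous_on ?b G" by (simp add: continuous_at_imp_continuous_on)
  then have "G holomorphic_on ?b" by (rule no_isolated_singularity[where K="{0}"]) (use hol0 in auto)
  then obtain g where g: "g holomorphic_on ?b" "\<And>X. X \<in> ?b \<Longrightarrow> G X = exp (g X)"
    using contractible_imp_holomorphic_log[of G ?b, OF _ convex_imp_contractible[OF convex_ball] nz] by blast
  have inb: "exp (- z) \<in> ?b" if "z \<in> vstrip {x0<..}" for z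
    using that v(1) by (simp add: vstrip_def exp_minus inverse_eq_divide divide_less_eq norm_divide exp_diff[symmetric] divide_strict_left_mono)
  have f: "periodic_holomorphic_on (\<lambda>z. g (exp (- z))) {x0<..}"
  proof -
    have "(g \<circ> (\<lambda>z. exp (- z))) holomorphic_on vstrip {x0<..}"
      by (rule holomorphic_on_compose_gen[OF _ g(1)]) (use inb in \<open>auto intro!: holomorphic_intros\<close>)
    moreover have "exp (- (z + 2 * of_real pi * \<i>)) = exp (- z)" for z
      by (simp add: exp_diff exp_minus exp_add)
    ultimately show ?thesis by (simp add: periodic_holomorphic_on_def o_def)
  qed
  have "isCont g 0"
    using holomorphic_on_imp_continuous_on[OF g(1)] v(3) by (simp add: continuous_on_eq_continuous_at)
  moreover have "((\<lambda>z. exp (- z) :: complex) \<longlongrightarrow> 0) right_end"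
    using tendsto_inverse_0[THEN filterlim_compose, OF filterlim_exp_right_end] by (simp add: exp_minus)
  ultimately have lim: "((\<lambda>z. g (exp (- z))) \<longlongrightarrow> g 0) right_end" by (rule isCont_tendsto_compose)
  have "continuous_on {0..2*pi} (\<lambda>t. g (exp (- Complex x t)))"
    using x by (intro continuous_on_vline[OF periodic_holomorphic_onD(2)[OF f]]) auto
  then have "((\<lambda>t. g (exp (- Complex x t))) has_integral vline_integral (\<lambda>z. g (exp (- z))) x) {0..2 * pi}"
    unfolding vline_integral_def by (intro integrable_integral integrable_continuous_interval)
  then have "((\<lambda>t. g (exp (- Complex x t))) has_integral 2 * of_real pi * g 0) {0..2 * pi}"
    unfolding vline_integral_right_end[OF f lim x(2)] .
  then have "((Re \<circ> (\<lambda>t. g (exp (- Complex x t)))) has_integral Re (2 * of_real pi * g 0)) {0..2 * pi}"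
    by (rule has_integral_linear[OF _ bounded_linear_Re])
  moreover have Reg: "Re (g X) = ln (norm (G X))" if "X \<in> ?b" for X using g(2)[OF that] by simp
  have "Re (2 * of_real pi * g 0) = 2 * pi * (- ln \<kappa>)"
    using Reg[of 0] v(3) \<kappa> by (simp add: G_def ln_div norm_divide)
  moreover have "Re (g (exp (- Complex x t))) = ln (dist (strip_map (Complex x0 s)) (strip_map (Complex x t))) - x" for t
  proof -
    have b: "exp (- Complex x t) \<in> ?b" by (rule inb) (use x in \<open>simp add: vstrip_def\<close>)
    have "G (exp (- Complex x t)) = exp (- Complex x t) * (strip_map (Complex x t) - strip_map (Complex x0 s))"
      by (simp add: G_def v_def strip_map_def exp_minus inverse_eq_divide)
    then have "norm (G (exp (- Complex x t))) = exp (- x) * dist (strip_map (Complex x0 s)) (strip_map (Complex x t))"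
      by (simp add: norm_mult dist_norm norm_minus_commute)
    moreover have "0 < norm (G (exp (- Complex x t)))" using nz[OF b] by simp
    ultimately have "ln (norm (G (exp (- Complex x t)))) = - x + ln (dist (strip_map (Complex x0 s)) (strip_map (Complex x t)))"
      by (simp add: ln_mult zero_less_mult_iff)
    then show ?thesis unfolding Reg[OF b] by simp
  qed
  ultimately have "((\<lambda>t. ln (dist (strip_map (Complex x0 s)) (strip_map (Complex x t))) - x) has_integral 2 * pi * (- ln \<kappa>)) {0..2 * pi}"
    unfolding o_def by (simp only:)
  from has_integral_add[OF this has_integral_const_real[of x 0 "2 * pi"]]
  show ?thesis by (simp add: algebra_simps)
qed

text \<open>The measure is the image of the uniform measure on a circle inside the unit circle,
  which gives compact support in \<open>D\<close>. Potentials of the larger circles are known from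
  \<open>log_potential_mean\<close>; on the circle itself an inequality from Fatou's lemma
  suffices.\<close>

lemma exists_low_energy_measure:
  assumes x0: "- width < x0" "x0 < 0"
  obtains \<nu> K where "prob_space \<nu>" "sets \<nu> = sets borel" "compact K" "K \<subseteq> D" "emeasure \<nu> (- K) = 0"
    "log_energy \<nu> \<noteq> \<infinity>" "real_of_ereal (log_energy \<nu>) \<le> ln \<kappa> - x0"
proof -
  define \<gamma> where "\<gamma> = (\<lambda>x t. strip_map (Complex x t))"
  define U where "U = uniform_measure lborel {0..2 * pi}"
  define \<nu> where "\<nu> = distr U borel (\<gamma> x0)"
  have em: "emeasure lborel {0..2 * pi} = ennreal (2 * pi)" by (simp add: emeasure_lborel_Icc)
  interpret U: prob_space U unfolding U_def by (rule prob_space_uniform_measure) (auto simp: em)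
  have setsU [measurable_cong]: "sets U = sets borel" by (simp add: U_def)
  have cont: "continuous_on A (\<gamma> x)" if "- width < x" for x A
    unfolding \<gamma>_def using that periodic_holomorphic_onD(2)[OF strip_map_periodic_holomorphic]
    by (intro continuous_on_vline[of "{-width<..}"]) auto
  have \<gamma>m: "\<gamma> x \<in> borel_measurable borel" if "- width < x" for x
    using cont[OF that] by (rule borel_measurable_continuous_onI)
  then have \<gamma>U: "\<gamma> x \<in> U \<rightarrow>\<^sub>M borel" if "- width < x" for x using that by simp
  note \<gamma>0 = \<gamma>U[OF x0(1)]
  interpret \<nu>: prob_space \<nu> unfolding \<nu>_def by (rule U.prob_space_distr[OF \<gamma>0])
  have sets\<nu> [measurable_cong]: "sets \<nu> = sets borel" by (simp add: \<nu>_def)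
  have inD: "\<gamma> x t \<in> D" if "- width < x" "x < 0" for x t
    unfolding \<gamma>_def strip_map_def using that in_chart[of "Complex x t"] \<psi>_in_D[of "exp (Complex x t)"] by simp
  obtain m where m: "m \<ge> 0" "\<And>x y. x \<in> D \<Longrightarrow> y \<in> D \<Longrightarrow> dist x y \<le> exp m"
  proof -
    obtain e where e: "\<And>x y. x \<in> D \<Longrightarrow> y \<in> D \<Longrightarrow> dist x y \<le> e" using bounded_D unfolding bounded_two_points by blast
    have "dist x y \<le> exp (max 0 e)" if "x \<in> D" "y \<in> D" for x y
      using e[OF that] exp_ge_add_one_self[of "max 0 e"] by linarith
    then show ?thesis using that[of "max 0 e"] by simp
  qed
  have diag: "AE w in \<nu>. z \<noteq> w" for z
  proof -
    have "AE t in U. z \<noteq> \<gamma> x0 t" unfolding U_def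
    proof (rule AE_uniform_measureI)
      \<comment> \<open>Without the end point the curve is injective, so \<open>z\<close> is hit at
        most once there; the end point is added back as one more null point.\<close>
      define S where "S = {t \<in> {0..<2 * pi}. \<gamma> x0 t = z}"
      have "inj_on (\<gamma> x0) S"
      proof (rule inj_onI)
        fix t u assume tu: "t \<in> S" "u \<in> S" "\<gamma> x0 t = \<gamma> x0 u"
        have "Complex x0 t = Complex x0 u"
          by (rule inj_onD[OF inj_strip_map[OF order_refl]]) (use tu x0 in \<open>auto simp: \<gamma>_def S_def half_open_collar_def\<close>)
        then show "t = u" by simp
      qed
      moreover have "finite (\<gamma> x0 ` S)" by (rule finite_subset[of _ "{z}"]) (auto simp: S_def)
      ultimately have "finite (insert (2 * pi) S)" using finite_imageD by blast
      then have "insert (2 * pi) S \<in> null_sets lborel" by (rule finite_imp_null_set_lborel)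
      then show "AE t in lborel. t \<in> {0..2 * pi} \<longrightarrow> z \<noteq> \<gamma> x0 t" by (rule AE_I') (auto simp: S_def)
    qed simp
    then show ?thesis unfolding \<nu>_def by (subst AE_distr_iff[OF \<gamma>0]) auto
  qed
  have AED: "AE z in \<nu>. z \<in> D"
    unfolding \<nu>_def by (subst AE_distr_iff[OF \<gamma>0]) (use open_D inD x0 in auto)
  have mean: "(\<integral>\<^sup>+t. ennreal (m - ln (dist (\<gamma> x0 s) (\<gamma> x t))) \<partial>U) = ennreal (m - (x - ln \<kappa>))" "0 \<le> m - (x - ln \<kappa>)"
    if x: "x0 < x" "x < 0" for x s
  proof -
    have nn: "0 \<le> m - ln (dist (\<gamma> x0 s) (\<gamma> x t))" for t
    proof (cases "\<gamma> x0 s = \<gamma> x t")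
      case False
      have "ln (dist (\<gamma> x0 s) (\<gamma> x t)) \<le> ln (exp m)"
        using m(2)[OF inD inD] x x0 False by (subst ln_le_cancel_iff) auto
      then show ?thesis by simp
    qed (use m in simp)
    have hi: "((\<lambda>t. m - ln (dist (\<gamma> x0 s) (\<gamma> x t))) has_integral 2 * pi * (m - (x - ln \<kappa>))) {0..2 * pi}"
      using has_integral_diff[OF has_integral_const_real[of m 0 "2 * pi"] log_potential_mean[OF x0(1) x(1), of s]]
      by (simp add: \<gamma>_def algebra_simps)
    then show p: "0 \<le> m - (x - ln \<kappa>)" using has_integral_nonneg[OF hi] nn pi_gt_zero by (simp add: zero_le_mult_iff)
    have "(\<integral>\<^sup>+t. ennreal (m - ln (dist (\<gamma> x0 s) (\<gamma> x t))) \<partial>U)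
      = (\<integral>\<^sup>+t. ennreal (m - ln (dist (\<gamma> x0 s) (\<gamma> x t))) * indicator {0..2 * pi} t \<partial>lborel) / ennreal (2 * pi)"
      unfolding U_def using \<gamma>m[of x] x x0 by (subst nn_integral_uniform_measure) (auto simp: em)
    also have "\<dots> = ennreal (2 * pi * (m - (x - ln \<kappa>))) / ennreal (2 * pi)"
      using nn_integral_has_integral_lebesgue'[OF _ hi] nn by simp
    also have "\<dots> = ennreal (m - (x - ln \<kappa>))" using p by (subst divide_ennreal) auto
    finally show "(\<integral>\<^sup>+t. ennreal (m - ln (dist (\<gamma> x0 s) (\<gamma> x t))) \<partial>U) = ennreal (m - (x - ln \<kappa>))" .
  qed
  have am: "0 \<le> (ln \<kappa> - x0) + m" using mean(2)[of "x0 / 2"] x0 by simp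
  have inner: "(\<integral>\<^sup>+w. ennreal (m - ln (dist (\<gamma> x0 s) w)) \<partial>\<nu>) \<le> ennreal ((ln \<kappa> - x0) + m)" for s
  proof -
    \<comment> \<open>Circles strictly between \<open>x0\<close> and the boundary that converge to
      \<open>x0\<close>; the shift by 2 keeps the factor strictly between 0 and 1.\<close>
    define xs where "xs = (\<lambda>n::nat. x0 * (1 - 1 / (real n + 2)))"
    have xs: "x0 < xs n" "xs n < 0" for n
    proof -
      define q where "q = 1 / (real n + 2)"
      have "0 < q" "q < 1" by (auto simp: q_def)
      then show "x0 < xs n" "xs n < 0" using x0(2) mult_neg_pos[of x0 q] unfolding xs_def q_def[symmetric]
        by (auto simp: mult_less_0_iff algebra_simps)
    qed
    have lim: "xs \<longlonglongrightarrow> x0" unfolding xs_def by real_asymp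
    have "(\<integral>\<^sup>+w. ennreal (m - ln (dist (\<gamma> x0 s) w)) \<partial>\<nu>) = (\<integral>\<^sup>+t. ennreal (m - ln (dist (\<gamma> x0 s) (\<gamma> x0 t))) \<partial>U)"
      unfolding \<nu>_def by (subst nn_integral_distr[OF \<gamma>0]) auto
    also have "\<dots> = (\<integral>\<^sup>+t. liminf (\<lambda>n. ennreal (m - ln (dist (\<gamma> x0 s) (\<gamma> (xs n) t)))) \<partial>U)"
    proof (rule nn_integral_cong_AE)
      have "AE t in U. \<gamma> x0 s \<noteq> \<gamma> x0 t"
        using diag[of "\<gamma> x0 s"] unfolding \<nu>_def by (subst (asm) AE_distr_iff[OF \<gamma>0]) auto
      then show "AE t in U. ennreal (m - ln (dist (\<gamma> x0 s) (\<gamma> x0 t))) = liminf (\<lambda>n. ennreal (m - ln (dist (\<gamma> x0 s) (\<gamma> (xs n) t))))"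
      proof eventually_elim
        case (elim t)
        have "isCont strip_map (Complex x0 t)"
          using periodic_holomorphic_onD(2)[OF strip_map_periodic_holomorphic] open_vstrip[of "{-width<..}"] x0
          by (auto simp: continuous_on_eq_continuous_at vstrip_def)
        moreover have "(\<lambda>n. Complex (xs n) t) \<longlonglongrightarrow> Complex x0 t" by (intro tendsto_intros lim)
        ultimately have "(\<lambda>n. \<gamma> (xs n) t) \<longlonglongrightarrow> \<gamma> x0 t" unfolding \<gamma>_def by (rule isCont_tendsto_compose)
        then have "(\<lambda>n. ennreal (m - ln (dist (\<gamma> x0 s) (\<gamma> (xs n) t)))) \<longlonglongrightarrow> ennreal (m - ln (dist (\<gamma> x0 s) (\<gamma> x0 t)))"
          using elim by (intro tendsto_intros) auto
        then show ?case by (intro lim_imp_Liminf[symmetric]) auto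
      qed
    qed
    \<comment> \<open>Fatou's lemma; the constant \<open>m\<close> was chosen to make the integrands
      nonnegative on \<open>D\<close>.\<close>
    also have "\<dots> \<le> liminf (\<lambda>n. (\<integral>\<^sup>+t. ennreal (m - ln (dist (\<gamma> x0 s) (\<gamma> (xs n) t))) \<partial>U))"
    proof (rule nn_integral_liminf)
      fix n
      have [measurable]: "\<gamma> (xs n) \<in> U \<rightarrow>\<^sub>M borel" using xs(1)[of n] x0 by (intro \<gamma>U) simp
      show "(\<lambda>t. ennreal (m - ln (dist (\<gamma> x0 s) (\<gamma> (xs n) t)))) \<in> borel_measurable U" by measurable
    qed
    also have "\<dots> = liminf (\<lambda>n. ennreal (m - (xs n - ln \<kappa>)))" using mean(1)[OF xs] by simp
    also have "\<dots> = ennreal (m - (x0 - ln \<kappa>))"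
      using lim by (intro lim_imp_Liminf tendsto_intros) auto
    finally show ?thesis by (simp add: algebra_simps)
  qed
  have J: "(\<lambda>z. \<integral>\<^sup>+w. ennreal (m - ln (dist z w)) \<partial>\<nu>) \<in> borel_measurable borel"
    by (rule \<nu>.borel_measurable_nn_integral) measurable
  have "(\<integral>\<^sup>+z. \<integral>\<^sup>+w. ennreal (m - ln (dist z w)) \<partial>\<nu> \<partial>\<nu>) = (\<integral>\<^sup>+s. (\<integral>\<^sup>+w. ennreal (m - ln (dist (\<gamma> x0 s) w)) \<partial>\<nu>) \<partial>U)"
    by (subst (1) \<nu>_def, subst nn_integral_distr[OF \<gamma>0]) (use J in auto)
  also have "\<dots> \<le> (\<integral>\<^sup>+s. ennreal ((ln \<kappa> - x0) + m) \<partial>U)" by (intro nn_integral_mono inner)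
  also have "\<dots> = ennreal ((ln \<kappa> - x0) + m)" by (simp add: U.emeasure_space_1)
  finally have le: "(\<integral>\<^sup>+z. \<integral>\<^sup>+w. ennreal (m - ln (dist z w)) \<partial>\<nu> \<partial>\<nu>) \<le> ennreal ((ln \<kappa> - x0) + m)" .
  note en = log_energy_le[OF \<nu>.prob_space_axioms sets\<nu> AED m(2) m(1) diag le am]
  show ?thesis
  proof (rule that[of \<nu> "\<gamma> x0 ` {0..2 * pi}"])
    have K: "compact (\<gamma> x0 ` {0..2 * pi})" by (intro compact_continuous_image cont x0) auto
    then show "compact (\<gamma> x0 ` {0..2 * pi})" .
    show "\<gamma> x0 ` {0..2 * pi} \<subseteq> D" using inD x0 by auto
    have "AE t in U. \<gamma> x0 t \<in> \<gamma> x0 ` {0..2 * pi}" unfolding U_def by (rule AE_uniform_measureI) auto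
    moreover have Kb: "\<gamma> x0 ` {0..2 * pi} \<in> sets borel" by (rule borel_closed[OF compact_imp_closed[OF K]])
    ultimately have "AE z in \<nu>. z \<in> \<gamma> x0 ` {0..2 * pi}"
      unfolding \<nu>_def by (subst AE_distr_iff[OF \<gamma>0]) auto
    moreover have "space \<nu> = UNIV" by (simp add: \<nu>_def)
    ultimately show "emeasure \<nu> (- \<gamma> x0 ` {0..2 * pi}) = 0"
      using Kb sets\<nu> by (subst (asm) AE_iff_measurable[of "- \<gamma> x0 ` {0..2 * pi}"]) auto
  qed (use en sets\<nu> \<nu>.prob_space_axioms in auto)
qed

text \<open>The Chebyshev polynomials bound every admissible energy from below by
  \<open>ln \<kappa>\<close>. Circles at level \<open>x0 < 0\<close> have energy at most
  \<open>ln \<kappa> - x0\<close>, which approaches that bound as \<open>x0\<close> tends to 0;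
  since \<open>D\<close> is open, compact supports never reach \<open>x0 = 0\<close>.\<close>

lemma log_capacity_eq: "log_capacity D = 1 / \<kappa>"
  unfolding log_capacity_def
proof (rule cSup_eq_non_empty)
  fix x assume "x \<in> insert 0 {exp (- real_of_ereal (log_energy \<mu>)) | \<mu>.
    prob_space \<mu> \<and> sets \<mu> = sets borel \<and> (\<exists>K. compact K \<and> K \<subseteq> D \<and> emeasure \<mu> (- K) = 0) \<and> log_energy \<mu> \<noteq> \<infinity>}"
  then consider "x = 0" | \<mu> K where "x = exp (- real_of_ereal (log_energy \<mu>))" "prob_space \<mu>" "sets \<mu> = sets borel"
    "compact K" "K \<subseteq> D" "emeasure \<mu> (- K) = 0" "log_energy \<mu> \<noteq> \<infinity>" by blast
  then show "x \<le> 1 / \<kappa>"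
  proof cases
    case 1
    then show ?thesis using \<kappa> by simp
  next
    case (2 \<mu> K)
    obtain T :: "nat \<Rightarrow> complex poly" and C where T: "C > 0" "\<And>n. degree (T n) \<le> n" "\<And>n. coeff (T n) n = 1"
      "\<And>n z. z \<in> D \<Longrightarrow> norm (poly (T n) z) \<le> C * (1 / \<kappa>) ^ n"
      using Chebyshev_polynomials by metis
    have "- K \<in> sets \<mu>" using 2(3,4) compact_imp_closed by (metis borel_open open_Compl)
    then have "- K \<in> null_sets \<mu>" using 2(6) by (simp add: null_sets_def)
    then have "AE x in \<mu>. x \<in> D" by (rule AE_I') (use 2(5) in auto)
    then have "- ln (1 / \<kappa>) \<le> real_of_ereal (log_energy \<mu>)"
      using \<kappa> by (intro log_energy_ge[OF T(2,3,4,1) _ 2(2,3) _ bounded_D 2(7)]) auto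
    then have "exp (- real_of_ereal (log_energy \<mu>)) \<le> exp (ln (1 / \<kappa>))" by simp
    then show ?thesis using 2(1) \<kappa> by simp
  qed
next
  fix y assume y: "\<And>x. x \<in> insert 0 {exp (- real_of_ereal (log_energy \<mu>)) | \<mu>.
    prob_space \<mu> \<and> sets \<mu> = sets borel \<and> (\<exists>K. compact K \<and> K \<subseteq> D \<and> emeasure \<mu> (- K) = 0) \<and> log_energy \<mu> \<noteq> \<infinity>} \<Longrightarrow> x \<le> y"
  have "x0 - ln \<kappa> \<le> ln y \<and> 0 < y" if x0: "- width < x0" "x0 < 0" for x0
  proof -
    obtain \<nu> K where \<nu>: "prob_space \<nu>" "sets \<nu> = sets borel" "compact K" "K \<subseteq> D" "emeasure \<nu> (- K) = 0"
      "log_energy \<nu> \<noteq> \<infinity>" "real_of_ereal (log_energy \<nu>) \<le> ln \<kappa> - x0"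
      using exists_low_energy_measure[OF x0] by metis
    have "exp (- real_of_ereal (log_energy \<nu>)) \<le> y" using \<nu> by (intro y) blast
    moreover have "exp (x0 - ln \<kappa>) \<le> exp (- real_of_ereal (log_energy \<nu>))" using \<nu>(7) by simp
    ultimately have "exp (x0 - ln \<kappa>) \<le> y" by linarith
    then have "0 < y" using exp_gt_zero[of "x0 - ln \<kappa>"] by linarith
    with \<open>exp (x0 - ln \<kappa>) \<le> y\<close> show ?thesis by (simp add: ln_ge_iff)
  qed
  note * = this
  have y0: "0 < y" using *[of "- width / 2"] width_pos by simp
  \<comment> \<open>All \<open>x0\<close> between \<open>- width\<close> and 0 are below the
    right-hand side, and so is their supremum 0.\<close>
  have "0 \<le> ln y + ln \<kappa>"
    by (rule dense_le_bounded[of "- width"]) (use * width_pos in force)+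
  then have "ln (1 / \<kappa>) \<le> ln y" using \<kappa> by (simp add: ln_div)
  then show "1 / \<kappa> \<le> y" using y0 \<kappa> by (subst (asm) ln_le_cancel_iff) auto
qed simp

end

section \<open>The geometric mean of the weight and the conclusion\<close>

context weighted_chart
begin

text \<open>The mean value property of \<open>V\<close> in the exterior, with value \<open>v\<close>
  at infinity; on the unit circle \<open>ln \<omega>\<close> is \<open>- 2 Re V\<close>.\<close>

lemma circle_mean_weight:
  assumes VB: "\<And>z. z \<in> frontier D \<Longrightarrow> 2 * Re (V z) = - ln (\<omega> z)"
  shows "circle_mean (\<lambda>w. ln (\<omega> (inv_into (- D) \<phi> w))) = - 2 * v"
proof -
  have inv: "inv_into (- D) \<phi> (cis t) = strip_map (Complex 0 t)" for t
  proof (rule inv_into_f_eq)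
    show "inj_on \<phi> (- D)" by (rule inj_on_inverseI[of _ \<psi>]) (use \<psi>_\<phi> in auto)
    have "exp (Complex 0 t) = cis t" by (simp add: cis_conv_exp complex_eq_iff Re_exp Im_exp)
    then show "\<phi> (strip_map (Complex 0 t)) = cis t" using \<phi>_strip_map[of "Complex 0 t"] width_pos by simp
    show "strip_map (Complex 0 t) \<in> - D"
      unfolding strip_map_def using \<psi>_in_D[of "exp (Complex 0 t)"] \<rho> by simp
  qed
  have w: "ln (\<omega> (inv_into (- D) \<phi> (cis t))) = - 2 * Re (strip_V (Complex 0 t))" for t
    unfolding inv using VB[OF strip_map_in_frontier[of "Complex 0 t"]] by (simp add: strip_V_def)
  have "continuous_on {0..2*pi} (\<lambda>t. strip_V (Complex 0 t))"
    using width_pos by (intro continuous_on_vline[OF periodic_holomorphic_onD(2)[OF strip_V_periodic_holomorphic]]) auto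
  then have "((\<lambda>t. strip_V (Complex 0 t)) has_integral vline_integral strip_V 0) {0..2 * pi}"
    unfolding vline_integral_def by (intro integrable_integral integrable_continuous_interval)
  then have "((\<lambda>t. strip_V (Complex 0 t)) has_integral 2 * of_real pi * of_real v) {0..2 * pi}"
    using vline_integral_right_end[OF strip_V_periodic_holomorphic strip_V_asymp] width_pos by simp
  then have "((Re \<circ> (\<lambda>t. strip_V (Complex 0 t))) has_integral Re (2 * of_real pi * of_real v)) {0..2 * pi}"
    by (rule has_integral_linear[OF _ bounded_linear_Re])
  then have "((\<lambda>t. - 2 * Re (strip_V (Complex 0 t))) has_integral - 2 * (2 * pi * v)) {0..2 * pi}"
    by (intro has_integral_mult_right) (simp add: o_def)
  then have "integral {0..2 * pi} (\<lambda>t. - 2 * Re (strip_V (Complex 0 t))) = - 2 * (2 * pi * v)" by (rule integral_unique)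
  then show ?thesis unfolding circle_mean_def w by simp
qed

end

theorem theorem1p2p1:
  fixes D :: "complex set" and \<omega> :: "complex \<Rightarrow> real"
    and \<phi> V :: "complex \<Rightarrow> complex" and P :: "nat \<Rightarrow> complex poly"
  assumes "analytic_Jordan_domain D"
    and "admissible_weight D \<omega>"
    and "exterior_conformal_map D \<phi>"
    and "szego_function D \<omega> V"
    and "\<And>N. monic_orthogonal_poly D \<omega> N (P N)"
  shows "(\<exists>U. \<exists>B :: nat \<Rightarrow> complex \<Rightarrow> complex.
            open U \<and> - D \<subseteq> U \<and>
            (\<forall>j. B j holomorphic_on U \<and> bounded (B j ` U)) \<and>
            (\<forall>z\<in>U. B 0 z = 1) \<and>
            (\<forall>j\<ge>1. (B j \<longlongrightarrow> 0) at_infinity) \<and>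
            (\<forall>(\<kappa>::nat) (A::real). A > 0 \<longrightarrow>
               (\<exists>K::real. \<forall>\<^sub>F N in sequentially. \<forall>z.
                  infdist z (- D) \<le> A * ln (real N) / real N \<longrightarrow>
                  z \<in> U \<and>
                  (\<exists>R::complex. norm R \<le> K / real N ^ (\<kappa> + 1) \<and>
                     poly (P N) z =
                       leading_const \<phi> V N * deriv \<phi> z * \<phi> z ^ N * exp (V z) *
                       ((\<Sum>j\<le>\<kappa>. B j z / of_nat N ^ j) + R)))))
       \<and> (\<forall>N\<ge>1. leading_const \<phi> V N =
            of_real (log_capacity D ^ (N + 1) *
              exp (1 / 2 * circle_mean (\<lambda>w. ln (\<omega> (inv_into (- D) \<phi> w))))))"
proof -
  obtain U v where U: "open U" "- D \<subseteq> U" "V holomorphic_on U" and v: "(V \<longlongrightarrow> of_real v) at_infinity"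
    and VB: "\<And>z. z \<in> frontier D \<Longrightarrow> 2 * Re (V z) = - ln (\<omega> z)"
    using assms(4) unfolding szego_function_def by auto
  \<comment> \<open>The chart is confined to the neighbourhood \<open>U\<close> on which
    \<open>V\<close> is holomorphic, so that \<open>V\<close> can be transported to the whole
    strip.\<close>
  obtain \<psi> \<rho> \<kappa> where chart: "exterior_chart D \<phi> \<psi> \<rho> \<kappa>" and sub: "\<psi> ` {w. \<rho> < norm w} \<subseteq> U"
    and d\<phi>: "(deriv \<phi> \<longlongrightarrow> of_real \<kappa>) at_infinity"
    using exterior_chart_exists[OF assms(1,3) U(1,2)] by blast
  interpret exterior_chart D \<phi> \<psi> \<rho> \<kappa> by (rule chart)
  interpret weighted_chart D \<phi> \<psi> \<rho> \<kappa> V v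
    by unfold_locales (use v holomorphic_on_subset[OF U(3) sub] in auto)
  obtain \<delta> c' h C where oc: "orthogonality_chart D \<phi> \<psi> \<rho> \<kappa> V v \<omega> \<delta> c' h C"
    using orthogonality_chart_exists[OF assms(2) VB] by blast
  have lc: "leading_const \<phi> V N = of_real (1 / (\<kappa> ^ (N + 1) * exp v))" for N
    by (rule leading_const_eq[OF d\<phi> \<kappa> v])
  have "filterlim \<phi> at_infinity at_infinity" using assms(3) by (simp add: exterior_conformal_map_def)
  note expansion = orthogonality_chart.expansion_exists[OF oc this assms(5) lc]
  have "1 / (\<kappa> ^ (N + 1) * exp v) = log_capacity D ^ (N + 1) *
      exp (1 / 2 * circle_mean (\<lambda>w. ln (\<omega> (inv_into (- D) \<phi> w))))" for N
    unfolding log_capacity_eq using circle_mean_weight[OF VB] by (simp add: exp_minus field_simps)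
  then show ?thesis using expansion lc by simp
qed

end
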